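(* Let $\{\mathbf{S}_N\}_{N\ge1}$ be the vectors of sample inclusion indicators of a sequence of measurable Poisson sampling designs with first order inclusion probabilities $\pi_{i,N}$, let $\mathcal{F}$ be a $P_y$-Donsker class of measurable functions $f:\mathcal{Y}\to\mathbb{R}$, and let $\{\mathbb{G}_N'\}_{N\ge1}$ be the corresponding sequence of Horvitz-Thompson empirical processes. Assume: (1) there is a function $\Sigma':\mathcal{F}^2\to\mathbb{R}$ such that $\Sigma_N'(f,g):=E_d[\mathbb{G}_N'f\,\mathbb{G}_N'g]\to\Sigma'(f,g)$ in probability for all $f,g\in\mathcal{F}$; (2) there is a constant $L>0$ such that $\min_{1\le i\le N}\pi_{i,N}\ge L$ with probability tending to $1$ as $N\to\infty$; (3) $\sup\{|P_yf|:f\in\mathcal{F}\}<\infty$. Then: (i) there exists a zero-mean Gaussian process $\{\mathbb{G}'f:f\in\mathcal{F}\}$ with covariance function $\Sigma'$ which is a Borel measurable and tight random element of $l^\infty(\mathcal{F})$ such that $\mathbb{G}_N'\rightsquigarrow\mathbb{G}'$ in $l^\infty(\mathcal{F})$; (ii) the sample paths $f\mapsto\mathbb{G}'f$ are, with probability $1$, uniformly continuous with respect to the semimetric $\rho(f,g):=\sqrt{P_y(f-g)^2}$ on $\mathcal{F}$.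
   Context: Setting. $\mathcal{Y},\mathcal{X}$ are separable Banach spaces. The underlying probability space is the product $\prod_{i=1}^\infty(\Omega_{y,x},\mathcal{A}_{y,x},P_{y,x})\times(\Omega_d,\mathcal{A}_d,P_d)\times\prod_{i=1}^\infty(\Omega_\varepsilon,\mathcal{A}_\varepsilon,P_\varepsilon)$ with product measure $P$; outer probabilities and expectations $P^*,E^*$ refer to it. The pairs $(Y_i,X_i)$, $i\ge1$, are the coordinate projections of the first factor: they are i.i.d. with values in $\mathcal{Y}\times\mathcal{X}$ and law $P_{y,x}$; $P_y$ is the law of $Y_1$. (The third factor carries an auxiliary i.i.d. Rademacher sequence.) Write $Qf:=\int f\,dQ$, $\mathbf{Y}_N=(Y_1,\dots,Y_N)$, $\mathbf{X}_N=(X_1,\dots,X_N)$. Poisson design. $D$ is a uniform-$[0,1]$ random variable depending only on the $\Omega_d$-coordinate. For each $N$ the inclusion probabilities $\pi_{i,N}\in(0,1]$, $i\le N$, are functions of $\mathbf{X}_N$; put $\mathfrak{p}_N(\mathbf{s})=\prod_{i=1}^N\pi_{i,N}^{s_i}(1-\pi_{i,N})^{1-s_i}$ for $\mathbf{s}\in\{0,1\}^N$. With a fixed enumeration $\mathbf{s}^{(1)},\dots,\mathbf{s}^{(2^N)}$ of $\{0,1\}^N$, $\mathbf{S}_N=(S_{1,N},\dots,S_{N,N}):=\mathbf{s}^{(1)}$ if $D\le\mathfrak{p}_N(\mathbf{s}^{(1)})$ and $:=\mathbf{s}^{(k)}$ if $\sum_{j<k}\mathfrak{p}_N(\mathbf{s}^{(j)})<D\le\sum_{j\le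 k}\mathfrak{p}_N(\mathbf{s}^{(j)})$. Thus, given $\mathbf{X}_N$, the indicators are independent Bernoulli($\pi_{i,N}$) and conditionally independent of $\mathbf{Y}_N$. The design is measurable if each $\mathfrak{p}_N(\mathbf{s})$ is a measurable function of $\mathbf{X}_N$. $E_d$ denotes expectation over $D$ with all else fixed: for any function $g$, $E_dg(\mathbf{S}_N,\mathbf{Y}_N,\mathbf{X}_N)=\sum_{\mathbf{s}}g(\mathbf{s},\mathbf{Y}_N,\mathbf{X}_N)\mathfrak{p}_N(\mathbf{s})$. Horvitz-Thompson empirical process: $\mathbb{G}_N'f:=\frac1{\sqrt N}\sum_{i=1}^N\left(\frac{S_{i,N}}{\pi_{i,N}}-1\right)f(Y_i)$, $f\in\mathcal{F}$. $l^\infty(\mathcal{F})$ is the space of bounded functions $z:\mathcal{F}\to\mathbb{R}$ with norm $\|z\|_{\mathcal{F}}=\sup_{f\in\mathcal{F}}|z(f)|$. $\mathbb{G}_N'\rightsquigarrow\mathbb{G}'$ means $E^*h(\mathbb{G}_N')\to Eh(\mathbb{G}')$ for every bounded continuous $h:l^\infty(\mathcal{F})\to\mathbb{R}$. A class $\mathcal{H}$ of measurable functions is $Q$-Donsker (usual sense) if $\sup_{f\in\mathcal{H}}|f(z)-Qf|<\infty$ for every $z$ and, for $Z_1,Z_2,\dots$ i.i.d. with law $Q$ (coordinate projections), the processes $f\mapsto N^{-1/2}\sum_{i=1}^N(f(Z_i)-Qf)$ converge weakly in $l^\infty(\mathcal{H})$ to a tight Borel measurable random element. *)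

theory Defs
  imports "HOL-Probability.Probability"
begin

subsection \<open>Weak convergence in \<open>l\<^sup>\<infinity>\<close>\<close>

text \<open>\<open>l\<^sup>\<infinity>(H)\<close>, as the library's metric space of extensional bounded functions on \<open>H\<close>
  with the supremum distance.\<close>

abbreviation linf :: "'a set \<Rightarrow> ('a \<Rightarrow> real) metric" where
  "linf H \<equiv> funspace H euclidean_metric"

definition borel_sigma :: "'a topology \<Rightarrow> 'a measure" where
  "borel_sigma X = sigma (topspace X) {U. openin X U}"

text \<open>Only applied to bounded \<open>T\<close> and probability measures \<open>P\<close>; then integrable real-valued
  majorants give the same infimum as measurable majorants with values in the extended reals.\<close>

definition outer_expectation :: "'w measure \<Rightarrow> ('w \<Rightarrow> real) \<Rightarrow> real" where
  "outer_expectation P T =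
     Inf {integral\<^sup>L P U |U. integrable P U \<and> (\<forall>\<omega>\<in>space P. T \<omega> \<le> U \<omega>)}"

definition weakly_converges ::
  "'a metric \<Rightarrow> 'w measure \<Rightarrow> (nat \<Rightarrow> 'w \<Rightarrow> 'a) \<Rightarrow> 'v measure \<Rightarrow> ('v \<Rightarrow> 'a) \<Rightarrow> bool" where
  "weakly_converges m P Z M G \<longleftrightarrow>
     (\<forall>h. continuous_map (mtopology_of m) euclideanreal h \<and> bounded (h ` mspace m) \<longrightarrow>
        (\<lambda>N. outer_expectation P (\<lambda>\<omega>. h (Z N \<omega>))) \<longlonglongrightarrow> integral\<^sup>L M (\<lambda>v. h (G v)))"

definition tight_borel_element :: "'a metric \<Rightarrow> 'v measure \<Rightarrow> ('v \<Rightarrow> 'a) \<Rightarrow> bool" where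
  "tight_borel_element m M G \<longleftrightarrow>
     G \<in> measurable M (borel_sigma (mtopology_of m)) \<and>
     (\<forall>e>0. \<exists>K. compactin (mtopology_of m) K \<and> measure M {v \<in> space M. G v \<in> K} \<ge> 1 - e)"

definition empirical_process ::
  "'z measure \<Rightarrow> ('z \<Rightarrow> real) set \<Rightarrow> nat \<Rightarrow> (nat \<Rightarrow> 'z) \<Rightarrow> ('z \<Rightarrow> real) \<Rightarrow> real" where
  "empirical_process Q H N z =
     restrict (\<lambda>f. 1 / sqrt (real N) * (\<Sum>i<N. f (z i) - integral\<^sup>L Q f)) H"

text \<open>Integrability makes explicit that the means \<open>Qf\<close> exist. The limit is defined on a
  probability space over the type of \<open>l\<^sup>\<infinity>(H)\<close>, which is no restriction: the law of a limit is
  a Borel measure on \<open>l\<^sup>\<infinity>(H)\<close>, and the identity map under this law is again a limit.\<close>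

definition donsker :: "'z measure \<Rightarrow> ('z \<Rightarrow> real) set \<Rightarrow> bool" where
  "donsker Q H \<longleftrightarrow>
     (\<forall>f\<in>H. integrable Q f) \<and>
     (\<forall>z\<in>space Q. bdd_above ((\<lambda>f. \<bar>f z - integral\<^sup>L Q f\<bar>) ` H)) \<and>
     (\<exists>(M :: (('z \<Rightarrow> real) \<Rightarrow> real) measure) G. prob_space M \<and>
        tight_borel_element (linf H) M G \<and>
        weakly_converges (linf H) (PiM UNIV (\<lambda>_. Q)) (empirical_process Q H) M G)"


subsection \<open>Gaussian processes and convergence in probability\<close>

definition normal_rv :: "'v measure \<Rightarrow> ('v \<Rightarrow> real) \<Rightarrow> bool" where
  "normal_rv M X \<longleftrightarrow> X \<in> borel_measurable M \<and>
     ((\<exists>\<mu>. AE v in M. X v = \<mu>) \<or>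
      (\<exists>\<mu> \<sigma>. \<sigma> > 0 \<and> distributed M lborel X (\<lambda>x. ennreal (normal_density \<mu> \<sigma> x))))"

text \<open>Joint normality of the finite-dimensional marginals: every linear combination of the
  coordinates is univariate normal, possibly degenerate.\<close>

definition gaussian_process :: "'v measure \<Rightarrow> 't set \<Rightarrow> ('v \<Rightarrow> 't \<Rightarrow> real) \<Rightarrow> bool" where
  "gaussian_process M T G \<longleftrightarrow>
     (\<forall>I a. finite I \<and> I \<subseteq> T \<longrightarrow> normal_rv M (\<lambda>v. \<Sum>t\<in>I. a t * G v t))"

definition zero_mean_gaussian_process ::
  "'v measure \<Rightarrow> 't set \<Rightarrow> ('t \<Rightarrow> 't \<Rightarrow> real) \<Rightarrow> ('v \<Rightarrow> 't \<Rightarrow> real) \<Rightarrow> bool" where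
  "zero_mean_gaussian_process M T C G \<longleftrightarrow>
     gaussian_process M T G \<and>
     (\<forall>t\<in>T. integral\<^sup>L M (\<lambda>v. G v t) = 0) \<and>
     (\<forall>s\<in>T. \<forall>t\<in>T. integral\<^sup>L M (\<lambda>v. G v s * G v t) = C s t)"

definition conv_in_prob :: "'w measure \<Rightarrow> (nat \<Rightarrow> 'w \<Rightarrow> real) \<Rightarrow> real \<Rightarrow> bool" where
  "conv_in_prob P X c \<longleftrightarrow>
     (\<forall>e>0. (\<lambda>N. measure P {\<omega> \<in> space P. \<bar>X N \<omega> - c\<bar> > e}) \<longlonglongrightarrow> 0)"


subsection \<open>The probability space and the Poisson designs\<close>

text \<open>All sequences are indexed from 0, so \<open>i \<in> {0..<N}\<close> replaces \<open>i \<in> {1..N}\<close>.\<close>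

type_synonym ('y, 'x, 'd, 'e) sample = "(nat \<Rightarrow> 'y \<times> 'x) \<times> 'd \<times> (nat \<Rightarrow> 'e)"

definition sample_space ::
  "('y \<times> 'x) measure \<Rightarrow> 'd measure \<Rightarrow> 'e measure \<Rightarrow> ('y, 'x, 'd, 'e) sample measure" where
  "sample_space Pyx Pd Pe = PiM UNIV (\<lambda>_. Pyx) \<Otimes>\<^sub>M (Pd \<Otimes>\<^sub>M PiM UNIV (\<lambda>_. Pe))"

definition Yv :: "nat \<Rightarrow> ('y, 'x, 'd, 'e) sample \<Rightarrow> 'y" where
  "Yv i \<omega> = fst (fst \<omega> i)"

definition Xvec :: "nat \<Rightarrow> ('y, 'x, 'd, 'e) sample \<Rightarrow> nat \<Rightarrow> 'x" where
  "Xvec N \<omega> = restrict (\<lambda>i. snd (fst \<omega> i)) {..<N}"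

definition law_Y ::
  "('y::topological_space \<times> 'x) measure \<Rightarrow> 'y measure" where
  "law_Y Pyx = distr Pyx borel fst"

definition binary_vectors :: "nat \<Rightarrow> (nat \<Rightarrow> nat) set" where
  "binary_vectors N = {..<N} \<rightarrow>\<^sub>E {0, 1}"

text \<open>\<open>\<pi> N i x\<close> is the inclusion probability \<open>\<pi>\<^bsub>i,N\<^esub>\<close> as a function of the vector \<open>x\<close> of the
  first \<open>N\<close> auxiliary values.\<close>

type_synonym 'x incl_probs = "nat \<Rightarrow> nat \<Rightarrow> (nat \<Rightarrow> 'x) \<Rightarrow> real"

definition design_prob :: "'x incl_probs \<Rightarrow> nat \<Rightarrow> (nat \<Rightarrow> nat) \<Rightarrow> (nat \<Rightarrow> 'x) \<Rightarrow> real" where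
  "design_prob \<pi> N s x = (\<Prod>i<N. \<pi> N i x ^ s i * (1 - \<pi> N i x) ^ (1 - s i))"

definition measurable_poisson_designs :: "('x::topological_space) incl_probs \<Rightarrow> bool" where
  "measurable_poisson_designs \<pi> \<longleftrightarrow>
     (\<forall>N. \<forall>i<N. \<forall>x \<in> {..<N} \<rightarrow>\<^sub>E UNIV. 0 < \<pi> N i x \<and> \<pi> N i x \<le> 1) \<and>
     (\<forall>N. \<forall>s \<in> binary_vectors N.
        design_prob \<pi> N s \<in> borel_measurable (PiM {..<N} (\<lambda>_. borel)))"

text \<open>\<open>enum N\<close> enumerates the binary vectors of length \<open>N\<close>. The first vector has no lower
  bound on \<open>D\<close>; for \<open>D > 1\<close>, a null event, the value is a constant vector left unspecified.\<close>

definition Svec ::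
  "'x incl_probs \<Rightarrow> (nat \<Rightarrow> nat \<Rightarrow> nat \<Rightarrow> nat) \<Rightarrow> ('d \<Rightarrow> real) \<Rightarrow> nat
     \<Rightarrow> ('y, 'x, 'd, 'e) sample \<Rightarrow> nat \<Rightarrow> nat" where
  "Svec \<pi> enum D N \<omega> =
     (let p = (\<lambda>j. design_prob \<pi> N (enum N j) (Xvec N \<omega>)); d = D (fst (snd \<omega>)) in
      enum N (THE k. k < 2 ^ N \<and> (k = 0 \<or> (\<Sum>j<k. p j) < d) \<and> d \<le> (\<Sum>j\<le>k. p j)))"

definition HT_process ::
  "'x incl_probs \<Rightarrow> (nat \<Rightarrow> nat \<Rightarrow> nat \<Rightarrow> nat) \<Rightarrow> ('d \<Rightarrow> real) \<Rightarrow> ('y \<Rightarrow> real) set \<Rightarrow> nat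
     \<Rightarrow> ('y, 'x, 'd, 'e) sample \<Rightarrow> ('y \<Rightarrow> real) \<Rightarrow> real" where
  "HT_process \<pi> enum D F N \<omega> =
     restrict (\<lambda>f. 1 / sqrt (real N) *
       (\<Sum>i<N. (real (Svec \<pi> enum D N \<omega> i) / \<pi> N i (Xvec N \<omega>) - 1) * f (Yv i \<omega>))) F"

definition design_expectation ::
  "'d measure \<Rightarrow> (('y, 'x, 'd, 'e) sample \<Rightarrow> real) \<Rightarrow> ('y, 'x, 'd, 'e) sample \<Rightarrow> real" where
  "design_expectation Pd T \<omega> = integral\<^sup>L Pd (\<lambda>d. T (fst \<omega>, d, snd (snd \<omega>)))"

definition HT_cov ::
  "'d measure \<Rightarrow> 'x incl_probs \<Rightarrow> (nat \<Rightarrow> nat \<Rightarrow> nat \<Rightarrow> nat) \<Rightarrow> ('d \<Rightarrow> real)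
     \<Rightarrow> ('y \<Rightarrow> real) set \<Rightarrow> ('y \<Rightarrow> real) \<Rightarrow> ('y \<Rightarrow> real) \<Rightarrow> nat
     \<Rightarrow> ('y, 'x, 'd, 'e) sample \<Rightarrow> real" where
  "HT_cov Pd \<pi> enum D F f g N =
     design_expectation Pd (\<lambda>\<omega>. HT_process \<pi> enum D F N \<omega> f * HT_process \<pi> enum D F N \<omega> g)"

definition rho :: "'y measure \<Rightarrow> ('y \<Rightarrow> real) \<Rightarrow> ('y \<Rightarrow> real) \<Rightarrow> real" where
  "rho Q f g = sqrt (integral\<^sup>L Q (\<lambda>y. (f y - g y)\<^sup>2))"

definition rho_uniformly_continuous ::
  "'y measure \<Rightarrow> ('y \<Rightarrow> real) set \<Rightarrow> (('y \<Rightarrow> real) \<Rightarrow> real) \<Rightarrow> bool" where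
  "rho_uniformly_continuous Q F z \<longleftrightarrow>
     (\<forall>e>0. \<exists>\<delta>>0. \<forall>f\<in>F. \<forall>g\<in>F. rho Q f g < \<delta> \<longrightarrow> \<bar>z f - z g\<bar> < e)"

end

theory Submission
  imports Defs
begin

text \<open>
  Given the data, the weights \<open>S\<^sub>i / \<pi>\<^sub>i - 1\<close> are independent, centred and, where \<open>\<pi>\<^sub>i \<ge> L\<close>, bounded by
  \<open>C = 1 / L + 1\<close>. Hence the weights divided by \<open>C\<close> are a mixture of sign vectors \<open>e\<close> whose mixing
  probabilities have the design expectation \<open>2\<^sup>-\<^sup>N\<close>, and the oscillation of the Horvitz--Thompson process
  is dominated by a mixture of the oscillations of the signed sums \<open>(\<Sum> e\<^sub>i f(Y\<^sub>i)) / sqrt N\<close>. For most \<open>e\<close> these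
  are differences of two empirical processes over about \<open>N / 2\<close> observations each, so they are small
  with large probability by the Donsker property, and the Khinchine--Kahane inequality turns this into
  smallness of their average over \<open>e\<close>. This is the asymptotic equicontinuity; minimal measurable
  majorants of the signed suprema make the expectations meaningful.

  The finite-dimensional limits follow from the conditional characteristic functions, which are
  products of characteristic functions of centred Bernoulli variables. The Gaussian limit is built from
  a sequence of independent standard normal variables by Cholesky factorization on a countable set of
  representatives and a uniform limit along finite approximations of the index set. Its paths are
  uniformly continuous because its increments satisfy \<open>E(G f - G g)\<^sup>2 \<le> 4 / L \<rho>(f, g)\<^sup>2\<close> and a tight process
  oscillates little over a finite partition of the index set.
\<close>

subsection \<open>Averages over signs\<close>

text \<open>The suprema over the class are possibly nonmeasurable functions of the data, so Fubini's
  theorem cannot exchange an average over signs with an outer expectation. This shapes the argument: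
  the signs are averaged by a finite sum over the 2^N sign vectors, and each signed supremum gets
  its own majorant. Minimality is what makes the majorants useful: invariance under e -> -e, the
  triangle inequality between a sign vector and its N one-coordinate flips, and outer tail bounds
  all pass from the suprema to the majorants almost surely. For almost every fixed data sequence,
  inequalities on the cube then apply to the majorants as functions of e. A second obstacle is that
  the Donsker property controls tail probabilities, whereas a mixture needs an average. For even
  functions with the flip inequality the second moment is at most twice the squared mean, so a level
  exceeded with probability at most 1/16 bounds the mean up to a factor 2. The partition of level m
  uses 2^-m both as size and as probability, which makes the exceptional events summable.\<close>

definition signs :: "nat \<Rightarrow> (nat \<Rightarrow> real) set" where
  "signs n = {e. (\<forall>i<n. e i = 1 \<or> e i = -1) \<and> (\<forall>i\<ge>n. e i = 0)}"

text \<open>Averaging out the last coordinate first gives the facts about the cube by induction on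
  its dimension; \<open>sign_avg_eq_sum\<close> identifies the result with the uniform average. The
  sign vectors vanish beyond \<open>n\<close>.\<close>

fun sign_avg :: "nat \<Rightarrow> ((nat \<Rightarrow> real) \<Rightarrow> real) \<Rightarrow> real" where
  "sign_avg 0 f = f (\<lambda>_. 0)"
| "sign_avg (Suc n) f = sign_avg n (\<lambda>e. (f (e(n := 1)) + f (e(n := -1))) / 2)"

lemma signs_0: "signs 0 = {\<lambda>_. 0}"
  by (auto simp: signs_def)

lemma signs_Suc: "signs (Suc n) = (\<lambda>e. e(n := 1)) ` signs n \<union> (\<lambda>e. e(n := -1)) ` signs n"
proof (intro set_eqI iffI)
  fix e assume e: "e \<in> signs (Suc n)"
  have 1: "e(n := 0) \<in> signs n"
    using e by (auto simp: signs_def)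
  have 2: "e = (e(n := 0))(n := e n)" by auto
  have "e n = 1 \<or> e n = -1" using e by (auto simp: signs_def)
  thus "e \<in> (\<lambda>e. e(n := 1)) ` signs n \<union> (\<lambda>e. e(n := -1)) ` signs n"
    using 1 2 by (metis UnCI image_eqI)
qed (auto simp: signs_def less_Suc_eq)

lemma finite_signs: "finite (signs n)"
  by (induction n) (auto simp: signs_0 signs_Suc)

lemma sign_avg_add: "sign_avg n (\<lambda>e. f e + g e) = sign_avg n f + sign_avg n g"
proof (induction n arbitrary: f g)
  case (Suc n)
  have "(\<lambda>e. (f (e(n := 1)) + g (e(n := 1)) + (f (e(n := -1)) + g (e(n := -1)))) / 2)
     = (\<lambda>e. (f (e(n := 1)) + f (e(n := -1))) / 2 + (g (e(n := 1)) + g (e(n := -1))) / 2)"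
    by (auto simp: field_simps)
  then show ?case by (simp add: Suc)
qed simp

lemma sign_avg_cmult: "sign_avg n (\<lambda>e. c * f e) = c * sign_avg n f"
proof (induction n arbitrary: f)
  case (Suc n)
  have "(\<lambda>e. (c * f (e(n := 1)) + c * f (e(n := -1))) / 2) = (\<lambda>e. c * ((f (e(n := 1)) + f (e(n := -1))) / 2))"
    by (auto simp: field_simps)
  then show ?case unfolding sign_avg.simps by (simp only: Suc)
qed simp

lemma sign_avg_const: "sign_avg n (\<lambda>e. c) = c"
  by (induction n) auto

lemma sign_avg_diff: "sign_avg n (\<lambda>e. f e - g e) = sign_avg n f - sign_avg n g"
  using sign_avg_add[of n f "\<lambda>e. (-1) * g e"] sign_avg_cmult[of n "-1" g] by simp

lemma sign_avg_sum: "sign_avg n (\<lambda>e. \<Sum>i\<in>I. f i e) = (\<Sum>i\<in>I. sign_avg n (f i))"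
  by (induction I rule: infinite_finite_induct) (auto simp: sign_avg_const sign_avg_add)

lemma sign_avg_mono: "(\<And>e. e \<in> signs n \<Longrightarrow> f e \<le> g e) \<Longrightarrow> sign_avg n f \<le> sign_avg n g"
proof (induction n arbitrary: f g)
  case (Suc n)
  show ?case unfolding sign_avg.simps
  proof (rule Suc.IH)
    fix e assume "e \<in> signs n"
    then have "e(n := 1) \<in> signs (Suc n)" "e(n := -1) \<in> signs (Suc n)"
      unfolding signs_Suc by blast+
    then have "f (e(n := 1)) \<le> g (e(n := 1))" "f (e(n := -1)) \<le> g (e(n := -1))"
      by (auto intro!: Suc.prems)
    then show "(f (e(n := 1)) + f (e(n := -1))) / 2 \<le> (g (e(n := 1)) + g (e(n := -1))) / 2"
      by simp
  qed
qed (auto simp: signs_0)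

lemma sign_avg_cong: "(\<And>e. e \<in> signs n \<Longrightarrow> f e = g e) \<Longrightarrow> sign_avg n f = sign_avg n g"
  by (intro antisym sign_avg_mono) auto

lemma sign_avg_nonneg: "(\<And>e. e \<in> signs n \<Longrightarrow> 0 \<le> f e) \<Longrightarrow> 0 \<le> sign_avg n f"
  using sign_avg_mono[of n "\<lambda>_. 0" f] by (simp add: sign_avg_const)

lemma sign_avg_eq_sum: "sign_avg n f = (\<Sum>e\<in>signs n. f e) / 2 ^ n"
proof (induction n arbitrary: f)
  case 0 then show ?case by (simp add: signs_0)
next
  case (Suc n)
  have i: "inj_on (\<lambda>e. e(n := c)) (signs n)" for c :: real
    by (rule inj_on_inverseI[where g = "\<lambda>e. e(n := 0)"]) (auto simp: signs_def)
  have d: "(\<lambda>e. e(n := 1)) ` signs n \<inter> (\<lambda>e. e(n := -1)) ` signs n = {}"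
    by (auto simp: fun_eq_iff) (metis fun_upd_same one_neq_neg_one)
  have "(\<Sum>e\<in>signs (Suc n). f e) = (\<Sum>e\<in>signs n. f (e(n := 1))) + (\<Sum>e\<in>signs n. f (e(n := -1)))"
    unfolding signs_Suc by (subst sum.union_disjoint[OF _ _ d]) (auto simp: finite_signs sum.reindex[OF i])
  then show ?case by (simp add: Suc sum.distrib sum_divide_distrib[symmetric] add_divide_distrib)
qed

lemma sign_avg_uminus: "sign_avg n (\<lambda>e. f (\<lambda>i. - e i)) = sign_avg n f"
proof (induction n arbitrary: f)
  case (Suc n)
  have a: "(\<lambda>i. - (e(n := c)) i) = (\<lambda>i. - e i)(n := - c)" for e :: "nat \<Rightarrow> real" and c by auto
  show ?case
    unfolding sign_avg.simps a using Suc[of "\<lambda>e. (f (e(n := 1)) + f (e(n := -1))) / 2"]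
    by (simp add: add.commute)
qed simp

lemma sign_avg_sq_le: "(sign_avg n f)\<^sup>2 \<le> sign_avg n (\<lambda>e. (f e)\<^sup>2)"
proof -
  let ?m = "sign_avg n f"
  have "0 \<le> sign_avg n (\<lambda>e. (f e - ?m)\<^sup>2)" by (intro sign_avg_nonneg) auto
  also have "(\<lambda>e. (f e - ?m)\<^sup>2) = (\<lambda>e. (f e)\<^sup>2 - (2 * ?m) * f e + ?m\<^sup>2)"
    by (auto simp: power2_eq_square algebra_simps)
  finally show ?thesis
    by (simp add: sign_avg_add sign_avg_diff sign_avg_cmult sign_avg_const power2_eq_square)
qed

declare sign_avg.simps(2) [simp del]

section \<open>Poincare-type inequalities on the discrete cube\<close>

definition flip :: "nat \<Rightarrow> (nat \<Rightarrow> real) \<Rightarrow> nat \<Rightarrow> real" where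
  "flip i e = e(i := - e i)"

text \<open>The quadratic form of the adjacency operator of the cube. On the Walsh function of a set
  S of coordinates it equals n - 2 |S|, which explains the two bounds below.\<close>

definition flip_corr :: "nat \<Rightarrow> ((nat \<Rightarrow> real) \<Rightarrow> real) \<Rightarrow> real" where
  "flip_corr n f = (\<Sum>i<n. sign_avg n (\<lambda>e. f e * f (flip i e)))"

text \<open>Along the last coordinate \<open>f = g + e n * h\<close> with \<open>g\<close> and
  \<open>h\<close> free of \<open>e n\<close>. These identities carry arguments about Walsh levels
  through an induction without introducing the Walsh expansion.\<close>

lemma sign_avg_Suc_split:
  assumes g_def: "g = (\<lambda>e. (f (e(n := 1)) + f (e(n := -1))) / 2)"
    and h_def: "h = (\<lambda>e. (f (e(n := 1)) - f (e(n := -1))) / 2)"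
  shows "sign_avg (Suc n) f = sign_avg n g"
    and "sign_avg (Suc n) (\<lambda>e. (f e)\<^sup>2) = sign_avg n (\<lambda>e. (g e)\<^sup>2) + sign_avg n (\<lambda>e. (h e)\<^sup>2)"
    and "flip_corr (Suc n) f = flip_corr n g + flip_corr n h
          + sign_avg n (\<lambda>e. (g e)\<^sup>2) - sign_avg n (\<lambda>e. (h e)\<^sup>2)"
    and "i < n \<Longrightarrow> sign_avg (Suc n) (\<lambda>e. e i * f e) = sign_avg n (\<lambda>e. e i * g e)"
    and "sign_avg (Suc n) (\<lambda>e. e n * f e) = sign_avg n h"
proof -
  show "sign_avg (Suc n) f = sign_avg n g" by (simp add: g_def sign_avg.simps)
  show "sign_avg (Suc n) (\<lambda>e. (f e)\<^sup>2) = sign_avg n (\<lambda>e. (g e)\<^sup>2) + sign_avg n (\<lambda>e. (h e)\<^sup>2)"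
    unfolding sign_avg.simps sign_avg_add[symmetric]
    by (intro sign_avg_cong) (simp add: g_def h_def power2_eq_square field_simps)
  have f1: "flip i (e(n := c)) = (flip i e)(n := c)" if "i < n" for i c e
    using that by (auto simp: flip_def)
  have "(\<Sum>i<n. sign_avg (Suc n) (\<lambda>e. f e * f (flip i e))) = flip_corr n g + flip_corr n h"
    unfolding flip_corr_def sum.distrib[symmetric] sign_avg_add[symmetric] sign_avg.simps
    by (intro sum.cong refl sign_avg_cong)
       (simp add: f1 g_def h_def power2_eq_square field_simps)
  moreover have "sign_avg (Suc n) (\<lambda>e. f e * f (flip n e))
      = sign_avg n (\<lambda>e. (g e)\<^sup>2) - sign_avg n (\<lambda>e. (h e)\<^sup>2)"
    unfolding sign_avg.simps sign_avg_diff[symmetric]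
    by (intro sign_avg_cong) (simp add: flip_def g_def h_def power2_eq_square field_simps)
  ultimately show "flip_corr (Suc n) f = flip_corr n g + flip_corr n h
          + sign_avg n (\<lambda>e. (g e)\<^sup>2) - sign_avg n (\<lambda>e. (h e)\<^sup>2)"
    unfolding flip_corr_def[of "Suc n"] by simp
  show "sign_avg (Suc n) (\<lambda>e. e i * f e) = sign_avg n (\<lambda>e. e i * g e)" if "i < n"
    unfolding sign_avg.simps using that
    by (intro sign_avg_cong) (simp add: g_def field_simps)
  show "sign_avg (Suc n) (\<lambda>e. e n * f e) = sign_avg n h"
    unfolding sign_avg.simps by (intro sign_avg_cong) (simp add: h_def field_simps)
qed

text \<open>Poincare inequality: the eigenvalue n - 2 |S| is at most n - 2 except at the empty set.
  In the induction \<open>h\<close> enters as \<open>e n * h\<close>, one level higher, and its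
  squared mean is absorbed by Cauchy-Schwarz.\<close>

lemma flip_corr_le1:
  "flip_corr n f \<le> (real n - 2) * sign_avg n (\<lambda>e. (f e)\<^sup>2) + 2 * (sign_avg n f)\<^sup>2"
proof (induction n arbitrary: f)
  case 0 then show ?case by (simp add: flip_corr_def)
next
  case (Suc n)
  define g where "g = (\<lambda>e. (f (e(n := 1)) + f (e(n := -1))) / 2)"
  define h where "h = (\<lambda>e. (f (e(n := 1)) - f (e(n := -1))) / 2)"
  note s = sign_avg_Suc_split[OF g_def h_def]
  show ?case unfolding s(1-3)
    using Suc[of g] Suc[of h] sign_avg_sq_le[of n h] by (simp add: algebra_simps)
qed

text \<open>The next spectral level: n - 4 bounds every eigenvalue with |S| >= 2, and the two extra
  terms correct for the empty set and for the singletons. Since \<open>h\<close> enters one level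
  higher, the previous bound suffices for it.\<close>

lemma flip_corr_le2:
  "flip_corr n f \<le> (real n - 4) * sign_avg n (\<lambda>e. (f e)\<^sup>2) + 4 * (sign_avg n f)\<^sup>2
     + 2 * (\<Sum>i<n. (sign_avg n (\<lambda>e. e i * f e))\<^sup>2)"
proof (induction n arbitrary: f)
  case 0 then show ?case by (simp add: flip_corr_def)
next
  case (Suc n)
  define g where "g = (\<lambda>e. (f (e(n := 1)) + f (e(n := -1))) / 2)"
  define h where "h = (\<lambda>e. (f (e(n := 1)) - f (e(n := -1))) / 2)"
  note s = sign_avg_Suc_split[OF g_def h_def]
  have "(\<Sum>i<n. (sign_avg (Suc n) (\<lambda>e. e i * f e))\<^sup>2) = (\<Sum>i<n. (sign_avg n (\<lambda>e. e i * g e))\<^sup>2)"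
    by (intro sum.cong refl) (simp add: s(4))
  then have "(\<Sum>i<Suc n. (sign_avg (Suc n) (\<lambda>e. e i * f e))\<^sup>2)
     = (\<Sum>i<n. (sign_avg n (\<lambda>e. e i * g e))\<^sup>2) + (sign_avg n h)\<^sup>2"
    by (simp add: s(5))
  then show ?case unfolding s(1-3)
    using Suc[of g] flip_corr_le1[of n h] by (simp add: algebra_simps)
qed

text \<open>Khinchine--Kahane inequality with the constant of Latala and Oleszkiewicz: evenness kills
  the first Walsh level, which improves the constant in the Poincare inequality.\<close>

lemma sign_avg_kahane:
  assumes even: "\<And>e. e \<in> signs n \<Longrightarrow> f (\<lambda>i. - e i) = f e"
    and nonneg: "\<And>e. e \<in> signs n \<Longrightarrow> 0 \<le> f e"
    and tri: "\<And>e. e \<in> signs n \<Longrightarrow> (real n - 2) * f e \<le> (\<Sum>i<n. f (flip i e))"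
  shows "sign_avg n (\<lambda>e. (f e)\<^sup>2) \<le> 2 * (sign_avg n f)\<^sup>2"
proof -
  have odd0: "sign_avg n (\<lambda>e. e i * f e) = 0" for i
  proof -
    have "sign_avg n (\<lambda>e. e i * f e) = sign_avg n (\<lambda>e. - e i * f (\<lambda>i. - e i))"
      using sign_avg_uminus[of n "\<lambda>e. e i * f e"] by simp
    also have "\<dots> = sign_avg n (\<lambda>e. (-1) * (e i * f e))"
      by (intro sign_avg_cong) (auto simp: even)
    also have "\<dots> = - sign_avg n (\<lambda>e. e i * f e)" by (subst sign_avg_cmult) simp
    finally show ?thesis by simp
  qed
  \<comment> \<open>Bounding \<open>flip_corr\<close> from below by \<open>tri\<close> and from
    above by the second spectral bound leaves twice the mean of \<open>f^2\<close> at most four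
    times the squared mean of \<open>f\<close>.\<close>
  have "(real n - 2) * sign_avg n (\<lambda>e. (f e)\<^sup>2) = sign_avg n (\<lambda>e. f e * ((real n - 2) * f e))"
    unfolding sign_avg_cmult[symmetric] by (intro sign_avg_cong) (simp add: power2_eq_square)
  also have "\<dots> \<le> sign_avg n (\<lambda>e. f e * (\<Sum>i<n. f (flip i e)))"
    by (intro sign_avg_mono mult_left_mono tri nonneg)
  also have "\<dots> = flip_corr n f"
    by (simp add: flip_corr_def sum_distrib_left sign_avg_sum)
  also have "\<dots> \<le> (real n - 4) * sign_avg n (\<lambda>e. (f e)\<^sup>2) + 4 * (sign_avg n f)\<^sup>2"
    using flip_corr_le2[of n f] by (simp add: odd0)
  finally show ?thesis by (simp add: algebra_simps)
qed

text \<open>An argument of Paley-Zygmund type: when the second moment is comparable with the squared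
  mean, an event of probability 1/16 carries only a fraction of the mean.\<close>

lemma sign_avg_le_of_small_prob:
  assumes even: "\<And>e. e \<in> signs n \<Longrightarrow> f (\<lambda>i. - e i) = f e"
    and nonneg: "\<And>e. e \<in> signs n \<Longrightarrow> 0 \<le> f e"
    and tri: "\<And>e. e \<in> signs n \<Longrightarrow> (real n - 2) * f e \<le> (\<Sum>i<n. f (flip i e))"
    and prob: "sign_avg n (\<lambda>e. of_bool (f e > t)) \<le> 1 / 16"
    and t: "0 \<le> t"
  shows "sign_avg n f \<le> 2 * t"
proof (rule ccontr)
  assume neg: "\<not> sign_avg n f \<le> 2 * t"
  define m where "m = sign_avg n f"
  have m: "m > 2 * t" "m > 0" using neg t by (auto simp: m_def)
  \<comment> \<open>AM-GM: \<open>f \<le> f\<^sup>2 / (8 m) + 2 m\<close> on the event \<open>f > t\<close>\<close>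
  have le: "f e \<le> t + (1 / (8 * m)) * (f e)\<^sup>2 + (2 * m) * of_bool (f e > t)" for e
  proof -
    have "0 \<le> (f e - 4 * m)\<^sup>2" by simp
    then have "f e \<le> (1 / (8 * m)) * (f e)\<^sup>2 + 2 * m"
      using m by (simp add: field_simps power2_eq_square)
    moreover have "0 \<le> (1 / (8 * m)) * (f e)\<^sup>2" using m by simp
    ultimately show ?thesis
      using t by (cases "f e > t") (auto simp: algebra_simps)
  qed
  have "sign_avg n f \<le> sign_avg n (\<lambda>e. t + (1 / (8 * m)) * (f e)\<^sup>2 + (2 * m) * of_bool (f e > t))"
    by (intro sign_avg_mono le)
  also have "\<dots> = t + (1 / (8 * m)) * sign_avg n (\<lambda>e. (f e)\<^sup>2) + (2 * m) * sign_avg n (\<lambda>e. of_bool (f e > t))"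
    unfolding sign_avg_add sign_avg_cmult sign_avg_const ..
  also have "\<dots> \<le> t + (1 / (8 * m)) * (2 * m\<^sup>2) + (2 * m) * (1 / 16)"
    using sign_avg_kahane[of n f, OF even nonneg tri] prob m
    by (intro add_mono mult_left_mono order_refl) (auto simp: m_def)
  \<comment> \<open>Here 3/8 = 1/4 + 1/8, one part from the second moment and one from the event.
    This forces \<open>m <= 8 * t / 5\<close>, against \<open>m > 2 * t\<close> and
    \<open>m > 0\<close>.\<close>
  also have "\<dots> = t + 3 / 8 * m" using m by (simp add: field_simps power2_eq_square)
  finally show False using m t by (simp add: m_def[symmetric])
qed

lemma sign_avg_sum_sq: "sign_avg n (\<lambda>e. (\<Sum>i<n. e i)\<^sup>2) = n"
proof (induction n)
  case (Suc n)
  have "sign_avg (Suc n) (\<lambda>e. (\<Sum>i<Suc n. e i)\<^sup>2) = sign_avg n (\<lambda>e. (\<Sum>i<n. e i)\<^sup>2 + 1)"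
    unfolding sign_avg.simps by (intro sign_avg_cong) (simp add: power2_eq_square field_simps)
  then show ?case by (simp add: sign_avg_add sign_avg_const Suc)
qed simp

lemma sign_avg_chebyshev:
  assumes "R > 0" "n > 0"
  shows "sign_avg n (\<lambda>e. of_bool (\<bar>\<Sum>i<n. e i\<bar> > R * sqrt n)) \<le> 1 / R\<^sup>2"
proof -
  have "sign_avg n (\<lambda>e. of_bool (\<bar>\<Sum>i<n. e i\<bar> > R * sqrt n))
     \<le> sign_avg n (\<lambda>e. (1 / (R\<^sup>2 * n)) * (\<Sum>i<n. e i)\<^sup>2)"
  proof (rule sign_avg_mono)
    fix e :: "nat \<Rightarrow> real"
    have "R\<^sup>2 * n \<le> (\<Sum>i<n. e i)\<^sup>2" if "\<bar>\<Sum>i<n. e i\<bar> > R * sqrt n"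
    proof -
      have "(R * sqrt n)\<^sup>2 \<le> \<bar>\<Sum>i<n. e i\<bar>\<^sup>2" using that assms by (intro power_mono) auto
      then show ?thesis by (simp add: power_mult_distrib)
    qed
    then show "of_bool (\<bar>\<Sum>i<n. e i\<bar> > R * sqrt n) \<le> (1 / (R\<^sup>2 * n)) * (\<Sum>i<n. e i)\<^sup>2"
      using assms by (auto simp: field_simps)
  qed
  also have "\<dots> = 1 / R\<^sup>2"
    unfolding sign_avg_cmult sign_avg_sum_sq using assms by simp
  finally show ?thesis .
qed

text \<open>The product law on the signs with coordinatewise means \<open>u i\<close> in \<open>[-1,1]\<close>: under it, a sum with
  the weights \<open>u i\<close> is a mean of signed sums.\<close>

definition sign_weight :: "nat \<Rightarrow> (nat \<Rightarrow> real) \<Rightarrow> (nat \<Rightarrow> real) \<Rightarrow> real" where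
  "sign_weight n u e = (\<Prod>i<n. (1 + e i * u i) / 2)"

lemma sign_weight_Suc:
  "sign_weight (Suc n) u (e(n := c)) = sign_weight n u e * ((1 + c * u n) / 2)"
  by (simp add: sign_weight_def)

lemma sum_signs_Suc: "(\<Sum>e\<in>signs (Suc n). f e) = (\<Sum>e\<in>signs n. f (e(n := 1)) + f (e(n := -1)))" for f :: "_ \<Rightarrow> real"
  using sign_avg_eq_sum[of "Suc n" f] sign_avg_eq_sum[of n "\<lambda>e. (f (e(n := 1)) + f (e(n := -1))) / 2"]
    sign_avg.simps(2)[of n f]
  by (simp add: sum_divide_distrib[symmetric])

lemma sum_sign_weight: "(\<Sum>e\<in>signs n. sign_weight n u e) = 1"
proof (induction n)
  case (Suc n)
  have "sign_weight n u e * ((1 + 1 * u n) / 2) + sign_weight n u e * ((1 + -1 * u n) / 2) = sign_weight n u e" for e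
    by (simp add: field_simps)
  then show ?case unfolding sum_signs_Suc sign_weight_Suc using Suc by simp
qed (simp add: signs_0 sign_weight_def)

lemma sum_sign_weight_mult:
  "(\<Sum>e\<in>signs n. sign_weight n u e * (\<Sum>i<n. e i * c i)) = (\<Sum>i<n. u i * c i)"
proof (induction n)
  case (Suc n)
  have eq: "sign_weight n u e * ((1 + 1 * u n) / 2) * (\<Sum>i<Suc n. (e(n := 1)) i * c i)
     + sign_weight n u e * ((1 + -1 * u n) / 2) * (\<Sum>i<Suc n. (e(n := -1)) i * c i)
     = sign_weight n u e * (\<Sum>i<n. e i * c i) + sign_weight n u e * (u n * c n)" for e
  proof -
    have "(\<Sum>i<Suc n. (e(n := b)) i * c i) = (\<Sum>i<n. e i * c i) + b * c n" for b by simp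
    then show ?thesis by (simp only:) (simp add: field_simps)
  qed
  show ?case unfolding sum_signs_Suc sign_weight_Suc eq sum.distrib Suc.IH
    sum_distrib_right[symmetric] sum_sign_weight by simp
qed (simp add: signs_0)

lemma sign_weight_nonneg:
  assumes "e \<in> signs n" "\<And>i. i < n \<Longrightarrow> \<bar>u i\<bar> \<le> 1"
  shows "0 \<le> sign_weight n u e"
  unfolding sign_weight_def
proof (intro prod_nonneg)
  fix i assume "i \<in> {..<n}"
  then have "e i = 1 \<or> e i = -1" "\<bar>u i\<bar> \<le> 1" using assms by (auto simp: signs_def)
  then show "0 \<le> (1 + e i * u i) / 2" by auto
qed

subsection \<open>Outer probability\<close>

text \<open>Outer probability at most \<open>\<eta>\<close>, encoded by a single measurable cover;
  unions, image laws and majorants below all work directly with such a cover.\<close>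

definition outer_small :: "'w measure \<Rightarrow> 'w set \<Rightarrow> real \<Rightarrow> bool" where
  "outer_small P A \<eta> \<longleftrightarrow> (\<exists>B\<in>sets P. A \<inter> space P \<subseteq> B \<and> measure P B \<le> \<eta>)"

lemma outer_smallI: "B \<in> sets P \<Longrightarrow> A \<inter> space P \<subseteq> B \<Longrightarrow> measure P B \<le> \<eta> \<Longrightarrow> outer_small P A \<eta>"
  by (auto simp: outer_small_def)

lemma outer_smallE:
  assumes "outer_small P A \<eta>"
  obtains B where "B \<in> sets P" "A \<inter> space P \<subseteq> B" "measure P B \<le> \<eta>"
  using assms by (auto simp: outer_small_def)

lemma outer_small_mono:
  "outer_small P A \<eta> \<Longrightarrow> (\<And>x. x \<in> space P \<Longrightarrow> x \<in> A' \<Longrightarrow> x \<in> A) \<Longrightarrow> \<eta> \<le> \<eta>' \<Longrightarrow> outer_small P A' \<eta>'"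
  unfolding outer_small_def by (smt (verit) Int_iff subset_iff)

lemma (in finite_measure) outer_small_Un:
  assumes "outer_small M A a" "outer_small M B b"
  shows "outer_small M (A \<union> B) (a + b)"
proof -
  obtain A' B' where *: "A' \<in> sets M" "A \<inter> space M \<subseteq> A'" "measure M A' \<le> a"
     "B' \<in> sets M" "B \<inter> space M \<subseteq> B'" "measure M B' \<le> b"
    using assms by (auto simp: outer_small_def)
  show ?thesis
  proof (rule outer_smallI)
    show "measure M (A' \<union> B') \<le> a + b"
      using measure_Un_le[of A' M B'] * by linarith
  qed (use * in auto)
qed

lemma (in finite_measure) outer_small_UN:
  assumes "finite I" "\<And>i. i \<in> I \<Longrightarrow> outer_small M (A i) (a i)"
  shows "outer_small M (\<Union>i\<in>I. A i) (\<Sum>i\<in>I. a i)"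
  using assms
proof (induction I rule: finite_induct)
  case empty then show ?case by (auto intro: outer_smallI[of "{}"])
next
  case (insert i I)
  then show ?case using outer_small_Un[of "A i" "a i" "\<Union>i\<in>I. A i"] by auto
qed

lemma outer_small_vimage:
  assumes T: "T \<in> measurable M N" and d: "distr M N T = N" and A: "outer_small N A \<eta>"
  shows "outer_small M {x. T x \<in> A} \<eta>"
proof -
  obtain B where B: "B \<in> sets N" "A \<inter> space N \<subseteq> B" "measure N B \<le> \<eta>"
    using A by (auto simp: outer_small_def)
  have "measure M (T -` B \<inter> space M) = measure N B"
    using measure_distr[OF T B(1)] d by simp
  then show ?thesis
    using B T by (intro outer_smallI[of "T -` B \<inter> space M"]) (auto dest: measurable_space)
qed

lemma AE_imp_outer_small_cong:
  assumes "prob_space M" "outer_small M A \<eta>" "AE x in M. x \<in> A' \<longrightarrow> x \<in> A"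
  shows "outer_small M A' \<eta>"
proof -
  interpret prob_space M by fact
  obtain B where B: "B \<in> sets M" "A \<inter> space M \<subseteq> B" "measure M B \<le> \<eta>"
    using assms(2) by (auto simp: outer_small_def)
  obtain N where N: "{x \<in> space M. \<not> (x \<in> A' \<longrightarrow> x \<in> A)} \<subseteq> N" "emeasure M N = 0" "N \<in> sets M"
    using assms(3) by (rule AE_E)
  have "measure M N = 0" using N by (simp add: measure_def)
  then have "measure M (B \<union> N) \<le> \<eta>"
    using measure_Un_le[of B M N] B N by linarith
  then show ?thesis using B N by (intro outer_smallI[of "B \<union> N"]) auto
qed

subsection \<open>Outer expectation\<close>

lemma (in prob_space) outer_expectation_bounds:
  fixes T :: "'a \<Rightarrow> real"
  assumes "\<And>x. x \<in> space M \<Longrightarrow> \<bar>T x\<bar> \<le> b"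
  shows "bdd_below {integral\<^sup>L M U |U. integrable M U \<and> (\<forall>x\<in>space M. T x \<le> U x)}"
    and "{integral\<^sup>L M U |U. integrable M U \<and> (\<forall>x\<in>space M. T x \<le> U x)} \<noteq> {}"
proof -
  show "bdd_below {integral\<^sup>L M U |U. integrable M U \<and> (\<forall>x\<in>space M. T x \<le> U x)}"
  proof (rule bdd_belowI[of _ "- b"], clarify)
    fix U assume U: "integrable M U" "\<forall>x\<in>space M. T x \<le> U x"
    have "integral\<^sup>L M (\<lambda>_. - b) \<le> integral\<^sup>L M U"
    proof (rule integral_mono)
      fix x assume "x \<in> space M"
      then have "\<bar>T x\<bar> \<le> b" "T x \<le> U x" using assms U(2) by auto
      then show "- b \<le> U x" by linarith
    qed (use U in auto)
    then show "- b \<le> integral\<^sup>L M U" by (simp add: prob_space)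
  qed
  show "{integral\<^sup>L M U |U. integrable M U \<and> (\<forall>x\<in>space M. T x \<le> U x)} \<noteq> {}"
    using assms by (auto intro!: exI[of _ "\<lambda>_. b"] simp: abs_le_iff)
qed

lemma (in prob_space) outer_expectation_le:
  assumes "\<And>x. x \<in> space M \<Longrightarrow> \<bar>T x\<bar> \<le> b" "integrable M U" "\<And>x. x \<in> space M \<Longrightarrow> T x \<le> U x"
  shows "outer_expectation M T \<le> integral\<^sup>L M U"
  unfolding outer_expectation_def
  using assms by (intro cInf_lower outer_expectation_bounds(1)[of T b]) auto

lemma (in prob_space) outer_expectation_greatest:
  assumes "\<And>x. x \<in> space M \<Longrightarrow> \<bar>T x\<bar> \<le> b"
    and "\<And>U. integrable M U \<Longrightarrow> (\<And>x. x \<in> space M \<Longrightarrow> T x \<le> U x) \<Longrightarrow> c \<le> integral\<^sup>L M U"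
  shows "c \<le> outer_expectation M T"
  unfolding outer_expectation_def
  using assms by (intro cInf_greatest outer_expectation_bounds(2)[of T b]) auto

lemma (in prob_space) outer_expectation_less_obtain:
  assumes "\<And>x. x \<in> space M \<Longrightarrow> \<bar>T x\<bar> \<le> b" "outer_expectation M T < c"
  obtains U where "integrable M U" "\<And>x. x \<in> space M \<Longrightarrow> T x \<le> U x" "integral\<^sup>L M U < c"
  using assms outer_expectation_greatest[of T b c] by (meson not_le)

lemma (in prob_space) outer_expectation_mono:
  assumes "\<And>x. x \<in> space M \<Longrightarrow> \<bar>T x\<bar> \<le> b" "\<And>x. x \<in> space M \<Longrightarrow> \<bar>T' x\<bar> \<le> b'"
    and "\<And>x. x \<in> space M \<Longrightarrow> T x \<le> T' x"
  shows "outer_expectation M T \<le> outer_expectation M T'"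
proof (rule outer_expectation_greatest[of T' b'])
  fix U assume "integrable M U" "\<And>x. x \<in> space M \<Longrightarrow> T' x \<le> U x"
  then show "outer_expectation M T \<le> integral\<^sup>L M U"
    using assms by (intro outer_expectation_le[of T b]) (force intro: order_trans)+
qed (use assms in auto)

lemma (in prob_space) outer_expectation_eq_integral:
  assumes "\<And>x. x \<in> space M \<Longrightarrow> \<bar>T x\<bar> \<le> b" "integrable M T"
  shows "outer_expectation M T = integral\<^sup>L M T"
proof (rule antisym)
  show "outer_expectation M T \<le> integral\<^sup>L M T"
    using assms by (intro outer_expectation_le[of T b]) auto
  show "integral\<^sup>L M T \<le> outer_expectation M T"
    using assms by (intro outer_expectation_greatest[of T b] integral_mono) auto
qed

lemma (in prob_space) outer_small_of_outer_expectation: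
  assumes "\<And>x. x \<in> space M \<Longrightarrow> 0 \<le> T x \<and> T x \<le> 1" "outer_expectation M T < c"
  shows "outer_small M {x. T x \<ge> 1} c"
proof -
  obtain U where U: "integrable M U" "\<And>x. x \<in> space M \<Longrightarrow> T x \<le> U x" "integral\<^sup>L M U < c"
    using assms by (elim outer_expectation_less_obtain[of T 1, rotated]) auto
  have [measurable]: "U \<in> borel_measurable M" using U by simp
  show ?thesis
  proof (rule outer_smallI)
    show "{x\<in>space M. U x \<ge> 1} \<in> sets M" by measurable
    show "{x. T x \<ge> 1} \<inter> space M \<subseteq> {x\<in>space M. U x \<ge> 1}" using U(2) by fastforce
    have "measure M {x\<in>space M. U x \<ge> 1} \<le> integral\<^sup>L M U / 1"
      using U assms by (intro integral_Markov_inequality_measure[where A = "{}"]) (auto, fastforce intro: order_trans)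
    then show "measure M {x\<in>space M. U x \<ge> 1} \<le> c" using U by simp
  qed
qed

text \<open>Off \<open>A\<close> the shift \<open>d\<close> is enough. On \<open>A\<close> the two
  functions differ by at most \<open>2 * b\<close>, and the extra |d| offsets a negative
  \<open>d\<close>.\<close>

lemma (in prob_space) outer_expectation_perturb:
  assumes T: "\<And>x. x \<in> space M \<Longrightarrow> \<bar>T x\<bar> \<le> b" and T': "\<And>x. x \<in> space M \<Longrightarrow> \<bar>T' x\<bar> \<le> b"
    and A: "outer_small M A \<eta>" and le: "\<And>x. x \<in> space M \<Longrightarrow> x \<notin> A \<Longrightarrow> T x \<le> T' x + d"
  shows "outer_expectation M T \<le> outer_expectation M T' + d + (2 * b + \<bar>d\<bar>) * \<eta>"
proof -
  obtain B where B [measurable]: "B \<in> sets M" and AB: "A \<inter> space M \<subseteq> B" and mB: "measure M B \<le> \<eta>"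
    using A by (rule outer_smallE)
  obtain x0 where "x0 \<in> space M" using not_empty by blast
  then have b0: "0 \<le> b" using T[of x0] by auto
  have "outer_expectation M T - d - (2 * b + \<bar>d\<bar>) * \<eta> \<le> outer_expectation M T'"
  proof (rule outer_expectation_greatest[of T' b])
    fix U assume U: "integrable M U" "\<And>x. x \<in> space M \<Longrightarrow> T' x \<le> U x"
    let ?U = "\<lambda>x. U x + d + (2 * b + \<bar>d\<bar>) * indicator B x"
    have "outer_expectation M T \<le> integral\<^sup>L M ?U"
    proof (rule outer_expectation_le[of T b])
      show "integrable M ?U"
        using U(1) by (intro Bochner_Integration.integrable_add integrable_mult_right integrable_const integrable_real_indicator)
          (auto simp: emeasure_eq_measure)
      fix x assume x: "x \<in> space M"
      show "T x \<le> ?U x"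
      proof (cases "x \<in> A")
        case True
        then have "x \<in> B" using AB x by auto
        then show ?thesis using T[OF x] T'[OF x] U(2)[OF x] by (simp split: abs_split)
      next
        case False
        then show ?thesis using le[OF x] U(2)[OF x] b0 by (auto simp: indicator_def)
      qed
    qed (use T in auto)
    also have "integral\<^sup>L M ?U = integral\<^sup>L M U + d + (2 * b + \<bar>d\<bar>) * measure M B"
      using U(1) by (simp add: prob_space emeasure_eq_measure)
    also have "\<dots> \<le> integral\<^sup>L M U + d + (2 * b + \<bar>d\<bar>) * \<eta>"
      using mB b0 by (intro add_left_mono mult_left_mono) auto
    finally show "outer_expectation M T - d - (2 * b + \<bar>d\<bar>) * \<eta> \<le> integral\<^sup>L M U" by simp
  qed (use T' in auto)
  then show ?thesis by simp
qed

subsection \<open>Minimal measurable majorants\<close>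

text \<open>The measurable cover function of the calculus of outer expectations, determined up to
  null sets. Nonnegativity is required everywhere, so that averages over signs need no exceptional
  set for it.\<close>

definition min_majorant :: "'w measure \<Rightarrow> ('w \<Rightarrow> real) \<Rightarrow> ('w \<Rightarrow> real) \<Rightarrow> bool" where
  "min_majorant M T U \<longleftrightarrow> U \<in> borel_measurable M \<and> (\<forall>x. 0 \<le> U x) \<and> (AE x in M. T x \<le> U x) \<and>
     (\<forall>V\<in>borel_measurable M. (AE x in M. T x \<le> V x) \<longrightarrow> (AE x in M. U x \<le> V x))"

text \<open>A bounded strictly increasing functional is minimised over the measurable majorants; the
  infimum of a minimising sequence is again a majorant and attains the minimum. The outer tightness
  \<open>fin\<close> supplies a first finite-valued majorant.\<close>

lemma (in prob_space) ex_min_majorant: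
  fixes T :: "'a \<Rightarrow> real"
  assumes pos: "\<And>x. x \<in> space M \<Longrightarrow> 0 \<le> T x"
    and fin: "\<And>\<eta>. \<eta> > 0 \<Longrightarrow> \<exists>K. outer_small M {x. T x > K} \<eta>"
  shows "\<exists>U. min_majorant M T U"
proof -
  have "\<forall>k::nat. \<exists>K B. B \<in> sets M \<and> {x. T x > K} \<inter> space M \<subseteq> B \<and> measure M B \<le> 1 / Suc k"
    using fin[of "1 / real (Suc _)"] unfolding outer_small_def by (metis of_nat_0_less_iff zero_less_Suc zero_less_divide_1_iff)
  then obtain K B where KB: "\<And>k::nat. B k \<in> sets M" "\<And>k. {x. T x > K k} \<inter> space M \<subseteq> B k"
      "\<And>k. measure M (B k) \<le> 1 / Suc k" by metis
  have [measurable]: "B k \<in> sets M" for k by (rule KB)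
  \<comment> \<open>The sets \<open>B k\<close> cover the events that \<open>T\<close> exceeds
    \<open>K k\<close>, and their measures tend to 0, so almost every point escapes some
    \<open>B k\<close>. The bound belonging to the first such \<open>k\<close> is finite and
    measurable.\<close>
  define W where "W = (\<lambda>x. K (LEAST k. x \<notin> B k))"
  have W [measurable]: "W \<in> borel_measurable M"
    unfolding W_def by measurable
  have "measure M (\<Inter>k. B k) \<le> 1 / Suc k" for k
    by (rule order_trans[OF _ KB(3)[of k]]) (intro finite_measure_mono, auto)
  then have m0: "measure M (\<Inter>k. B k) \<le> 0"
    by (intro LIMSEQ_le_const[OF LIMSEQ_inverse_real_of_nat]) (auto simp: inverse_eq_divide)
  have "(\<Inter>k. B k) \<in> null_sets M"
    using m0 by (intro null_setsI) (auto simp: emeasure_eq_measure order_antisym)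
  then have AEW: "AE x in M. T x \<le> W x"
  proof (rule AE_I', intro subsetI)
    fix x assume x: "x \<in> {x \<in> space M. \<not> T x \<le> W x}"
    show "x \<in> (\<Inter>k. B k)"
    proof (rule ccontr)
      assume "x \<notin> (\<Inter>k. B k)"
      then have "x \<notin> B (LEAST k. x \<notin> B k)" by (metis (mono_tags, lifting) INT_I LeastI)
      moreover have "x \<in> B (LEAST k. x \<notin> B k)"
        using x KB(2)[of "LEAST k. x \<notin> B k"] by (auto simp: W_def)
      ultimately show False by blast
    qed
  qed
  define VV where "VV = {V \<in> borel_measurable M. (\<forall>x. 0 \<le> V x) \<and> (AE x in M. T x \<le> V x)}"
  \<comment> \<open>The transform v / (1 + v) keeps the integral finite for every \<open>V\<close>
    and is strictly increasing, so that ordered functions with equal integrals agree almost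
    everywhere.\<close>
  define \<psi> where "\<psi> V = (\<integral>x. V x / (1 + V x) \<partial>M)" for V :: "'a \<Rightarrow> real"
  have int: "integrable M (\<lambda>x. V x / (1 + V x))" if "V \<in> VV" for V
  proof (rule integrable_const_bound[of _ 1])
    show "AE x in M. norm (V x / (1 + V x)) \<le> 1"
    proof (rule AE_I2)
      fix x
      have "0 \<le> V x" using that by (auto simp: VV_def)
      then show "norm (V x / (1 + V x)) \<le> 1" by (auto simp: divide_le_eq_1)
    qed
  qed (use that in \<open>auto simp: VV_def\<close>)
  have ne: "(\<lambda>x. max 0 (W x)) \<in> VV" using AEW by (auto simp: VV_def elim: eventually_mono)
  have psi0: "0 \<le> \<psi> V" if "V \<in> VV" for V
    unfolding \<psi>_def using that by (intro integral_nonneg_AE AE_I2) (auto simp: VV_def)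
  have bb: "bdd_below (\<psi> ` VV)" by (intro bdd_belowI2[of _ 0] psi0)
  define c where "c = Inf (\<psi> ` VV)"
  have "\<exists>V\<in>VV. \<psi> V < c + 1 / Suc k" for k :: nat
    using cInf_lessD[of "\<psi> ` VV" "c + 1 / Suc k"] ne by (auto simp: c_def)
  then obtain V where V: "\<And>k::nat. V k \<in> VV" "\<And>k. \<psi> (V k) < c + 1 / Suc k" by metis
  have [measurable]: "V k \<in> borel_measurable M" for k using V(1)[of k] by (auto simp: VV_def)
  have V0: "0 \<le> V k x" for k x using V(1)[of k] by (auto simp: VV_def)
  define U where "U = (\<lambda>x. INF k. V k x)"
  have bV: "bdd_below (range (\<lambda>k. V k x))" for x by (intro bdd_belowI2[of _ 0] V0)
  have Um [measurable]: "U \<in> borel_measurable M"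
    unfolding U_def using bV by (intro borel_measurable_cINF_real) auto
  have U0: "0 \<le> U x" for x unfolding U_def using V0 by (intro cINF_greatest) auto
  have "AE x in M. \<forall>k. T x \<le> V k x" using V(1) by (auto simp: AE_all_countable VV_def)
  then have UT: "AE x in M. T x \<le> U x"
    by eventually_elim (auto simp: U_def intro!: cINF_greatest)
  have UVV: "U \<in> VV" using UT U0 by (auto simp: VV_def)
  have mono: "u / (1 + u) \<le> v / (1 + v)" if "0 \<le> u" "u \<le> v" for u v :: real
    using that by (simp add: field_simps)
  have "\<psi> U \<le> \<psi> (V k)" for k
    unfolding \<psi>_def using U0 V(1) UVV bV
    by (intro integral_mono int mono) (auto simp: U_def intro!: cINF_lower)
  then have "\<psi> U \<le> c + 1 / Suc k" for k using V(2)[of k] by (meson less_imp_le order_trans)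
  then have "\<psi> U \<le> c"
  proof (intro LIMSEQ_le_const[of "\<lambda>k. c + 1 / Suc k" c])
    show "(\<lambda>k. c + 1 / Suc k) \<longlonglongrightarrow> c"
      using tendsto_add[OF tendsto_const[of c] LIMSEQ_inverse_real_of_nat] by (simp add: inverse_eq_divide)
  qed auto
  have min: "AE x in M. U x \<le> V x" if [measurable]: "V \<in> borel_measurable M" and VT: "AE x in M. T x \<le> V x" for V
  proof -
    \<comment> \<open>Cutting the minimiser \<open>U\<close> down by a competitor leaves a majorant,
      whose value cannot fall below the infimum; hence almost surely nothing was cut off.\<close>
    define W' where "W' = (\<lambda>x. min (U x) (max 0 (V x)))"
    have W': "W' \<in> VV"
      using VT UT U0 by (auto simp: VV_def W'_def)
    have "c \<le> \<psi> W'" unfolding c_def using W' by (intro cINF_lower bb) auto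
    then have le: "\<psi> U - \<psi> W' \<le> 0" using \<open>\<psi> U \<le> c\<close> by simp
    have i: "integrable M (\<lambda>x. U x / (1 + U x) - W' x / (1 + W' x))"
      using int[OF UVV] int[OF W'] by auto
    have nn: "0 \<le> U x / (1 + U x) - W' x / (1 + W' x)" for x
      using mono[of "W' x" "U x"] U0[of x] by (auto simp: W'_def)
    have "(\<integral>x. U x / (1 + U x) - W' x / (1 + W' x) \<partial>M) = 0"
    proof (rule antisym)
      show "0 \<le> (\<integral>x. U x / (1 + U x) - W' x / (1 + W' x) \<partial>M)" using nn by (intro integral_nonneg_AE AE_I2)
      show "(\<integral>x. U x / (1 + U x) - W' x / (1 + W' x) \<partial>M) \<le> 0"
        using le int[OF UVV] int[OF W'] by (simp add: \<psi>_def)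
    qed
    then have "AE x in M. U x / (1 + U x) - W' x / (1 + W' x) = 0"
      using integral_nonneg_eq_0_iff_AE[OF i] nn by auto
    then show ?thesis using VT AE_space
    proof eventually_elim
      case (elim x)
      have W0: "0 \<le> W' x" using U0 by (auto simp: W'_def)
      have "U x * (1 + W' x) = W' x * (1 + U x)"
        using elim(1) U0[of x] W0 by (simp add: frac_eq_eq)
      then have "U x = W' x" by (simp add: algebra_simps)
      then show ?case using elim(2) pos[OF elim(3)] by (simp add: W'_def)
    qed
  qed
  show ?thesis unfolding min_majorant_def using Um U0 UT min by blast
qed

text \<open>Lowering \<open>U\<close> to \<open>t\<close> outside a cover of the event
  \<open>T > t\<close> gives a competitor, so minimality forces \<open>U <= t\<close> there almost
  surely. Tail bounds of the nonmeasurable \<open>T\<close> thus pass to \<open>U\<close> without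
  loss.\<close>

lemma (in prob_space) min_majorant_outer_small:
  assumes U: "min_majorant M T U" and A: "outer_small M {x. T x > t} \<eta>"
  shows "measure M {x\<in>space M. U x > t} \<le> \<eta>"
proof -
  obtain B where B [measurable]: "B \<in> sets M" and AB: "{x. T x > t} \<inter> space M \<subseteq> B" and mB: "measure M B \<le> \<eta>"
    using A by (rule outer_smallE)
  have [measurable]: "U \<in> borel_measurable M" using U by (simp add: min_majorant_def)
  have UT: "AE x in M. T x \<le> U x" using U by (simp add: min_majorant_def)
  have "AE x in M. T x \<le> (if x \<in> B then U x else t)"
    using UT AE_space by eventually_elim (use AB in force)
  then have "AE x in M. U x \<le> (if x \<in> B then U x else t)"
    using U by (auto simp: min_majorant_def)
  then have "measure M {x\<in>space M. U x > t} \<le> measure M B"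
    by (intro finite_measure_mono_AE) (auto elim!: eventually_mono split: if_splits)
  then show ?thesis using mB by simp
qed

subsection \<open>Reduction of weak convergence to Lipschitz functions\<close>

definition lipschitz_real :: "'a metric \<Rightarrow> real \<Rightarrow> ('a \<Rightarrow> real) \<Rightarrow> bool" where
  "lipschitz_real m C h \<longleftrightarrow> 0 \<le> C \<and> (\<forall>x\<in>mspace m. \<forall>y\<in>mspace m. \<bar>h x - h y\<bar> \<le> C * mdist m x y)"

lemma lipschitz_real_continuous_map:
  assumes "lipschitz_real m C h"
  shows "continuous_map (mtopology_of m) euclideanreal h"
proof -
  have "Lipschitz_continuous_map m euclidean_metric h"
    using assms unfolding Lipschitz_continuous_map_def lipschitz_real_def by (auto simp: dist_real_def)
  from Lipschitz_continuous_imp_continuous_map[OF this] show ?thesis by simp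
qed

lemma space_borel_sigma [simp]: "space (borel_sigma X) = topspace X"
  by (auto simp: borel_sigma_def space_measure_of_conv)

lemma sets_borel_sigma: "openin X U \<Longrightarrow> U \<in> sets (borel_sigma X)"
  unfolding borel_sigma_def by (subst sets_measure_of) (auto dest: openin_subset)

lemma sets_borel_sigma_closed: "closedin X C \<Longrightarrow> C \<in> sets (borel_sigma X)"
proof -
  assume C: "closedin X C"
  then have "topspace X - (topspace X - C) \<in> sets (borel_sigma X)"
    by (intro sets.Diff sets_borel_sigma) auto
  moreover have "topspace X - (topspace X - C) = C" using closedin_subset[OF C] by auto
  ultimately show ?thesis by simp
qed

lemma measurable_borel_sigmaI:
  assumes "\<And>x. x \<in> space M \<Longrightarrow> f x \<in> topspace X"
    and "\<And>U. openin X U \<Longrightarrow> f -` U \<inter> space M \<in> sets M"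
  shows "f \<in> measurable M (borel_sigma X)"
  unfolding borel_sigma_def
  using assms by (intro measurable_measure_of) (auto dest: openin_subset)

lemma measurable_continuous_map_borel_sigma:
  assumes h: "continuous_map X euclideanreal h"
  shows "h \<in> borel_measurable (borel_sigma X)"
proof (rule borel_measurableI)
  fix S :: "real set" assume "open S"
  then have "openin X {x \<in> topspace X. h x \<in> S}"
    using h by (auto simp: continuous_map_def)
  then have "{x \<in> topspace X. h x \<in> S} \<in> sets (borel_sigma X)" by (rule sets_borel_sigma)
  also have "{x \<in> topspace X. h x \<in> S} = h -` S \<inter> space (borel_sigma X)" by auto
  finally show "h -` S \<inter> space (borel_sigma X) \<in> sets (borel_sigma X)" .
qed

text \<open>The largest \<open>k\<close>-Lipschitz minorant of a bounded function, its
  Pasch-Hausdorff envelope.\<close>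

definition inf_conv :: "'a metric \<Rightarrow> nat \<Rightarrow> ('a \<Rightarrow> real) \<Rightarrow> 'a \<Rightarrow> real" where
  "inf_conv m k h x = (INF y\<in>mspace m. h y + k * mdist m x y)"

context
  fixes m :: "'a metric" and h :: "'a \<Rightarrow> real" and b :: real
  assumes b: "\<And>x. x \<in> mspace m \<Longrightarrow> \<bar>h x\<bar> \<le> b"
begin

lemma inf_conv_bdd: "x \<in> mspace m \<Longrightarrow> bdd_below ((\<lambda>y. h y + real k * mdist m x y) ` mspace m)"
proof (rule bdd_belowI2[of _ "- b"])
  fix y assume "x \<in> mspace m" "y \<in> mspace m"
  then have "- b \<le> h y" "0 \<le> real k * mdist m x y" using b[of y] by auto
  then show "- b \<le> h y + real k * mdist m x y" by linarith
qed

lemma inf_conv_le: "x \<in> mspace m \<Longrightarrow> y \<in> mspace m \<Longrightarrow> inf_conv m k h x \<le> h y + k * mdist m x y"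
  unfolding inf_conv_def by (intro cINF_lower inf_conv_bdd) auto

lemma inf_conv_le_self: assumes "x \<in> mspace m" shows "inf_conv m k h x \<le> h x"
proof -
  have "mdist m x x = 0" using assms by simp
  then show ?thesis using inf_conv_le[OF assms assms, of k] by simp
qed

lemma inf_conv_abs_le: assumes x: "x \<in> mspace m" shows "\<bar>inf_conv m k h x\<bar> \<le> b"
proof -
  have "- b \<le> inf_conv m k h x" unfolding inf_conv_def
  proof (rule cINF_greatest)
    fix y assume y: "y \<in> mspace m"
    then have "- b \<le> h y" "0 \<le> real k * mdist m x y" using b[of y] by auto
    then show "- b \<le> h y + real k * mdist m x y" by linarith
  qed (use x in auto)
  then show ?thesis using inf_conv_le_self[OF x, of k] b[OF x] by linarith
qed

lemma inf_conv_lipschitz: "lipschitz_real m k (inf_conv m k h)"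
proof -
  have *: "inf_conv m k h x \<le> inf_conv m k h y + k * mdist m x y" if x: "x \<in> mspace m" and y: "y \<in> mspace m" for x y
  proof -
    have "inf_conv m k h x - k * mdist m x y \<le> inf_conv m k h y"
      unfolding inf_conv_def[of m k h y]
    proof (rule cINF_greatest)
      fix z assume z: "z \<in> mspace m"
      have "real k * mdist m x z \<le> real k * (mdist m x y + mdist m y z)"
        by (intro mult_left_mono mdist_triangle x y z) auto
      then show "inf_conv m k h x - k * mdist m x y \<le> h z + k * mdist m y z"
        using inf_conv_le[OF x z, of k] by (simp add: distrib_left)
    qed (use y in auto)
    then show ?thesis by simp
  qed
  show ?thesis
    using * by (auto simp: lipschitz_real_def abs_le_iff) (metis add.commute diff_le_eq mdist_commute)+
qed

text \<open>Near \<open>x\<close> continuity keeps \<open>h\<close> above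
  \<open>h x - e / 2\<close>; at distance \<open>r\<close> or more the penalty \<open>k * r\<close>
  eventually exceeds the oscillation \<open>2 * b\<close>.\<close>

lemma inf_conv_tendsto:
  assumes h: "continuous_map (mtopology_of m) euclideanreal h" and x: "x \<in> mspace m"
  shows "(\<lambda>k. inf_conv m k h x) \<longlonglongrightarrow> h x"
proof (rule LIMSEQ_I)
  fix e :: real assume e: "e > 0"
  interpret Metric_space "mspace m" "mdist m" by simp
  have "openin mtopology {y \<in> mspace m. h y \<in> {h x - e/2 <..}}"
    using openin_continuous_map_preimage[OF h, of "{h x - e/2 <..}"] by (simp add: mtopology_of_def)
  then obtain r where r: "r > 0" "mball x r \<subseteq> {y \<in> mspace m. h y \<in> {h x - e/2 <..}}"
    using x e by (auto simp: openin_mtopology)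
  obtain n :: nat where n: "real n > 2 * b / r" using reals_Archimedean2 by blast
  show "\<exists>n. \<forall>k\<ge>n. norm (inf_conv m k h x - h x) < e"
  proof (intro exI allI impI)
    fix k assume "n \<le> k"
    then have "real k \<ge> real n" by simp
    then have "real n * r \<le> real k * r" using r by (intro mult_right_mono) auto
    moreover have "2 * b < real n * r" using n r by (simp add: field_simps)
    ultimately have k: "real k * r > 2 * b" by linarith
    have "h x - e / 2 \<le> inf_conv m k h x" unfolding inf_conv_def
    proof (rule cINF_greatest)
      fix y assume y: "y \<in> mspace m"
      show "h x - e / 2 \<le> h y + real k * mdist m x y"
      proof (cases "mdist m x y < r")
        case True
        then have "h y > h x - e / 2" using r y x by (auto simp: subset_iff in_mball)
        moreover have "0 \<le> real k * mdist m x y" by simp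
        ultimately show ?thesis by linarith
      next
        case False
        then have "real k * r \<le> real k * mdist m x y" by (intro mult_left_mono) auto
        then show ?thesis using k b[OF x] b[OF y] e by linarith
      qed
    qed (use x in auto)
    then show "norm (inf_conv m k h x - h x) < e" using inf_conv_le_self[OF x, of k] e by simp
  qed
qed

end

text \<open>A bounded continuous \<open>h\<close> is squeezed between Lipschitz functions: its
  envelopes from below yield the lower limit, and those of \<open>-h\<close>, negated, the upper
  one. On the side of \<open>Z\<close> the comparison is monotonicity of outer expectations; on the
  side of \<open>G\<close> it is dominated convergence.\<close>

lemma weakly_converges_lipschitzI:
  fixes m :: "'a metric"
  assumes P: "prob_space P" and M: "prob_space M"
    and Z: "\<And>N \<omega>. \<omega> \<in> space P \<Longrightarrow> Z N \<omega> \<in> mspace m"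
    and G: "G \<in> measurable M (borel_sigma (mtopology_of m))"
    and lip: "\<And>h C b. lipschitz_real m C h \<Longrightarrow> (\<And>x. x \<in> mspace m \<Longrightarrow> \<bar>h x\<bar> \<le> b) \<Longrightarrow>
       (\<lambda>N. outer_expectation P (\<lambda>\<omega>. h (Z N \<omega>))) \<longlonglongrightarrow> integral\<^sup>L M (\<lambda>v. h (G v))"
  shows "weakly_converges m P Z M G"
  unfolding weakly_converges_def
proof (intro allI impI, elim conjE)
  fix h :: "'a \<Rightarrow> real"
  assume h: "continuous_map (mtopology_of m) euclideanreal h" and "bounded (h ` mspace m)"
  then obtain b where b: "\<And>x. x \<in> mspace m \<Longrightarrow> \<bar>h x\<bar> \<le> b" by (auto simp: bounded_iff)
  then have b': "\<And>x. x \<in> mspace m \<Longrightarrow> \<bar>- h x\<bar> \<le> b" by auto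
  have h': "continuous_map (mtopology_of m) euclideanreal (\<lambda>x. - h x)"
    using h by (rule continuous_map_minus)
  interpret P: prob_space P by fact
  interpret M: prob_space M by fact
  have Gs: "G v \<in> mspace m" if "v \<in> space M" for v
    using measurable_space[OF G that] by simp
  have meas: "(\<lambda>v. g (G v)) \<in> borel_measurable M" if "continuous_map (mtopology_of m) euclideanreal g" for g
    by (rule measurable_compose[OF G measurable_continuous_map_borel_sigma[OF that]])
  have conv: "(\<lambda>k. integral\<^sup>L M (\<lambda>v. inf_conv m k g (G v))) \<longlonglongrightarrow> integral\<^sup>L M (\<lambda>v. g (G v))"
    if g: "continuous_map (mtopology_of m) euclideanreal g" "\<And>x. x \<in> mspace m \<Longrightarrow> \<bar>g x\<bar> \<le> b" for g
  proof (rule integral_dominated_convergence[where w = "\<lambda>_. b"])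
    show "(\<lambda>v. inf_conv m k g (G v)) \<in> borel_measurable M" for k
      by (intro meas lipschitz_real_continuous_map[OF inf_conv_lipschitz[of m g b]] g)
    show "AE v in M. (\<lambda>k. inf_conv m k g (G v)) \<longlonglongrightarrow> g (G v)"
      by (intro AE_I2 inf_conv_tendsto[of m g b] g Gs)
    show "AE v in M. norm (inf_conv m k g (G v)) \<le> b" for k
      using inf_conv_abs_le[of m g b, OF g(2)] Gs by (intro AE_I2) auto
  qed (use meas[OF g(1)] in auto)
  show "(\<lambda>N. outer_expectation P (\<lambda>\<omega>. h (Z N \<omega>))) \<longlonglongrightarrow> integral\<^sup>L M (\<lambda>v. h (G v))"
  proof (rule order_tendstoI)
    fix c assume "c < integral\<^sup>L M (\<lambda>v. h (G v))"
    then have "\<forall>\<^sub>F k in sequentially. c < integral\<^sup>L M (\<lambda>v. inf_conv m k h (G v))"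
      using order_tendstoD(1)[OF conv[OF h b]] by blast
    then obtain k where "c < integral\<^sup>L M (\<lambda>v. inf_conv m k h (G v))"
      unfolding eventually_sequentially by blast
    moreover have "(\<lambda>N. outer_expectation P (\<lambda>\<omega>. inf_conv m k h (Z N \<omega>))) \<longlonglongrightarrow> integral\<^sup>L M (\<lambda>v. inf_conv m k h (G v))"
      by (rule lip[OF inf_conv_lipschitz[OF b] inf_conv_abs_le[OF b]])
    ultimately have "\<forall>\<^sub>F N in sequentially. c < outer_expectation P (\<lambda>\<omega>. inf_conv m k h (Z N \<omega>))"
      by (rule order_tendstoD(1)[rotated])
    then show "\<forall>\<^sub>F N in sequentially. c < outer_expectation P (\<lambda>\<omega>. h (Z N \<omega>))"
    proof eventually_elim
      case (elim N)
      have "outer_expectation P (\<lambda>\<omega>. inf_conv m k h (Z N \<omega>)) \<le> outer_expectation P (\<lambda>\<omega>. h (Z N \<omega>))"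
        by (intro P.outer_expectation_mono[of _ b _ b] inf_conv_abs_le[OF b] b Z inf_conv_le_self[OF b])
      then show ?case using elim by simp
    qed
  next
    fix c assume c: "integral\<^sup>L M (\<lambda>v. h (G v)) < c"
    let ?g = "\<lambda>k x. - inf_conv m k (\<lambda>x. - h x) x"
    have "(\<lambda>k. integral\<^sup>L M (\<lambda>v. ?g k (G v))) \<longlonglongrightarrow> integral\<^sup>L M (\<lambda>v. h (G v))"
      using tendsto_minus[OF conv[OF h' b']] by simp
    from order_tendstoD(2)[OF this c] obtain k where "integral\<^sup>L M (\<lambda>v. ?g k (G v)) < c"
      unfolding eventually_sequentially by blast
    moreover have "(\<lambda>N. outer_expectation P (\<lambda>\<omega>. ?g k (Z N \<omega>))) \<longlonglongrightarrow> integral\<^sup>L M (\<lambda>v. ?g k (G v))"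
    proof (rule lip)
      have "lipschitz_real m k (inf_conv m k (\<lambda>x. - h x))" by (rule inf_conv_lipschitz[of m "\<lambda>x. - h x" b, OF b'])
      then show "lipschitz_real m k (?g k)" by (auto simp: lipschitz_real_def abs_minus_commute)
      show "\<bar>?g k x\<bar> \<le> b" if "x \<in> mspace m" for x
        using inf_conv_abs_le[of m "\<lambda>x. - h x" b, OF b' that] by simp
    qed
    ultimately have "\<forall>\<^sub>F N in sequentially. outer_expectation P (\<lambda>\<omega>. ?g k (Z N \<omega>)) < c"
      by (rule order_tendstoD(2)[rotated])
    then show "\<forall>\<^sub>F N in sequentially. outer_expectation P (\<lambda>\<omega>. h (Z N \<omega>)) < c"
    proof eventually_elim
      case (elim N)
      have "outer_expectation P (\<lambda>\<omega>. h (Z N \<omega>)) \<le> outer_expectation P (\<lambda>\<omega>. ?g k (Z N \<omega>))"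
      proof (rule P.outer_expectation_mono[of _ b _ b])
        fix \<omega> assume w: "\<omega> \<in> space P"
        show "\<bar>h (Z N \<omega>)\<bar> \<le> b" using b Z[OF w] by auto
        show "\<bar>?g k (Z N \<omega>)\<bar> \<le> b" using inf_conv_abs_le[of m "\<lambda>x. - h x" b, OF b' Z[OF w, of N]] by simp
        show "h (Z N \<omega>) \<le> ?g k (Z N \<omega>)" using inf_conv_le_self[of m "\<lambda>x. - h x" b, OF b' Z[OF w, of N], of k] by simp
      qed
      then show ?case using elim by simp
    qed
  qed
qed

subsection \<open>The space of bounded functions\<close>

lemma mem_linf: "z \<in> mspace (linf H) \<longleftrightarrow> z \<in> extensional H \<and> (\<exists>b. \<forall>f\<in>H. \<bar>z f\<bar> \<le> b)"
proof -
  have "bounded (z ` H) \<longleftrightarrow> (\<exists>b. \<forall>f\<in>H. \<bar>z f\<bar> \<le> b)" by (simp add: bounded_iff)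
  then show ?thesis by (auto simp: Met_TC.fspace_def)
qed

lemma mdist_linf_le:
  "z \<in> mspace (linf H) \<Longrightarrow> w \<in> mspace (linf H) \<Longrightarrow> H \<noteq> {} \<Longrightarrow>
   mdist (linf H) z w \<le> a \<longleftrightarrow> (\<forall>f\<in>H. \<bar>z f - w f\<bar> \<le> a)"
  by (subst funspace_mdist_le) (auto simp: dist_real_def)

declare mspace_funspace [simp del] mdist_funspace [simp del]

lemma abs_le_mdist_linf:
  "z \<in> mspace (linf H) \<Longrightarrow> w \<in> mspace (linf H) \<Longrightarrow> f \<in> H \<Longrightarrow> \<bar>z f - w f\<bar> \<le> mdist (linf H) z w"
  using mdist_linf_le[of z H w "mdist (linf H) z w"] by auto

lemma lipschitz_real_eval: "f \<in> H \<Longrightarrow> lipschitz_real (linf H) 1 (\<lambda>z. z f)"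
  unfolding lipschitz_real_def using abs_le_mdist_linf by auto

lemma mcomplete_linf: "mcomplete_of (linf H)"
proof -
  have eq: "Met_TC.Self = (euclidean_metric :: real metric)"
    by (simp add: Met_TC.Self_def euclidean_metric_def)
  have "Met_TC.mcomplete (TYPE(real))" by (simp add: complete_UNIV)
  from Met_TC.mcomplete_funspace[OF this, of H] show ?thesis unfolding eq .
qed

text \<open>Two members of \<open>H\<close> share a cell when their values at all points of a finite
  net of \<open>K\<close> fall into the same grid intervals of length e / 4. Within a cell every
  \<open>z\<close> in \<open>K\<close> then varies by at most 3 e / 4. The representative depends on
  the cell alone, which makes \<open>r\<close> idempotent.\<close>

lemma compactin_linf_finite_reps:
  assumes K: "compactin (mtopology_of (linf H)) K" and e: "e > 0"
  shows "\<exists>r. finite (r ` H) \<and> r ` H \<subseteq> H \<and> (\<forall>f\<in>H. r (r f) = r f) \<and>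
    (\<forall>z\<in>K. \<forall>f\<in>H. \<bar>z f - z (r f)\<bar> \<le> e)"
proof -
  interpret L: Metric_space "mspace (linf H)" "mdist (linf H)" by simp
  have "L.mtotally_bounded K" using K by (simp add: L.compactin_imp_mtotally_bounded mtopology_of_def)
  moreover have "e / 4 > 0" using e by simp
  ultimately obtain T where T: "finite T" "T \<subseteq> K" "K \<subseteq> (\<Union>x\<in>T. L.mball x (e / 4))"
    unfolding L.mtotally_bounded_def by meson
  have KM: "K \<subseteq> mspace (linf H)" using compactin_subset_topspace[OF K] by simp
  define \<kappa> where "\<kappa> f = (\<lambda>z\<in>T. \<lfloor>z f / (e / 4)\<rfloor>)" for f
  have "\<forall>z\<in>T. \<exists>b. \<forall>f\<in>H. \<bar>z f\<bar> \<le> b" using T KM mem_linf by blast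
  then obtain B where B: "\<And>z f. z \<in> T \<Longrightarrow> f \<in> H \<Longrightarrow> \<bar>z f\<bar> \<le> B z" by metis
  have "\<kappa> ` H \<subseteq> (\<Pi>\<^sub>E z\<in>T. {\<lfloor>- B z / (e/4)\<rfloor>..\<lfloor>B z / (e/4)\<rfloor>})"
  proof
    fix k assume "k \<in> \<kappa> ` H"
    then obtain f where f: "f \<in> H" "k = \<kappa> f" by blast
    have "- B z \<le> z f" "z f \<le> B z" if "z \<in> T" for z using B[OF that f(1)] by auto
    then show "k \<in> (\<Pi>\<^sub>E z\<in>T. {\<lfloor>- B z / (e/4)\<rfloor>..\<lfloor>B z / (e/4)\<rfloor>})"
      unfolding f(2) \<kappa>_def restrict_PiE_iff using e
      by (intro ballI, unfold atLeastAtMost_iff, intro conjI floor_mono divide_right_mono) auto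
  qed
  then have fin: "finite (\<kappa> ` H)" by (rule finite_subset) (auto intro: finite_PiE T)
  define r where "r f = (SOME g. g \<in> H \<and> \<kappa> g = \<kappa> f)" for f
  have r: "r f \<in> H \<and> \<kappa> (r f) = \<kappa> f" if "f \<in> H" for f
    unfolding r_def by (rule someI[of _ f]) (use that in auto)
  have "r ` H = (\<lambda>k. SOME g. g \<in> H \<and> \<kappa> g = k) ` \<kappa> ` H" by (auto simp: r_def image_image)
  then have "finite (r ` H)" using fin by simp
  moreover have "\<bar>z f - z (r f)\<bar> \<le> e" if z: "z \<in> K" and f: "f \<in> H" for z f
  proof -
    obtain w where w: "w \<in> T" "z \<in> L.mball w (e / 4)" using T z by blast
    have wM: "w \<in> mspace (linf H)" "z \<in> mspace (linf H)" using w z T KM by auto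
    have d: "\<bar>w g - z g\<bar> \<le> e / 4" if "g \<in> H" for g
      using abs_le_mdist_linf[OF wM that] w by (auto simp: L.in_mball)
    have "\<lfloor>w (r f) / (e / 4)\<rfloor> = \<lfloor>w f / (e / 4)\<rfloor>"
      using r[OF f] w(1) by (auto simp: \<kappa>_def dest: fun_cong[of _ _ w])
    then have "w (r f) / (e / 4) - w f / (e / 4) < 1" "w f / (e / 4) - w (r f) / (e / 4) < 1" by linarith+
    then have "w (r f) - w f < e / 4" "w f - w (r f) < e / 4" using e by (simp_all add: field_simps)
    then have "\<bar>w (r f) - w f\<bar> < e / 4" by linarith
    then show ?thesis using d[OF f] d[of "r f"] r[OF f] by linarith
  qed
  moreover have "r (r f) = r f" if "f \<in> H" for f using r[OF that] by (simp add: r_def)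
  ultimately show ?thesis using r by (intro exI[of _ r]) auto
qed

text \<open>Asymptotic equicontinuity is expressed through a selector \<open>r\<close> with finite
  range: values are compared with those at finitely many representatives rather than over small
  balls of a semimetric.\<close>

definition osc :: "'t set \<Rightarrow> ('t \<Rightarrow> 't) \<Rightarrow> ('t \<Rightarrow> real) \<Rightarrow> real" where
  "osc H r z = (SUP f\<in>H. \<bar>z f - z (r f)\<bar>)"

lemma osc_bdd:
  fixes z :: "'t \<Rightarrow> real"
  assumes "r ` H \<subseteq> H" "\<And>f. f \<in> H \<Longrightarrow> \<bar>z f\<bar> \<le> b"
  shows "bdd_above ((\<lambda>f. \<bar>z f - z (r f)\<bar>) ` H)"
proof (rule bdd_aboveI2[of _ _ "2 * b"])
  fix f assume "f \<in> H"
  then have "\<bar>z f\<bar> \<le> b" "\<bar>z (r f)\<bar> \<le> b" using assms by auto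
  then show "\<bar>z f - z (r f)\<bar> \<le> 2 * b" by linarith
qed

lemma osc_bdd_linf:
  "r ` H \<subseteq> H \<Longrightarrow> z \<in> mspace (linf H) \<Longrightarrow> bdd_above ((\<lambda>f. \<bar>z f - z (r f)\<bar>) ` H)"
  using osc_bdd unfolding mem_linf by metis

lemma le_osc: "r ` H \<subseteq> H \<Longrightarrow> z \<in> mspace (linf H) \<Longrightarrow> f \<in> H \<Longrightarrow> \<bar>z f - z (r f)\<bar> \<le> osc H r z"
  unfolding osc_def by (intro cSUP_upper osc_bdd_linf)

lemma osc_le: "H \<noteq> {} \<Longrightarrow> (\<And>f. f \<in> H \<Longrightarrow> \<bar>z f - z (r f)\<bar> \<le> c) \<Longrightarrow> osc H r z \<le> c"
  unfolding osc_def by (intro cSUP_least) auto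

lemma osc_lipschitz:
  assumes r: "r ` H \<subseteq> H" and H: "H \<noteq> {}"
  shows "lipschitz_real (linf H) 2 (osc H r)"
proof -
  have *: "osc H r z \<le> osc H r w + 2 * mdist (linf H) z w"
    if z: "z \<in> mspace (linf H)" and w: "w \<in> mspace (linf H)" for z w
  proof (rule osc_le[OF H])
    fix f assume f: "f \<in> H"
    have "r f \<in> H" using f r by auto
    then have "\<bar>z f - w f\<bar> \<le> mdist (linf H) z w" "\<bar>z (r f) - w (r f)\<bar> \<le> mdist (linf H) z w"
       "\<bar>w f - w (r f)\<bar> \<le> osc H r w"
      using f abs_le_mdist_linf[OF z w] le_osc[OF r w] by auto
    then show "\<bar>z f - z (r f)\<bar> \<le> osc H r w + 2 * mdist (linf H) z w" by linarith
  qed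
  show ?thesis unfolding lipschitz_real_def
  proof (intro conjI ballI)
    fix z w assume zw: "z \<in> mspace (linf H)" "w \<in> mspace (linf H)"
    show "\<bar>osc H r z - osc H r w\<bar> \<le> 2 * mdist (linf H) z w"
      using *[OF zw] *[OF zw(2,1)] by (simp add: abs_le_iff mdist_commute[of _ w z])
  qed simp
qed

text \<open>A Lipschitz stand-in for the indicator of \<open>w >= 2 * a\<close>: it is 1 on that set
  and 0 where \<open>w <= a\<close>.\<close>

lemma lipschitz_ramp:
  assumes "lipschitz_real m C w" "a > 0"
  shows "lipschitz_real m (C / a) (\<lambda>z. min 1 (max 0 (w z / a - 1)))"
  unfolding lipschitz_real_def
proof (intro conjI ballI)
  show "0 \<le> C / a" using assms by (auto simp: lipschitz_real_def)
  fix x y assume "x \<in> mspace m" "y \<in> mspace m"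
  then have "\<bar>w x - w y\<bar> \<le> C * mdist m x y" using assms by (auto simp: lipschitz_real_def)
  then have "\<bar>w x - w y\<bar> / a \<le> (C * mdist m x y) / a" using assms by (intro divide_right_mono) auto
  then have "\<bar>w x / a - w y / a\<bar> \<le> C / a * mdist m x y"
    using assms(2) by (simp add: diff_divide_distrib[symmetric] abs_divide)
  then show "\<bar>min 1 (max 0 (w x / a - 1)) - min 1 (max 0 (w y / a - 1))\<bar> \<le> C / a * mdist m x y"
    by linarith
qed

subsection \<open>A compactness criterion and measurability of limits\<close>

text \<open>Arzela-Ascoli for a sequence of finite partitions. Level \<open>j\<close> determines
  \<open>z\<close> up to \<open>c j\<close> by its values at finitely many representatives, so
  rounding these values gives total boundedness; completeness and closedness then give
  compactness.\<close>

lemma compactin_linfI: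
  assumes H: "H \<noteq> {}" and r: "\<And>j. r j ` H \<subseteq> H" "\<And>j. finite (r j ` H)" and c: "c \<longlonglongrightarrow> (0::real)"
  shows "compactin (mtopology_of (linf H))
    {z \<in> mspace (linf H). (\<forall>f\<in>H. \<bar>z f\<bar> \<le> R) \<and> (\<forall>j::nat. \<forall>f\<in>H. \<bar>z f - z (r j f)\<bar> \<le> c j)}" (is "compactin _ ?K")
proof -
  interpret L: Metric_space "mspace (linf H)" "mdist (linf H)" by simp
  have tb: "L.mtotally_bounded ?K"
    unfolding L.mtotally_bounded_def
  proof (intro allI impI)
    fix e :: real assume e: "e > 0"
    \<comment> \<open>Two passages to the representatives and one rounding will each cost at most e
      / 8, which stays below e / 2 in all.\<close>
    then obtain j where j: "c j < e / 8"
      using order_tendstoD(2)[OF c, of "e / 8"] by (auto simp: eventually_sequentially)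
    define \<kappa> where "\<kappa> z = (\<lambda>g\<in>r j ` H. \<lfloor>z g / (e / 8)\<rfloor>)" for z :: "'a \<Rightarrow> real"
    have "\<kappa> ` ?K \<subseteq> (\<Pi>\<^sub>E g\<in>r j ` H. {\<lfloor>- R / (e/8)\<rfloor>..\<lfloor>R / (e/8)\<rfloor>})"
    proof
      fix k assume "k \<in> \<kappa> ` ?K"
      then obtain z where z: "z \<in> ?K" "k = \<kappa> z" by blast
      have "- R \<le> z g" "z g \<le> R" if "g \<in> r j ` H" for g
      proof -
        have "\<bar>z g\<bar> \<le> R" using z(1) that r(1)[of j] by blast
        then show "- R \<le> z g" "z g \<le> R" by auto
      qed
      then show "k \<in> (\<Pi>\<^sub>E g\<in>r j ` H. {\<lfloor>- R / (e/8)\<rfloor>..\<lfloor>R / (e/8)\<rfloor>})"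
        unfolding z(2) \<kappa>_def restrict_PiE_iff using e
        by (intro ballI, unfold atLeastAtMost_iff, intro conjI floor_mono divide_right_mono) auto
    qed
    then have fin: "finite (\<kappa> ` ?K)" by (rule finite_subset) (auto intro: finite_PiE r)
    define T where "T = (\<lambda>k. SOME z. z \<in> ?K \<and> \<kappa> z = k) ` \<kappa> ` ?K"
    have rep: "(SOME w. w \<in> ?K \<and> \<kappa> w = \<kappa> z) \<in> ?K \<and> \<kappa> (SOME w. w \<in> ?K \<and> \<kappa> w = \<kappa> z) = \<kappa> z" if "z \<in> ?K" for z
      by (rule someI[of _ z]) (use that in auto)
    have "T \<subseteq> ?K" using rep unfolding T_def by blast
    moreover have "?K \<subseteq> (\<Union>w\<in>T. L.mball w e)"
    proof
      fix z assume z: "z \<in> ?K"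
      define w where "w = (SOME w. w \<in> ?K \<and> \<kappa> w = \<kappa> z)"
      have w: "w \<in> ?K" "\<kappa> w = \<kappa> z" "w \<in> T" using rep[OF z] z unfolding T_def w_def by blast+
      have "\<bar>w f - z f\<bar> \<le> e / 2" if f: "f \<in> H" for f
      proof -
        have "\<bar>w f - w (r j f)\<bar> \<le> c j" "\<bar>z f - z (r j f)\<bar> \<le> c j" using w(1) z f by blast+
        moreover have "\<lfloor>w (r j f) / (e / 8)\<rfloor> = \<lfloor>z (r j f) / (e / 8)\<rfloor>"
          using fun_cong[OF w(2), of "r j f"] f by (simp add: \<kappa>_def)
        then have "w (r j f) / (e / 8) - z (r j f) / (e / 8) < 1" "z (r j f) / (e / 8) - w (r j f) / (e / 8) < 1" by linarith+
        then have "w (r j f) - z (r j f) < e / 8" "z (r j f) - w (r j f) < e / 8" using e by (simp_all add: field_simps)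
        then have "\<bar>w (r j f) - z (r j f)\<bar> < e / 8"
          by linarith
        ultimately show ?thesis using j by linarith
      qed
      then have "mdist (linf H) w z \<le> e / 2"
        using w(1) z H by (subst mdist_linf_le) auto
      then have "z \<in> L.mball w e" using w z e by (auto simp: L.in_mball)
      then show "z \<in> (\<Union>w\<in>T. L.mball w e)" using w by blast
    qed
    ultimately show "\<exists>T. finite T \<and> T \<subseteq> ?K \<and> ?K \<subseteq> (\<Union>w\<in>T. L.mball w e)"
      using fin by (intro exI[of _ T]) (simp add: T_def)
  qed
  have clo: "closedin L.mtopology {z \<in> mspace (linf H). h z \<le> a}"
    if "continuous_map L.mtopology euclideanreal h" for h a
    using closedin_continuous_map_preimage[OF that, of "{..a}"] by simp
  have ev: "continuous_map L.mtopology euclideanreal (\<lambda>z. z f)" if "f \<in> H" for f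
    using lipschitz_real_continuous_map[OF lipschitz_real_eval[OF that]] by (simp add: mtopology_of_def)
  have "?K = (\<Inter>f\<in>H. {z \<in> mspace (linf H). \<bar>z f\<bar> \<le> R}) \<inter>
     (\<Inter>(j, f)\<in>UNIV \<times> H. {z \<in> mspace (linf H). \<bar>z f - z (r j f)\<bar> \<le> c j})"
    using H by auto
  also have "closedin L.mtopology \<dots>"
    using H r(1)
    by (intro closedin_Int closedin_Inter) (auto intro!: clo continuous_map_real_abs continuous_map_diff ev)
  finally have cl: "closedin L.mtopology ?K" .
  have "L.mcomplete" using mcomplete_linf[of H] by (simp add: mcomplete_of_def)
  then have "compactin L.mtopology (L.mtopology closure_of ?K)"
    using L.mtotally_bounded_eq_compact_closure_of tb by blast
  also have "L.mtopology closure_of ?K = ?K" using cl by (rule closure_of_closedin)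
  finally show ?thesis by (simp add: mtopology_of_def)
qed

lemma measurable_borel_sigma_limit:
  assumes Z: "\<And>n. Z n \<in> measurable M (borel_sigma (mtopology_of m))"
    and G: "\<And>v. v \<in> space M \<Longrightarrow> G v \<in> mspace m"
    and lim: "\<And>v. v \<in> space M \<Longrightarrow> (\<lambda>n. mdist m (Z n v) (G v)) \<longlonglongrightarrow> 0"
  shows "G \<in> measurable M (borel_sigma (mtopology_of m))"
proof (rule measurable_borel_sigmaI)
  interpret Metric_space "mspace m" "mdist m" by simp
  have Zs: "Z n v \<in> mspace m" if "v \<in> space M" for n v using measurable_space[OF Z that] by simp
  fix U assume "openin (mtopology_of m) U"
  then have U: "openin mtopology U" by (simp add: mtopology_of_def)
  \<comment> \<open>The points of \<open>U\<close> at distance at least 1 / (k + 1) from its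
    complement. These sets are closed, and the limit lies in \<open>U\<close> exactly when the
    approximations eventually stay in one of them.\<close>
  define C where "C k = {x \<in> mspace m. mball x (1 / Suc k) \<subseteq> U}" for k :: nat
  have "mspace m - (\<Union>y\<in>mspace m - U. mball y (1 / Suc k)) = C k" for k
    by (auto simp: C_def in_mball subset_iff commute)
  moreover have "closedin mtopology (mspace m - (\<Union>y\<in>mspace m - U. mball y (1 / Suc k)))" for k
    using closedin_def[of mtopology] by (auto simp: double_diff openin_clauses Union_upper intro!: closedin_diff openin_Union)
  ultimately have "closedin (mtopology_of m) (C k)" for k by (simp add: mtopology_of_def)
  then have Cm: "Z n -` C k \<inter> space M \<in> sets M" for n k
    by (intro measurable_sets[OF Z] sets_borel_sigma_closed)
  have "G -` U \<inter> space M = (\<Union>k. \<Union>n0. \<Inter>n\<in>{n0..}. Z n -` C k \<inter> space M)"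
  proof (intro set_eqI iffI)
    fix v assume v: "v \<in> G -` U \<inter> space M"
    then obtain e where e: "e > 0" "mball (G v) e \<subseteq> U" using U by (auto simp: openin_mtopology)
    obtain k where k: "1 / Suc k < e / 2" using nat_approx_posE[of "e / 2"] e by auto
    obtain n0 where n0: "\<And>n. n \<ge> n0 \<Longrightarrow> mdist m (Z n v) (G v) < e / 2"
      using order_tendstoD(2)[OF lim, of v "e / 2"] v e by (auto simp: eventually_sequentially)
    have "Z n v \<in> C k" if "n \<ge> n0" for n
    proof -
      have "mball (Z n v) (1 / Suc k) \<subseteq> mball (G v) e"
      proof
        fix x assume "x \<in> mball (Z n v) (1 / Suc k)"
        then have x: "x \<in> mspace m" "mdist m (Z n v) x < 1 / Suc k" by (auto simp: in_mball)
        have "mdist m (G v) x \<le> mdist m (G v) (Z n v) + mdist m (Z n v) x"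
          using v x G Zs by (intro triangle) auto
        also have "\<dots> < e" using x k n0[OF that] by (simp add: commute[of "G v"])
        finally show "x \<in> mball (G v) e" using x v G by (auto simp: in_mball)
      qed
      then show ?thesis using e Zs v by (auto simp: C_def)
    qed
    then show "v \<in> (\<Union>k. \<Union>n0. \<Inter>n\<in>{n0..}. Z n -` C k \<inter> space M)" using v by auto
  next
    fix v assume "v \<in> (\<Union>k. \<Union>n0. \<Inter>n\<in>{n0..}. Z n -` C k \<inter> space M)"
    then obtain k n0 where k: "\<And>n. n \<ge> n0 \<Longrightarrow> Z n v \<in> C k" and v: "v \<in> space M" by auto
    obtain n1 where n1: "\<And>n. n \<ge> n1 \<Longrightarrow> mdist m (Z n v) (G v) < 1 / Suc k"
      using order_tendstoD(2)[OF lim[OF v], of "1 / Suc k"] by (auto simp: eventually_sequentially)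
    have "G v \<in> mball (Z (max n0 n1) v) (1 / Suc k)"
      using n1[of "max n0 n1"] G[OF v] Zs[OF v] by (auto simp: in_mball)
    then show "v \<in> G -` U \<inter> space M" using k[of "max n0 n1"] v by (auto simp: C_def)
  qed
  also have "\<dots> \<in> sets M"
    by (intro sets.countable_UN sets.countable_INT image_subsetI Cm) auto
  finally show "G -` U \<inter> space M \<in> sets M" .
qed (use G in auto)

subsection \<open>Gaussian smoothing of multivariate laws\<close>

definition gauss_kernel :: "nat \<Rightarrow> real \<Rightarrow> (nat \<Rightarrow> real) \<Rightarrow> (nat \<Rightarrow> real) \<Rightarrow> real" where
  "gauss_kernel k s x y = (\<Prod>j<k. normal_density (x j) s (y j))"

abbreviation lborel_vec :: "nat \<Rightarrow> (nat \<Rightarrow> real) measure" where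
  "lborel_vec k \<equiv> PiM {..<k} (\<lambda>_. lborel)"

abbreviation std_normal_vec :: "nat \<Rightarrow> (nat \<Rightarrow> real) measure" where
  "std_normal_vec k \<equiv> PiM {..<k} (\<lambda>_. std_normal_distribution)"

interpretation lborel_prod: product_sigma_finite "\<lambda>_::nat. lborel :: real measure" ..

lemma product_prob_space_std_normal: "product_prob_space (\<lambda>_::nat. std_normal_distribution)"
  by (simp add: product_prob_space_def product_prob_space_axioms_def product_sigma_finite_def
      prob_space_normal_density prob_space_imp_sigma_finite)

lemma gauss_kernel_nonneg: "s > 0 \<Longrightarrow> 0 \<le> gauss_kernel k s x y"
  by (auto simp: gauss_kernel_def intro!: prod_nonneg)

lemma
  assumes "s > 0"
  shows integrable_gauss_kernel: "integrable (lborel_vec k) (gauss_kernel k s x)"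
    and integral_gauss_kernel: "(\<integral>y. gauss_kernel k s x y \<partial>lborel_vec k) = 1"
  unfolding gauss_kernel_def
   apply (rule lborel_prod.product_integrable_prod)
    apply simp
   apply (use assms in simp)
  apply (subst lborel_prod.product_integral_prod)
  using assms by auto

lemma
  assumes s: "s > 0" and i: "i < k"
  shows integrable_gauss_kernel_abs: "integrable (lborel_vec k) (\<lambda>y. \<bar>y i - x i\<bar> * gauss_kernel k s x y)"
    and integral_gauss_kernel_abs: "(\<integral>y. \<bar>y i - x i\<bar> * gauss_kernel k s x y \<partial>lborel_vec k) \<le> s"
proof -
  let ?g = "\<lambda>j u. (if j = i then \<bar>u - x i\<bar> else 1) * normal_density (x j) s u"
  have eq: "\<bar>y i - x i\<bar> * gauss_kernel k s x y = (\<Prod>j<k. ?g j (y j))" for y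
    unfolding gauss_kernel_def prod.distrib using i by (simp add: if_distrib[of "\<lambda>c. c * _"] prod.delta cong: if_cong)
  have m: "has_bochner_integral lborel (\<lambda>u. normal_density (x i) s u * \<bar>u - x i\<bar>) (s * sqrt (2 / pi))"
    using normal_moment_abs_odd[of s "x i" 0] s by simp
  have int: "integrable lborel (?g j)" for j
    using m s by (cases "j = i") (auto simp: has_bochner_integral_iff mult.commute)
  show "integrable (lborel_vec k) (\<lambda>y. \<bar>y i - x i\<bar> * gauss_kernel k s x y)"
    unfolding eq by (intro lborel_prod.product_integrable_prod int) auto
  have "(\<integral>y. \<bar>y i - x i\<bar> * gauss_kernel k s x y \<partial>lborel_vec k) = (\<Prod>j<k. integral\<^sup>L lborel (?g j))"
    unfolding eq by (intro lborel_prod.product_integral_prod int) auto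
  also have "\<dots> = (\<Prod>j<k. if j = i then s * sqrt (2 / pi) else 1)"
    using m s by (intro prod.cong) (auto simp: has_bochner_integral_iff mult.commute)
  also have "\<dots> = s * sqrt (2 / pi)" using i by simp
  also have "\<dots> \<le> s * 1"
    using s pi_gt3 by (intro mult_left_mono) auto
  finally show "(\<integral>y. \<bar>y i - x i\<bar> * gauss_kernel k s x y \<partial>lborel_vec k) \<le> s" by simp
qed

lemma integral_iexp_std_normal: "(\<integral>w. iexp (t * w) \<partial>std_normal_distribution) = exp (- (complex_of_real t)\<^sup>2 / 2)"
  using fun_cong[OF char_std_normal_distribution, of t] unfolding char_def
  by (simp add: exp_of_real[symmetric])

lemma iexp_sum: "finite I \<Longrightarrow> iexp (\<Sum>j\<in>I. f j) = (\<Prod>j\<in>I. iexp (f j))"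
  by (simp add: sum_distrib_left exp_sum)

lemma integral_iexp_std_normal_vec:
  "(\<integral>w. iexp (\<Sum>j<k. t j * w j) \<partial>std_normal_vec k) = exp (- (\<Sum>j<k. (complex_of_real (t j))\<^sup>2) / 2)"
proof -
  interpret std_normal_prod: product_prob_space "\<lambda>_::nat. std_normal_distribution" UNIV
    by (rule product_prob_space_std_normal)
  have "(\<integral>w. iexp (\<Sum>j<k. t j * w j) \<partial>std_normal_vec k) = (\<integral>w. (\<Prod>j<k. iexp (t j * w j)) \<partial>std_normal_vec k)"
    by (simp only: iexp_sum finite_lessThan)
  also have "\<dots> = (\<Prod>j<k. \<integral>w. iexp (t j * w) \<partial>std_normal_distribution)"
    by (intro std_normal_prod.product_integral_prod prob_space.integrable_iexp prob_space_normal_density) auto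
  also have "\<dots> = exp (- (\<Sum>j<k. (complex_of_real (t j))\<^sup>2) / 2)"
    unfolding integral_iexp_std_normal by (simp add: exp_sum[symmetric] sum_negf sum_divide_distrib)
  finally show ?thesis .
qed

text \<open>Up to scaling, the Gaussian is its own Fourier transform. This is what turns a smoothed
  density into an average of characteristic functions.\<close>

lemma gauss_kernel_eq_integral:
  assumes s: "s > 0"
  shows "complex_of_real (gauss_kernel k s x y) =
    of_real ((1 / sqrt (2 * pi * s\<^sup>2)) ^ k) * (\<integral>w. iexp (\<Sum>j<k. (x j - y j) / s * w j) \<partial>std_normal_vec k)"
proof -
  have "gauss_kernel k s x y = (1 / sqrt (2 * pi * s\<^sup>2)) ^ k * exp (- (\<Sum>j<k. ((x j - y j) / s)\<^sup>2) / 2)"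
    unfolding gauss_kernel_def normal_density_def prod.distrib
    by (simp add: exp_sum[symmetric] sum_negf sum_divide_distrib power_divide power2_commute mult.commute[of "s\<^sup>2" 2])
  then show ?thesis
    unfolding integral_iexp_std_normal_vec by (simp add: exp_of_real[symmetric])
qed

lemma (in prob_space) AE_bounded_integrable:
  "f \<in> borel_measurable M \<Longrightarrow> (\<And>x. x \<in> space M \<Longrightarrow> norm (f x) \<le> b) \<Longrightarrow> integrable M (f :: _ \<Rightarrow> _::{banach,second_countable_topology})"
  by (intro integrable_const_bound[of _ b]) auto

text \<open>The density of \<open>X\<close> plus \<open>s\<close> times an independent standard
  normal vector.\<close>

definition smooth_dens :: "'w measure \<Rightarrow> ('w \<Rightarrow> nat \<Rightarrow> real) \<Rightarrow> nat \<Rightarrow> real \<Rightarrow> (nat \<Rightarrow> real) \<Rightarrow> real" where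
  "smooth_dens P X k s y = (\<integral>\<omega>. gauss_kernel k s (X \<omega>) y \<partial>P)"

context
  fixes P :: "'w measure" and X :: "'w \<Rightarrow> nat \<Rightarrow> real" and k :: nat and s :: real
  assumes P: "prob_space P" and X: "\<And>j. (\<lambda>\<omega>. X \<omega> j) \<in> borel_measurable P" and s: "s > 0"
begin

interpretation prob_space P by (rule P)

interpretation pair_sigma_finite P "lborel_vec k"
  by (intro pair_sigma_finite.intro sigma_finite_measure_axioms lborel_prod.sigma_finite) auto

interpretation W: prob_space "std_normal_vec k"
  by (intro prob_space_PiM prob_space_normal_density) simp

interpretation PW: pair_prob_space P "std_normal_vec k" ..

lemma gauss_kernel_measurable:
  "(\<lambda>p. gauss_kernel k s (X (fst p)) (snd p)) \<in> borel_measurable (P \<Otimes>\<^sub>M lborel_vec k)"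
proof -
  note [measurable] = X
  show ?thesis unfolding gauss_kernel_def normal_density_def by measurable
qed

lemma smooth_dens_nonneg: "0 \<le> smooth_dens P X k s y"
  unfolding smooth_dens_def using gauss_kernel_nonneg[OF s] by (intro integral_nonneg_AE) auto

lemma integrable_gauss_kernel_pair:
  "integrable (P \<Otimes>\<^sub>M lborel_vec k) (\<lambda>p. gauss_kernel k s (X (fst p)) (snd p))"
proof (rule Fubini_integrable)
  show "integrable P (\<lambda>\<omega>. \<integral>y. norm (gauss_kernel k s (X (fst (\<omega>, y))) (snd (\<omega>, y))) \<partial>lborel_vec k)"
    using s by (simp add: gauss_kernel_nonneg integral_gauss_kernel)
qed (use s in \<open>auto simp: integrable_gauss_kernel gauss_kernel_measurable\<close>)

lemma integrable_smooth_dens: "integrable (lborel_vec k) (smooth_dens P X k s)"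
proof -
  have "integrable (P \<Otimes>\<^sub>M lborel_vec k) (\<lambda>(\<omega>, y). gauss_kernel k s (X \<omega>) y)"
    using integrable_gauss_kernel_pair by (simp add: case_prod_beta')
  from integrable_snd[OF this] show ?thesis unfolding smooth_dens_def .
qed

lemma integral_smooth_dens_mult:
  assumes \<phi>: "\<phi> \<in> borel_measurable (lborel_vec k)" and b: "\<And>x. \<bar>\<phi> x\<bar> \<le> b"
  shows "(\<integral>y. \<phi> y * smooth_dens P X k s y \<partial>lborel_vec k) =
    (\<integral>\<omega>. (\<integral>y. \<phi> y * gauss_kernel k s (X \<omega>) y \<partial>lborel_vec k) \<partial>P)"
    and "integrable P (\<lambda>\<omega>. \<integral>y. \<phi> y * gauss_kernel k s (X \<omega>) y \<partial>lborel_vec k)"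
proof -
  note [measurable] = \<phi> gauss_kernel_measurable
  have "integrable (P \<Otimes>\<^sub>M lborel_vec k) (\<lambda>p. \<phi> (snd p) * gauss_kernel k s (X (fst p)) (snd p))"
  proof (rule Bochner_Integration.integrable_bound)
    show "integrable (P \<Otimes>\<^sub>M lborel_vec k) (\<lambda>p. b * gauss_kernel k s (X (fst p)) (snd p))"
      using integrable_gauss_kernel_pair by simp
    show "AE p in P \<Otimes>\<^sub>M lborel_vec k. norm (\<phi> (snd p) * gauss_kernel k s (X (fst p)) (snd p))
        \<le> norm (b * gauss_kernel k s (X (fst p)) (snd p))"
    proof (rule AE_I2)
      fix p :: "'w \<times> (nat \<Rightarrow> real)"
      have "\<bar>\<phi> (snd p)\<bar> \<le> \<bar>b\<bar>" using b[of "snd p"] by linarith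
      then show "norm (\<phi> (snd p) * gauss_kernel k s (X (fst p)) (snd p)) \<le> norm (b * gauss_kernel k s (X (fst p)) (snd p))"
        unfolding real_norm_def abs_mult by (rule mult_right_mono) simp
    qed
  qed measurable
  then have i: "integrable (P \<Otimes>\<^sub>M lborel_vec k) (\<lambda>(\<omega>, y). \<phi> y * gauss_kernel k s (X \<omega>) y)"
    by (simp add: case_prod_beta')
  show "(\<integral>y. \<phi> y * smooth_dens P X k s y \<partial>lborel_vec k) =
    (\<integral>\<omega>. (\<integral>y. \<phi> y * gauss_kernel k s (X \<omega>) y \<partial>lborel_vec k) \<partial>P)"
    using Fubini_integral[OF i] by (simp add: smooth_dens_def)
  show "integrable P (\<lambda>\<omega>. \<integral>y. \<phi> y * gauss_kernel k s (X \<omega>) y \<partial>lborel_vec k)"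
    using integrable_fst[OF i] by simp
qed

lemma integral_smooth_dens: "(\<integral>y. smooth_dens P X k s y \<partial>lborel_vec k) = 1"
  using integral_smooth_dens_mult(1)[of "\<lambda>_. 1" 1] s by (simp add: integral_gauss_kernel prob_space)

text \<open>Fourier inversion for the smoothed law: the density depends on \<open>X\<close> only
  through its characteristic function, taken at the random frequencies \<open>w / s\<close>.\<close>

lemma smooth_dens_eq:
  "complex_of_real (smooth_dens P X k s y) = of_real ((1 / sqrt (2 * pi * s\<^sup>2)) ^ k) *
     (\<integral>w. iexp (\<Sum>j<k. - y j / s * w j) * (\<integral>\<omega>. iexp (\<Sum>j<k. w j / s * X \<omega> j) \<partial>P) \<partial>std_normal_vec k)"
proof -
  note [measurable] = X
  have i: "integrable (P \<Otimes>\<^sub>M std_normal_vec k) (\<lambda>(\<omega>, w). iexp (\<Sum>j<k. (X \<omega> j - y j) / s * w j))"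
    by (intro PW.AE_bounded_integrable[of _ 1]) auto
  have "complex_of_real (smooth_dens P X k s y) = (\<integral>\<omega>. complex_of_real (gauss_kernel k s (X \<omega>) y) \<partial>P)"
    unfolding smooth_dens_def by simp
  also have "\<dots> = of_real ((1 / sqrt (2 * pi * s\<^sup>2)) ^ k) *
      (\<integral>\<omega>. (\<integral>w. iexp (\<Sum>j<k. (X \<omega> j - y j) / s * w j) \<partial>std_normal_vec k) \<partial>P)"
    unfolding gauss_kernel_eq_integral[OF s] by (rule integral_mult_right_zero)
  also have "(\<integral>\<omega>. (\<integral>w. iexp (\<Sum>j<k. (X \<omega> j - y j) / s * w j) \<partial>std_normal_vec k) \<partial>P)
     = (\<integral>w. (\<integral>\<omega>. iexp (\<Sum>j<k. (X \<omega> j - y j) / s * w j) \<partial>P) \<partial>std_normal_vec k)"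
    using PW.Fubini_integral[OF i] by simp
  also have "\<dots> = (\<integral>w. iexp (\<Sum>j<k. - y j / s * w j) * (\<integral>\<omega>. iexp (\<Sum>j<k. w j / s * X \<omega> j) \<partial>P) \<partial>std_normal_vec k)"
  proof (intro Bochner_Integration.integral_cong refl)
    fix w :: "nat \<Rightarrow> real"
    have "iexp (\<Sum>j<k. (X \<omega> j - y j) / s * w j) = iexp (\<Sum>j<k. - y j / s * w j) * iexp (\<Sum>j<k. w j / s * X \<omega> j)" for \<omega>
      unfolding exp_add[symmetric] distrib_left[symmetric] of_real_add[symmetric] sum.distrib[symmetric]
      by (intro arg_cong[where f = exp] arg_cong[where f = "\<lambda>z. \<i> * z"] arg_cong[where f = complex_of_real] sum.cong refl)
         (use s in \<open>simp add: field_simps\<close>)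
    then show "(\<integral>\<omega>. iexp (\<Sum>j<k. (X \<omega> j - y j) / s * w j) \<partial>P) =
       iexp (\<Sum>j<k. - y j / s * w j) * (\<integral>\<omega>. iexp (\<Sum>j<k. w j / s * X \<omega> j) \<partial>P)"
      by (simp only: integral_mult_right_zero)
  qed
  finally show ?thesis .
qed

end

section \<open>Levy's continuity theorem in several dimensions\<close>

definition lipschitz_vec :: "nat \<Rightarrow> real \<Rightarrow> ((nat \<Rightarrow> real) \<Rightarrow> real) \<Rightarrow> bool" where
  "lipschitz_vec k C \<phi> \<longleftrightarrow> (\<forall>x y. \<bar>\<phi> x - \<phi> y\<bar> \<le> C * (\<Sum>j<k. \<bar>x j - y j\<bar>))"

lemma lipschitz_vec_measurable:
  assumes \<phi>: "lipschitz_vec k C \<phi>"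
  shows "\<phi> \<in> borel_measurable (PiM UNIV (\<lambda>_. borel))"
proof -
  have "continuous_on UNIV \<phi>"
    unfolding continuous_on_def
  proof
    fix x :: "nat \<Rightarrow> real"
    have c: "((\<lambda>y. y j) \<longlongrightarrow> x j) (at x)" for j
      using continuous_on_product_coordinates[of j, where 'b = real] unfolding continuous_on_def by simp
    have "((\<lambda>y. C * (\<Sum>j<k. \<bar>y j - x j\<bar>)) \<longlongrightarrow> C * (\<Sum>j<k. \<bar>x j - x j\<bar>)) (at x)"
      by (intro tendsto_intros tendsto_rabs tendsto_diff c)
    then have "((\<lambda>y. C * (\<Sum>j<k. \<bar>y j - x j\<bar>)) \<longlongrightarrow> 0) (at x)" by simp
    then have "((\<lambda>y. \<phi> y - \<phi> x) \<longlongrightarrow> 0) (at x)"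
      by (rule Lim_null_comparison[rotated]) (use \<phi> in \<open>auto simp: lipschitz_vec_def\<close>)
    then show "(\<phi> \<longlongrightarrow> \<phi> x) (at x)" using Lim_null by blast
  qed
  then have "\<phi> \<in> borel_measurable borel" by (rule borel_measurable_continuous_onI)
  moreover have "sets (PiM UNIV (\<lambda>_::nat. borel :: real measure)) = sets borel"
    by (rule sets_PiM_equal_borel)
  ultimately show ?thesis using measurable_cong_sets by blast
qed

text \<open>The Lipschitz bound sees only the first \<open>k\<close> coordinates, so
  \<open>\<phi>\<close> cannot depend on the others and may be evaluated after extending a vector by
  zero.\<close>

lemma lipschitz_vec_measurable_lborel:
  assumes \<phi>: "lipschitz_vec k C \<phi>"
  shows "\<phi> \<in> borel_measurable (lborel_vec k)"
proof -
  have "(\<lambda>y. (\<lambda>i\<in>UNIV. if i < k then y i else 0)) \<in> measurable (lborel_vec k) (PiM UNIV (\<lambda>_. borel :: real measure))"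
  proof (intro measurable_restrict)
    show "(\<lambda>y. if i < k then y i else 0) \<in> borel_measurable (lborel_vec k)" for i
      by (cases "i < k") (auto intro!: measurable_component_singleton[where M = "\<lambda>_. lborel", simplified])
  qed
  then have "(\<lambda>y. \<phi> (\<lambda>i\<in>UNIV. if i < k then y i else 0)) \<in> borel_measurable (lborel_vec k)"
    by (rule measurable_compose[OF _ lipschitz_vec_measurable[OF \<phi>]])
  moreover have "\<phi> (\<lambda>i\<in>UNIV. if i < k then y i else 0) = \<phi> y" for y
  proof -
    have "\<bar>\<phi> (\<lambda>i\<in>UNIV. if i < k then y i else 0) - \<phi> y\<bar> \<le> C * (\<Sum>j<k. \<bar>(\<lambda>i\<in>UNIV. if i < k then y i else 0) j - y j\<bar>)"
      using \<phi> unfolding lipschitz_vec_def by blast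
    then show ?thesis by simp
  qed
  ultimately show ?thesis by simp
qed

text \<open>Each coordinate is moved by a centred normal variable whose mean absolute value is at
  most \<open>s\<close>. The bound is the same for all laws, so \<open>s\<close> can be fixed before
  the index of the sequence.\<close>

lemma smoothing_error:
  assumes P: "prob_space P" and X: "\<And>j. (\<lambda>\<omega>. X \<omega> j) \<in> borel_measurable P" and s: "s > 0"
    and \<phi>: "lipschitz_vec k C \<phi>" and b: "\<And>x. \<bar>\<phi> x\<bar> \<le> b" and C: "C \<ge> 0"
  shows "\<bar>(\<integral>\<omega>. \<phi> (X \<omega>) \<partial>P) - (\<integral>y. \<phi> y * smooth_dens P X k s y \<partial>lborel_vec k)\<bar> \<le> C * k * s"
proof -
  interpret prob_space P by fact
  have [measurable]: "\<phi> \<in> borel_measurable (lborel_vec k)" by (rule lipschitz_vec_measurable_lborel[OF \<phi>])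
  have "(\<lambda>\<omega>. (\<lambda>i\<in>UNIV. X \<omega> i)) \<in> measurable P (PiM UNIV (\<lambda>_. borel))"
    by (intro measurable_restrict X)
  then have Xm: "X \<in> measurable P (PiM UNIV (\<lambda>_. borel))" by (simp add: restrict_def)
  have ip: "integrable P (\<lambda>\<omega>. \<phi> (X \<omega>))"
    using b by (intro AE_bounded_integrable[of _ b] measurable_compose[OF Xm lipschitz_vec_measurable[OF \<phi>]]) auto
  have pw: "\<bar>\<phi> x - (\<integral>y. \<phi> y * gauss_kernel k s x y \<partial>lborel_vec k)\<bar> \<le> C * k * s" for x
  proof -
    have i1: "integrable (lborel_vec k) (\<lambda>y. \<phi> y * gauss_kernel k s x y)"
    proof (rule Bochner_Integration.integrable_bound[OF integrable_mult_right[of b, OF integrable_gauss_kernel[OF s]]])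
      show "AE y in lborel_vec k. norm (\<phi> y * gauss_kernel k s x y) \<le> norm (b * gauss_kernel k s x y)"
      proof (rule AE_I2)
        fix y
        have "\<bar>\<phi> y\<bar> \<le> \<bar>b\<bar>" using b[of y] by linarith
        then show "norm (\<phi> y * gauss_kernel k s x y) \<le> norm (b * gauss_kernel k s x y)"
          unfolding real_norm_def abs_mult by (rule mult_right_mono) simp
      qed
    qed (use integrable_gauss_kernel[OF s, of k x] in measurable)
    have i2: "integrable (lborel_vec k) (\<lambda>y. (\<phi> x - \<phi> y) * gauss_kernel k s x y)"
      using i1 integrable_mult_right[of "\<phi> x", OF integrable_gauss_kernel[OF s, of k x]] by (simp add: left_diff_distrib)
    have i3: "integrable (lborel_vec k) (\<lambda>y. C * (\<Sum>j<k. \<bar>y j - x j\<bar> * gauss_kernel k s x y))"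
      using integrable_gauss_kernel_abs[OF s] by (intro integrable_mult_right Bochner_Integration.integrable_sum) auto
    have "\<phi> x - (\<integral>y. \<phi> y * gauss_kernel k s x y \<partial>lborel_vec k) = (\<integral>y. (\<phi> x - \<phi> y) * gauss_kernel k s x y \<partial>lborel_vec k)"
      using i1 integrable_gauss_kernel[OF s, of k x] by (simp add: left_diff_distrib integral_gauss_kernel[OF s])
    then have "\<bar>\<phi> x - (\<integral>y. \<phi> y * gauss_kernel k s x y \<partial>lborel_vec k)\<bar> \<le> (\<integral>y. \<bar>(\<phi> x - \<phi> y) * gauss_kernel k s x y\<bar> \<partial>lborel_vec k)"
      by (simp only: integral_abs_bound)
    also have "\<dots> \<le> (\<integral>y. C * (\<Sum>j<k. \<bar>y j - x j\<bar> * gauss_kernel k s x y) \<partial>lborel_vec k)"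
    proof (rule integral_mono[OF integrable_abs[OF i2] i3])
      fix y
      have "\<bar>\<phi> x - \<phi> y\<bar> \<le> C * (\<Sum>j<k. \<bar>y j - x j\<bar>)"
        using \<phi> unfolding lipschitz_vec_def by (subst abs_minus_commute) blast
      then have "\<bar>\<phi> x - \<phi> y\<bar> * gauss_kernel k s x y \<le> C * (\<Sum>j<k. \<bar>y j - x j\<bar>) * gauss_kernel k s x y"
        by (rule mult_right_mono) (rule gauss_kernel_nonneg[OF s])
      then show "\<bar>(\<phi> x - \<phi> y) * gauss_kernel k s x y\<bar> \<le> C * (\<Sum>j<k. \<bar>y j - x j\<bar> * gauss_kernel k s x y)"
        using gauss_kernel_nonneg[OF s, of k x y] by (simp add: abs_mult sum_distrib_right mult.assoc)
    qed
    also have "\<dots> = C * (\<Sum>j<k. \<integral>y. \<bar>y j - x j\<bar> * gauss_kernel k s x y \<partial>lborel_vec k)"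
      using integrable_gauss_kernel_abs[OF s] by (simp add: Bochner_Integration.integral_sum)
    also have "\<dots> \<le> C * (\<Sum>j<k. s)"
      using integral_gauss_kernel_abs[OF s] C by (intro mult_left_mono sum_mono) auto
    finally show ?thesis by (simp add: mult.assoc)
  qed
  have im: "integrable P (\<lambda>\<omega>. \<integral>y. \<phi> y * gauss_kernel k s (X \<omega>) y \<partial>lborel_vec k)"
    by (rule integral_smooth_dens_mult(2)[OF P X s _ b]) measurable
  have "(\<integral>\<omega>. \<phi> (X \<omega>) \<partial>P) - (\<integral>y. \<phi> y * smooth_dens P X k s y \<partial>lborel_vec k)
    = (\<integral>\<omega>. \<phi> (X \<omega>) - (\<integral>y. \<phi> y * gauss_kernel k s (X \<omega>) y \<partial>lborel_vec k) \<partial>P)"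
    using ip im by (subst integral_smooth_dens_mult(1)[OF P X s _ b]) auto
  also have "\<bar>\<dots>\<bar> \<le> (\<integral>\<omega>. \<bar>\<phi> (X \<omega>) - (\<integral>y. \<phi> y * gauss_kernel k s (X \<omega>) y \<partial>lborel_vec k)\<bar> \<partial>P)"
    by (rule integral_abs_bound)
  also have "\<dots> \<le> (\<integral>\<omega>. C * k * s \<partial>P)"
    using ip im pw by (intro integral_mono integrable_abs) auto
  finally show ?thesis by (simp add: prob_space)
qed

text \<open>For fixed \<open>s\<close> the smoothed densities converge pointwise by the inversion
  formula, hence in L1 by Scheffe's lemma. The smoothing errors are uniform in \<open>N\<close> and
  vanish with \<open>s\<close>.\<close>

lemma levy_multivariate:
  assumes P: "prob_space P" and X: "\<And>N j. (\<lambda>\<omega>. X N \<omega> j) \<in> borel_measurable P"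
    and M: "prob_space M" and Z: "\<And>j. (\<lambda>\<omega>. Z \<omega> j) \<in> borel_measurable M"
    and char: "\<And>a. (\<lambda>N. \<integral>\<omega>. iexp (\<Sum>j<k. a j * X N \<omega> j) \<partial>P) \<longlonglongrightarrow> (\<integral>v. iexp (\<Sum>j<k. a j * Z v j) \<partial>M)"
    and \<phi>: "lipschitz_vec k C \<phi>" and b: "\<And>x. \<bar>\<phi> x\<bar> \<le> b" and C: "C \<ge> 0"
  shows "(\<lambda>N. \<integral>\<omega>. \<phi> (X N \<omega>) \<partial>P) \<longlonglongrightarrow> (\<integral>v. \<phi> (Z v) \<partial>M)"
proof -
  interpret P: prob_space P by fact
  interpret W: prob_space "std_normal_vec k"
    by (intro prob_space_PiM prob_space_normal_density) simp
  have [measurable]: "\<phi> \<in> borel_measurable (lborel_vec k)" by (rule lipschitz_vec_measurable_lborel[OF \<phi>])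
  have b0: "0 \<le> b" using b[of undefined] by linarith
  have smooth: "(\<lambda>N. \<integral>y. \<phi> y * smooth_dens P (X N) k s y \<partial>lborel_vec k) \<longlonglongrightarrow>
     (\<integral>y. \<phi> y * smooth_dens M Z k s y \<partial>lborel_vec k)" if s: "s > 0" for s
  proof -
    have pt: "(\<lambda>N. smooth_dens P (X N) k s y) \<longlonglongrightarrow> smooth_dens M Z k s y" for y
    proof -
      have "(\<lambda>N. \<integral>w. iexp (\<Sum>j<k. - y j / s * w j) * (\<integral>\<omega>. iexp (\<Sum>j<k. w j / s * X N \<omega> j) \<partial>P) \<partial>std_normal_vec k)
        \<longlonglongrightarrow> (\<integral>w. iexp (\<Sum>j<k. - y j / s * w j) * (\<integral>v. iexp (\<Sum>j<k. w j / s * Z v j) \<partial>M) \<partial>std_normal_vec k)"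
      proof (rule integral_dominated_convergence[where w = "\<lambda>_. 1"])
        interpret M: prob_space M by fact
        interpret PW: pair_sigma_finite "std_normal_vec k" P ..
        interpret MW: pair_sigma_finite "std_normal_vec k" M ..
        note [measurable] = X Z
        have [measurable]: "(\<lambda>w. \<integral>v. iexp (\<Sum>j<k. w j / s * Z v j) \<partial>M) \<in> borel_measurable (std_normal_vec k)"
          by (rule M.borel_measurable_lebesgue_integral) measurable
        have [measurable]: "(\<lambda>w. \<integral>\<omega>. iexp (\<Sum>j<k. w j / s * X N \<omega> j) \<partial>P) \<in> borel_measurable (std_normal_vec k)" for N
          by (rule P.borel_measurable_lebesgue_integral) measurable
        show "(\<lambda>w. iexp (\<Sum>j<k. - y j / s * w j) * (\<integral>v. iexp (\<Sum>j<k. w j / s * Z v j) \<partial>M)) \<in> borel_measurable (std_normal_vec k)"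
          by measurable
        show "(\<lambda>w. iexp (\<Sum>j<k. - y j / s * w j) * (\<integral>\<omega>. iexp (\<Sum>j<k. w j / s * X N \<omega> j) \<partial>P)) \<in> borel_measurable (std_normal_vec k)" for N
          by measurable
        show "AE w in std_normal_vec k. (\<lambda>N. iexp (\<Sum>j<k. - y j / s * w j) * (\<integral>\<omega>. iexp (\<Sum>j<k. w j / s * X N \<omega> j) \<partial>P))
           \<longlonglongrightarrow> iexp (\<Sum>j<k. - y j / s * w j) * (\<integral>v. iexp (\<Sum>j<k. w j / s * Z v j) \<partial>M)"
          by (intro AE_I2 tendsto_mult tendsto_const char)
        have "norm (\<integral>\<omega>. iexp (\<Sum>j<k. w j / s * X N \<omega> j) \<partial>P) \<le> (\<integral>\<omega>. norm (iexp (\<Sum>j<k. w j / s * X N \<omega> j)) \<partial>P)" for w N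
          by (rule integral_norm_bound)
        then show "AE w in std_normal_vec k. norm (iexp (\<Sum>j<k. - y j / s * w j) * (\<integral>\<omega>. iexp (\<Sum>j<k. w j / s * X N \<omega> j) \<partial>P)) \<le> 1" for N
          by (simp add: norm_mult P.prob_space)
      qed simp
      then have "(\<lambda>N. complex_of_real (smooth_dens P (X N) k s y)) \<longlonglongrightarrow> complex_of_real (smooth_dens M Z k s y)"
        unfolding smooth_dens_eq[OF P X s] smooth_dens_eq[OF M Z s] by (intro tendsto_mult tendsto_const)
      then show ?thesis by (simp only: tendsto_of_real_iff)
    qed
    note iN = integrable_smooth_dens[OF P X s] note iM = integrable_smooth_dens[OF M Z s]
    have nn: "(\<integral>\<^sup>+y. norm (smooth_dens P (X N) k s y) \<partial>lborel_vec k) = 1"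
       "(\<integral>\<^sup>+y. norm (smooth_dens M Z k s y) \<partial>lborel_vec k) = 1" for N
      using smooth_dens_nonneg[OF P X s] smooth_dens_nonneg[OF M Z s] integral_smooth_dens[OF P X s] integral_smooth_dens[OF M Z s]
      by (subst nn_integral_eq_integral; auto intro!: integrable_norm iN iM)+
    have "(\<lambda>N. \<integral>\<^sup>+y. norm (smooth_dens P (X N) k s y - smooth_dens M Z k s y) \<partial>lborel_vec k) \<longlonglongrightarrow> 0"
      by (rule Scheffe_lemma2) (use iN iM pt nn in auto)
    then have "(\<lambda>N. ennreal (\<integral>y. norm (smooth_dens P (X N) k s y - smooth_dens M Z k s y) \<partial>lborel_vec k)) \<longlonglongrightarrow> ennreal 0"
      by (subst (asm) nn_integral_eq_integral) (auto intro!: iN iM)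
    then have l1: "(\<lambda>N. \<integral>y. norm (smooth_dens P (X N) k s y - smooth_dens M Z k s y) \<partial>lborel_vec k) \<longlonglongrightarrow> 0"
      by (subst (asm) tendsto_ennreal_iff) auto
    show ?thesis
    proof (rule Lim_null[THEN iffD2], rule Lim_null_comparison[OF always_eventually[OF allI]])
      show "(\<lambda>N. b * (\<integral>y. norm (smooth_dens P (X N) k s y - smooth_dens M Z k s y) \<partial>lborel_vec k)) \<longlonglongrightarrow> 0"
        using tendsto_mult[OF tendsto_const l1, of b] by simp
      fix N
      have ib: "integrable (lborel_vec k) (\<lambda>y. \<phi> y * g y)" if g: "integrable (lborel_vec k) g" for g
      proof (rule Bochner_Integration.integrable_bound[OF integrable_mult_right[of b, OF g]])
        show "AE y in lborel_vec k. norm (\<phi> y * g y) \<le> norm (b * g y)"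
          using b b0 by (intro AE_I2) (auto simp: abs_mult intro!: mult_right_mono)
      qed (use g in measurable)
      have "(\<integral>y. \<phi> y * smooth_dens P (X N) k s y \<partial>lborel_vec k) - (\<integral>y. \<phi> y * smooth_dens M Z k s y \<partial>lborel_vec k)
        = (\<integral>y. \<phi> y * (smooth_dens P (X N) k s y - smooth_dens M Z k s y) \<partial>lborel_vec k)"
        using ib[OF iN] ib[OF iM] by (simp add: right_diff_distrib)
      also have "norm \<dots> \<le> (\<integral>y. norm (\<phi> y * (smooth_dens P (X N) k s y - smooth_dens M Z k s y)) \<partial>lborel_vec k)"
        by (rule integral_norm_bound)
      also have "\<dots> \<le> (\<integral>y. b * norm (smooth_dens P (X N) k s y - smooth_dens M Z k s y) \<partial>lborel_vec k)"
        using b b0 by (intro integral_mono integrable_norm integrable_mult_right ib Bochner_Integration.integrable_diff iN iM)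
          (auto simp: abs_mult intro!: mult_right_mono)
      finally show "norm ((\<integral>y. \<phi> y * smooth_dens P (X N) k s y \<partial>lborel_vec k) - (\<integral>y. \<phi> y * smooth_dens M Z k s y \<partial>lborel_vec k))
        \<le> b * (\<integral>y. norm (smooth_dens P (X N) k s y - smooth_dens M Z k s y) \<partial>lborel_vec k)" by simp
    qed
  qed
  show ?thesis
  proof (rule LIMSEQ_I)
    fix e :: real assume e: "e > 0"
    \<comment> \<open>Each of the two smoothing errors becomes at most e / 4; the summand 1 keeps
      the denominator positive when \<open>C * k = 0\<close>.\<close>
    define s where "s = e / (4 * (C * k + 1))"
    have s: "s > 0" using e C by (auto simp: s_def intro!: divide_pos_pos add_nonneg_pos)
    have "C * k * s \<le> (C * k + 1) * s" using s by (intro mult_right_mono) auto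
    also have "\<dots> = e / 4" using C by (simp add: s_def field_simps add_nonneg_eq_0_iff) 
    finally have Cs: "C * k * s \<le> e / 4" .
    obtain N0 where N0: "\<And>N. N \<ge> N0 \<Longrightarrow> norm ((\<integral>y. \<phi> y * smooth_dens P (X N) k s y \<partial>lborel_vec k) - (\<integral>y. \<phi> y * smooth_dens M Z k s y \<partial>lborel_vec k)) < e / 4"
      using LIMSEQ_D[OF smooth[OF s], of "e / 4"] e by auto
    show "\<exists>N0. \<forall>N\<ge>N0. norm ((\<integral>\<omega>. \<phi> (X N \<omega>) \<partial>P) - (\<integral>v. \<phi> (Z v) \<partial>M)) < e"
    proof (intro exI allI impI)
      fix N assume "N \<ge> N0"
      from N0[OF this] smoothing_error[where X = "X N", OF P X s \<phi> b C] smoothing_error[where X = Z, OF M Z s \<phi> b C] Cs e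
      show "norm ((\<integral>\<omega>. \<phi> (X N \<omega>) \<partial>P) - (\<integral>v. \<phi> (Z v) \<partial>M)) < e"
        unfolding real_norm_def by linarith
    qed
  qed
qed

subsection \<open>Gaussian sequences with given covariances\<close>

definition psd_kernel :: "(nat \<Rightarrow> nat \<Rightarrow> real) \<Rightarrow> bool" where
  "psd_kernel C \<longleftrightarrow> (\<forall>i j. C i j = C j i) \<and> (\<forall>n a. 0 \<le> (\<Sum>i<n. \<Sum>j<n. a i * a j * C i j))"

text \<open>Successive Schur complements (Cholesky). If a pivot \<open>C\<^sub>k\<^sub>k\<close> vanishes, then so does its row, and
  \<open>x / 0 = 0\<close> makes the step trivial.\<close>

fun schur :: "(nat \<Rightarrow> nat \<Rightarrow> real) \<Rightarrow> nat \<Rightarrow> nat \<Rightarrow> nat \<Rightarrow> real" where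
  "schur C 0 = C"
| "schur C (Suc k) = (\<lambda>i j. schur C k i j - schur C k i k * schur C k j k / schur C k k k)"

lemma psd_kernel_diag: "psd_kernel C \<Longrightarrow> 0 \<le> C k k"
proof -
  assume C: "psd_kernel C"
  define a where "a = (\<lambda>i. of_bool (i = k) :: real)"
  have "0 \<le> (\<Sum>i<Suc k. \<Sum>j<Suc k. a i * a j * C i j)" using C unfolding psd_kernel_def by blast
  also have "\<dots> = C k k" by (simp add: a_def of_bool_def)
  finally show ?thesis .
qed

text \<open>On the vector with entry 1 at \<open>i\<close> and \<open>y\<close> at \<open>k\<close>
  the form is \<open>C i i + 2 * y * C i k\<close>; if \<open>C i k\<close> were nonzero, the chosen
  \<open>y\<close> would make this -1.\<close>

lemma psd_kernel_zero:
  assumes C: "psd_kernel C" and z: "C k k = 0"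
  shows "C i k = 0"
proof (rule ccontr)
  assume nz: "C i k \<noteq> 0"
  then have ik: "i \<noteq> k" using z by auto
  define y where "y = - (C i i + 1) / (2 * C i k)"
  define a where "a = (\<lambda>j. if j = i then 1 else if j = k then y else 0 :: real)"
  define n where "n = Suc (max i k)"
  have split: "(\<Sum>j<n. a j * g j) = g i + y * g k" for g
  proof -
    have "(\<Sum>j<n. a j * g j) = (\<Sum>j\<in>{i, k}. a j * g j)"
      by (rule sum.mono_neutral_right) (auto simp: n_def a_def)
    then show ?thesis using ik by (simp add: a_def)
  qed
  have "0 \<le> (\<Sum>i<n. \<Sum>j<n. a i * a j * C i j)" using C unfolding psd_kernel_def by blast
  also have "\<dots> = (\<Sum>i<n. a i * (\<Sum>j<n. a j * C i j))" by (simp add: sum_distrib_left mult.assoc)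
  also have "\<dots> = C i i + y * C i k + y * (C k i + y * C k k)" unfolding split ..
  also have "\<dots> = C i i + 2 * (y * C i k)" using C z by (simp add: psd_kernel_def)
  also have "y * C i k = - (C i i + 1) / 2" using nz by (simp add: y_def)
  finally show False by (simp add: field_simps)
qed

text \<open>For a nonzero pivot, the new form at \<open>a\<close> is the minimum of the old one over
  all vectors obtained from \<open>a\<close> by subtracting a multiple \<open>t\<close> of the unit
  vector at \<open>k\<close>. The minimiser is \<open>t = s / C k k\<close>.\<close>

lemma psd_kernel_schur_step:
  assumes C: "psd_kernel C"
  shows "psd_kernel (\<lambda>i j. C i j - C i k * C j k / C k k)"
proof (cases "C k k = 0")
  case True then show ?thesis using C by simp
next
  case False
  have sym: "C i j = C j i" for i j using C by (simp add: psd_kernel_def)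
  show ?thesis unfolding psd_kernel_def
  proof (intro conjI allI)
    show "C i j - C i k * C j k / C k k = C j i - C j k * C i k / C k k" for i j
      using sym[of i j] by simp
    fix n and a :: "nat \<Rightarrow> real"
    define n' where "n' = max n (Suc k)"
    define b where "b = (\<lambda>i. if i < n then a i else 0)"
    define s where "s = (\<Sum>j<n. a j * C j k)"
    have ext: "(\<Sum>j<n. a j * g j) = (\<Sum>j<n'. b j * g j)" for g :: "nat \<Rightarrow> real"
      by (rule sum.mono_neutral_cong_left) (auto simp: n'_def b_def)
    define t where "t = s / C k k"
    have delta: "(\<Sum>j<n'. (b j - t * of_bool (j = k)) * g j) = (\<Sum>j<n'. b j * g j) - t * g k" for g
    proof -
      have "(\<Sum>j<n'. t * of_bool (j = k) * g j) = (\<Sum>j\<in>{k}. t * of_bool (j = k) * g j)"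
        by (rule sum.mono_neutral_right) (auto simp: n'_def)
      then show ?thesis by (simp add: left_diff_distrib sum_subtractf)
    qed
    have "0 \<le> (\<Sum>i<n'. \<Sum>j<n'. (b i - t * of_bool (i = k)) * (b j - t * of_bool (j = k)) * C i j)"
      using C[unfolded psd_kernel_def, THEN conjunct2, rule_format, of "\<lambda>i. b i - t * of_bool (i = k)" n'] .
    also have "\<dots> = (\<Sum>i<n'. (b i - t * of_bool (i = k)) * (\<Sum>j<n'. (b j - t * of_bool (j = k)) * C i j))"
      by (simp add: sum_distrib_left mult.assoc)
    also have "\<dots> = (\<Sum>i<n'. b i * ((\<Sum>j<n'. b j * C i j) - t * C i k)) - t * ((\<Sum>j<n'. b j * C k j) - t * C k k)"
      unfolding delta ..
    also have "\<dots> = (\<Sum>i<n'. b i * (\<Sum>j<n'. b j * C i j)) - t * (\<Sum>i<n'. b i * C i k)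
         - t * ((\<Sum>j<n'. b j * C j k) - t * C k k)"
    proof -
      have "(\<Sum>j<n'. b j * C k j) = (\<Sum>j<n'. b j * C j k)" by (intro sum.cong refl arg_cong2[where f = times] sym)
      moreover have "(\<Sum>i<n'. b i * (g i - t * C i k)) = (\<Sum>i<n'. b i * g i) - t * (\<Sum>i<n'. b i * C i k)" for g
        by (simp add: right_diff_distrib sum_subtractf sum_distrib_left mult.left_commute)
      ultimately show ?thesis by simp
    qed
    also have "\<dots> = (\<Sum>i<n. a i * (\<Sum>j<n. a j * C i j)) - t * s - t * (s - t * C k k)"
      unfolding s_def ext ..
    also have "\<dots> = (\<Sum>i<n. a i * (\<Sum>j<n. a j * C i j)) - s * s / C k k"
      using False by (simp add: t_def field_simps)
    also have "\<dots> = (\<Sum>i<n. \<Sum>j<n. a i * a j * (C i j - C i k * C j k / C k k))"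
      by (simp add: s_def sum_product sum_divide_distrib sum_distrib_left sum_subtractf[symmetric] right_diff_distrib ac_simps)
    finally show "0 \<le> (\<Sum>i<n. \<Sum>j<n. a i * a j * (C i j - C i k * C j k / C k k))" .
  qed
qed

lemma psd_kernel_schur: "psd_kernel C \<Longrightarrow> psd_kernel (schur C k)"
  by (induction k) (auto intro: psd_kernel_schur_step)

lemma schur_eq_0:
  assumes C: "psd_kernel C"
  shows "j < k \<Longrightarrow> schur C k i j = 0"
proof (induction k arbitrary: i)
  case (Suc k)
  note p = psd_kernel_schur[OF C, of k]
  have z: "schur C k k k = 0 \<Longrightarrow> schur C k i k = 0" for i by (rule psd_kernel_zero[OF p])
  have sym: "schur C k i j = schur C k j i" for i j using p by (simp add: psd_kernel_def)
  show ?case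
  proof (cases "j = k")
    case True then show ?thesis using z[of i] by (cases "schur C k k k = 0") auto
  next
    case False
    then have "j < k" using Suc.prems by simp
    then show ?thesis using Suc.IH[of i] Suc.IH[of k] sym[of j k] by simp
  qed
qed simp

definition cholesky :: "(nat \<Rightarrow> nat \<Rightarrow> real) \<Rightarrow> nat \<Rightarrow> nat \<Rightarrow> real" where
  "cholesky C i k = schur C k i k / sqrt (schur C k k k)"

text \<open>Each Schur step removes exactly the products of the entries of one column, so the sum
  telescopes; after \<open>n > i\<close> steps nothing remains in row \<open>i\<close>.\<close>

lemma cholesky_sum:
  assumes C: "psd_kernel C" and n: "i < n"
  shows "(\<Sum>k<n. cholesky C i k * cholesky C j k) = C i j"
proof -
  have "schur C n i j = C i j - (\<Sum>k<n. cholesky C i k * cholesky C j k)" for n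
  proof (induction n)
    case (Suc n)
    have "0 \<le> schur C n n n" by (rule psd_kernel_diag[OF psd_kernel_schur[OF C]])
    then show ?case using Suc by (simp add: cholesky_def)
  qed simp
  moreover have "schur C n i j = 0"
    using schur_eq_0[OF C n, of j] psd_kernel_schur[OF C, of n] by (simp add: psd_kernel_def)
  ultimately show ?thesis by (metis eq_iff_diff_eq_0)
qed

lemma cholesky_eq_0: "psd_kernel C \<Longrightarrow> i < k \<Longrightarrow> cholesky C i k = 0"
  using schur_eq_0[of C i k k] psd_kernel_schur[of C k] by (simp add: cholesky_def psd_kernel_def)

abbreviation std_normal_seq :: "(nat \<Rightarrow> real) measure" where
  "std_normal_seq \<equiv> PiM UNIV (\<lambda>_. std_normal_distribution)"

text \<open>The factor is lower triangular, so every coordinate is a finite combination and the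
  whole infinite family lives on one sequence of independent normals.\<close>

definition gauss_seq :: "(nat \<Rightarrow> nat \<Rightarrow> real) \<Rightarrow> (nat \<Rightarrow> real) \<Rightarrow> nat \<Rightarrow> real" where
  "gauss_seq C \<xi> i = (\<Sum>k<Suc i. cholesky C i k * \<xi> k)"

lemma gauss_seq_measurable [measurable]: "(\<lambda>\<xi>. gauss_seq C \<xi> i) \<in> borel_measurable std_normal_seq"
  unfolding gauss_seq_def by measurable

lemma prob_space_std_normal_seq: "prob_space std_normal_seq"
  by (intro prob_space_PiM prob_space_normal_density) simp

lemma integral_iexp_std_normal_seq:
  "(\<integral>\<xi>. iexp (\<Sum>k<n. b k * \<xi> k) \<partial>std_normal_seq) = exp (- (\<Sum>k<n. (complex_of_real (b k))\<^sup>2) / 2)"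
proof -
  interpret std_normal_prod: product_prob_space "\<lambda>_::nat. std_normal_distribution" UNIV
    by (rule product_prob_space_std_normal)
  have "(\<integral>\<xi>. iexp (\<Sum>k<n. b k * \<xi> k) \<partial>std_normal_seq) =
      (\<integral>\<xi>. iexp (\<Sum>k<n. b k * restrict \<xi> {..<n} k) \<partial>std_normal_seq)" by simp
  also have "\<dots> = (\<integral>w. iexp (\<Sum>k<n. b k * w k) \<partial>distr std_normal_seq (std_normal_vec n) (\<lambda>\<xi>. restrict \<xi> {..<n}))"
    by (subst integral_distr) auto
  also have "distr std_normal_seq (std_normal_vec n) (\<lambda>\<xi>. restrict \<xi> {..<n}) = std_normal_vec n"
    by (rule std_normal_prod.distr_PiM_restrict_finite) auto
  finally show ?thesis unfolding integral_iexp_std_normal_vec .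
qed

lemma integral_iexp_gauss_seq:
  assumes C: "psd_kernel C"
  shows "(\<integral>\<xi>. iexp (\<Sum>j<n. a j * gauss_seq C \<xi> j) \<partial>std_normal_seq) =
    complex_of_real (exp (- (\<Sum>i<n. \<Sum>j<n. a i * a j * C i j) / 2))"
proof -
  define b where "b k = (\<Sum>j<n. a j * cholesky C j k)" for k
  have "gauss_seq C \<xi> j = (\<Sum>k<n. cholesky C j k * \<xi> k)" if "j < n" for \<xi> j
    unfolding gauss_seq_def
    by (rule sum.mono_neutral_left) (use that cholesky_eq_0[OF C] in auto)
  then have "(\<Sum>j<n. a j * gauss_seq C \<xi> j) = (\<Sum>j<n. \<Sum>k<n. a j * (cholesky C j k * \<xi> k))" for \<xi>
    by (simp add: sum_distrib_left)
  also have "\<dots> \<xi> = (\<Sum>k<n. b k * \<xi> k)" for \<xi>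
    by (subst sum.swap) (simp add: b_def sum_distrib_right mult.assoc)
  finally have eq: "(\<Sum>j<n. a j * gauss_seq C \<xi> j) = (\<Sum>k<n. b k * \<xi> k)" for \<xi> .
  have "(\<Sum>k<n. (b k)\<^sup>2) = (\<Sum>k<n. \<Sum>i<n. \<Sum>j<n. a i * a j * (cholesky C i k * cholesky C j k))"
    unfolding b_def power2_eq_square sum_product by (simp add: ac_simps)
  also have "\<dots> = (\<Sum>i<n. \<Sum>j<n. a i * a j * (\<Sum>k<n. cholesky C i k * cholesky C j k))"
  proof -
    have "(\<Sum>k<n. \<Sum>i<n. \<Sum>j<n. a i * a j * (cholesky C i k * cholesky C j k))
        = (\<Sum>i<n. \<Sum>k<n. \<Sum>j<n. a i * a j * (cholesky C i k * cholesky C j k))" by (rule sum.swap)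
    also have "\<dots> = (\<Sum>i<n. \<Sum>j<n. \<Sum>k<n. a i * a j * (cholesky C i k * cholesky C j k))"
      by (rule sum.cong[OF refl], rule sum.swap)
    finally show ?thesis by (simp add: sum_distrib_left)
  qed
  also have "\<dots> = (\<Sum>i<n. \<Sum>j<n. a i * a j * C i j)"
    by (intro sum.cong refl) (simp add: cholesky_sum[OF C])
  finally show ?thesis
    unfolding eq integral_iexp_std_normal_seq by (simp add: exp_of_real[symmetric] del: of_real_sum flip: of_real_power of_real_sum)
qed

subsection \<open>Gaussianity of weak limits\<close>

text \<open>Uniqueness of characteristic functions identifies \<open>Y\<close> in law with
  \<open>sqrt v\<close> times a standard normal, and the moments are read off there. Variance 0
  leads to the degenerate alternative in \<open>normal_rv\<close>.\<close>

lemma char_gaussian_imp: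
  assumes M: "prob_space M" and Y: "Y \<in> borel_measurable M" and v: "0 \<le> v"
    and char: "\<And>t. (\<integral>x. iexp (t * Y x) \<partial>M) = complex_of_real (exp (- t\<^sup>2 * v / 2))"
  shows "normal_rv M Y" "integral\<^sup>L M Y = 0" "integrable M (\<lambda>x. (Y x)\<^sup>2)" "integral\<^sup>L M (\<lambda>x. (Y x)\<^sup>2) = v"
proof -
  interpret prob_space M by fact
  note [measurable] = Y
  have rd: "real_distribution (distr M borel Y)" by (rule real_distribution_distr) (rule Y)
  have rn: "real_distribution (distr std_normal_distribution borel (\<lambda>x. sqrt v * x))"
    by (rule prob_space.real_distribution_distr[OF prob_space_normal_density]) auto
  have "char (distr M borel Y) t = char (distr std_normal_distribution borel (\<lambda>x. sqrt v * x)) t" for t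
  proof -
    have "char (distr M borel Y) t = complex_of_real (exp (- t\<^sup>2 * v / 2))"
    proof -
      have "char (distr M borel Y) t = (\<integral>x. iexp (t * Y x) \<partial>M)"
        unfolding char_def by (subst integral_distr) auto
      then show ?thesis using char[of t] by simp
    qed
    moreover have "char (distr std_normal_distribution borel (\<lambda>x. sqrt v * x)) t = (\<integral>x. iexp ((t * sqrt v) * x) \<partial>std_normal_distribution)"
      unfolding char_def by (subst integral_distr) (auto simp: mult.assoc)
    moreover have "\<dots> = complex_of_real (exp (- t\<^sup>2 * v / 2))"
      unfolding integral_iexp_std_normal using v
      by (simp add: exp_of_real[symmetric] power_mult_distrib flip: of_real_power of_real_mult)
    ultimately show ?thesis by simp
  qed
  then have eq: "distr M borel Y = distr std_normal_distribution borel (\<lambda>x. sqrt v * x)"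
    by (intro Levy_uniqueness rd rn ext)
  have tr: "integral\<^sup>L M (\<lambda>x. h (Y x)) = (\<integral>x. h (sqrt v * x) \<partial>std_normal_distribution)"
    if [measurable]: "h \<in> borel_measurable borel" for h :: "real \<Rightarrow> real"
  proof -
    have "integral\<^sup>L M (\<lambda>x. h (Y x)) = integral\<^sup>L (distr M borel Y) h" by (subst integral_distr) auto
    also have "\<dots> = (\<integral>x. h (sqrt v * x) \<partial>std_normal_distribution)" unfolding eq by (subst integral_distr) auto
    finally show ?thesis .
  qed
  have m1: "(\<integral>x. x \<partial>std_normal_distribution) = 0"
    using integral_std_normal_distribution_moment_odd[of 1] by simp
  have m2: "(\<integral>x. x\<^sup>2 \<partial>std_normal_distribution) = 1"
    using std_normal_distribution_even_moments(1)[of 1] by (simp add: fact_2)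
  show "integral\<^sup>L M Y = 0" using tr[of "\<lambda>x. x"] m1 by simp
  show "integral\<^sup>L M (\<lambda>x. (Y x)\<^sup>2) = v"
    using tr[of "\<lambda>x. x\<^sup>2"] m2 v by (simp add: power_mult_distrib)
  show "integrable M (\<lambda>x. (Y x)\<^sup>2)"
  proof -
    have "integrable std_normal_distribution (\<lambda>x. v * x\<^sup>2)"
      using integrable_std_normal_distribution_moment[of 2] by simp
    then have "integrable (distr std_normal_distribution borel (\<lambda>x. sqrt v * x)) (\<lambda>x. x\<^sup>2)"
      using v by (subst integrable_distr_eq) (auto simp: power_mult_distrib)
    then have "integrable (distr M borel Y) (\<lambda>x. x\<^sup>2)" by (simp only: eq)
    then show ?thesis by (subst (asm) integrable_distr_eq) auto
  qed
  show "normal_rv M Y"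
  proof (cases "v = 0")
    case True
    then have "AE x in distr M borel Y. x = 0" unfolding eq by (subst AE_distr_iff) auto
    then have "AE x in M. Y x = 0" by (subst (asm) AE_distr_iff) auto
    then show ?thesis unfolding normal_rv_def using Y by blast
  next
    case False
    then have s: "sqrt v > 0" using v by simp
    have "distributed std_normal_distribution lborel (\<lambda>x. 0 + sqrt v * x) (\<lambda>x. ennreal (normal_density (0 + sqrt v * 0) (\<bar>sqrt v\<bar> * 1) x))"
    proof (rule prob_space.normal_density_affine[OF prob_space_normal_density])
      show "distributed std_normal_distribution lborel (\<lambda>x. x) (\<lambda>x. ennreal (std_normal_density x))"
        by (auto simp: distributed_def distr_id2 intro!: measure_eqI)
    qed (use s in auto)
    then have "distr std_normal_distribution lborel (\<lambda>x. sqrt v * x) = density lborel (\<lambda>x. ennreal (normal_density 0 (sqrt v) x))"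
      using s by (simp add: distributed_def)
    moreover have "distr std_normal_distribution lborel (\<lambda>x. sqrt v * x) = distr std_normal_distribution borel (\<lambda>x. sqrt v * x)"
      "distr M lborel Y = distr M borel Y" by (intro distr_cong, auto)+
    ultimately have "distributed M lborel Y (\<lambda>x. ennreal (normal_density 0 (sqrt v) x))"
      using eq by (simp add: distributed_def)
    then show ?thesis unfolding normal_rv_def using Y s by blast
  qed
qed

text \<open>Finite combinations of coordinates are measurable, so the outer expectations of their
  cosine and sine are ordinary integrals, and both are bounded continuous functionals.\<close>

lemma weakly_converges_iexp:
  fixes X :: "nat \<Rightarrow> 'w \<Rightarrow> 't \<Rightarrow> real" and s :: "nat \<Rightarrow> 't"
  assumes P: "prob_space P" and M: "prob_space M"
    and X_meas: "\<And>N f. f \<in> H \<Longrightarrow> (\<lambda>\<omega>. X N \<omega> f) \<in> borel_measurable P"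
    and G: "G \<in> measurable M (borel_sigma (mtopology_of (linf H)))"
    and weak: "weakly_converges (linf H) P X M G" and s: "range s \<subseteq> H"
  shows "(\<lambda>N. \<integral>\<omega>. iexp (\<Sum>j<k. a j * X N \<omega> (s j)) \<partial>P) \<longlonglongrightarrow> (\<integral>v. iexp (\<Sum>j<k. a j * G v (s j)) \<partial>M)"
proof -
  interpret P: prob_space P by fact
  interpret M: prob_space M by fact
  have sH: "s j \<in> H" for j using s by auto
  have Gm: "(\<lambda>v. G v f) \<in> borel_measurable M" if "f \<in> H" for f
    using measurable_compose[OF G measurable_continuous_map_borel_sigma[OF lipschitz_real_continuous_map[OF lipschitz_real_eval[OF that]]]] .
  have cont: "continuous_map (mtopology_of (linf H)) euclideanreal (\<lambda>z. \<Sum>j<k. a j * z (s j))"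
    by (intro continuous_map_sum continuous_map_real_mult_left lipschitz_real_continuous_map[OF lipschitz_real_eval[OF sH]]) auto
  have lim: "(\<lambda>N. \<integral>\<omega>. g (\<Sum>j<k. a j * X N \<omega> (s j)) \<partial>P) \<longlonglongrightarrow> (\<integral>v. g (\<Sum>j<k. a j * G v (s j)) \<partial>M)"
    if g: "continuous_on UNIV g" "\<And>x. \<bar>g x\<bar> \<le> 1" for g :: "real \<Rightarrow> real"
  proof -
    have "continuous_map (mtopology_of (linf H)) euclideanreal (g \<circ> (\<lambda>z. \<Sum>j<k. a j * z (s j)))"
      by (rule continuous_map_compose[OF cont]) (use g in auto)
    moreover have "bounded ((g \<circ> (\<lambda>z. \<Sum>j<k. a j * z (s j))) ` mspace (linf H))"
      using g by (auto simp: bounded_iff)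
    ultimately have "(\<lambda>N. outer_expectation P (\<lambda>\<omega>. (g \<circ> (\<lambda>z. \<Sum>j<k. a j * z (s j))) (X N \<omega>)))
        \<longlonglongrightarrow> (\<integral>v. (g \<circ> (\<lambda>z. \<Sum>j<k. a j * z (s j))) (G v) \<partial>M)"
      using weak unfolding weakly_converges_def by blast
    moreover have "outer_expectation P (\<lambda>\<omega>. (g \<circ> (\<lambda>z. \<Sum>j<k. a j * z (s j))) (X N \<omega>)) = (\<integral>\<omega>. g (\<Sum>j<k. a j * X N \<omega> (s j)) \<partial>P)" for N
    proof -
      note [measurable] = borel_measurable_continuous_onI[OF g(1)] X_meas[OF sH]
      have "integrable P (\<lambda>\<omega>. g (\<Sum>j<k. a j * X N \<omega> (s j)))"
        by (rule P.AE_bounded_integrable[of _ 1]) (use g in auto)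
      then show ?thesis using g by (subst P.outer_expectation_eq_integral[of _ 1]) (auto simp: o_def)
    qed
    ultimately show ?thesis by (simp add: o_def)
  qed
  have cs: "continuous_on UNIV (cos :: real \<Rightarrow> real)" "continuous_on UNIV (sin :: real \<Rightarrow> real)"
    by (intro continuous_intros)+
  have iX: "integrable P (\<lambda>\<omega>. iexp (\<Sum>j<k. a j * X N \<omega> (s j)))" for N
    using X_meas[OF sH] by (intro P.integrable_iexp) auto
  have iG: "integrable M (\<lambda>v. iexp (\<Sum>j<k. a j * G v (s j)))"
    using Gm[OF sH] by (intro M.integrable_iexp) auto
  show ?thesis
  proof (rule tendsto_complex_iff[THEN iffD2], intro conjI)
    show "(\<lambda>N. Re (\<integral>\<omega>. iexp (\<Sum>j<k. a j * X N \<omega> (s j)) \<partial>P)) \<longlonglongrightarrow> Re (\<integral>v. iexp (\<Sum>j<k. a j * G v (s j)) \<partial>M)"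
      using lim[of cos] iX iG cs by (simp add: Re_exp flip: integral_Re)
    show "(\<lambda>N. Im (\<integral>\<omega>. iexp (\<Sum>j<k. a j * X N \<omega> (s j)) \<partial>P)) \<longlonglongrightarrow> Im (\<integral>v. iexp (\<Sum>j<k. a j * G v (s j)) \<partial>M)"
      using lim[of sin] iX iG cs by (simp add: Im_exp flip: integral_Im)
  qed
qed

text \<open>Cramer-Wold: scaling the coefficients by \<open>t\<close> gives the whole characteristic
  function of each finite combination, and it is that of a centred normal. Index points come as
  sequences in \<open>H\<close>, possibly with repetitions.\<close>

lemma weak_limit_gaussian:
  fixes X :: "nat \<Rightarrow> 'w \<Rightarrow> 't \<Rightarrow> real"
  assumes P: "prob_space P" and M: "prob_space M"
    and X_mem: "\<And>N \<omega>. \<omega> \<in> space P \<Longrightarrow> X N \<omega> \<in> mspace (linf H)"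
    and X_meas: "\<And>N f. f \<in> H \<Longrightarrow> (\<lambda>\<omega>. X N \<omega> f) \<in> borel_measurable P"
    and char: "\<And>s a (k::nat). range s \<subseteq> H \<Longrightarrow> (\<lambda>N. \<integral>\<omega>. iexp (\<Sum>j<k. a j * X N \<omega> (s j)) \<partial>P)
      \<longlonglongrightarrow> complex_of_real (exp (- (\<Sum>i<k. \<Sum>j<k. a i * a j * S (s i) (s j)) / 2))"
    and psd: "\<And>s. range s \<subseteq> H \<Longrightarrow> psd_kernel (\<lambda>i j. S (s i) (s j))"
    and G: "G \<in> measurable M (borel_sigma (mtopology_of (linf H)))"
    and weak: "weakly_converges (linf H) P X M G"
  shows "zero_mean_gaussian_process M H S G"
    and "\<And>f. f \<in> H \<Longrightarrow> integrable M (\<lambda>v. (G v f)\<^sup>2)"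
    and "\<And>f. f \<in> H \<Longrightarrow> (\<lambda>v. G v f) \<in> borel_measurable M"
proof -
  interpret P: prob_space P by fact
  interpret M: prob_space M by fact
  show Gm: "(\<lambda>v. G v f) \<in> borel_measurable M" if "f \<in> H" for f
    using measurable_compose[OF G measurable_continuous_map_borel_sigma[OF lipschitz_real_continuous_map[OF lipschitz_real_eval[OF that]]]] .
  have comb: "normal_rv M (\<lambda>v. \<Sum>j<k. a j * G v (s j))"
    "(\<integral>v. (\<Sum>j<k. a j * G v (s j)) \<partial>M) = 0"
    "integrable M (\<lambda>v. (\<Sum>j<k. a j * G v (s j))\<^sup>2)"
    "(\<integral>v. (\<Sum>j<k. a j * G v (s j))\<^sup>2 \<partial>M) = (\<Sum>i<k. \<Sum>j<k. a i * a j * S (s i) (s j))"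
    if s: "range s \<subseteq> H" for s a and k :: nat
  proof -
    have sH: "s j \<in> H" for j using s by auto
    have Ym: "(\<lambda>v. \<Sum>j<k. a j * G v (s j)) \<in> borel_measurable M"
      using Gm[OF sH] by measurable
    let ?v = "\<Sum>i<k. \<Sum>j<k. a i * a j * S (s i) (s j)"
    have v0: "0 \<le> ?v" using psd[OF s] by (simp add: psd_kernel_def)
    have ch: "(\<integral>v. iexp (t * (\<Sum>j<k. a j * G v (s j))) \<partial>M) = complex_of_real (exp (- t\<^sup>2 * ?v / 2))" for t
    proof -
      have e1: "t * (\<Sum>j<k. a j * y j) = (\<Sum>j<k. t * a j * y j)" for y by (simp add: sum_distrib_left mult.assoc)
      have "(\<lambda>N. \<integral>\<omega>. iexp (\<Sum>j<k. t * a j * X N \<omega> (s j)) \<partial>P) \<longlonglongrightarrow> (\<integral>v. iexp (\<Sum>j<k. t * a j * G v (s j)) \<partial>M)"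
        by (rule weakly_converges_iexp[OF P M X_meas G weak s])
      moreover have "(\<Sum>i<k. \<Sum>j<k. t * a i * (t * a j) * S (s i) (s j)) = t\<^sup>2 * ?v"
        by (simp add: sum_distrib_left power2_eq_square ac_simps)
      ultimately show ?thesis
        using char[OF s, where k = k and a = "\<lambda>j. t * a j"] LIMSEQ_unique unfolding e1 by force
    qed
    show "normal_rv M (\<lambda>v. \<Sum>j<k. a j * G v (s j))"
    "(\<integral>v. (\<Sum>j<k. a j * G v (s j)) \<partial>M) = 0"
    "integrable M (\<lambda>v. (\<Sum>j<k. a j * G v (s j))\<^sup>2)"
    "(\<integral>v. (\<Sum>j<k. a j * G v (s j))\<^sup>2 \<partial>M) = ?v"
      using char_gaussian_imp[OF M Ym v0 ch] by auto
  qed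
  show sq: "integrable M (\<lambda>v. (G v f)\<^sup>2)" if "f \<in> H" for f
    using comb(3)[of "\<lambda>_. f" "\<lambda>_. 1" 1] that by simp
  show "zero_mean_gaussian_process M H S G"
    unfolding zero_mean_gaussian_process_def gaussian_process_def
  proof (intro conjI allI impI ballI)
    fix I a assume I: "finite I \<and> I \<subseteq> H"
    show "normal_rv M (\<lambda>v. \<Sum>t\<in>I. a t * G v t)"
    proof (cases "I = {}")
      case True then show ?thesis by (auto simp: normal_rv_def)
    next
      case False
      then obtain t0 where t0: "t0 \<in> I" by blast
      obtain h where h: "bij_betw h {0..<card I} I" using I ex_bij_betw_nat_finite by blast
      \<comment> \<open>Beyond \<open>card I\<close> the sequence is padded with a point of
        \<open>I\<close>, which keeps its range inside \<open>H\<close>; the padding is never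
        summed.\<close>
      define s where "s j = (if j < card I then h j else t0)" for j
      have "range s \<subseteq> H" using h t0 I by (auto simp: s_def bij_betw_def)
      from comb(1)[OF this, of "\<lambda>j. a (s j)" "card I"]
      have "normal_rv M (\<lambda>v. \<Sum>j<card I. a (s j) * G v (s j))" .
      also have "(\<lambda>v. \<Sum>j<card I. a (s j) * G v (s j)) = (\<lambda>v. \<Sum>t\<in>I. a t * G v t)"
      proof
        fix v show "(\<Sum>j<card I. a (s j) * G v (s j)) = (\<Sum>t\<in>I. a t * G v t)"
          using sum.reindex_bij_betw[OF h, of "\<lambda>t. a t * G v t"] by (simp add: s_def lessThan_atLeast0)
      qed
      finally show ?thesis .
    qed
  next
    fix t assume "t \<in> H"
    then show "(\<integral>v. G v t \<partial>M) = 0" using comb(2)[of "\<lambda>_. t" "\<lambda>_. 1" 1] by auto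
  next
    fix s t assume st: "s \<in> H" "t \<in> H"
    \<comment> \<open>A two-point sequence for polarization: the mixed moment follows from the
      second moments of the sum and of the two coordinates.\<close>
    define q where "q = (\<lambda>j::nat. if j = 0 then s else t)"
    have q: "range q \<subseteq> H" using st by (auto simp: q_def)
    have sym: "S s t = S t s"
      using psd[OF q, unfolded psd_kernel_def, THEN conjunct1, rule_format, of 0 1] by (simp add: q_def)
    have 2: "(\<Sum>j<2. g j) = g 0 + g 1" for g :: "nat \<Rightarrow> real" by (simp add: numeral_2_eq_2)
    have A: "(\<integral>v. (G v s + G v t)\<^sup>2 \<partial>M) = S s s + S s t + (S t s + S t t)"
       "integrable M (\<lambda>v. (G v s + G v t)\<^sup>2)"
      using comb(3,4)[OF q, of "\<lambda>_. 1" 2] by (simp_all add: 2 q_def)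
    have B: "(\<integral>v. (G v f)\<^sup>2 \<partial>M) = S f f" if "f \<in> H" for f
      using comb(4)[of "\<lambda>_. f" "\<lambda>_. 1" 1] that by auto
    have "(\<integral>v. G v s * G v t \<partial>M) = (\<integral>v. ((G v s + G v t)\<^sup>2 - (G v s)\<^sup>2 - (G v t)\<^sup>2) / 2 \<partial>M)"
      by (intro Bochner_Integration.integral_cong refl) (simp add: power2_eq_square algebra_simps)
    then show "(\<integral>v. G v s * G v t \<partial>M) = S s t"
      using A B[OF st(1)] B[OF st(2)] sq[OF st(1)] sq[OF st(2)] sym by simp
  qed
qed

subsection \<open>Uniform continuity of the paths\<close>

text \<open>On a compact set of nearly full probability the paths are almost constant on the cells
  of a finite partition. For each pair of cells containing a close pair of points one witness pair
  is kept, and \<open>incr\<close> controls these finitely many witness increments at once.\<close>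

lemma tight_paths_uniformly_continuous:
  fixes d :: "'t \<Rightarrow> 't \<Rightarrow> real"
  assumes M: "prob_space M" and tight: "tight_borel_element (linf H) M G"
    and incr: "\<And>\<eta> t. \<eta> > 0 \<Longrightarrow> t > 0 \<Longrightarrow> \<exists>\<delta>>0. \<forall>f\<in>H. \<forall>g\<in>H. d f g < \<delta> \<longrightarrow>
      measure M {v\<in>space M. \<bar>G v f - G v g\<bar> > t} \<le> \<eta>"
  shows "AE v in M. \<forall>e>0. \<exists>\<delta>>0. \<forall>f\<in>H. \<forall>g\<in>H. d f g < \<delta> \<longrightarrow> \<bar>G v f - G v g\<bar> < e"
proof -
  interpret prob_space M by fact
  have Gmeas: "G \<in> measurable M (borel_sigma (mtopology_of (linf H)))" using tight by (simp add: tight_borel_element_def)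
  have Gm [measurable]: "(\<lambda>v. G v f) \<in> borel_measurable M" if "f \<in> H" for f
    using measurable_compose[OF Gmeas measurable_continuous_map_borel_sigma[OF lipschitz_real_continuous_map[OF lipschitz_real_eval[OF that]]]] .
  have step: "\<exists>\<delta>>0. \<exists>B\<in>sets M. measure M B \<le> \<eta> \<and> (\<forall>v\<in>space M - B. \<forall>f\<in>H. \<forall>g\<in>H. d f g < \<delta> \<longrightarrow> \<bar>G v f - G v g\<bar> \<le> 5 * t)"
    if \<eta>: "\<eta> > 0" and t: "t > 0" for \<eta> t
  proof -
    obtain K where K: "compactin (mtopology_of (linf H)) K" "measure M {v\<in>space M. G v \<in> K} \<ge> 1 - \<eta> / 2"
      using tight \<eta> unfolding tight_borel_element_def by (metis half_gt_zero)
    obtain r where r: "finite (r ` H)" "r ` H \<subseteq> H" "\<And>z f. z \<in> K \<Longrightarrow> f \<in> H \<Longrightarrow> \<bar>z f - z (r f)\<bar> \<le> t"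
      using compactin_linf_finite_reps[OF K(1) t] by blast
    have "closedin (mtopology_of (linf H)) K"
      by (rule compactin_imp_closedin[OF _ K(1)]) (simp add: mtopology_of_def Metric_space.Hausdorff_space_mtopology)
    then have Km: "{v\<in>space M. G v \<in> K} \<in> sets M"
      using measurable_sets[OF Gmeas sets_borel_sigma_closed] by (simp add: vimage_def Collect_conj_eq Int_commute)
    define Q where "Q = r ` H \<times> r ` H"
    have Q: "finite Q" using r by (simp add: Q_def)
    \<comment> \<open>At most \<open>card Q\<close> witness increments have to share the probability
      \<open>\<eta> / 2\<close>.\<close>
    define \<eta>' where "\<eta>' = \<eta> / (2 * (card Q + 1))"
    have \<eta>': "\<eta>' > 0" using \<eta> by (simp add: \<eta>'_def)
    from incr[OF \<eta>' t] obtain \<delta>0 where \<delta>0: "\<delta>0 > 0" "\<And>f g. f \<in> H \<Longrightarrow> g \<in> H \<Longrightarrow> d f g < \<delta>0 \<Longrightarrow> measure M {v\<in>space M. \<bar>G v f - G v g\<bar> > t} \<le> \<eta>'"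
      by (elim exE conjE) blast
    define close where "close q \<delta> \<longleftrightarrow> (\<exists>f\<in>H. \<exists>g\<in>H. (r f, r g) = q \<and> d f g < \<delta>)" for q \<delta>
    \<comment> \<open>A genuine witness is chosen only for pairs of cells that contain a close pair;
      for the others the implication is vacuous.\<close>
    have "\<exists>\<delta> f g. \<delta> > 0 \<and> f \<in> H \<and> g \<in> H \<and> (close q \<delta> \<longrightarrow> (r f, r g) = q \<and> d f g < \<delta>0)" if "q \<in> Q" for q
    proof (cases "close q \<delta>0")
      case True
      then show ?thesis unfolding close_def using \<delta>0(1) by blast
    next
      case False
      then show ?thesis using \<delta>0(1) that by (auto simp: Q_def)
    qed
    then obtain \<delta>s fs gs where sel: "\<And>q. q \<in> Q \<Longrightarrow> \<delta>s q > (0::real)" "\<And>q. q \<in> Q \<Longrightarrow> fs q \<in> H" "\<And>q. q \<in> Q \<Longrightarrow> gs q \<in> H"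
      "\<And>q. q \<in> Q \<Longrightarrow> close q (\<delta>s q) \<Longrightarrow> (r (fs q), r (gs q)) = q \<and> d (fs q) (gs q) < \<delta>0" by metis
    define \<delta> where "\<delta> = Min (insert 1 (\<delta>s ` Q))"
    have \<delta>: "\<delta> > 0" "\<And>q. q \<in> Q \<Longrightarrow> \<delta> \<le> \<delta>s q" using sel Q by (auto simp: \<delta>_def)
    define B where "B = (space M - {v\<in>space M. G v \<in> K}) \<union> (\<Union>q\<in>{q\<in>Q. d (fs q) (gs q) < \<delta>0}. {v\<in>space M. \<bar>G v (fs q) - G v (gs q)\<bar> > t})"
    have sm: "{v\<in>space M. \<bar>G v (fs q) - G v (gs q)\<bar> > t} \<in> sets M" if "q \<in> Q" for q
      using Gm[OF sel(2)[OF that]] Gm[OF sel(3)[OF that]] by measurable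
    have Bm: "B \<in> sets M" unfolding B_def using Km Q sm by (intro sets.Un sets.finite_UN) auto
    have "measure M B \<le> measure M (space M - {v\<in>space M. G v \<in> K}) +
       measure M (\<Union>q\<in>{q\<in>Q. d (fs q) (gs q) < \<delta>0}. {v\<in>space M. \<bar>G v (fs q) - G v (gs q)\<bar> > t})"
      unfolding B_def using Km Q sm by (intro measure_Un_le sets.finite_UN) auto
    also have "measure M (space M - {v\<in>space M. G v \<in> K}) \<le> \<eta> / 2" using K(2) prob_compl[OF Km] by simp
    also have "measure M (\<Union>q\<in>{q\<in>Q. d (fs q) (gs q) < \<delta>0}. {v\<in>space M. \<bar>G v (fs q) - G v (gs q)\<bar> > t})
        \<le> (\<Sum>q\<in>{q\<in>Q. d (fs q) (gs q) < \<delta>0}. measure M {v\<in>space M. \<bar>G v (fs q) - G v (gs q)\<bar> > t})"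
      using Q sm by (intro measure_UNION_le) auto
    also have "\<dots> \<le> (\<Sum>q\<in>{q\<in>Q. d (fs q) (gs q) < \<delta>0}. \<eta>')"
      using \<delta>0 sel by (intro sum_mono) auto
    also have "\<dots> \<le> card Q * \<eta>'" using \<open>\<eta>' > 0\<close> Q by (auto intro!: mult_right_mono card_mono)
    also have "\<dots> \<le> \<eta> / 2" using \<eta> by (simp add: \<eta>'_def field_simps)
    finally have mB: "measure M B \<le> \<eta>" by simp
    \<comment> \<open>Five moves of size \<open>t\<close>: from \<open>f\<close> to its
      representative, on to the witness in the same cell, across the witness pair, to the
      representative of \<open>g\<close>, and to \<open>g\<close>.\<close>
    have "\<bar>G v f - G v g\<bar> \<le> 5 * t" if v: "v \<in> space M - B" and fg: "f \<in> H" "g \<in> H" "d f g < \<delta>" for v f g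
    proof -
      define q where "q = (r f, r g)"
      have q: "q \<in> Q" using fg by (auto simp: Q_def q_def)
      have "close q (\<delta>s q)" unfolding close_def q_def using fg \<delta>(2)[OF q] by (force simp: q_def)
      from sel(4)[OF q this] have e: "r (fs q) = r f" "r (gs q) = r g" "d (fs q) (gs q) < \<delta>0" by (auto simp: q_def)
      have z: "G v \<in> K" using v by (auto simp: B_def)
      have "\<bar>G v (fs q) - G v (gs q)\<bar> \<le> t"
      proof (rule ccontr)
        assume "\<not> \<bar>G v (fs q) - G v (gs q)\<bar> \<le> t"
        then have "v \<in> B" unfolding B_def using q e(3) v by (intro UnI2 UN_I[of q]) auto
        then show False using v by simp
      qed
      then show ?thesis
        using r(3)[OF z fg(1)] r(3)[OF z fg(2)] r(3)[OF z sel(2)[OF q], unfolded e(1)] r(3)[OF z sel(3)[OF q], unfolded e(2)] by linarith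
    qed
    then show ?thesis using \<delta> Bm mB by blast
  qed
  have ae: "AE v in M. \<exists>\<delta>>0. \<forall>f\<in>H. \<forall>g\<in>H. d f g < \<delta> \<longrightarrow> \<bar>G v f - G v g\<bar> \<le> 5 * t" if t: "t > 0" for t
  proof -
    have "\<forall>k::nat. \<exists>\<delta> B. \<delta> > 0 \<and> B \<in> sets M \<and> measure M B \<le> 1 / Suc k \<and> (\<forall>v\<in>space M - B. \<forall>f\<in>H. \<forall>g\<in>H. d f g < \<delta> \<longrightarrow> \<bar>G v f - G v g\<bar> \<le> 5 * t)"
      using step[OF _ t] by (metis of_nat_0_less_iff zero_less_Suc zero_less_divide_1_iff)
    then obtain \<delta> B where dB: "\<And>k::nat. \<delta> k > (0::real)" "\<And>k. B k \<in> sets M" "\<And>k. measure M (B k) \<le> 1 / Suc k"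
      "\<And>k v f g. v \<in> space M - B k \<Longrightarrow> f \<in> H \<Longrightarrow> g \<in> H \<Longrightarrow> d f g < \<delta> k \<Longrightarrow> \<bar>G v f - G v g\<bar> \<le> 5 * t" by metis
    have "measure M (\<Inter>k. B k) \<le> 1 / Suc k" for k
      by (rule order_trans[OF _ dB(3)[of k]]) (intro finite_measure_mono dB, auto)
    then have "measure M (\<Inter>k. B k) \<le> 0"
      by (intro LIMSEQ_le_const[OF LIMSEQ_inverse_real_of_nat]) (auto simp: inverse_eq_divide)
    then have "(\<Inter>k. B k) \<in> null_sets M"
      using dB(2) by (intro null_setsI) (auto simp: emeasure_eq_measure order_antisym)
    then show ?thesis
    proof (rule AE_I', intro subsetI)
      fix v assume v: "v \<in> {v \<in> space M. \<not> (\<exists>\<delta>>0. \<forall>f\<in>H. \<forall>g\<in>H. d f g < \<delta> \<longrightarrow> \<bar>G v f - G v g\<bar> \<le> 5 * t)}"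
      show "v \<in> (\<Inter>k. B k)"
      proof
        fix k show "v \<in> B k"
        proof (rule ccontr)
          assume "v \<notin> B k"
          then have "\<forall>f\<in>H. \<forall>g\<in>H. d f g < \<delta> k \<longrightarrow> \<bar>G v f - G v g\<bar> \<le> 5 * t" using v dB(4)[of v k] by blast
          then show False using v dB(1)[of k] by blast
        qed
      qed
    qed
  qed
  have "AE v in M. \<forall>n::nat. \<exists>\<delta>>0. \<forall>f\<in>H. \<forall>g\<in>H. d f g < \<delta> \<longrightarrow> \<bar>G v f - G v g\<bar> \<le> 5 * (1 / Suc n)"
    unfolding AE_all_countable by (intro allI ae) simp
  then show ?thesis
  proof eventually_elim
    case (elim v)
    show ?case
    proof (intro allI impI)
      fix e :: real assume "e > 0"
      then obtain n where n: "1 / Suc n < e / 5" using nat_approx_posE[of "e / 5"] by auto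
      then have "5 * (1 / Suc n) < e" by simp
      then show "\<exists>\<delta>>0. \<forall>f\<in>H. \<forall>g\<in>H. d f g < \<delta> \<longrightarrow> \<bar>G v f - G v g\<bar> < e"
        using elim[rule_format, of n] by (meson le_less_trans)
    qed
  qed
qed

subsection \<open>Existence of the weak limit from finite approximations\<close>

lemma (in prob_space) outer_small_integral_le:
  assumes "\<And>x. x \<in> space M \<Longrightarrow> \<bar>f x\<bar> \<le> 1" "f \<in> borel_measurable M"
    and A: "outer_small M A \<eta>" and "\<And>x. x \<in> space M \<Longrightarrow> x \<notin> A \<Longrightarrow> f x \<le> 0"
  shows "integral\<^sup>L M f \<le> \<eta>"
proof -
  obtain B where B [measurable]: "B \<in> sets M" and AB: "A \<inter> space M \<subseteq> B" and mB: "measure M B \<le> \<eta>"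
    using A by (rule outer_smallE)
  have "integral\<^sup>L M f \<le> (\<integral>x. indicator B x \<partial>M)"
  proof (rule integral_mono)
    show "integrable M f" using assms by (intro AE_bounded_integrable[of _ 1]) auto
    fix x assume x: "x \<in> space M"
    show "f x \<le> indicator B x"
      using assms(1)[OF x] assms(4)[OF x] AB x by (cases "x \<in> A") (auto simp: indicator_def)
  qed (auto simp: emeasure_eq_measure)
  then show ?thesis using mB by simp
qed

lemma sum_half_powers: "summable (\<lambda>i. c * (1 / 2 :: real) ^ (i + m))" "(\<Sum>i. c * (1 / 2 :: real) ^ (i + m)) = 2 * c * (1 / 2) ^ m"
proof -
  have s: "(\<lambda>i. (c * (1 / 2) ^ m) * (1 / 2 :: real) ^ i) sums ((c * (1 / 2) ^ m) * 2)"
    using sums_mult[OF geometric_sums[of "1 / 2 :: real"]] by simp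
  have e: "(\<lambda>i. c * (1 / 2 :: real) ^ (i + m)) = (\<lambda>i. (c * (1 / 2) ^ m) * (1 / 2 :: real) ^ i)"
    by (auto simp: power_add)
  show "summable (\<lambda>i. c * (1 / 2 :: real) ^ (i + m))" unfolding e using s by (rule sums_summable)
  show "(\<Sum>i. c * (1 / 2 :: real) ^ (i + m)) = 2 * c * (1 / 2) ^ m" unfolding e using sums_unique[OF s] by simp
qed

text \<open>On the countable set of representatives the limit is a Gaussian sequence. The
  oscillation bounds of the prelimits pass to it through finite-dimensional convergence, and their
  summability makes the step functions of successive levels converge uniformly with probability 1.
  Consecutive levels are compared through the full process, so no nesting of the partitions is
  involved.\<close>

theorem weak_limit_of_finite_approximations:
  fixes X :: "nat \<Rightarrow> 'w \<Rightarrow> 't \<Rightarrow> real" and r :: "nat \<Rightarrow> 't \<Rightarrow> 't"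
  assumes P: "prob_space P" and H: "H \<noteq> {}"
    and X_mem: "\<And>N \<omega>. \<omega> \<in> space P \<Longrightarrow> X N \<omega> \<in> mspace (linf H)"
    and X_meas: "\<And>N f. f \<in> H \<Longrightarrow> (\<lambda>\<omega>. X N \<omega> f) \<in> borel_measurable P"
    and char: "\<And>s a (k::nat). range s \<subseteq> H \<Longrightarrow> (\<lambda>N. \<integral>\<omega>. iexp (\<Sum>j<k. a j * X N \<omega> (s j)) \<partial>P)
      \<longlonglongrightarrow> complex_of_real (exp (- (\<Sum>i<k. \<Sum>j<k. a i * a j * S (s i) (s j)) / 2))"
    and psd: "\<And>s. range s \<subseteq> H \<Longrightarrow> psd_kernel (\<lambda>i j. S (s i) (s j))"
    and r: "\<And>m. r m ` H \<subseteq> H" "\<And>m. finite (r m ` H)" "\<And>m f. f \<in> H \<Longrightarrow> r m (r m f) = r m f"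
    and small: "\<And>m. \<forall>\<^sub>F N in sequentially. outer_small P {\<omega>. osc H (r m) (X N \<omega>) > (1 / 2) ^ m} ((1 / 2) ^ m)"
  shows "\<exists>(M :: ('t \<Rightarrow> real) measure) G. prob_space M \<and> tight_borel_element (linf H) M G \<and>
    weakly_converges (linf H) P X M G"
proof -
  interpret P: prob_space P by fact
  interpret O: prob_space std_normal_seq by (rule prob_space_std_normal_seq)
  let ?O = std_normal_seq
  have rH: "r m f \<in> H" if "f \<in> H" for m f using r(1)[of m] that by auto
  define A where "A = (\<Union>m. r m ` H)"
  have "countable A" unfolding A_def by (intro countable_UN countableI_type countable_finite r(2))
  moreover have "A \<noteq> {}" "A \<subseteq> H" using r(1) H unfolding A_def by auto
  ultimately have A: "countable A" "A \<noteq> {}" "A \<subseteq> H" by auto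
  define s where "s = from_nat_into A"
  have ran: "range s = A" unfolding s_def using A by (intro range_from_nat_into)
  then have sH: "range s \<subseteq> H" "\<And>j. s j \<in> H" using A by auto
  define ix where "ix g = (SOME i. s i = g)" for g
  have ix: "s (ix g) = g" if "g \<in> A" for g
  proof -
    have "\<exists>i. s i = g" using that ran by auto
    then show ?thesis unfolding ix_def by (rule someI_ex)
  qed
  have rA: "r m f \<in> A" if "f \<in> H" for m f using that by (auto simp: A_def)
  define p where "p m f = ix (r m f)" for m f
  have sp: "s (p m f) = r m f" if "f \<in> H" for m f unfolding p_def using ix rA[OF that] by blast
  define k where "k m = Suc (Max (p m ` H))" for m
  have finp: "finite (p m ` H)" for m
  proof -
    have "p m ` H = ix ` r m ` H" by (auto simp: p_def)
    then show ?thesis using r(2)[of m] by simp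
  qed
  have pk: "p m f < k m" if "f \<in> H" for m f
    using finp[of m] that by (auto simp: k_def less_Suc_eq_le)
  have coord_le: "\<bar>x (p m f) - y (p m f)\<bar> \<le> (\<Sum>j<k m. \<bar>x j - y j\<bar>)" if "f \<in> H" for x y :: "nat \<Rightarrow> real" and m f
    using pk[OF that, of m] by (intro member_le_sum) auto
  define C where "C i j = S (s i) (s j)" for i j
  have C: "psd_kernel C" unfolding C_def using psd[OF sH(1)] .
  define Z where "Z = gauss_seq C"
  have Zm [measurable]: "(\<lambda>\<xi>. Z \<xi> j) \<in> borel_measurable ?O" for j unfolding Z_def by measurable
  have levy: "(\<lambda>N. \<integral>\<omega>. \<phi> (\<lambda>j. X N \<omega> (s j)) \<partial>P) \<longlonglongrightarrow> (\<integral>\<xi>. \<phi> (Z \<xi>) \<partial>?O)"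
    if "lipschitz_vec n L \<phi>" "\<And>x. \<bar>\<phi> x\<bar> \<le> b" "L \<ge> 0" for n L \<phi> b
  proof (rule levy_multivariate[OF P _ prob_space_std_normal_seq _ _ that])
    show "(\<lambda>N. \<integral>\<omega>. iexp (\<Sum>j<n. a j * X N \<omega> (s j)) \<partial>P) \<longlonglongrightarrow> (\<integral>\<xi>. iexp (\<Sum>j<n. a j * Z \<xi> j) \<partial>?O)" for a
      unfolding Z_def integral_iexp_gauss_seq[OF C] unfolding C_def by (rule char[OF sH(1)])
  qed (auto intro: X_meas sH)
  \<comment> \<open>The step function on the cells of level \<open>m\<close>; it involves finitely
    many coordinates of \<open>x\<close>.\<close>
  define \<psi> where "\<psi> m x = (\<lambda>f\<in>H. x (p m f))" for m and x :: "nat \<Rightarrow> real"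
  have \<psi>_mem: "\<psi> m x \<in> mspace (linf H)" for m x
  proof -
    have "\<bar>x (p m f)\<bar> \<le> (\<Sum>j<k m. \<bar>x j\<bar>)" if "f \<in> H" for f
      using coord_le[OF that, of x m "\<lambda>_. 0"] by simp
    then show ?thesis unfolding mem_linf \<psi>_def by auto
  qed
  have \<psi>_lip: "mdist (linf H) (\<psi> m x) (\<psi> m y) \<le> (\<Sum>j<k m. \<bar>x j - y j\<bar>)" for m x y
    unfolding mdist_linf_le[OF \<psi>_mem \<psi>_mem H] using coord_le by (auto simp: \<psi>_def)
  define D where "D m x = (SUP f\<in>H. \<bar>x (p m f) - x (p (Suc m) f)\<bar>)" for m and x :: "nat \<Rightarrow> real"
  have D_bdd: "bdd_above ((\<lambda>f. \<bar>x (p m f) - x (p (Suc m) f)\<bar>) ` H)" for m and x :: "nat \<Rightarrow> real"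
  proof (rule bdd_aboveI2)
    fix f assume f: "f \<in> H"
    show "\<bar>x (p m f) - x (p (Suc m) f)\<bar> \<le> (\<Sum>j<k m. \<bar>x j\<bar>) + (\<Sum>j<k (Suc m). \<bar>x j\<bar>)"
      using coord_le[OF f, of x m "\<lambda>_. 0"] coord_le[OF f, of x "Suc m" "\<lambda>_. 0"] by simp
  qed
  have D_ge: "\<bar>x (p m f) - x (p (Suc m) f)\<bar> \<le> D m x" if "f \<in> H" for m x f
    unfolding D_def by (rule cSUP_upper[OF that D_bdd])
  have D_le: "D m x \<le> c" if "\<And>f. f \<in> H \<Longrightarrow> \<bar>x (p m f) - x (p (Suc m) f)\<bar> \<le> c" for m x c
    unfolding D_def using that H by (intro cSUP_least) auto
  have D_lip1: "D m x \<le> D m y + 2 * (\<Sum>j<max (k m) (k (Suc m)). \<bar>x j - y j\<bar>)" for m x y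
  proof (rule D_le)
    fix f assume f: "f \<in> H"
    have "\<bar>x (p m f) - y (p m f)\<bar> \<le> (\<Sum>j<max (k m) (k (Suc m)). \<bar>x j - y j\<bar>)"
      "\<bar>x (p (Suc m) f) - y (p (Suc m) f)\<bar> \<le> (\<Sum>j<max (k m) (k (Suc m)). \<bar>x j - y j\<bar>)"
      using pk[OF f, of m] pk[OF f, of "Suc m"] by (auto intro!: member_le_sum[where f = "\<lambda>j. \<bar>x j - y j\<bar>"])
    then show "\<bar>x (p m f) - x (p (Suc m) f)\<bar> \<le> D m y + 2 * (\<Sum>j<max (k m) (k (Suc m)). \<bar>x j - y j\<bar>)"
      using D_ge[OF f, of y m] by linarith
  qed
  \<comment> \<open>For the prelimit, consecutive step functions differ by at most (1/2)^m +
    (1/2)^(m+1) when both oscillation bounds hold, which is below \<open>t m\<close>.\<close>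
  define t where "t m = 2 * (1 / 2 :: real) ^ m" for m :: nat
  have t0: "t m > 0" for m by (simp add: t_def)
  define ramp where "ramp m x = min 1 (max 0 (D m x / t m - 1))" for m x
  have ramp_lip: "lipschitz_vec (max (k m) (k (Suc m))) (2 / t m) (ramp m)" for m
    unfolding lipschitz_vec_def
  proof (intro allI)
    fix x y :: "nat \<Rightarrow> real"
    let ?S = "\<Sum>j<max (k m) (k (Suc m)). \<bar>x j - y j\<bar>"
    have "(\<Sum>j<max (k m) (k (Suc m)). \<bar>y j - x j\<bar>) = ?S" by (intro sum.cong refl abs_minus_commute)
    then have "\<bar>D m x - D m y\<bar> \<le> 2 * ?S" using D_lip1[of m x y] D_lip1[of m y x] by linarith
    then have "\<bar>D m x - D m y\<bar> / t m \<le> 2 * ?S / t m" using t0[of m] by (intro divide_right_mono) auto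
    then have "\<bar>D m x / t m - D m y / t m\<bar> \<le> 2 / t m * ?S"
      using t0[of m] by (simp add: diff_divide_distrib[symmetric] abs_divide)
    then show "\<bar>ramp m x - ramp m y\<bar> \<le> 2 / t m * ?S" unfolding ramp_def by linarith
  qed
  have D_meas [measurable]: "(\<lambda>\<xi>. D m (Z \<xi>)) \<in> borel_measurable ?O" for m
  proof -
    \<comment> \<open>The supremum runs over finitely many pairs of coordinates, hence is a
      measurable maximum.\<close>
    have "D m x = Max ((\<lambda>(i, j). \<bar>x i - x j\<bar>) ` (\<lambda>f. (p m f, p (Suc m) f)) ` H)" for x
    proof -
      have "(\<lambda>f. (p m f, p (Suc m) f)) ` H \<subseteq> p m ` H \<times> p (Suc m) ` H" by auto
      then have "finite ((\<lambda>f. (p m f, p (Suc m) f)) ` H)" using finp finite_subset by blast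
      from finite_imageI[OF this, of "\<lambda>(i, j). \<bar>x i - x j\<bar>"]
      show ?thesis unfolding D_def using H by (subst cSup_eq_Max[symmetric]) (auto simp: image_image)
    qed
    moreover have "finite ((\<lambda>f. (p m f, p (Suc m) f)) ` H)"
      by (rule finite_subset[of _ "p m ` H \<times> p (Suc m) ` H"]) (use finp in auto)
    ultimately show ?thesis by (simp add: case_prod_beta' borel_measurable_Max)
  qed
  have ramp_small: "integral\<^sup>L ?O (\<lambda>\<xi>. ramp m (Z \<xi>)) \<le> 2 * (1 / 2) ^ m" for m
  proof (rule LIMSEQ_le_const2[OF levy[OF ramp_lip[of m], of 1]])
    show "\<bar>ramp m x\<bar> \<le> 1" for x by (auto simp: ramp_def)
    show "0 \<le> 2 / t m" using t0[of m] by simp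
    have "\<forall>\<^sub>F N in sequentially. (\<integral>\<omega>. ramp m (\<lambda>j. X N \<omega> (s j)) \<partial>P) \<le> 2 * (1 / 2) ^ m"
      using small[of m] small[of "Suc m"]
    proof eventually_elim
      case (elim N)
      have "(\<integral>\<omega>. ramp m (\<lambda>j. X N \<omega> (s j)) \<partial>P) \<le> (1 / 2) ^ m + (1 / 2) ^ Suc m"
      proof (rule P.outer_small_integral_le[OF _ _ P.outer_small_Un[OF elim]])
        have "(\<lambda>\<omega>. (\<lambda>i\<in>UNIV. X N \<omega> (s i))) \<in> measurable P (PiM UNIV (\<lambda>_. borel))"
          by (intro measurable_restrict X_meas sH)
        from measurable_compose[OF this lipschitz_vec_measurable[OF ramp_lip[of m]]]
        show "(\<lambda>\<omega>. ramp m (\<lambda>j. X N \<omega> (s j))) \<in> borel_measurable P" by (simp add: restrict_def)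
        fix \<omega> assume w: "\<omega> \<in> space P" "\<omega> \<notin> {\<omega>. (1 / 2) ^ m < osc H (r m) (X N \<omega>)} \<union> {\<omega>. (1 / 2) ^ Suc m < osc H (r (Suc m)) (X N \<omega>)}"
        have "D m (\<lambda>j. X N \<omega> (s j)) \<le> t m"
        proof (rule D_le)
          fix f assume f: "f \<in> H"
          have "\<bar>X N \<omega> f - X N \<omega> (r m f)\<bar> \<le> (1 / 2) ^ m"
            using le_osc[OF r(1) X_mem[OF w(1)] f, of N m] w(2) by auto
          moreover have "\<bar>X N \<omega> f - X N \<omega> (r (Suc m) f)\<bar> \<le> (1 / 2) ^ Suc m"
            using le_osc[OF r(1) X_mem[OF w(1)] f, of N "Suc m"] w(2) by auto
          moreover have "(1 / 2 :: real) ^ Suc m \<le> (1 / 2) ^ m" by simp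
          ultimately show "\<bar>X N \<omega> (s (p m f)) - X N \<omega> (s (p (Suc m) f))\<bar> \<le> t m"
            unfolding sp[OF f] t_def by linarith
        qed
        then show "ramp m (\<lambda>j. X N \<omega> (s j)) \<le> 0" using t0[of m] by (simp add: ramp_def)
      qed (auto simp: ramp_def)
      moreover have "(1 / 2 :: real) ^ Suc m \<le> (1 / 2) ^ m" by simp
      ultimately show ?case by linarith
    qed
    then show "\<exists>N0. \<forall>N\<ge>N0. (\<integral>\<omega>. ramp m (\<lambda>j. X N \<omega> (s j)) \<partial>P) \<le> 2 * (1 / 2) ^ m"
      by (simp add: eventually_sequentially)
  qed
  \<comment> \<open>The threshold equals \<open>2 * t m\<close>, where the ramp reaches 1. The
    resulting probabilities are summable, as in the Borel-Cantelli lemma.\<close>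
  define bad where "bad m = {\<xi>\<in>space ?O. D m (Z \<xi>) \<ge> 4 * (1 / 2) ^ m}" for m
  have bad_sets [measurable]: "bad m \<in> sets ?O" for m unfolding bad_def by measurable
  have bad: "measure ?O (bad m) \<le> 2 * (1 / 2) ^ m" for m
  proof -
    have rm [measurable]: "(\<lambda>\<xi>. ramp m (Z \<xi>)) \<in> borel_measurable ?O" unfolding ramp_def by measurable
    have "measure ?O (bad m) \<le> measure ?O {\<xi>\<in>space ?O. ramp m (Z \<xi>) \<ge> 1}"
    proof (rule O.finite_measure_mono)
      show "bad m \<subseteq> {\<xi>\<in>space ?O. ramp m (Z \<xi>) \<ge> 1}"
        using t0[of m] by (auto simp: bad_def ramp_def t_def field_simps)
    qed measurable
    also have "\<dots> \<le> integral\<^sup>L ?O (\<lambda>\<xi>. ramp m (Z \<xi>)) / 1"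
      by (intro integral_Markov_inequality_measure[where A = "{}"] O.AE_bounded_integrable[of _ 1] rm) (auto simp: ramp_def)
    finally show ?thesis using ramp_small[of m] by simp
  qed
  define good where "good m0 = space ?O - (\<Union>i. bad (i + m0))" for m0
  have good_sets [measurable]: "good m0 \<in> sets ?O" for m0 unfolding good_def by measurable
  have good_prob: "measure ?O (space ?O - good m0) \<le> 4 * (1 / 2) ^ m0" for m0
  proof -
    have "space ?O - good m0 = (\<Union>i. bad (i + m0))" using sets.sets_into_space[OF bad_sets] by (auto simp: good_def)
    moreover have "measure ?O (\<Union>i. bad (i + m0)) \<le> (\<Sum>i. measure ?O (bad (i + m0)))"
    proof (rule O.finite_measure_subadditive_countably)
      show "summable (\<lambda>i. measure ?O (bad (i + m0)))"
        by (rule summable_comparison_test'[OF sum_half_powers(1)[of 2 m0]]) (use bad in auto)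
    qed auto
    moreover have "\<dots> \<le> (\<Sum>i. 2 * (1 / 2) ^ (i + m0))"
      by (intro suminf_le bad sum_half_powers(1) summable_comparison_test'[OF sum_half_powers(1)[of 2 m0]]) (use bad in auto)
    ultimately show ?thesis unfolding sum_half_powers(2) by simp
  qed
  define Good where "Good = (\<Union>m0. good m0)"
  have Good_sets [measurable]: "Good \<in> sets ?O" unfolding Good_def by measurable
  have Good_AE: "AE \<xi> in ?O. \<xi> \<in> Good"
  proof -
    have "measure ?O (space ?O - Good) \<le> 4 * (1 / 2) ^ m0" for m0
      by (rule order_trans[OF O.finite_measure_mono good_prob]) (auto simp: Good_def)
    then have "measure ?O (space ?O - Good) \<le> 4 * 0"
      by (intro LIMSEQ_le_const[OF tendsto_mult[OF tendsto_const LIMSEQ_power_zero[of "1 / 2 :: real"]]]) auto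
    then have "space ?O - Good \<in> null_sets ?O"
      by (intro null_setsI) (auto simp: O.emeasure_eq_measure order_antisym)
    then show ?thesis by (rule AE_I') auto
  qed
  have diff: "\<bar>Z \<xi> (p m f) - Z \<xi> (p n f)\<bar> \<le> 8 * (1 / 2) ^ m" if g: "\<xi> \<in> good m0" and m: "m0 \<le> m" "m \<le> n" and f: "f \<in> H" for \<xi> m0 m n f
  proof -
    have step: "\<bar>Z \<xi> (p i f) - Z \<xi> (p (Suc i) f)\<bar> \<le> 4 * (1 / 2) ^ i" if "m0 \<le> i" for i
    proof -
      have "\<xi> \<notin> bad ((i - m0) + m0)" "\<xi> \<in> space ?O" using g by (auto simp: good_def)
      then have "D i (Z \<xi>) < 4 * (1 / 2) ^ i" using that by (simp add: bad_def)
      then show ?thesis using D_ge[OF f, of "Z \<xi>" i] by linarith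
    qed
    \<comment> \<open>The geometric sum of the steps \<open>4 * (1 / 2) ^ i\<close> is kept with its
      exact remainder, which is what lets the induction on \<open>n\<close> close.\<close>
    have "\<bar>Z \<xi> (p m f) - Z \<xi> (p n f)\<bar> \<le> 8 * (1 / 2) ^ m - 8 * (1 / 2) ^ n"
      using m(2)
    proof (induction n rule: dec_induct)
      case (step n)
      then show ?case using step m(1) \<open>\<And>i. m0 \<le> i \<Longrightarrow> \<bar>Z \<xi> (p i f) - Z \<xi> (p (Suc i) f)\<bar> \<le> 4 * (1 / 2) ^ i\<close>[of n] by simp
    qed simp
    moreover have "0 \<le> 8 * (1 / 2 :: real) ^ n" by simp
    ultimately show ?thesis by linarith
  qed
  \<comment> \<open>Off the event \<open>Good\<close> of probability 1 the zero function is used, so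
    that \<open>Y\<close> and \<open>G\<close> take values in \<open>linf H\<close>
    everywhere.\<close>
  define Y where "Y m \<xi> = (if \<xi> \<in> Good then \<psi> m (Z \<xi>) else (\<lambda>f\<in>H. 0))" for m \<xi>
  define G where "G \<xi> = (if \<xi> \<in> Good then (\<lambda>f\<in>H. lim (\<lambda>n. Z \<xi> (p n f))) else (\<lambda>f\<in>H. 0))" for \<xi>
  have G_lim: "(\<lambda>n. Z \<xi> (p n f)) \<longlonglongrightarrow> G \<xi> f" if g: "\<xi> \<in> good m0" and f: "f \<in> H" for \<xi> m0 f
  proof -
    have "Cauchy (\<lambda>n. Z \<xi> (p n f))"
    proof (rule metric_CauchyI)
      fix e :: real assume e: "e > 0"
      have "(\<lambda>m. 8 * (1 / 2 :: real) ^ m) \<longlonglongrightarrow> 8 * 0" by (intro tendsto_intros LIMSEQ_power_zero) simp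
      then have "\<forall>\<^sub>F m in sequentially. 8 * (1 / 2 :: real) ^ m < e / 2" using e by (intro order_tendstoD(2)[where y = "8 * 0"]) auto
      then obtain m where m: "m \<ge> m0" "8 * (1 / 2 :: real) ^ m < e / 2"
        unfolding eventually_sequentially by (metis max.cobounded1 max.cobounded2)
      show "\<exists>M. \<forall>i\<ge>M. \<forall>j\<ge>M. dist (Z \<xi> (p i f)) (Z \<xi> (p j f)) < e"
      proof (intro exI allI impI)
        fix i j assume "i \<ge> m" "j \<ge> m"
        then show "dist (Z \<xi> (p i f)) (Z \<xi> (p j f)) < e"
          using diff[OF g m(1) _ f, of i] diff[OF g m(1) _ f, of j] m(2) unfolding dist_real_def by linarith
      qed
    qed
    then have "convergent (\<lambda>n. Z \<xi> (p n f))" by (rule Cauchy_convergent)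
    then show ?thesis using g f by (auto simp: G_def Good_def convergent_LIMSEQ_iff)
  qed
  have G_diff: "\<bar>Z \<xi> (p m f) - G \<xi> f\<bar> \<le> 8 * (1 / 2) ^ m" if g: "\<xi> \<in> good m0" and m: "m0 \<le> m" and f: "f \<in> H" for \<xi> m0 m f
  proof (rule LIMSEQ_le_const2)
    show "(\<lambda>n. \<bar>Z \<xi> (p m f) - Z \<xi> (p n f)\<bar>) \<longlonglongrightarrow> \<bar>Z \<xi> (p m f) - G \<xi> f\<bar>"
      by (intro tendsto_intros G_lim[OF g f])
    show "\<exists>N. \<forall>n\<ge>N. \<bar>Z \<xi> (p m f) - Z \<xi> (p n f)\<bar> \<le> 8 * (1 / 2) ^ m"
      using diff[OF g m _ f] by blast
  qed
  have zero_mem: "(\<lambda>f\<in>H. 0) \<in> mspace (linf H)" unfolding mem_linf by auto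
  have G_mem: "G \<xi> \<in> mspace (linf H)" for \<xi>
  proof (cases "\<xi> \<in> Good")
    case True
    then obtain m0 where m0: "\<xi> \<in> good m0" by (auto simp: Good_def)
    have "\<bar>G \<xi> f\<bar> \<le> (\<Sum>j<k m0. \<bar>Z \<xi> j\<bar>) + 8 * (1 / 2) ^ m0" if "f \<in> H" for f
      using G_diff[OF m0 order_refl that] coord_le[OF that, of "Z \<xi>" m0 "\<lambda>_. 0"] by simp
    then show ?thesis using True unfolding mem_linf by (auto simp: G_def)
  next
    case False then show ?thesis using zero_mem by (simp add: G_def)
  qed
  have Y_mem: "Y m \<xi> \<in> mspace (linf H)" for m \<xi> using zero_mem \<psi>_mem by (simp add: Y_def)
  have Y_lim: "(\<lambda>m. mdist (linf H) (Y m \<xi>) (G \<xi>)) \<longlonglongrightarrow> 0" for \<xi>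
  proof (cases "\<xi> \<in> Good")
    case True
    then obtain m0 where m0: "\<xi> \<in> good m0" by (auto simp: Good_def)
    have "(\<lambda>m. 8 * (1 / 2 :: real) ^ m) \<longlonglongrightarrow> 8 * 0" by (intro tendsto_intros LIMSEQ_power_zero) simp
    then have "(\<lambda>m. 8 * (1 / 2 :: real) ^ m) \<longlonglongrightarrow> 0" by (simp only: mult_zero_right)
    moreover have "\<forall>\<^sub>F m in sequentially. norm (mdist (linf H) (Y m \<xi>) (G \<xi>)) \<le> 8 * (1 / 2) ^ m"
    proof (rule eventually_sequentiallyI[of m0])
      fix m assume "m0 \<le> m"
      then show "norm (mdist (linf H) (Y m \<xi>) (G \<xi>)) \<le> 8 * (1 / 2) ^ m"
        using G_diff[OF m0] True by (simp add: mdist_linf_le[OF Y_mem G_mem H]) (simp add: Y_def \<psi>_def)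
    qed
    ultimately show ?thesis by (rule Lim_null_comparison[rotated])
  next
    case False
    then have "mdist (linf H) (Y m \<xi>) (G \<xi>) = 0" for m using zero_mem by (simp add: Y_def G_def)
    then show ?thesis by simp
  qed
  have Zvec: "Z \<in> measurable ?O (PiM UNIV (\<lambda>_. borel))"
  proof -
    have "(\<lambda>\<xi>. (\<lambda>i\<in>UNIV. Z \<xi> i)) \<in> measurable ?O (PiM UNIV (\<lambda>_. borel))" by (intro measurable_restrict Zm)
    then show ?thesis by (simp add: restrict_def)
  qed
  have Y_meas: "Y m \<in> measurable ?O (borel_sigma (mtopology_of (linf H)))" for m
  proof (rule measurable_borel_sigmaI)
    fix U assume U: "openin (mtopology_of (linf H)) U"
    \<comment> \<open>The space \<open>linf H\<close> is in general not separable; measurability of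
      the step functions comes from their continuity in the product topology on coordinate
      sequences.\<close>
    have "open {x. \<psi> m x \<in> U}"
      unfolding open_subopen[of "{x. \<psi> m x \<in> U}"]
    proof (intro ballI)
      fix x assume x: "x \<in> {x. \<psi> m x \<in> U}"
      then obtain e where e: "e > 0" "Metric_space.mball (mspace (linf H)) (mdist (linf H)) (\<psi> m x) e \<subseteq> U"
        using U by (auto simp: mtopology_of_def Metric_space.openin_mtopology)
      have "open {y. (\<Sum>j<k m. \<bar>x j - y j\<bar>) < e}"
        by (intro open_Collect_less continuous_on_sum continuous_on_rabs continuous_on_diff continuous_on_const continuous_on_product_coordinates)
      moreover have "{y. (\<Sum>j<k m. \<bar>x j - y j\<bar>) < e} \<subseteq> {x. \<psi> m x \<in> U}"
      proof
        fix y assume "y \<in> {y. (\<Sum>j<k m. \<bar>x j - y j\<bar>) < e}"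
        then have "\<psi> m y \<in> Metric_space.mball (mspace (linf H)) (mdist (linf H)) (\<psi> m x) e"
          using \<psi>_lip[of m x y] \<psi>_mem by (simp add: Metric_space.in_mball)
        then show "y \<in> {x. \<psi> m x \<in> U}" using e by auto
      qed
      ultimately show "\<exists>T. open T \<and> x \<in> T \<and> T \<subseteq> {x. \<psi> m x \<in> U}"
        using e by (intro exI[of _ "{y. (\<Sum>j<k m. \<bar>x j - y j\<bar>) < e}"]) auto
    qed
    then have "{x. \<psi> m x \<in> U} \<in> sets (PiM UNIV (\<lambda>_::nat. borel :: real measure))"
      by (simp add: sets_PiM_equal_borel)
    from measurable_sets[OF Zvec this] have [measurable]: "{\<xi>\<in>space ?O. \<psi> m (Z \<xi>) \<in> U} \<in> sets ?O"
      by (simp add: vimage_def Collect_conj_eq Int_commute)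
    have "Y m -` U \<inter> space ?O = ({\<xi>\<in>space ?O. \<psi> m (Z \<xi>) \<in> U} \<inter> Good) \<union> (if (\<lambda>f\<in>H. 0) \<in> U then space ?O - Good else {})"
      by (auto simp: Y_def split: if_splits)
    then show "Y m -` U \<inter> space ?O \<in> sets ?O" by auto
  qed (simp add: Y_mem)
  have G_meas: "G \<in> measurable ?O (borel_sigma (mtopology_of (linf H)))"
    by (rule measurable_borel_sigma_limit[OF Y_meas G_mem Y_lim])
  have tight: "tight_borel_element (linf H) ?O G"
    unfolding tight_borel_element_def
  proof (intro conjI allI impI G_meas)
    fix e :: real assume e: "e > 0"
    have "(\<lambda>m. 4 * (1 / 2 :: real) ^ m) \<longlonglongrightarrow> 4 * 0" by (intro tendsto_intros LIMSEQ_power_zero) simp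
    then have "\<forall>\<^sub>F m in sequentially. 4 * (1 / 2 :: real) ^ m < e / 2" using e by (intro order_tendstoD(2)[where y = "4 * 0"]) auto
    then obtain m0 where m0: "4 * (1 / 2 :: real) ^ m0 < e / 2" unfolding eventually_sequentially by blast
    define W where "W \<xi> = (\<Sum>j<k m0. \<bar>Z \<xi> j\<bar>)" for \<xi>
    have [measurable]: "W \<in> borel_measurable ?O" unfolding W_def by measurable
    have "(\<lambda>n. measure ?O {\<xi>\<in>space ?O. W \<xi> > real n}) \<longlonglongrightarrow> measure ?O (\<Inter>n. {\<xi>\<in>space ?O. W \<xi> > real n})"
      by (intro O.finite_Lim_measure_decseq) (auto simp: decseq_def)
    also have "(\<Inter>n. {\<xi>\<in>space ?O. W \<xi> > real n}) = {}"
      using reals_Archimedean2 by (auto, meson less_asym)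
    finally have "\<forall>\<^sub>F n in sequentially. measure ?O {\<xi>\<in>space ?O. W \<xi> > real n} < e / 2"
      using e by (intro order_tendstoD(2)[where y = 0]) auto
    then obtain n where n: "measure ?O {\<xi>\<in>space ?O. W \<xi> > real n} < e / 2" unfolding eventually_sequentially by blast
    define c where "c j = 16 * (1 / 2 :: real) ^ (j + m0)" for j
    have c: "c \<longlonglongrightarrow> 0"
    proof -
      have "(\<lambda>j. (16 * (1 / 2) ^ m0) * (1 / 2 :: real) ^ j) \<longlonglongrightarrow> (16 * (1 / 2) ^ m0) * 0"
        by (intro tendsto_intros LIMSEQ_power_zero) simp
      then show ?thesis by (simp add: c_def[abs_def] power_add mult_ac)
    qed
    let ?K = "{z \<in> mspace (linf H). (\<forall>f\<in>H. \<bar>z f\<bar> \<le> real n + 8) \<and> (\<forall>j. \<forall>f\<in>H. \<bar>z f - z (r (j + m0) f)\<bar> \<le> c j)}"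
    have K: "compactin (mtopology_of (linf H)) ?K"
      by (rule compactin_linfI[OF H, where r = "\<lambda>j. r (j + m0)", OF _ _ c]) (use r in auto)
    have "closedin (mtopology_of (linf H)) ?K"
      by (rule compactin_imp_closedin[OF _ K]) (simp add: mtopology_of_def Metric_space.Hausdorff_space_mtopology)
    then have Km: "{\<xi>\<in>space ?O. G \<xi> \<in> ?K} \<in> sets ?O"
      using measurable_sets[OF G_meas sets_borel_sigma_closed, of ?K] by (simp add: vimage_def Collect_conj_eq Int_commute)
    have sub: "space ?O - ((space ?O - good m0) \<union> {\<xi>\<in>space ?O. W \<xi> > real n}) \<subseteq> {\<xi>\<in>space ?O. G \<xi> \<in> ?K}"
    proof
      fix \<xi> assume x: "\<xi> \<in> space ?O - ((space ?O - good m0) \<union> {\<xi>\<in>space ?O. W \<xi> > real n})"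
      then have g: "\<xi> \<in> good m0" and W: "W \<xi> \<le> real n" by auto
      have "\<bar>G \<xi> f\<bar> \<le> real n + 8" if f: "f \<in> H" for f
      proof -
        have "8 * (1 / 2 :: real) ^ m0 \<le> 8 * 1" by (intro mult_left_mono power_le_one) auto
        then show ?thesis
          using G_diff[OF g order_refl f] coord_le[OF f, of "Z \<xi>" m0 "\<lambda>_. 0"] W by (simp add: W_def)
      qed
      moreover have "\<bar>G \<xi> f - G \<xi> (r (j + m0) f)\<bar> \<le> c j" if f: "f \<in> H" for f j
      proof -
        \<comment> \<open>By idempotence \<open>f\<close> and its representative share the
          approximating coordinate. Both are within \<open>8 * (1 / 2) ^ (j + m0)\<close> of it,
          whence the factor 16 in \<open>c\<close>.\<close>
        have "p (j + m0) (r (j + m0) f) = p (j + m0) f" using r(3)[OF f] by (simp add: p_def)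
        then show ?thesis
          using G_diff[OF g _ f, of "j + m0"] G_diff[OF g _ rH[OF f], of "j + m0" "j + m0"] by (simp add: c_def)
      qed
      ultimately show "\<xi> \<in> {\<xi>\<in>space ?O. G \<xi> \<in> ?K}" using x G_mem by auto
    qed
    have "1 - e \<le> 1 - measure ?O ((space ?O - good m0) \<union> {\<xi>\<in>space ?O. W \<xi> > real n})"
    proof -
      have "measure ?O ((space ?O - good m0) \<union> {\<xi>\<in>space ?O. W \<xi> > real n}) \<le> measure ?O (space ?O - good m0) + measure ?O {\<xi>\<in>space ?O. W \<xi> > real n}"
        by (intro measure_Un_le) auto
      then show ?thesis using good_prob[of m0] m0 n by linarith
    qed
    also have "\<dots> = measure ?O (space ?O - ((space ?O - good m0) \<union> {\<xi>\<in>space ?O. W \<xi> > real n}))"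
      by (intro O.prob_compl[symmetric]) auto
    also have "\<dots> \<le> measure ?O {\<xi>\<in>space ?O. G \<xi> \<in> ?K}"
      by (intro O.finite_measure_mono sub Km)
    finally show "\<exists>K. compactin (mtopology_of (linf H)) K \<and> 1 - e \<le> measure ?O {\<xi>\<in>space ?O. G \<xi> \<in> K}"
      using K by blast
  qed
  have weak: "weakly_converges (linf H) P X ?O G"
  proof (rule weakly_converges_lipschitzI[OF P prob_space_std_normal_seq X_mem G_meas])
    fix h L b assume h: "lipschitz_real (linf H) L h" and b: "\<And>x. x \<in> mspace (linf H) \<Longrightarrow> \<bar>h x\<bar> \<le> b"
    have L: "L \<ge> 0" using h by (simp add: lipschitz_real_def)
    have b0: "0 \<le> b" using b[OF zero_mem] by linarith
    have hc: "continuous_map (mtopology_of (linf H)) euclideanreal h" by (rule lipschitz_real_continuous_map[OF h])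
    have lipv: "lipschitz_vec (k m) L (\<lambda>x. h (\<psi> m x))" for m
      unfolding lipschitz_vec_def
    proof (intro allI)
      fix x y
      have "\<bar>h (\<psi> m x) - h (\<psi> m y)\<bar> \<le> L * mdist (linf H) (\<psi> m x) (\<psi> m y)"
        using h \<psi>_mem by (auto simp: lipschitz_real_def)
      also have "\<dots> \<le> L * (\<Sum>j<k m. \<bar>x j - y j\<bar>)" by (intro mult_left_mono \<psi>_lip L)
      finally show "\<bar>h (\<psi> m x) - h (\<psi> m y)\<bar> \<le> L * (\<Sum>j<k m. \<bar>x j - y j\<bar>)" .
    qed
    define E where "E m N = (\<integral>\<omega>. h (\<psi> m (\<lambda>j. X N \<omega> (s j))) \<partial>P)" for m N
    define e0 where "e0 m = (\<integral>\<xi>. h (\<psi> m (Z \<xi>)) \<partial>?O)" for m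
    have lim1: "(\<lambda>N. E m N) \<longlonglongrightarrow> e0 m" for m
      unfolding E_def e0_def by (rule levy[OF lipv b[OF \<psi>_mem] L])
    have "e0 = (\<lambda>m. \<integral>\<xi>. h (Y m \<xi>) \<partial>?O)"
      unfolding e0_def
    proof (rule ext, rule integral_cong_AE)
      fix m
      show "(\<lambda>\<xi>. h (\<psi> m (Z \<xi>))) \<in> borel_measurable ?O" by (rule measurable_compose[OF Zvec lipschitz_vec_measurable[OF lipv]])
      show "(\<lambda>\<xi>. h (Y m \<xi>)) \<in> borel_measurable ?O" by (rule measurable_compose[OF Y_meas measurable_continuous_map_borel_sigma[OF hc]])
      show "AE \<xi> in ?O. h (\<psi> m (Z \<xi>)) = h (Y m \<xi>)" using Good_AE by eventually_elim (simp add: Y_def)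
    qed
    moreover have "(\<lambda>m. \<integral>\<xi>. h (Y m \<xi>) \<partial>?O) \<longlonglongrightarrow> (\<integral>\<xi>. h (G \<xi>) \<partial>?O)"
    proof (rule integral_dominated_convergence[where w = "\<lambda>_. b"])
      show "(\<lambda>\<xi>. h (G \<xi>)) \<in> borel_measurable ?O" by (rule measurable_compose[OF G_meas measurable_continuous_map_borel_sigma[OF hc]])
      show "(\<lambda>\<xi>. h (Y m \<xi>)) \<in> borel_measurable ?O" for m by (rule measurable_compose[OF Y_meas measurable_continuous_map_borel_sigma[OF hc]])
      show "AE \<xi> in ?O. (\<lambda>m. h (Y m \<xi>)) \<longlonglongrightarrow> h (G \<xi>)"
      proof (rule AE_I2, rule Lim_null[THEN iffD2], rule Lim_null_comparison[OF always_eventually[OF allI]])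
        fix \<xi>
        show "(\<lambda>m. L * mdist (linf H) (Y m \<xi>) (G \<xi>)) \<longlonglongrightarrow> 0" using tendsto_mult[OF tendsto_const Y_lim, of L \<xi>] by simp
        show "norm (h (Y m \<xi>) - h (G \<xi>)) \<le> L * mdist (linf H) (Y m \<xi>) (G \<xi>)" for m
          using h Y_mem G_mem by (auto simp: lipschitz_real_def)
      qed
    qed (use b Y_mem in auto)
    ultimately have lim2: "e0 \<longlonglongrightarrow> (\<integral>\<xi>. h (G \<xi>) \<partial>?O)" by simp
    \<comment> \<open>The loss in \<open>outer_expectation_perturb\<close> when the functions differ
      by at most \<open>L * (1 / 2) ^ m\<close> off an event of outer probability (1/2)^m.\<close>
    define c where "c m = L * (1 / 2) ^ m + (2 * b + L * (1 / 2) ^ m) * (1 / 2) ^ m" for m :: nat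
    have close: "\<forall>\<^sub>F N in sequentially. \<bar>outer_expectation P (\<lambda>\<omega>. h (X N \<omega>)) - E m N\<bar> \<le> c m" for m
      using small[of m]
    proof eventually_elim
      case (elim N)
      have Em: "(\<lambda>\<omega>. h (\<psi> m (\<lambda>j. X N \<omega> (s j)))) \<in> borel_measurable P"
      proof -
        have "(\<lambda>\<omega>. (\<lambda>i\<in>UNIV. X N \<omega> (s i))) \<in> measurable P (PiM UNIV (\<lambda>_. borel))"
          by (intro measurable_restrict X_meas sH)
        from measurable_compose[OF this lipschitz_vec_measurable[OF lipv[of m]]]
        show ?thesis by (simp add: restrict_def)
      qed
      have EE: "E m N = outer_expectation P (\<lambda>\<omega>. h (\<psi> m (\<lambda>j. X N \<omega> (s j))))"
        unfolding E_def
        by (intro P.outer_expectation_eq_integral[symmetric, of _ b] P.AE_bounded_integrable[of _ b] Em) (use b[OF \<psi>_mem] in auto)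
      have near: "\<bar>h (X N \<omega>) - h (\<psi> m (\<lambda>j. X N \<omega> (s j)))\<bar> \<le> L * (1 / 2) ^ m"
        if w: "\<omega> \<in> space P" "\<omega> \<notin> {\<omega>. (1 / 2) ^ m < osc H (r m) (X N \<omega>)}" for \<omega>
      proof -
        have "\<bar>X N \<omega> f - X N \<omega> (r m f)\<bar> \<le> (1 / 2) ^ m" if "f \<in> H" for f
          using le_osc[OF r(1) X_mem[OF w(1)] that, of N m] w(2) by auto
        then have "mdist (linf H) (X N \<omega>) (\<psi> m (\<lambda>j. X N \<omega> (s j))) \<le> (1 / 2) ^ m"
          unfolding mdist_linf_le[OF X_mem[OF w(1)] \<psi>_mem H] by (simp add: \<psi>_def sp)
        then have "L * mdist (linf H) (X N \<omega>) (\<psi> m (\<lambda>j. X N \<omega> (s j))) \<le> L * (1 / 2) ^ m"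
          by (intro mult_left_mono L)
        moreover have "\<bar>h (X N \<omega>) - h (\<psi> m (\<lambda>j. X N \<omega> (s j)))\<bar> \<le> L * mdist (linf H) (X N \<omega>) (\<psi> m (\<lambda>j. X N \<omega> (s j)))"
          using h X_mem[OF w(1)] \<psi>_mem by (auto simp: lipschitz_real_def)
        ultimately show ?thesis by linarith
      qed
      have "outer_expectation P (\<lambda>\<omega>. h (X N \<omega>)) \<le> outer_expectation P (\<lambda>\<omega>. h (\<psi> m (\<lambda>j. X N \<omega> (s j)))) + L * (1 / 2) ^ m + (2 * b + \<bar>L * (1 / 2) ^ m\<bar>) * (1 / 2) ^ m"
        by (rule P.outer_expectation_perturb[OF _ _ elim]) (use b X_mem \<psi>_mem near in \<open>force simp: abs_le_iff\<close>)+
      moreover have "outer_expectation P (\<lambda>\<omega>. h (\<psi> m (\<lambda>j. X N \<omega> (s j)))) \<le> outer_expectation P (\<lambda>\<omega>. h (X N \<omega>)) + L * (1 / 2) ^ m + (2 * b + \<bar>L * (1 / 2) ^ m\<bar>) * (1 / 2) ^ m"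
        by (rule P.outer_expectation_perturb[OF _ _ elim]) (use b X_mem \<psi>_mem near in \<open>force simp: abs_le_iff\<close>)+
      moreover have "\<bar>L * (1 / 2) ^ m\<bar> = L * (1 / 2) ^ m" using L by simp
      ultimately show ?case unfolding EE c_def by linarith
    qed
    have climit: "c \<longlonglongrightarrow> 0"
    proof -
      have q: "(\<lambda>m. (1 / 2 :: real) ^ m) \<longlonglongrightarrow> 0" by (rule LIMSEQ_power_zero) simp
      have "c \<longlonglongrightarrow> L * 0 + (2 * b + L * 0) * 0" unfolding c_def by (intro tendsto_intros q)
      then show ?thesis by simp
    qed
    show "(\<lambda>N. outer_expectation P (\<lambda>\<omega>. h (X N \<omega>))) \<longlonglongrightarrow> (\<integral>\<xi>. h (G \<xi>) \<partial>?O)"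
    proof (rule tendstoI)
      fix e :: real assume e: "e > 0"
      have "\<forall>\<^sub>F m in sequentially. dist (e0 m) (\<integral>\<xi>. h (G \<xi>) \<partial>?O) < e / 3 \<and> dist (c m) 0 < e / 3"
        using e by (intro eventually_conj tendstoD[OF lim2] tendstoD[OF climit]) auto
      then obtain m where m: "dist (e0 m) (\<integral>\<xi>. h (G \<xi>) \<partial>?O) < e / 3" "dist (c m) 0 < e / 3"
        unfolding eventually_sequentially by blast
      have "\<forall>\<^sub>F N in sequentially. dist (E m N) (e0 m) < e / 3" using e by (intro tendstoD[OF lim1]) auto
      with close[of m] show "\<forall>\<^sub>F N in sequentially. dist (outer_expectation P (\<lambda>\<omega>. h (X N \<omega>))) (\<integral>\<xi>. h (G \<xi>) \<partial>?O) < e"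
      proof eventually_elim
        case (elim N)
        then show ?case using m unfolding dist_real_def by linarith
      qed
    qed
  qed
  \<comment> \<open>Passing to the image law puts the limit on a probability space over the function
    type, with the identity as the random element.\<close>
  define M where "M = distr ?O (borel_sigma (mtopology_of (linf H))) G"
  have "prob_space M" unfolding M_def by (rule O.prob_space_distr[OF G_meas])
  moreover have "tight_borel_element (linf H) M (\<lambda>z. z)"
    unfolding tight_borel_element_def
  proof (intro conjI allI impI)
    show "(\<lambda>z. z) \<in> measurable M (borel_sigma (mtopology_of (linf H)))" unfolding M_def by simp
    fix e :: real assume "e > 0"
    then obtain K where K: "compactin (mtopology_of (linf H)) K" "1 - e \<le> measure ?O {v\<in>space ?O. G v \<in> K}"
      using tight unfolding tight_borel_element_def by blast
    have "closedin (mtopology_of (linf H)) K"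
      by (rule compactin_imp_closedin[OF _ K(1)]) (simp add: mtopology_of_def Metric_space.Hausdorff_space_mtopology)
    then have Ks: "K \<in> sets (borel_sigma (mtopology_of (linf H)))" by (rule sets_borel_sigma_closed)
    have "{v\<in>space M. v \<in> K} = K" using compactin_subset_topspace[OF K(1)] by (auto simp: M_def)
    then have "measure M {v\<in>space M. v \<in> K} = measure ?O (G -` K \<inter> space ?O)"
      using measure_distr[OF G_meas Ks] by (simp add: M_def)
    also have "G -` K \<inter> space ?O = {v\<in>space ?O. G v \<in> K}" by auto
    finally show "\<exists>K. compactin (mtopology_of (linf H)) K \<and> 1 - e \<le> measure M {v\<in>space M. v \<in> K}" using K by auto
  qed
  moreover have "weakly_converges (linf H) P X M (\<lambda>z. z)"
    unfolding weakly_converges_def M_def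
  proof (intro allI impI)
    fix h assume h: "continuous_map (mtopology_of (linf H)) euclideanreal h \<and> bounded (h ` mspace (linf H))"
    have "integral\<^sup>L (distr ?O (borel_sigma (mtopology_of (linf H))) G) h = (\<integral>\<xi>. h (G \<xi>) \<partial>?O)"
      using h by (intro integral_distr[OF G_meas] measurable_continuous_map_borel_sigma) auto
    then show "(\<lambda>N. outer_expectation P (\<lambda>\<omega>. h (X N \<omega>))) \<longlonglongrightarrow> integral\<^sup>L (distr ?O (borel_sigma (mtopology_of (linf H))) G) h"
      using weak h unfolding weakly_converges_def by simp
  qed
  ultimately show ?thesis by blast
qed

subsection \<open>Consequences of the Donsker property\<close>

lemma tight_borel_elementE:
  assumes "tight_borel_element m M G" "e > 0"
  obtains K where "compactin (mtopology_of m) K" "measure M {v\<in>space M. G v \<in> K} \<ge> 1 - e"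
  using assms unfolding tight_borel_element_def by blast

lemma donskerE:
  fixes Q :: "'z measure"
  assumes "donsker Q H"
  obtains M :: "(('z \<Rightarrow> real) \<Rightarrow> real) measure" and G where "prob_space M" "tight_borel_element (linf H) M G"
    "weakly_converges (linf H) (PiM UNIV (\<lambda>_. Q)) (empirical_process Q H) M G"
  using assms unfolding donsker_def by (elim conjE exE)

lemma donsker_bdd: "donsker Q H \<Longrightarrow> z \<in> space Q \<Longrightarrow> bdd_above ((\<lambda>f. \<bar>f z - integral\<^sup>L Q f\<bar>) ` H)"
  by (simp add: donsker_def)

text \<open>A portmanteau inequality with the ramp as test function. The compact set misses only
  \<open>\<eta> / 2\<close>, which leaves the strict inequality that survives for large
  \<open>N\<close>.\<close>

lemma weakly_converges_outer_small:
  assumes P: "prob_space P" and M: "prob_space M" and Z: "\<And>N \<omega>. \<omega> \<in> space P \<Longrightarrow> Z N \<omega> \<in> mspace m"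
    and weak: "weakly_converges m P Z M G" and tight: "tight_borel_element m M G"
    and w: "lipschitz_real m C w" and K: "compactin (mtopology_of m) K" "measure M {v\<in>space M. G v \<in> K} \<ge> 1 - \<eta> / 2"
    and le: "\<And>z. z \<in> K \<Longrightarrow> w z \<le> a" and a: "a > 0" and \<eta>: "\<eta> > 0"
  shows "\<forall>\<^sub>F N in sequentially. outer_small P {\<omega>. w (Z N \<omega>) \<ge> 2 * a} \<eta>"
proof -
  interpret P: prob_space P by fact
  interpret M: prob_space M by fact
  have G: "G \<in> measurable M (borel_sigma (mtopology_of m))" using tight by (simp add: tight_borel_element_def)
  define h where "h z = min 1 (max 0 (w z / a - 1))" for z
  have h: "continuous_map (mtopology_of m) euclideanreal h"
    unfolding h_def by (rule lipschitz_real_continuous_map[OF lipschitz_ramp[OF w a]])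
  have hb: "0 \<le> h z" "h z \<le> 1" for z by (auto simp: h_def)
  have "closedin (mtopology_of m) K"
    by (rule compactin_imp_closedin[OF _ K(1)]) (simp add: mtopology_of_def Metric_space.Hausdorff_space_mtopology)
  then have Km: "{v\<in>space M. G v \<in> K} \<in> sets M"
    using measurable_sets[OF G sets_borel_sigma_closed] by (simp add: vimage_def Collect_conj_eq Int_commute)
  have "outer_small M (space M - {v\<in>space M. G v \<in> K}) (\<eta> / 2)"
    by (rule outer_smallI[of "space M - {v\<in>space M. G v \<in> K}"]) (use Km K(2) M.prob_compl[OF Km] in auto)
  then have "(\<integral>v. h (G v) \<partial>M) \<le> \<eta> / 2"
  proof (rule M.outer_small_integral_le[rotated 2])
    show "(\<lambda>v. h (G v)) \<in> borel_measurable M"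
      by (rule measurable_compose[OF G measurable_continuous_map_borel_sigma[OF h]])
    fix v assume v: "v \<in> space M" "v \<notin> space M - {v\<in>space M. G v \<in> K}"
    then have "w (G v) \<le> a" using le by auto
    then show "h (G v) \<le> 0" using a by (simp add: h_def)
  qed (use hb in auto)
  then have lt: "(\<integral>v. h (G v) \<partial>M) < \<eta>" using \<eta> by linarith
  have "bounded (h ` mspace m)" using hb by (auto simp: bounded_iff intro!: exI[of _ 1])
  then have "(\<lambda>N. outer_expectation P (\<lambda>\<omega>. h (Z N \<omega>))) \<longlonglongrightarrow> (\<integral>v. h (G v) \<partial>M)"
    using weak h unfolding weakly_converges_def by blast
  from order_tendstoD(2)[OF this lt] show ?thesis
  proof eventually_elim
    case (elim N)
    have "outer_small P {\<omega>. h (Z N \<omega>) \<ge> 1} \<eta>"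
      using hb elim by (intro P.outer_small_of_outer_expectation) auto
    then show ?case
      by (rule outer_small_mono) (use a in \<open>auto simp: h_def field_simps\<close>)
  qed
qed

lemma empirical_process_mem:
  assumes b: "\<And>z. z \<in> space Q \<Longrightarrow> bdd_above ((\<lambda>f. \<bar>f z - integral\<^sup>L Q f\<bar>) ` H)"
    and z: "z \<in> space (PiM UNIV (\<lambda>_. Q))"
  shows "empirical_process Q H n z \<in> mspace (linf H)"
proof -
  have "\<forall>i. \<exists>B. \<forall>f\<in>H. \<bar>f (z i) - integral\<^sup>L Q f\<bar> \<le> B"
    using b z by (auto simp: space_PiM bdd_above_def PiE_iff)
  then obtain B where B: "\<And>i f. f \<in> H \<Longrightarrow> \<bar>f (z i) - integral\<^sup>L Q f\<bar> \<le> B i" by metis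
  have "\<bar>1 / sqrt n * (\<Sum>i<n. f (z i) - integral\<^sup>L Q f)\<bar> \<le> 1 / sqrt n * (\<Sum>i<n. B i)" if "f \<in> H" for f
  proof -
    have "\<bar>\<Sum>i<n. f (z i) - integral\<^sup>L Q f\<bar> \<le> (\<Sum>i<n. B i)"
      by (rule order_trans[OF sum_abs]) (intro sum_mono B that)
    then show ?thesis unfolding abs_mult by (intro mult_mono) auto
  qed
  then show ?thesis unfolding mem_linf empirical_process_def by auto
qed

text \<open>An injective selection of coordinates of an i.i.d. sequence has the same product
  law.\<close>

lemma outer_small_reindex:
  assumes Q: "prob_space Q" and \<sigma>: "inj \<sigma>" and A: "outer_small (PiM UNIV (\<lambda>_. Q)) A \<eta>"
  shows "outer_small (PiM UNIV (\<lambda>_::nat. Q)) {z. (\<lambda>n::nat. z (\<sigma> n)) \<in> A} \<eta>"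
proof (rule outer_small_vimage[OF _ _ A])
  show "(\<lambda>z n. z (\<sigma> n)) \<in> measurable (PiM UNIV (\<lambda>_. Q)) (PiM UNIV (\<lambda>_. Q))"
    by (rule measurable_PiM_single') (auto simp: space_PiM)
  show "distr (PiM UNIV (\<lambda>_. Q)) (PiM UNIV (\<lambda>_. Q)) (\<lambda>z n. z (\<sigma> n)) = PiM UNIV (\<lambda>_. Q)"
    using distr_PiM_reindex[of UNIV "\<lambda>_. Q" \<sigma> UNIV] Q \<sigma> by (simp add: restrict_def)
qed

lemma donsker_osc:
  assumes Q: "prob_space Q" and d: "donsker Q H" and H: "H \<noteq> {}"
    and mean: "bdd_above ((\<lambda>f. \<bar>integral\<^sup>L Q f\<bar>) ` H)" and t: "t > 0" and \<eta>: "\<eta> > 0" and \<tau>: "\<tau> > 0"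
  shows "\<exists>r. finite (r ` H) \<and> r ` H \<subseteq> H \<and> (\<forall>f\<in>H. r (r f) = r f) \<and>
    (\<forall>f\<in>H. \<bar>integral\<^sup>L Q f - integral\<^sup>L Q (r f)\<bar> \<le> \<tau>) \<and>
    (\<forall>\<^sub>F n in sequentially. outer_small (PiM UNIV (\<lambda>_. Q)) {z. osc H r (empirical_process Q H n z) \<ge> t} \<eta>)"
proof -
  let ?P = "PiM UNIV (\<lambda>_::nat. Q)"
  obtain M :: "(('a \<Rightarrow> real) \<Rightarrow> real) measure" and G where M: "prob_space M" "tight_borel_element (linf H) M G"
      "weakly_converges (linf H) ?P (empirical_process Q H) M G"
    using d by (rule donskerE)
  note b = donsker_bdd[OF d]
  obtain K where K: "compactin (mtopology_of (linf H)) K" "measure M {v\<in>space M. G v \<in> K} \<ge> 1 - \<eta> / 2"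
    using \<eta> by (elim tight_borel_elementE[OF M(2), of "\<eta> / 2", rotated]) simp
  \<comment> \<open>Adding the mean function to the compact set makes a single partition control
    both the oscillation of the process and that of the means.\<close>
  define \<mu> where "\<mu> = (\<lambda>f\<in>H. integral\<^sup>L Q f)"
  have "\<mu> \<in> mspace (linf H)" using mean unfolding mem_linf \<mu>_def by (auto simp: bdd_above_def)
  then have cc: "compactin (mtopology_of (linf H)) ({\<mu>} \<union> K)"
    using K(1) by (intro compactin_Un) auto
  have pos: "min \<tau> (t / 2) > 0" using t \<tau> by simp
  obtain r where r0: "finite (r ` H) \<and> r ` H \<subseteq> H \<and> (\<forall>f\<in>H. r (r f) = r f) \<and>
      (\<forall>z\<in>{\<mu>} \<union> K. \<forall>f\<in>H. \<bar>z f - z (r f)\<bar> \<le> min \<tau> (t / 2))"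
    using compactin_linf_finite_reps[OF cc pos] ..
  have r: "finite (r ` H)" "r ` H \<subseteq> H" "\<And>f. f \<in> H \<Longrightarrow> r (r f) = r f"
    and r4: "\<And>z f. z \<in> {\<mu>} \<union> K \<Longrightarrow> f \<in> H \<Longrightarrow> \<bar>z f - z (r f)\<bar> \<le> min \<tau> (t / 2)"
    using r0 by (simp_all del: Un_insert_left)
  have "\<bar>integral\<^sup>L Q f - integral\<^sup>L Q (r f)\<bar> \<le> \<tau>" if "f \<in> H" for f
    using r4[of \<mu> f] r(2) that by (auto simp: \<mu>_def)
  moreover have "\<forall>\<^sub>F n in sequentially. outer_small ?P {z. osc H r (empirical_process Q H n z) \<ge> 2 * (t / 2)} \<eta>"
  proof (rule weakly_converges_outer_small[OF _ M(1) _ M(3,2) osc_lipschitz[OF r(2) H] K])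
    show "osc H r z \<le> t / 2" if "z \<in> K" for z
      by (rule osc_le[OF H]) (use r4[of z] that in auto)
  qed (use t \<eta> Q empirical_process_mem[OF b] in \<open>auto intro: prob_space_PiM\<close>)
  ultimately show ?thesis using r by (intro exI[of _ r]) auto
qed

text \<open>One centred observation is the difference of two consecutive empirical sums, and both
  normalized processes are bounded outside a small event. Transposing coordinates carries the bound
  from index \<open>n\<close> to every \<open>i\<close>.\<close>

lemma donsker_envelope:
  assumes Q: "prob_space Q" and d: "donsker Q H" and H: "H \<noteq> {}" and \<eta>: "\<eta> > 0"
  shows "\<exists>K. \<forall>i. outer_small (PiM UNIV (\<lambda>_::nat. Q)) {z. \<exists>f\<in>H. \<bar>f (z i) - integral\<^sup>L Q f\<bar> > K} \<eta>"
proof -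
  let ?P = "PiM UNIV (\<lambda>_::nat. Q)"
  interpret P: prob_space ?P using Q by (intro prob_space_PiM)
  obtain M :: "(('a \<Rightarrow> real) \<Rightarrow> real) measure" and G where M: "prob_space M" "tight_borel_element (linf H) M G"
      "weakly_converges (linf H) ?P (empirical_process Q H) M G"
    using d by (rule donskerE)
  note b = donsker_bdd[OF d]
  have mem: "empirical_process Q H n z \<in> mspace (linf H)" if "z \<in> space ?P" for n z
    by (rule empirical_process_mem[OF b that])
  obtain K where K: "compactin (mtopology_of (linf H)) K" "measure M {v\<in>space M. G v \<in> K} \<ge> 1 - \<eta> / 2 / 2"
    using \<eta> by (elim tight_borel_elementE[OF M(2), of "\<eta> / 2 / 2", rotated]) simp
  interpret L: Metric_space "mspace (linf H)" "mdist (linf H)" by simp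
  define z0 where "z0 = (\<lambda>f\<in>H. 0 :: real)"
  have z0: "z0 \<in> mspace (linf H)" unfolding mem_linf z0_def by auto
  have "L.mbounded K" using K(1) by (intro L.compactin_imp_mbounded) (simp add: mtopology_of_def)
  then have "L.mbounded (insert z0 K)" using z0 by (simp add: L.mbounded_insert)
  then obtain a where a: "a > 0" "\<And>z. z \<in> K \<Longrightarrow> mdist (linf H) z z0 \<le> a"
    unfolding L.mbounded_alt_pos by (metis insertI1 insertI2)
  have w: "lipschitz_real (linf H) 1 (\<lambda>z. mdist (linf H) z z0)"
    unfolding lipschitz_real_def
  proof (intro conjI ballI)
    fix x y assume "x \<in> mspace (linf H)" "y \<in> mspace (linf H)"
    then show "\<bar>mdist (linf H) x z0 - mdist (linf H) y z0\<bar> \<le> 1 * mdist (linf H) x y"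
      using L.triangle[of x y z0] L.triangle[of y x z0] z0 L.commute[of x y] by (simp add: abs_le_iff)
  qed simp
  have "\<forall>\<^sub>F n in sequentially. outer_small ?P {z. mdist (linf H) (empirical_process Q H n z) z0 \<ge> 2 * a} (\<eta> / 2)"
    by (rule weakly_converges_outer_small[OF P.prob_space_axioms M(1) mem M(3,2) w K a(2,1)]) (use \<eta> in auto)
  then obtain n where n: "\<And>k. k \<ge> n \<Longrightarrow> outer_small ?P {z. mdist (linf H) (empirical_process Q H k z) z0 \<ge> 2 * a} (\<eta> / 2)"
    unfolding eventually_sequentially by blast
  define K' where "K' = 2 * a * sqrt (n + 1) + 2 * a * sqrt n"
  have base: "outer_small ?P {z. \<exists>f\<in>H. \<bar>f (z n) - integral\<^sup>L Q f\<bar> > K'} \<eta>"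
  proof (rule outer_small_mono[OF P.outer_small_Un[OF n[of n] n[of "Suc n"]]])
    fix z assume z: "z \<in> space ?P" "z \<in> {z. \<exists>f\<in>H. \<bar>f (z n) - integral\<^sup>L Q f\<bar> > K'}"
    then obtain f where f: "f \<in> H" "\<bar>f (z n) - integral\<^sup>L Q f\<bar> > K'" by blast
    have s: "(\<Sum>i<k. f (z i) - integral\<^sup>L Q f) = sqrt k * empirical_process Q H k z f" for k
      using f(1) by (cases "k = 0") (auto simp: empirical_process_def)
    have e1: "f (z n) - integral\<^sup>L Q f = sqrt (Suc n) * empirical_process Q H (Suc n) z f - sqrt n * empirical_process Q H n z f"
      unfolding s[symmetric] by simp
    have bd: "\<bar>sqrt k * empirical_process Q H k z f\<bar> \<le> sqrt k * (2 * a)" if "mdist (linf H) (empirical_process Q H k z) z0 < 2 * a" for k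
    proof -
      have "\<bar>empirical_process Q H k z f - z0 f\<bar> \<le> 2 * a"
        using abs_le_mdist_linf[OF mem[OF z(1), of k] z0 f(1)] that by linarith
      then show ?thesis using f(1) by (simp add: z0_def abs_mult mult_left_mono)
    qed
    show "z \<in> {z. mdist (linf H) (empirical_process Q H n z) z0 \<ge> 2 * a} \<union> {z. mdist (linf H) (empirical_process Q H (Suc n) z) z0 \<ge> 2 * a}"
    proof (rule ccontr)
      assume "z \<notin> {z. mdist (linf H) (empirical_process Q H n z) z0 \<ge> 2 * a} \<union> {z. mdist (linf H) (empirical_process Q H (Suc n) z) z0 \<ge> 2 * a}"
      then have "mdist (linf H) (empirical_process Q H n z) z0 < 2 * a" "mdist (linf H) (empirical_process Q H (Suc n) z) z0 < 2 * a" by auto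
      then have "\<bar>sqrt n * empirical_process Q H n z f\<bar> \<le> sqrt n * (2 * a)"
         "\<bar>sqrt (Suc n) * empirical_process Q H (Suc n) z f\<bar> \<le> sqrt (Suc n) * (2 * a)"
        using bd by blast+
      moreover have "K' = sqrt (Suc n) * (2 * a) + sqrt n * (2 * a)" by (simp add: K'_def)
      ultimately show False using f(2) e1 by linarith
    qed
  qed (use \<eta> in auto)
  have "outer_small ?P {z. \<exists>f\<in>H. \<bar>f (z i) - integral\<^sup>L Q f\<bar> > K'} \<eta>" for i
    using outer_small_reindex[OF Q inj_transpose[of i n] base] by simp
  then show ?thesis by blast
qed

section \<open>Finite second moments from weak convergence\<close>

lemma integral_PiM_iexp_sum:
  assumes Q: "prob_space Q" and g: "g \<in> borel_measurable Q"
  shows "(\<integral>z. iexp (\<Sum>i<n. c i * g (z i)) \<partial>PiM UNIV (\<lambda>_::nat. Q)) = (\<Prod>i<n. \<integral>x. iexp (c i * g x) \<partial>Q)"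
proof -
  interpret Q: prob_space Q by fact
  interpret product_prob_space "\<lambda>_::nat. Q" UNIV ..
  note [measurable] = g
  have "(\<integral>z. iexp (\<Sum>i<n. c i * g (z i)) \<partial>PiM UNIV (\<lambda>_::nat. Q)) =
      (\<integral>z. iexp (\<Sum>i<n. c i * g (restrict z {..<n} i)) \<partial>PiM UNIV (\<lambda>_::nat. Q))" by simp
  also have "\<dots> = (\<integral>z. iexp (\<Sum>i<n. c i * g (z i)) \<partial>distr (PiM UNIV (\<lambda>_::nat. Q)) (PiM {..<n} (\<lambda>_. Q)) (\<lambda>z. restrict z {..<n}))"
    by (subst integral_distr) auto
  also have "distr (PiM UNIV (\<lambda>_::nat. Q)) (PiM {..<n} (\<lambda>_. Q)) (\<lambda>z. restrict z {..<n}) = PiM {..<n} (\<lambda>_. Q)"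
    by (rule distr_PiM_restrict_finite) auto
  also have "(\<integral>z. iexp (\<Sum>i<n. c i * g (z i)) \<partial>PiM {..<n} (\<lambda>_. Q)) = (\<integral>z. (\<Prod>i<n. iexp (c i * g (z i))) \<partial>PiM {..<n} (\<lambda>_. Q))"
    by (simp only: iexp_sum finite_lessThan)
  also have "\<dots> = (\<Prod>i<n. \<integral>x. iexp (c i * g x) \<partial>Q)"
    by (intro product_integral_prod Q.integrable_iexp) auto
  finally show ?thesis .
qed

text \<open>The quarter in place of the half absorbs the fourth-order remainder, which is at most
  x^2 / 24 on the unit interval.\<close>

lemma one_minus_cos_ge: "\<bar>x\<bar> \<le> 1 \<Longrightarrow> x\<^sup>2 / 4 \<le> 1 - cos (x :: real)"
proof -
  assume x: "\<bar>x\<bar> \<le> 1"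
  have "cmod (iexp x - (\<Sum>k\<le>3. (\<i> * x) ^ k / fact k)) \<le> \<bar>x\<bar> ^ 4 / fact 4"
    using iexp_approx1[of x 3] by simp
  then have "\<bar>Re (iexp x - (\<Sum>k\<le>3. (\<i> * x) ^ k / fact k))\<bar> \<le> \<bar>x\<bar> ^ 4 / fact 4"
    by (rule order_trans[OF abs_Re_le_cmod])
  also have "(fact 4 :: real) = 24" by (simp add: fact_numeral)
  finally have "\<bar>Re (iexp x - (\<Sum>k\<le>3. (\<i> * x) ^ k / fact k))\<bar> \<le> \<bar>x\<bar> ^ 4 / 24" .
  moreover have "Re (iexp x - (\<Sum>k\<le>3. (\<i> * x) ^ k / fact k)) = cos x - (1 - x\<^sup>2 / 2)"
    by (simp add: Re_exp numeral_3_eq_3 power2_eq_square)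
  ultimately have "1 - cos x \<ge> x\<^sup>2 / 2 - \<bar>x\<bar> ^ 4 / 24" by linarith
  moreover have "\<bar>x\<bar> ^ 4 \<le> x\<^sup>2"
    using power_decreasing[of 2 4 "\<bar>x\<bar>"] x by simp
  moreover have "0 \<le> x\<^sup>2" by simp
  ultimately show ?thesis by linarith
qed

text \<open>The converse of the central limit theorem: symmetrize and apply Fatou's lemma.\<close>

lemma square_integrable_of_char_limit:
  assumes Q: "prob_space Q" and g [measurable]: "g \<in> borel_measurable Q"
    and M: "prob_space M" and Y [measurable]: "Y \<in> borel_measurable M"
    and lim: "\<And>t. (\<lambda>n. \<integral>z. iexp (t * (1 / sqrt n * (\<Sum>i<n. g (z i)))) \<partial>PiM UNIV (\<lambda>_::nat. Q)) \<longlonglongrightarrow> (\<integral>v. iexp (t * Y v) \<partial>M)"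
  shows "integrable Q (\<lambda>x. (g x)\<^sup>2)"
proof -
  interpret Q: prob_space Q by fact
  interpret M: prob_space M by fact
  interpret QQ: pair_prob_space Q Q ..
  define \<psi> where "\<psi> s = (\<integral>x. iexp (s * g x) \<partial>Q)" for s
  define \<phi> where "\<phi> t = (\<integral>v. iexp (t * Y v) \<partial>M)" for t
  have lim': "(\<lambda>n. \<psi> (t / sqrt n) ^ n) \<longlonglongrightarrow> \<phi> t" for t
  proof -
    have "(\<integral>z. iexp (t * (1 / sqrt n * (\<Sum>i<n. g (z i)))) \<partial>PiM UNIV (\<lambda>_::nat. Q)) = \<psi> (t / sqrt n) ^ n" for n
    proof -
      have "t * (1 / sqrt n * (\<Sum>i<n. g (z i))) = (\<Sum>i<n. t / sqrt n * g (z i))" for z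
        by (simp add: sum_distrib_left)
      then show ?thesis by (simp only: integral_PiM_iexp_sum[OF Q g]) (simp add: \<psi>_def)
    qed
    then show ?thesis using lim[of t] by (simp add: \<phi>_def)
  qed
  have \<phi>c: "\<phi> t = char (distr M borel Y) t" for t
    unfolding \<phi>_def char_def by (subst integral_distr) auto
  interpret RD: real_distribution "distr M borel Y" by (rule M.real_distribution_distr) measurable
  have "isCont \<phi> 0" using RD.isCont_char[of 0] \<phi>c[abs_def] by simp
  then have "((\<lambda>t. cmod (\<phi> t)) \<longlongrightarrow> cmod (\<phi> 0)) (at 0)"
    unfolding isCont_def by (rule tendsto_norm)
  moreover have "\<phi> 0 = 1" by (simp add: \<phi>_def M.prob_space)
  ultimately have "\<forall>\<^sub>F t in at 0. cmod (\<phi> t) > 1 / 2" by (intro order_tendstoD(1)[where y = 1]) auto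
  then obtain d where d: "d > 0" "\<And>t. t \<noteq> 0 \<Longrightarrow> \<bar>t\<bar> < d \<Longrightarrow> cmod (\<phi> t) > 1 / 2"
    unfolding eventually_at by (auto simp: dist_real_def)
  define t where "t = d / 2"
  have t: "t > 0" "cmod (\<phi> t) > 1 / 2" using d by (auto simp: t_def)
  have "\<forall>\<^sub>F n in sequentially. cmod (\<psi> (t / sqrt n) ^ n) > 1 / 2"
    by (rule order_tendstoD(1)[OF tendsto_norm[OF lim'] t(2)])
  \<comment> \<open>Write \<open>u\<close> for the squared modulus: \<open>u ^ n >= 1 / 4\<close>
    and \<open>u <= exp (u - 1)\<close> together bound \<open>n * (1 - u)\<close> by ln 4.\<close>
  then have ev: "\<forall>\<^sub>F n in sequentially. n * (1 - (cmod (\<psi> (t / sqrt n)))\<^sup>2) \<le> ln 4"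
  proof (rule eventually_mono)
    fix n :: nat assume n: "cmod (\<psi> (t / sqrt n) ^ n) > 1 / 2"
    define u where "u = (cmod (\<psi> (t / sqrt n)))\<^sup>2"
    have "u ^ n = (cmod (\<psi> (t / sqrt n) ^ n))\<^sup>2" by (simp add: u_def norm_power mult.commute flip: power_mult)
    moreover have "(1 / 2)\<^sup>2 \<le> (cmod (\<psi> (t / sqrt n) ^ n))\<^sup>2" using n by (intro power_mono) auto
    ultimately have "1 / 4 \<le> u ^ n" by (simp add: power2_eq_square)
    also have "u ^ n \<le> exp (u - 1) ^ n"
      using exp_ge_add_one_self[of "u - 1"] by (intro power_mono) (auto simp: u_def)
    also have "\<dots> = exp (n * (u - 1))" by (simp add: exp_of_nat_mult)
    finally have "ln (1 / 4) \<le> ln (exp (real n * (u - 1)))" by (subst ln_le_cancel_iff) auto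
    then show "n * (1 - (cmod (\<psi> (t / sqrt n)))\<^sup>2) \<le> ln 4" by (simp add: u_def ln_div algebra_simps)
  qed
  \<comment> \<open>The squared modulus is the characteristic function of the difference of two
    independent copies, which is real.\<close>
  have sym: "1 - (cmod (\<psi> s))\<^sup>2 = (\<integral>p. 1 - cos (s * (g (fst p) - g (snd p))) \<partial>(Q \<Otimes>\<^sub>M Q))" for s
  proof -
    have i: "integrable (Q \<Otimes>\<^sub>M Q) (\<lambda>(x, y). iexp (s * g x) * iexp (- s * g y))"
      by (rule QQ.AE_bounded_integrable[of _ 1]) (auto simp: norm_mult)
    have "of_real ((cmod (\<psi> s))\<^sup>2) = \<psi> s * cnj (\<psi> s)" by (rule complex_norm_square)
    also have "cnj (\<psi> s) = (\<integral>y. iexp (- s * g y) \<partial>Q)"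
    proof -
      have "cnj (iexp (s * g y)) = iexp (- s * g y)" for y by (simp add: exp_cnj)
      then have "(\<integral>y. iexp (- s * g y) \<partial>Q) = (\<integral>y. cnj (iexp (s * g y)) \<partial>Q)" by simp
      also have "\<dots> = cnj (\<psi> s)" unfolding \<psi>_def by (rule Bochner_Integration.integral_cnj)
      finally show ?thesis by (rule sym)
    qed
    also have "\<psi> s * (\<integral>y. iexp (- s * g y) \<partial>Q) = (\<integral>x. (\<integral>y. iexp (s * g x) * iexp (- s * g y) \<partial>Q) \<partial>Q)"
      by (simp add: \<psi>_def)
    also have "\<dots> = (\<integral>p. iexp (s * g (fst p)) * iexp (- s * g (snd p)) \<partial>(Q \<Otimes>\<^sub>M Q))"
      using QQ.integral_fst'[OF i[unfolded case_prod_beta']] by simp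
    also have "\<dots> = (\<integral>p. iexp (s * (g (fst p) - g (snd p))) \<partial>(Q \<Otimes>\<^sub>M Q))"
      by (simp add: exp_add[symmetric] right_diff_distrib)
    finally have "(cmod (\<psi> s))\<^sup>2 = Re (\<integral>p. iexp (s * (g (fst p) - g (snd p))) \<partial>(Q \<Otimes>\<^sub>M Q))"
      by (metis Re_complex_of_real)
    also have "\<dots> = (\<integral>p. cos (s * (g (fst p) - g (snd p))) \<partial>(Q \<Otimes>\<^sub>M Q))"
      by (subst integral_Re[symmetric]) (auto simp: Re_exp intro!: QQ.integrable_iexp)
    finally have e: "(cmod (\<psi> s))\<^sup>2 = (\<integral>p. cos (s * (g (fst p) - g (snd p))) \<partial>(Q \<Otimes>\<^sub>M Q))" .
    have "integrable (Q \<Otimes>\<^sub>M Q) (\<lambda>p. cos (s * (g (fst p) - g (snd p))))"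
      by (rule QQ.AE_bounded_integrable[of _ 1]) auto
    then show ?thesis unfolding e by (simp add: QQ.prob_space)
  qed
  define D where "D p = g (fst p) - g (snd p)" for p
  have Dm [measurable]: "D \<in> borel_measurable (Q \<Otimes>\<^sub>M Q)" unfolding D_def by measurable
  have "(\<integral>\<^sup>+p. ennreal (t\<^sup>2 / 4 * (D p)\<^sup>2) \<partial>(Q \<Otimes>\<^sub>M Q)) \<le>
     (\<integral>\<^sup>+p. liminf (\<lambda>n. ennreal (n * (1 - cos (t / sqrt n * D p)))) \<partial>(Q \<Otimes>\<^sub>M Q))"
  proof (rule nn_integral_mono, rule Liminf_bounded)
    fix p
    show "\<forall>\<^sub>F n in sequentially. ennreal (t\<^sup>2 / 4 * (D p)\<^sup>2) \<le> ennreal (real n * (1 - cos (t / sqrt n * D p)))"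
    proof (rule eventually_sequentiallyI[of "nat \<lceil>(t * D p)\<^sup>2\<rceil> + 1"])
      fix n assume "nat \<lceil>(t * D p)\<^sup>2\<rceil> + 1 \<le> n"
      then have n: "(t * D p)\<^sup>2 \<le> n" "n > 0" by (auto, linarith)
      have "\<bar>t * D p\<bar> \<le> sqrt n" using n(1) by (metis real_sqrt_abs real_sqrt_le_iff)
      then have "\<bar>t / sqrt n * D p\<bar> \<le> 1" using n(2) by (simp add: abs_mult abs_divide)
      then have "(t / sqrt n * D p)\<^sup>2 / 4 \<le> 1 - cos (t / sqrt n * D p)" by (rule one_minus_cos_ge)
      then have "real n * ((t / sqrt n * D p)\<^sup>2 / 4) \<le> n * (1 - cos (t / sqrt n * D p))" by (intro mult_left_mono) auto
      moreover have "real n * ((t / sqrt n * D p)\<^sup>2 / 4) = t\<^sup>2 / 4 * (D p)\<^sup>2"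
        using n(2) by (simp add: power_mult_distrib power_divide)
      ultimately show "ennreal (t\<^sup>2 / 4 * (D p)\<^sup>2) \<le> ennreal (real n * (1 - cos (t / sqrt n * D p)))"
        by (intro ennreal_leI) simp
    qed
  qed
  also have "\<dots> \<le> liminf (\<lambda>n. \<integral>\<^sup>+p. ennreal (n * (1 - cos (t / sqrt n * D p))) \<partial>(Q \<Otimes>\<^sub>M Q))"
    by (rule nn_integral_liminf) measurable
  also have "\<dots> \<le> ennreal (ln 4)"
  proof (rule Liminf_le)
    show "\<forall>\<^sub>F n in sequentially. (\<integral>\<^sup>+p. ennreal (n * (1 - cos (t / sqrt n * D p))) \<partial>(Q \<Otimes>\<^sub>M Q)) \<le> ennreal (ln 4)"
      using ev
    proof eventually_elim
      case (elim n)
      have "(\<integral>\<^sup>+p. ennreal (n * (1 - cos (t / sqrt n * D p))) \<partial>(Q \<Otimes>\<^sub>M Q)) = ennreal (\<integral>p. n * (1 - cos (t / sqrt n * D p)) \<partial>(Q \<Otimes>\<^sub>M Q))"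
        by (intro nn_integral_eq_integral QQ.AE_bounded_integrable[of _ "real n * 2"]) (auto simp: abs_mult intro!: mult_left_mono)
      also have "(\<integral>p. n * (1 - cos (t / sqrt n * D p)) \<partial>(Q \<Otimes>\<^sub>M Q)) = n * (1 - (cmod (\<psi> (t / sqrt n)))\<^sup>2)"
        unfolding sym D_def by simp
      finally show ?case using elim by (simp add: ennreal_leI)
    qed
  qed simp
  finally have fin: "(\<integral>\<^sup>+p. ennreal (t\<^sup>2 / 4 * (D p)\<^sup>2) \<partial>(Q \<Otimes>\<^sub>M Q)) < \<infinity>" by (simp add: order_le_less_trans)
  have "integrable (Q \<Otimes>\<^sub>M Q) (\<lambda>p. t\<^sup>2 / 4 * (D p)\<^sup>2)"
    by (rule integrableI_bounded) (use fin in auto)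
  then have "integrable (Q \<Otimes>\<^sub>M Q) (\<lambda>p. 4 / t\<^sup>2 * (t\<^sup>2 / 4 * (D p)\<^sup>2))"
    by (rule integrable_mult_right)
  moreover have "4 / t\<^sup>2 * (t\<^sup>2 / 4 * y) = y" for y using t(1) by (simp add: field_simps)
  ultimately have "integrable (Q \<Otimes>\<^sub>M Q) (\<lambda>p. (D p)\<^sup>2)" by (simp only:)
  then have "integrable (Q \<Otimes>\<^sub>M Q) (\<lambda>(x, y). (g x - g y)\<^sup>2)" by (simp add: D_def case_prod_beta')
  \<comment> \<open>One good section \<open>x\<close> brings square integrability back from the
    symmetrized variable to \<open>g\<close>.\<close>
  then have "AE x in Q. integrable Q (\<lambda>y. (g x - g y)\<^sup>2)" by (rule QQ.AE_integrable_fst)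
  then obtain x where x: "integrable Q (\<lambda>y. (g x - g y)\<^sup>2)"
    using eventually_happens[of _ "ae_filter Q"] Q.not_empty Q.AE_False by (auto simp: trivial_limit_def)
  show ?thesis
  proof (rule Bochner_Integration.integrable_bound)
    show "integrable Q (\<lambda>y. 2 * (g x - g y)\<^sup>2 + 2 * (g x)\<^sup>2)" using x by simp
    show "AE y in Q. norm ((g y)\<^sup>2) \<le> norm (2 * (g x - g y)\<^sup>2 + 2 * (g x)\<^sup>2)"
    proof (rule AE_I2)
      fix y
      have "0 \<le> (2 * g x - g y)\<^sup>2" by simp
      then have "(g y)\<^sup>2 \<le> 2 * (g x - g y)\<^sup>2 + 2 * (g x)\<^sup>2" by (simp add: power2_eq_square algebra_simps)
      then show "norm ((g y)\<^sup>2) \<le> norm (2 * (g x - g y)\<^sup>2 + 2 * (g x)\<^sup>2)" by simp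
    qed
  qed measurable
qed

text \<open>Weak convergence at a single \<open>f\<close> already forces a finite variance. This
  second moment later dominates the Lindeberg terms and bounds the increments of the limit.\<close>

lemma donsker_square_integrable:
  assumes Q: "prob_space Q" and d: "donsker Q H" and f: "f \<in> H"
  shows "integrable Q (\<lambda>x. (f x)\<^sup>2)"
proof -
  let ?P = "PiM UNIV (\<lambda>_::nat. Q)"
  obtain M :: "(('a \<Rightarrow> real) \<Rightarrow> real) measure" and G where M: "prob_space M" "tight_borel_element (linf H) M G"
      "weakly_converges (linf H) ?P (empirical_process Q H) M G"
    using d by (rule donskerE)
  have int: "\<And>f. f \<in> H \<Longrightarrow> integrable Q f" using d by (simp add: donsker_def)
  have [measurable]: "f \<in> borel_measurable Q" if "f \<in> H" for f using int[OF that] by simp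
  have P: "prob_space ?P" using Q by (intro prob_space_PiM)
  have G: "G \<in> measurable M (borel_sigma (mtopology_of (linf H)))" using M(2) by (simp add: tight_borel_element_def)
  have em: "(\<lambda>z. empirical_process Q H N z f) \<in> borel_measurable ?P" if "f \<in> H" for N f
    using that unfolding empirical_process_def by simp
  let ?g = "\<lambda>x. f x - integral\<^sup>L Q f"
  have "integrable Q (\<lambda>x. (?g x)\<^sup>2)"
  proof (rule square_integrable_of_char_limit[OF Q _ M(1)])
    show "(\<lambda>v. G v f) \<in> borel_measurable M"
      using measurable_compose[OF G measurable_continuous_map_borel_sigma[OF lipschitz_real_continuous_map[OF lipschitz_real_eval[OF f]]]] .
    show "(\<lambda>n. \<integral>z. iexp (t * (1 / sqrt n * (\<Sum>i<n. ?g (z i)))) \<partial>?P) \<longlonglongrightarrow> (\<integral>v. iexp (t * G v f) \<partial>M)" for t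
      using weakly_converges_iexp[OF P M(1) em G M(3), where s = "\<lambda>_. f" and a = "\<lambda>_. t" and k = 1] f
      by (simp add: empirical_process_def)
  qed (use f in measurable)
  interpret prob_space Q by fact
  have "integrable Q (\<lambda>x. (?g x)\<^sup>2 + (2 * integral\<^sup>L Q f * f x - (integral\<^sup>L Q f)\<^sup>2))"
    using \<open>integrable Q (\<lambda>x. (?g x)\<^sup>2)\<close> int[OF f] by simp
  moreover have "(f x)\<^sup>2 = (?g x)\<^sup>2 + (2 * integral\<^sup>L Q f * f x - (integral\<^sup>L Q f)\<^sup>2)" for x
    by (simp add: power2_eq_square algebra_simps)
  ultimately show ?thesis by simp
qed

subsection \<open>Signed sums over a Donsker class\<close>

definition sup_signed :: "('z \<Rightarrow> real) set \<Rightarrow> (('z \<Rightarrow> real) \<Rightarrow> 'z \<Rightarrow> real) \<Rightarrow> nat \<Rightarrow> (nat \<Rightarrow> real) \<Rightarrow> (nat \<Rightarrow> 'z) \<Rightarrow> real" where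
  "sup_signed H r N e z = (SUP f\<in>H. \<bar>1 / sqrt N * (\<Sum>i<N. e i * (f (z i) - r f (z i)))\<bar>)"

lemma donsker_abs_bdd:
  assumes "donsker Q H" "bdd_above ((\<lambda>f. \<bar>integral\<^sup>L Q f\<bar>) ` H)" "z \<in> space Q"
  shows "\<exists>B. \<forall>f\<in>H. \<bar>f z\<bar> \<le> B"
proof -
  obtain B1 B2 where "\<And>f. f \<in> H \<Longrightarrow> \<bar>f z - integral\<^sup>L Q f\<bar> \<le> B1" "\<And>f. f \<in> H \<Longrightarrow> \<bar>integral\<^sup>L Q f\<bar> \<le> B2"
    using donsker_bdd[OF assms(1,3)] assms(2) by (auto simp: bdd_above_def)
  then have "\<bar>f z\<bar> \<le> B1 + B2" if "f \<in> H" for f using that by (smt (verit))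
  then show ?thesis by blast
qed

context
  fixes Q :: "'z measure" and H :: "('z \<Rightarrow> real) set" and r :: "('z \<Rightarrow> real) \<Rightarrow> 'z \<Rightarrow> real"
  assumes Q: "prob_space Q" and d: "donsker Q H" and H: "H \<noteq> {}" and rH: "r ` H \<subseteq> H"
    and mean: "bdd_above ((\<lambda>f. \<bar>integral\<^sup>L Q f\<bar>) ` H)"
begin

abbreviation PQ :: "(nat \<Rightarrow> 'z) measure" where "PQ \<equiv> PiM UNIV (\<lambda>_. Q)"

interpretation PQ: prob_space PQ using Q by (intro prob_space_PiM)

lemma sup_signed_bdd:
  assumes z: "z \<in> space PQ"
  shows "bdd_above ((\<lambda>f. \<bar>1 / sqrt N * (\<Sum>i<N. e i * (f (z i) - r f (z i)))\<bar>) ` H)"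
proof -
  have "\<exists>B. \<forall>f\<in>H. \<bar>f (z i)\<bar> \<le> B" for i
    using z by (intro donsker_abs_bdd[OF d mean]) (auto simp: space_PiM PiE_iff)
  then obtain B where B: "\<And>i f. f \<in> H \<Longrightarrow> \<bar>f (z i)\<bar> \<le> B i" by metis
  show ?thesis
  proof (rule bdd_aboveI2)
    fix f assume f: "f \<in> H"
    have "\<bar>\<Sum>i<N. e i * (f (z i) - r f (z i))\<bar> \<le> (\<Sum>i<N. \<bar>e i\<bar> * (2 * B i))"
    proof (rule order_trans[OF sum_abs sum_mono])
      fix i
      have "r f \<in> H" using f rH by auto
      then have "\<bar>f (z i) - r f (z i)\<bar> \<le> 2 * B i" using B[OF f, of i] B[of "r f" i] by linarith
      then show "\<bar>e i * (f (z i) - r f (z i))\<bar> \<le> \<bar>e i\<bar> * (2 * B i)" by (simp add: abs_mult mult_left_mono)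
    qed
    then show "\<bar>1 / sqrt N * (\<Sum>i<N. e i * (f (z i) - r f (z i)))\<bar> \<le> 1 / sqrt N * (\<Sum>i<N. \<bar>e i\<bar> * (2 * B i))"
      unfolding abs_mult by (intro mult_mono) auto
  qed
qed

lemma le_sup_signed:
  "z \<in> space PQ \<Longrightarrow> f \<in> H \<Longrightarrow> \<bar>1 / sqrt N * (\<Sum>i<N. e i * (f (z i) - r f (z i)))\<bar> \<le> sup_signed H r N e z"
  unfolding sup_signed_def by (rule cSUP_upper[OF _ sup_signed_bdd])

lemma sup_signed_le:
  "(\<And>f. f \<in> H \<Longrightarrow> \<bar>1 / sqrt N * (\<Sum>i<N. e i * (f (z i) - r f (z i)))\<bar> \<le> c) \<Longrightarrow> sup_signed H r N e z \<le> c"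
  unfolding sup_signed_def using H by (intro cSUP_least) auto

lemma sup_signed_nonneg: "z \<in> space PQ \<Longrightarrow> 0 \<le> sup_signed H r N e z"
  using le_sup_signed H by (meson abs_ge_zero all_not_in_conv order_trans)

text \<open>After reindexing, the sum over \<open>J\<close> is an empirical process with
  \<open>card J\<close> observations; dividing by the larger \<open>sqrt N\<close> only makes it
  smaller.\<close>

lemma outer_small_partial_sum:
  assumes n0: "\<And>n. n \<ge> n0 \<Longrightarrow> outer_small PQ {z. osc H r (empirical_process Q H n z) \<ge> t} \<eta>"
    and J: "finite J" "card J \<ge> n0" "card J \<le> N" "card J > 0"
  shows "outer_small PQ {z. \<exists>f\<in>H. \<bar>1 / sqrt N * (\<Sum>i\<in>J. (f (z i) - integral\<^sup>L Q f) - (r f (z i) - integral\<^sup>L Q (r f)))\<bar> \<ge> t} \<eta>"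
proof -
  define m where "m = card J"
  obtain h where h: "bij_betw h {..<m} J"
    using ex_bij_betw_nat_finite[OF J(1)] by (auto simp: m_def lessThan_atLeast0)
  \<comment> \<open>Indices from \<open>m\<close> on are sent past \<open>Max J\<close>, which keeps
    the reindexing injective.\<close>
  define \<sigma> where "\<sigma> i = (if i < m then h i else i + Suc (Max J))" for i
  have "inj \<sigma>"
  proof (rule injI)
    fix i j assume e: "\<sigma> i = \<sigma> j"
    have hJ: "h i \<le> Max J" if "i < m" for i using h J(1) that by (auto simp: bij_betw_def)
    show "i = j"
      using e h hJ[of i] hJ[of j] unfolding \<sigma>_def bij_betw_def
      by (auto split: if_splits simp: inj_on_eq_iff)
  qed
  from outer_small_reindex[OF Q this n0[OF J(2)]]
  show ?thesis
  proof (rule outer_small_mono)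
    fix z assume z: "z \<in> space PQ"
      and "z \<in> {z. \<exists>f\<in>H. \<bar>1 / sqrt N * (\<Sum>i\<in>J. (f (z i) - integral\<^sup>L Q f) - (r f (z i) - integral\<^sup>L Q (r f)))\<bar> \<ge> t}"
    then obtain f where f: "f \<in> H" and ge: "\<bar>1 / sqrt N * (\<Sum>i\<in>J. (f (z i) - integral\<^sup>L Q f) - (r f (z i) - integral\<^sup>L Q (r f)))\<bar> \<ge> t" by blast
    define S where "S = (\<Sum>i\<in>J. (f (z i) - integral\<^sup>L Q f) - (r f (z i) - integral\<^sup>L Q (r f)))"
    have zs: "(\<lambda>n. z (\<sigma> n)) \<in> space PQ" using z by (auto simp: space_PiM PiE_iff)
    have "r f \<in> H" using f rH by auto
    have "S = (\<Sum>i<m. (f (z (h i)) - integral\<^sup>L Q f) - (r f (z (h i)) - integral\<^sup>L Q (r f)))"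
      unfolding S_def by (rule sum.reindex_bij_betw[OF h, symmetric])
    then have "S = (\<Sum>i<m. (f (z (\<sigma> i)) - integral\<^sup>L Q f) - (r f (z (\<sigma> i)) - integral\<^sup>L Q (r f)))"
      by (simp add: \<sigma>_def)
    then have E: "empirical_process Q H m (\<lambda>n. z (\<sigma> n)) f - empirical_process Q H m (\<lambda>n. z (\<sigma> n)) (r f) = 1 / sqrt m * S"
      using f \<open>r f \<in> H\<close> by (simp add: empirical_process_def sum_subtractf diff_divide_distrib)
    have "1 / sqrt N \<le> 1 / sqrt m" using J by (intro divide_left_mono) (auto simp: m_def)
    then have "1 / sqrt N * \<bar>S\<bar> \<le> 1 / sqrt m * \<bar>S\<bar>" by (rule mult_right_mono) simp
    then have "t \<le> \<bar>1 / sqrt m * S\<bar>" using ge by (simp add: S_def[symmetric] abs_mult)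
    also have "\<dots> \<le> osc H r (empirical_process Q H m (\<lambda>n. z (\<sigma> n)))"
      unfolding E[symmetric] by (intro le_osc rH empirical_process_mem[OF donsker_bdd[OF d] zs] f)
    finally show "z \<in> {z. (\<lambda>n. z (\<sigma> n)) \<in> {z. osc H r (empirical_process Q H (card J) z) \<ge> t}}"
      by (simp add: m_def)
  qed simp
qed

text \<open>The signed sum is a difference of centred sums over the plus and the minus positions,
  and near balance of the signs gives each at least \<open>n0\<close> terms. What centring leaves
  over is the sum of the signs times a difference of means, at most
  \<open>R * sqrt N * \<tau>\<close> in modulus. The three pieces account for
  \<open>3 * t\<close>.\<close>

lemma outer_small_signed_sum:
  fixes n0 :: nat
  assumes n0: "\<And>n. n \<ge> n0 \<Longrightarrow> outer_small PQ {z. osc H r (empirical_process Q H n z) \<ge> t} \<eta>" "n0 > 0"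
    and e: "e \<in> signs N" "\<bar>\<Sum>i<N. e i\<bar> \<le> R * sqrt N" and N: "(N - R * sqrt N) / 2 \<ge> n0"
    and \<tau>: "\<And>f. f \<in> H \<Longrightarrow> \<bar>integral\<^sup>L Q f - integral\<^sup>L Q (r f)\<bar> \<le> \<tau>" "\<tau> * R \<le> t" "0 \<le> R"
  shows "outer_small PQ {z. sup_signed H r N e z > 3 * t} (2 * \<eta>)"
proof -
  define Jp where "Jp = {i\<in>{..<N}. e i = 1}"
  define Jm where "Jm = {i\<in>{..<N}. e i = -1}"
  have J: "finite Jp" "finite Jm" "Jp \<inter> Jm = {}" "{..<N} = Jp \<union> Jm"
    using e(1) by (auto simp: Jp_def Jm_def signs_def)
  have sp: "(\<Sum>i<N. e i * g i) = (\<Sum>i\<in>Jp. g i) - (\<Sum>i\<in>Jm. g i)" for g :: "nat \<Rightarrow> real"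
  proof -
    have "(\<Sum>i<N. e i * g i) = (\<Sum>i\<in>Jp. e i * g i) + (\<Sum>i\<in>Jm. e i * g i)"
      unfolding J(4) by (rule sum.union_disjoint[OF J(1-3)])
    also have "(\<Sum>i\<in>Jp. e i * g i) = (\<Sum>i\<in>Jp. g i)" by (intro sum.cong) (auto simp: Jp_def)
    also have "(\<Sum>i\<in>Jm. e i * g i) = - (\<Sum>i\<in>Jm. g i)" unfolding sum_negf[symmetric] by (intro sum.cong) (auto simp: Jm_def)
    finally show ?thesis by simp
  qed
  have c1: "(\<Sum>i<N. e i) = real (card Jp) - real (card Jm)" using sp[of "\<lambda>_. 1"] by simp
  have "N = card Jp + card Jm" using card_Un_disjoint[OF J(1-3)] J(4) by (metis card_lessThan)
  then have c2: "real N = real (card Jp) + real (card Jm)" by simp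
  define K where "K = R * sqrt N"
  have "\<bar>real (card Jp) - real (card Jm)\<bar> \<le> K" "real n0 \<le> (real (card Jp) + real (card Jm) - K) / 2"
    using e(2) N unfolding c1[symmetric] c2[symmetric] K_def by auto
  then have "real n0 \<le> real (card Jp)" "real n0 \<le> real (card Jm)" by (auto simp: abs_le_iff)
  then have cJ: "card Jp \<ge> n0" "card Jm \<ge> n0" "card Jp \<le> N" "card Jm \<le> N" using c2 by linarith+
  have "outer_small PQ ({z. \<exists>f\<in>H. \<bar>1 / sqrt N * (\<Sum>i\<in>Jp. (f (z i) - integral\<^sup>L Q f) - (r f (z i) - integral\<^sup>L Q (r f)))\<bar> \<ge> t} \<union>
     {z. \<exists>f\<in>H. \<bar>1 / sqrt N * (\<Sum>i\<in>Jm. (f (z i) - integral\<^sup>L Q f) - (r f (z i) - integral\<^sup>L Q (r f)))\<bar> \<ge> t}) (\<eta> + \<eta>)"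
    by (intro PQ.outer_small_Un outer_small_partial_sum[OF n0(1)]) (use J cJ n0(2) in auto)
  then show ?thesis
  proof (rule outer_small_mono)
    fix z assume z: "z \<in> space PQ" and big: "z \<in> {z. sup_signed H r N e z > 3 * t}"
    show "z \<in> {z. \<exists>f\<in>H. \<bar>1 / sqrt N * (\<Sum>i\<in>Jp. (f (z i) - integral\<^sup>L Q f) - (r f (z i) - integral\<^sup>L Q (r f)))\<bar> \<ge> t} \<union>
     {z. \<exists>f\<in>H. \<bar>1 / sqrt N * (\<Sum>i\<in>Jm. (f (z i) - integral\<^sup>L Q f) - (r f (z i) - integral\<^sup>L Q (r f)))\<bar> \<ge> t}"
    proof (rule ccontr)
      assume no: "\<not> ?thesis"
      have "sup_signed H r N e z \<le> 3 * t"
      proof (rule sup_signed_le)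
        fix f assume f: "f \<in> H"
        let ?c = "\<lambda>i. (f (z i) - integral\<^sup>L Q f) - (r f (z i) - integral\<^sup>L Q (r f))"
        let ?m = "integral\<^sup>L Q f - integral\<^sup>L Q (r f)"
        have "(\<Sum>i<N. e i * (f (z i) - r f (z i))) = (\<Sum>i<N. e i * (?c i + ?m))" by simp
        also have "\<dots> = (\<Sum>i<N. e i * ?c i) + (\<Sum>i<N. e i) * ?m"
          unfolding distrib_left sum.distrib sum_distrib_right ..
        finally have "1 / sqrt N * (\<Sum>i<N. e i * (f (z i) - r f (z i))) =
            1 / sqrt N * (\<Sum>i\<in>Jp. ?c i) - 1 / sqrt N * (\<Sum>i\<in>Jm. ?c i) + 1 / sqrt N * ((\<Sum>i<N. e i) * ?m)"
          unfolding sp[of ?c] by (simp only: distrib_left right_diff_distrib)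
        moreover have "\<bar>1 / sqrt N * (\<Sum>i\<in>Jp. ?c i)\<bar> < t" "\<bar>1 / sqrt N * (\<Sum>i\<in>Jm. ?c i)\<bar> < t"
          using no f by (auto simp: not_le)
        moreover have "\<bar>1 / sqrt N * ((\<Sum>i<N. e i) * ?m)\<bar> \<le> t"
        proof -
          have "\<bar>(\<Sum>i<N. e i) * ?m\<bar> \<le> (R * sqrt N) * \<tau>"
            unfolding abs_mult using e(2) \<tau>(1)[OF f] \<tau>(3) by (intro mult_mono) auto
          then have "1 / sqrt N * \<bar>(\<Sum>i<N. e i) * ?m\<bar> \<le> 1 / sqrt N * ((R * sqrt N) * \<tau>)"
            by (intro mult_left_mono) auto
          also have "\<dots> \<le> \<tau> * R"
          proof -
            have "0 \<le> \<tau>" using \<tau>(1)[OF f] by linarith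
            then show ?thesis using \<tau>(3) by (cases "N = 0") auto
          qed
          finally show ?thesis using \<tau>(2) by (simp add: abs_mult)
        qed
        ultimately show "\<bar>1 / sqrt N * (\<Sum>i<N. e i * (f (z i) - r f (z i)))\<bar> \<le> 3 * t" by linarith
      qed
      then show False using big by simp
    qed
  qed simp
qed

text \<open>The input for the existence of a minimal majorant. At fixed \<open>N\<close> a union
  bound over the \<open>N\<close> observations is enough.\<close>

lemma sup_signed_tight:
  assumes e: "e \<in> signs N" and \<eta>: "\<eta> > 0"
  shows "\<exists>K. outer_small PQ {z. sup_signed H r N e z > K} \<eta>"
proof -
  have "\<eta> / (N + 1) > 0" using \<eta> by simp
  from donsker_envelope[OF Q d H this] obtain K where K: "\<And>i. outer_small PQ {z. \<exists>f\<in>H. \<bar>f (z i) - integral\<^sup>L Q f\<bar> > K} (\<eta> / (N + 1))" by blast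
  obtain B where B: "\<And>f. f \<in> H \<Longrightarrow> \<bar>integral\<^sup>L Q f\<bar> \<le> B" using mean by (auto simp: bdd_above_def)
  have "outer_small PQ (\<Union>i\<in>{..<N}. {z. \<exists>f\<in>H. \<bar>f (z i) - integral\<^sup>L Q f\<bar> > K}) (\<Sum>i\<in>{..<N}. \<eta> / (N + 1))"
    by (intro PQ.outer_small_UN K) auto
  then have "outer_small PQ {z. sup_signed H r N e z > 1 / sqrt N * (\<Sum>i<N. 2 * (K + B))} \<eta>"
  proof (rule outer_small_mono)
    fix z assume big: "z \<in> {z. sup_signed H r N e z > 1 / sqrt N * (\<Sum>i<N. 2 * (K + B))}"
    show "z \<in> (\<Union>i\<in>{..<N}. {z. \<exists>f\<in>H. \<bar>f (z i) - integral\<^sup>L Q f\<bar> > K})"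
    proof (rule ccontr)
      assume no: "\<not> ?thesis"
      have le: "\<bar>f (z i)\<bar> \<le> K + B" if "i < N" "f \<in> H" for f i
      proof -
        have "\<bar>f (z i) - integral\<^sup>L Q f\<bar> \<le> K" using no that by (auto simp: not_less)
        then show ?thesis using B[OF that(2)] by linarith
      qed
      have "sup_signed H r N e z \<le> 1 / sqrt N * (\<Sum>i<N. 2 * (K + B))"
      proof (rule sup_signed_le)
        fix f assume f: "f \<in> H"
        have "\<bar>\<Sum>i<N. e i * (f (z i) - r f (z i))\<bar> \<le> (\<Sum>i<N. 2 * (K + B))"
        proof (rule order_trans[OF sum_abs sum_mono])
          fix i assume i: "i \<in> {..<N}"
          then have "\<bar>e i\<bar> = 1" using e by (auto simp: signs_def)
          moreover have "r f \<in> H" using f rH by auto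
          ultimately show "\<bar>e i * (f (z i) - r f (z i))\<bar> \<le> 2 * (K + B)"
            using le[of i f] le[of i "r f"] f i by (simp add: abs_mult abs_le_iff)
        qed
        then show "\<bar>1 / sqrt N * (\<Sum>i<N. e i * (f (z i) - r f (z i)))\<bar> \<le> 1 / sqrt N * (\<Sum>i<N. 2 * (K + B))"
          unfolding abs_mult by (intro mult_mono) auto
      qed
      then show False using big by simp
    qed
  next
    have "N * (\<eta> / (N + 1)) \<le> (N + 1) * (\<eta> / (N + 1))" using \<eta> by (intro mult_right_mono) auto
    then show "(\<Sum>i\<in>{..<N}. \<eta> / (N + 1)) \<le> \<eta>" by simp
  qed
  then show ?thesis by blast
qed

lemma sup_signed_uminus: "sup_signed H r N (\<lambda>i. - e i) z = sup_signed H r N e z"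
  unfolding sup_signed_def by (simp add: sum_negf)

text \<open>Among the \<open>N\<close> flips of \<open>e\<close> each coordinate keeps its sign
  \<open>N - 1\<close> times and changes it once, so the flips add up to \<open>N - 2\<close> times
  \<open>e\<close>. The triangle inequality for the supremum then yields the flip hypothesis of the
  moment comparison.\<close>

lemma sup_signed_flip:
  assumes z: "z \<in> space PQ" and N: "N > 2"
  shows "sup_signed H r N e z \<le> (\<Sum>i<N. sup_signed H r N (flip i e) z) / (real N - 2)"
proof (rule sup_signed_le)
  fix f assume f: "f \<in> H"
  let ?c = "\<lambda>j. f (z j) - r f (z j)"
  have one: "(\<Sum>j<N. flip i e j * ?c j) = (\<Sum>j<N. e j * ?c j) - 2 * (e i * ?c i)" if "i < N" for i
  proof -
    have "(\<Sum>j<N. flip i e j * ?c j) = (\<Sum>j<N. e j * ?c j - (if j = i then 2 * (e i * ?c i) else 0))"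
      by (intro sum.cong) (auto simp: flip_def)
    then show ?thesis using that by (simp add: sum_subtractf)
  qed
  have "(\<Sum>i<N. \<Sum>j<N. flip i e j * ?c j) = (\<Sum>i<N. (\<Sum>j<N. e j * ?c j) - 2 * (e i * ?c i))"
    by (intro sum.cong) (auto simp: one)
  also have "\<dots> = (real N - 2) * (\<Sum>j<N. e j * ?c j)"
    by (simp add: sum_subtractf sum_distrib_left[symmetric] left_diff_distrib)
  finally have "(real N - 2) * \<bar>1 / sqrt N * (\<Sum>j<N. e j * ?c j)\<bar> = \<bar>\<Sum>i<N. 1 / sqrt N * (\<Sum>j<N. flip i e j * ?c j)\<bar>"
    using N by (simp add: abs_mult sum_divide_distrib[symmetric])
  also have "\<dots> \<le> (\<Sum>i<N. sup_signed H r N (flip i e) z)"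
    by (rule order_trans[OF sum_abs]) (intro sum_mono le_sup_signed z f)
  finally show "\<bar>1 / sqrt N * (\<Sum>j<N. e j * ?c j)\<bar> \<le> (\<Sum>i<N. sup_signed H r N (flip i e) z) / (real N - 2)"
    using N by (simp add: pos_le_divide_eq mult.commute)
qed

lemma flip_signs: "e \<in> signs N \<Longrightarrow> i < N \<Longrightarrow> flip i e \<in> signs N"
  by (auto simp: signs_def flip_def)

lemma uminus_signs: "e \<in> signs N \<Longrightarrow> (\<lambda>i. - e i) \<in> signs N"
  by (auto simp: signs_def)

text \<open>Origin of the constants: on average over signs the level \<open>3 * t\<close> is
  exceeded with probability at most \<open>2 * \<eta>\<close> plus the Chebyshev term, in all
  \<open>3 * \<eta>\<close>. Markov's inequality at level 1/16 gives \<open>48 * \<eta>\<close>, and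
  the moment comparison doubles \<open>3 * t\<close>.\<close>

lemma sign_majorant:
  fixes n0 :: nat
  assumes n0: "\<And>n. n \<ge> n0 \<Longrightarrow> outer_small PQ {z. osc H r (empirical_process Q H n z) \<ge> t} \<eta>" "n0 > 0"
    and N: "(N - R * sqrt N) / 2 \<ge> n0" "N > 2"
    and \<tau>: "\<And>f. f \<in> H \<Longrightarrow> \<bar>integral\<^sup>L Q f - integral\<^sup>L Q (r f)\<bar> \<le> \<tau>" "\<tau> * R \<le> t" "0 < R" "1 / R\<^sup>2 \<le> \<eta>" and t: "t > 0"
  shows "\<exists>U. (\<forall>e\<in>signs N. U e \<in> borel_measurable PQ \<and> (\<forall>z. 0 \<le> U e z)) \<and>
    (AE z in PQ. \<forall>e\<in>signs N. sup_signed H r N e z \<le> U e z) \<and>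
    measure PQ {z\<in>space PQ. sign_avg N (\<lambda>e. U e z) > 6 * t} \<le> 48 * \<eta>"
proof -
  have "\<forall>e\<in>signs N. \<exists>U. min_majorant PQ (sup_signed H r N e) U"
    by (intro ballI PQ.ex_min_majorant sup_signed_nonneg sup_signed_tight)
  then obtain U where U: "\<And>e. e \<in> signs N \<Longrightarrow> min_majorant PQ (sup_signed H r N e) (U e)" by metis
  have Um [measurable]: "U e \<in> borel_measurable PQ" and U0: "\<And>z. 0 \<le> U e z"
    and UT: "AE z in PQ. sup_signed H r N e z \<le> U e z" if "e \<in> signs N" for e
    using U[OF that] by (auto simp: min_majorant_def)
  have Umin: "AE z in PQ. U e z \<le> V z" if "e \<in> signs N" "V \<in> borel_measurable PQ" "AE z in PQ. sup_signed H r N e z \<le> V z" for e V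
    using U[OF that(1)] that(2,3) unfolding min_majorant_def by blast
  have fin: "finite (signs N)" by (rule finite_signs)
  have all: "AE z in PQ. \<forall>e\<in>signs N. sup_signed H r N e z \<le> U e z"
    using fin UT by (intro AE_finite_allI)
  \<comment> \<open>By symmetry of the supremum, \<open>U e\<close> also majorizes it at the negated
    signs, so minimality gives the inequality; used for \<open>e\<close> and for its negative it
    becomes an equality.\<close>
  have even: "AE z in PQ. \<forall>e\<in>signs N. U (\<lambda>i. - e i) z \<le> U e z"
  proof (rule AE_finite_allI[OF fin])
    fix e assume e: "e \<in> signs N"
    show "AE z in PQ. U (\<lambda>i. - e i) z \<le> U e z"
      by (rule Umin[OF uminus_signs[OF e] Um[OF e]]) (use UT[OF e] in \<open>simp add: sup_signed_uminus\<close>)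
  qed
  have tri: "AE z in PQ. \<forall>e\<in>signs N. U e z \<le> (\<Sum>i<N. U (flip i e) z) / (real N - 2)"
  proof (rule AE_finite_allI[OF fin])
    fix e assume e: "e \<in> signs N"
    show "AE z in PQ. U e z \<le> (\<Sum>i<N. U (flip i e) z) / (real N - 2)"
    proof (rule Umin[OF e])
      show "(\<lambda>z. (\<Sum>i<N. U (flip i e) z) / (real N - 2)) \<in> borel_measurable PQ"
        using Um[OF flip_signs[OF e]] by (intro borel_measurable_divide borel_measurable_sum) auto
      show "AE z in PQ. sup_signed H r N e z \<le> (\<Sum>i<N. U (flip i e) z) / (real N - 2)"
        using all AE_space
      proof eventually_elim
        case (elim z)
        have "sup_signed H r N e z \<le> (\<Sum>i<N. sup_signed H r N (flip i e) z) / (real N - 2)"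
          by (rule sup_signed_flip[OF elim(2) N(2)])
        also have "\<dots> \<le> (\<Sum>i<N. U (flip i e) z) / (real N - 2)"
          using elim(1) flip_signs[OF e] N(2) by (intro divide_right_mono sum_mono) auto
        finally show ?case .
      qed
    qed
  qed
  \<comment> \<open>For given data, the proportion of sign vectors whose majorant is large. Its
    integral exchanges with the finite sum over signs, so it is small on average.\<close>
  define p where "p z = sign_avg N (\<lambda>e. of_bool (U e z > 3 * t))" for z
  have pm [measurable]: "p \<in> borel_measurable PQ"
    unfolding p_def sign_avg_eq_sum using Um by (intro borel_measurable_divide borel_measurable_sum) (auto simp: of_bool_def)
  have p0: "0 \<le> p z" for z unfolding p_def by (rule sign_avg_nonneg) simp
  have p1: "p z \<le> 1" for z
    using sign_avg_mono[of N "\<lambda>e. of_bool (U e z > 3 * t)" "\<lambda>_. 1"] by (simp add: p_def sign_avg_const)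
  have Am: "(\<lambda>z. sign_avg N (\<lambda>e. U e z)) \<in> borel_measurable PQ"
    unfolding sign_avg_eq_sum using Um by (intro borel_measurable_divide borel_measurable_sum) auto
  have "AE z in PQ. p z \<le> 1 / 16 \<longrightarrow> sign_avg N (\<lambda>e. U e z) \<le> 2 * (3 * t)"
    using even tri
  proof eventually_elim
    case (elim z)
    show ?case
    proof
      assume pz: "p z \<le> 1 / 16"
      show "sign_avg N (\<lambda>e. U e z) \<le> 2 * (3 * t)"
      proof (rule sign_avg_le_of_small_prob)
        fix e assume e: "e \<in> signs N"
        show "U (\<lambda>i. - e i) z = U e z"
          using elim(1) e uminus_signs[OF e] by (intro antisym) force+
        show "0 \<le> U e z" using U0[OF e] .
        show "(real N - 2) * U e z \<le> (\<Sum>i<N. U (flip i e) z)"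
          using elim(2) e N(2) by (auto simp: pos_le_divide_eq mult.commute)
      qed (use pz t in \<open>auto simp: p_def\<close>)
    qed
  qed
  then have "measure PQ {z\<in>space PQ. sign_avg N (\<lambda>e. U e z) > 6 * t} \<le> measure PQ {z\<in>space PQ. p z \<ge> 1 / 16}"
    by (intro PQ.finite_measure_mono_AE) (auto elim!: eventually_mono)
  also have "\<dots> \<le> (\<integral>z. p z \<partial>PQ) / (1 / 16)"
    by (intro integral_Markov_inequality_measure[where A = "{}"] PQ.AE_bounded_integrable[of _ 1] pm) (auto simp: p0 p1)
  also have "(\<integral>z. p z \<partial>PQ) = sign_avg N (\<lambda>e. measure PQ {z\<in>space PQ. U e z > 3 * t})"
  proof -
    have m: "{z\<in>space PQ. U e z > 3 * t} \<in> sets PQ" if "e \<in> signs N" for e using Um[OF that] by measurable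
    have ind: "integrable PQ (\<lambda>z. of_bool (U e z > 3 * t) :: real)" if "e \<in> signs N" for e
      using Um[OF that] by (intro PQ.AE_bounded_integrable[of _ 1]) (auto simp: of_bool_def)
    have "(\<integral>z. of_bool (U e z > 3 * t) \<partial>PQ) = measure PQ {z\<in>space PQ. U e z > 3 * t}" if "e \<in> signs N" for e
    proof -
      have "(\<integral>z. of_bool (U e z > 3 * t) \<partial>PQ) = (\<integral>z. indicator {z\<in>space PQ. U e z > 3 * t} z \<partial>PQ)"
        by (intro Bochner_Integration.integral_cong) (auto simp: indicator_def)
      also have "\<dots> = measure PQ ({z\<in>space PQ. U e z > 3 * t} \<inter> space PQ)" by (rule Bochner_Integration.integral_indicator)
      also have "{z\<in>space PQ. U e z > 3 * t} \<inter> space PQ = {z\<in>space PQ. U e z > 3 * t}" by auto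
      finally show ?thesis .
    qed
    then show ?thesis
      unfolding p_def sign_avg_eq_sum using ind by (simp add: Bochner_Integration.integral_sum)
  qed
  also have "\<dots> \<le> sign_avg N (\<lambda>e. 2 * \<eta> + of_bool (\<bar>\<Sum>i<N. e i\<bar> > R * sqrt N))"
  proof (rule sign_avg_mono)
    fix e assume e: "e \<in> signs N"
    show "measure PQ {z\<in>space PQ. U e z > 3 * t} \<le> 2 * \<eta> + of_bool (\<bar>\<Sum>i<N. e i\<bar> > R * sqrt N)"
    proof (cases "\<bar>\<Sum>i<N. e i\<bar> > R * sqrt N")
      case True
      have "0 \<le> \<eta>" using \<tau>(4) zero_le_divide_1_iff[of "R\<^sup>2"] by (meson order_trans zero_le_power2)
      then show ?thesis using True by (auto intro: order_trans[OF PQ.prob_le_1])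
    next
      case False
      have "outer_small PQ {z. sup_signed H r N e z > 3 * t} (2 * \<eta>)"
        by (rule outer_small_signed_sum[OF n0 e _ N(1) \<tau>(1,2)]) (use False \<tau>(3) in auto)
      from PQ.min_majorant_outer_small[OF U[OF e] this] show ?thesis using False by simp
    qed
  qed
  also have "\<dots> \<le> 2 * \<eta> + 1 / R\<^sup>2"
    unfolding sign_avg_add sign_avg_const using sign_avg_chebyshev[OF \<tau>(3), of N] N(2) by simp
  also have "\<dots> \<le> 3 * \<eta>" using \<tau>(4) by simp
  finally have "measure PQ {z\<in>space PQ. sign_avg N (\<lambda>e. U e z) > 6 * t} \<le> 48 * \<eta>" by simp
  then show ?thesis using Um U0 all by blast
qed

end

lemma donsker_sign_majorant:
  fixes Q :: "'z measure"
  assumes Q: "prob_space Q" and d: "donsker Q H" and H: "H \<noteq> {}"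
    and mean: "bdd_above ((\<lambda>f. \<bar>integral\<^sup>L Q f\<bar>) ` H)" and t: "t > 0" and \<eta>: "\<eta> > 0"
  shows "\<exists>r. finite (r ` H) \<and> r ` H \<subseteq> H \<and> (\<forall>f\<in>H. r (r f) = r f) \<and>
    (\<forall>\<^sub>F N in sequentially. \<exists>U. (\<forall>e\<in>signs N. U e \<in> borel_measurable (PiM UNIV (\<lambda>_. Q)) \<and> (\<forall>z. 0 \<le> U e z)) \<and>
      (AE z in PiM UNIV (\<lambda>_. Q). \<forall>e\<in>signs N. sup_signed H r N e z \<le> U e z) \<and>
      measure (PiM UNIV (\<lambda>_. Q)) {z\<in>space (PiM UNIV (\<lambda>_. Q)). sign_avg N (\<lambda>e. U e z) > t} \<le> \<eta>)"
proof -
  \<comment> \<open>This makes the Chebyshev term \<open>1 / R^2\<close> equal to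
    \<open>\<eta> / 48\<close>; the factors 6 and 48 lost in \<open>sign_majorant\<close> are paid
    in advance.\<close>
  define R where "R = sqrt (48 / \<eta>)"
  have R: "R > 0" "1 / R\<^sup>2 \<le> \<eta> / 48" using \<eta> by (auto simp: R_def)
  define \<tau> where "\<tau> = t / 6 / R"
  have \<tau>: "\<tau> > 0" "\<tau> * R \<le> t / 6" using t R by (auto simp: \<tau>_def)
  have t6: "t / 6 > 0" and \<eta>48: "\<eta> / 48 > 0" using t \<eta> by auto
  obtain r where r0: "finite (r ` H) \<and> r ` H \<subseteq> H \<and> (\<forall>f\<in>H. r (r f) = r f) \<and>
    (\<forall>f\<in>H. \<bar>integral\<^sup>L Q f - integral\<^sup>L Q (r f)\<bar> \<le> \<tau>) \<and>
    (\<forall>\<^sub>F n in sequentially. outer_small (PiM UNIV (\<lambda>_. Q)) {z. osc H r (empirical_process Q H n z) \<ge> t / 6} (\<eta> / 48))"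
    using donsker_osc[OF Q d H mean t6 \<eta>48 \<tau>(1)] ..
  then have r: "finite (r ` H)" "r ` H \<subseteq> H" "\<forall>f\<in>H. r (r f) = r f" "\<And>f. f \<in> H \<Longrightarrow> \<bar>integral\<^sup>L Q f - integral\<^sup>L Q (r f)\<bar> \<le> \<tau>"
    and ev: "\<forall>\<^sub>F n in sequentially. outer_small (PiM UNIV (\<lambda>_. Q)) {z. osc H r (empirical_process Q H n z) \<ge> t / 6} (\<eta> / 48)"
    by blast+
  from ev obtain n1 where n1: "\<And>n. n \<ge> n1 \<Longrightarrow> outer_small (PiM UNIV (\<lambda>_. Q)) {z. osc H r (empirical_process Q H n z) \<ge> t / 6} (\<eta> / 48)"
    unfolding eventually_sequentially by blast
  define n0 where "n0 = Suc n1"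
  have n0: "\<And>n. n \<ge> n0 \<Longrightarrow> outer_small (PiM UNIV (\<lambda>_. Q)) {z. osc H r (empirical_process Q H n z) \<ge> t / 6} (\<eta> / 48)" "n0 > 0"
    using n1 by (auto simp: n0_def)
  have "\<forall>\<^sub>F N in sequentially. N > 2 \<and> (real N - R * sqrt N) / 2 \<ge> n0"
  proof (rule eventually_sequentiallyI)
    \<comment> \<open>For N >= 4 R^2 one has R sqrt N <= N / 2, so half the difference N - R sqrt N
      is at least N / 4, hence at least \<open>n0\<close>.\<close>
    fix N :: nat assume N: "N \<ge> nat \<lceil>(2 * R)\<^sup>2\<rceil> + 4 * n0 + 3"
    then have a: "real N \<ge> (2 * R)\<^sup>2" "real N \<ge> 4 * real n0" "N > 2" by linarith+
    have "2 * R \<le> sqrt N" using a(1) R by (simp add: real_le_rsqrt)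
    then have "2 * R * sqrt N \<le> sqrt N * sqrt N" by (intro mult_right_mono) auto
    then show "N > 2 \<and> (real N - R * sqrt N) / 2 \<ge> n0" using a by simp
  qed
  then have "\<forall>\<^sub>F N in sequentially. \<exists>U. (\<forall>e\<in>signs N. U e \<in> borel_measurable (PiM UNIV (\<lambda>_. Q)) \<and> (\<forall>z. 0 \<le> U e z)) \<and>
      (AE z in PiM UNIV (\<lambda>_. Q). \<forall>e\<in>signs N. sup_signed H r N e z \<le> U e z) \<and>
      measure (PiM UNIV (\<lambda>_. Q)) {z\<in>space (PiM UNIV (\<lambda>_. Q)). sign_avg N (\<lambda>e. U e z) > t} \<le> \<eta>"
  proof eventually_elim
    case (elim N)
    from sign_majorant[OF Q d H r(2) mean n0 _ _ r(4) \<tau>(2) R t6] elim show ?case by simp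
  qed
  then show ?thesis using r by blast
qed

subsection \<open>The law of the Poisson design\<close>

text \<open>Expectation over the design in scalar-multiplication form, so that it serves real
  weights as well as complex exponentials.\<close>

definition design_mean :: "'x incl_probs \<Rightarrow> nat \<Rightarrow> (nat \<Rightarrow> 'x) \<Rightarrow> ((nat \<Rightarrow> nat) \<Rightarrow> 'b) \<Rightarrow> 'b::real_vector" where
  "design_mean \<pi> N x g = (\<Sum>s\<in>binary_vectors N. design_prob \<pi> N s x *\<^sub>R g s)"

text \<open>Independence of the inclusion indicators, in the guise of distributing a product over
  sums.\<close>

lemma design_mean_prod:
  fixes h :: "nat \<Rightarrow> nat \<Rightarrow> 'b::real_normed_field"
  shows "design_mean \<pi> N x (\<lambda>s. \<Prod>i<N. h i (s i)) = (\<Prod>i<N. \<pi> N i x *\<^sub>R h i 1 + (1 - \<pi> N i x) *\<^sub>R h i 0)"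
proof -
  have "design_mean \<pi> N x (\<lambda>s. \<Prod>i<N. h i (s i)) =
      (\<Sum>s\<in>{..<N} \<rightarrow>\<^sub>E {0, 1}. \<Prod>i<N. of_real (\<pi> N i x ^ s i * (1 - \<pi> N i x) ^ (1 - s i)) * h i (s i))"
    by (simp add: design_mean_def design_prob_def binary_vectors_def scaleR_conv_of_real prod.distrib)
  also have "\<dots> = (\<Prod>i<N. \<Sum>b\<in>{0, 1}. of_real (\<pi> N i x ^ b * (1 - \<pi> N i x) ^ (1 - b)) * h i b)"
    by (rule prod_sum_PiE[symmetric]) auto
  finally show ?thesis by (simp add: scaleR_conv_of_real add.commute)
qed

lemma design_mean_cmult: "design_mean \<pi> N x (\<lambda>s. c * f s) = c * design_mean \<pi> N x f" for c :: "'b::real_algebra"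
  by (simp add: design_mean_def sum_distrib_left)

lemma design_mean_sum: "design_mean \<pi> N x (\<lambda>s. \<Sum>i\<in>I. f i s) = (\<Sum>i\<in>I. design_mean \<pi> N x (f i))"
  by (simp add: design_mean_def scaleR_sum_right sum.swap[of _ I])

lemma design_mean_one: "design_mean \<pi> N x (\<lambda>s. 1 :: real) = 1"
  using design_mean_prod[of \<pi> N x "\<lambda>_ _. 1 :: real"] by simp

definition incl_weight :: "'x incl_probs \<Rightarrow> nat \<Rightarrow> (nat \<Rightarrow> 'x) \<Rightarrow> (nat \<Rightarrow> nat) \<Rightarrow> nat \<Rightarrow> real" where
  "incl_weight \<pi> N x s i = real (s i) / \<pi> N i x - 1"

text \<open>Centring removes the off-diagonal products; on the diagonal the variance of a weight is
  \<open>1 / \<pi> - 1\<close>.\<close>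

lemma design_mean_cross:
  assumes \<pi>: "\<And>i. i < N \<Longrightarrow> 0 < \<pi> N i x"
  shows "design_mean \<pi> N x (\<lambda>s. (\<Sum>i<N. incl_weight \<pi> N x s i * c i) * (\<Sum>j<N. incl_weight \<pi> N x s j * d j)) =
    (\<Sum>i<N. (1 / \<pi> N i x - 1) * (c i * d i))"
proof -
  have e: "design_mean \<pi> N x (\<lambda>s. incl_weight \<pi> N x s i * incl_weight \<pi> N x s j) = (if i = j then 1 / \<pi> N i x - 1 else 0)"
    if ij: "i < N" "j < N" for i j
  proof -
    define h where "h l b = (if l = i then real b / \<pi> N i x - 1 else 1) * (if l = j then real b / \<pi> N j x - 1 else 1)" for l b
    have "incl_weight \<pi> N x s i * incl_weight \<pi> N x s j = (\<Prod>l<N. h l (s l))" for s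
    proof -
      have "(\<Prod>l<N. h l (s l)) = (\<Prod>l<N. if l = i then real (s l) / \<pi> N i x - 1 else 1) * (\<Prod>l<N. if l = j then real (s l) / \<pi> N j x - 1 else 1)"
        unfolding h_def by (rule prod.distrib)
      then show ?thesis using ij by (simp add: prod.delta incl_weight_def)
    qed
    then have "design_mean \<pi> N x (\<lambda>s. incl_weight \<pi> N x s i * incl_weight \<pi> N x s j) =
        (\<Prod>l<N. \<pi> N l x * h l 1 + (1 - \<pi> N l x) * h l 0)"
      using design_mean_prod[of \<pi> N x h] by simp
    also have "\<dots> = (if i = j then 1 / \<pi> N i x - 1 else 0)"
    proof (cases "i = j")
      case True
      have "(\<Prod>l<N. \<pi> N l x * h l 1 + (1 - \<pi> N l x) * h l 0) = (\<Prod>l<N. if l = i then 1 / \<pi> N i x - 1 else 1)"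
        using \<pi>[OF ij(1)] True by (intro prod.cong) (auto simp: h_def field_simps power2_eq_square)
      then show ?thesis using True ij by simp
    next
      case False
      have "\<pi> N i x * h i 1 + (1 - \<pi> N i x) * h i 0 = 0"
        using \<pi>[OF ij(1)] False by (simp add: h_def field_simps)
      then have "(\<Prod>l<N. \<pi> N l x * h l 1 + (1 - \<pi> N l x) * h l 0) = 0"
        using ij by (intro prod_zero bexI[of _ i]) auto
      then show ?thesis using False by simp
    qed
    finally show ?thesis .
  qed
  have "design_mean \<pi> N x (\<lambda>s. (\<Sum>i<N. incl_weight \<pi> N x s i * c i) * (\<Sum>j<N. incl_weight \<pi> N x s j * d j))
    = design_mean \<pi> N x (\<lambda>s. \<Sum>i<N. \<Sum>j<N. (c i * d j) * (incl_weight \<pi> N x s i * incl_weight \<pi> N x s j))"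
    by (simp add: sum_product mult_ac)
  also have "\<dots> = (\<Sum>i<N. \<Sum>j<N. (c i * d j) * (if i = j then 1 / \<pi> N i x - 1 else 0))"
    unfolding design_mean_sum design_mean_cmult by (intro sum.cong refl) (simp add: e)
  also have "\<dots> = (\<Sum>i<N. (1 / \<pi> N i x - 1) * (c i * d i))"
    by (intro sum.cong refl) (simp add: if_distrib[of "\<lambda>z. _ * z"] cong: if_cong)
  finally show ?thesis .
qed

text \<open>The inverse of the cumulative probabilities, by a least index so that measurability is
  direct. \<open>THE k. False\<close> is the value that the description in \<open>Svec\<close> takes
  for arguments above 1.\<close>

definition design_select :: "(nat \<Rightarrow> real) \<Rightarrow> nat \<Rightarrow> real \<Rightarrow> nat" where
  "design_select p n d = (if d \<le> 1 then (LEAST k. k < n \<and> d \<le> (\<Sum>j\<le>k. p j)) else (THE k. False))"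

context
  fixes p :: "nat \<Rightarrow> real" and n :: nat
  assumes n: "n > 0" and p0: "\<And>j. j < n \<Longrightarrow> 0 \<le> p j" and p1: "(\<Sum>j<n. p j) = 1"
begin

lemma partial_mono: "k \<le> l \<Longrightarrow> l \<le> n \<Longrightarrow> (\<Sum>j<k. p j) \<le> (\<Sum>j<l. p j)"
  using p0 by (intro sum_mono2) auto

lemma atMost_lessThan: "(\<Sum>j\<le>k. p j) = (\<Sum>j<Suc k. p j)"
  by (simp add: lessThan_Suc_atMost)

lemma design_select_iff:
  assumes d: "d \<le> 1"
  shows "design_select p n d = k \<longleftrightarrow> k < n \<and> (k = 0 \<or> (\<Sum>j<k. p j) < d) \<and> d \<le> (\<Sum>j\<le>k. p j)"
proof -
  define R where "R k \<longleftrightarrow> k < n \<and> d \<le> (\<Sum>j\<le>k. p j)" for k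
  have "R (n - 1)" using n p1 d unfolding R_def atMost_lessThan by simp
  then have L: "R (LEAST k. R k)" "\<And>k. R k \<Longrightarrow> (LEAST k. R k) \<le> k" by (auto intro: LeastI Least_le)
  have ds: "design_select p n d = (LEAST k. R k)" using d by (simp add: design_select_def R_def)
  show ?thesis
  proof
    assume "design_select p n d = k"
    then have k: "k = (LEAST k. R k)" using ds by simp
    have "k = 0 \<or> (\<Sum>j<k. p j) < d"
    proof (rule ccontr)
      assume "\<not> ?thesis"
      then have "k > 0" "d \<le> (\<Sum>j<k. p j)" by auto
      then have "R (k - 1)" using L(1) k unfolding R_def atMost_lessThan by auto
      then show False using L(2)[of "k - 1"] k \<open>k > 0\<close> by auto
    qed
    then show "k < n \<and> (k = 0 \<or> (\<Sum>j<k. p j) < d) \<and> d \<le> (\<Sum>j\<le>k. p j)" using L(1) k by (auto simp: R_def)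
  next
    assume k: "k < n \<and> (k = 0 \<or> (\<Sum>j<k. p j) < d) \<and> d \<le> (\<Sum>j\<le>k. p j)"
    have "(LEAST k. R k) = k"
    proof (rule Least_equality)
      show "R k" using k by (simp add: R_def)
      fix l assume l: "R l"
      show "k \<le> l"
      proof (rule ccontr)
        assume "\<not> k \<le> l"
        then have "(\<Sum>j<Suc l. p j) \<le> (\<Sum>j<k. p j)" using k by (intro partial_mono) auto
        then show False using k l \<open>\<not> k \<le> l\<close> unfolding R_def atMost_lessThan by auto
      qed
    qed
    then show "design_select p n d = k" using ds by simp
  qed
qed

lemma the_eq_design_select:
  "(THE k. k < n \<and> (k = 0 \<or> (\<Sum>j<k. p j) < d) \<and> d \<le> (\<Sum>j\<le>k. p j)) = design_select p n d"
proof (cases "d \<le> 1")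
  case True
  show ?thesis
    by (rule the_equality) (simp_all only: design_select_iff[OF True, symmetric])
next
  case False
  have "\<not> (k < n \<and> (k = 0 \<or> (\<Sum>j<k. p j) < d) \<and> d \<le> (\<Sum>j\<le>k. p j))" for k
  proof
    assume k: "k < n \<and> (k = 0 \<or> (\<Sum>j<k. p j) < d) \<and> d \<le> (\<Sum>j\<le>k. p j)"
    then have "(\<Sum>j\<le>k. p j) \<le> 1" unfolding atMost_lessThan p1[symmetric] by (intro partial_mono) auto
    then show False using k False by simp
  qed
  then have "(\<lambda>k. k < n \<and> (k = 0 \<or> (\<Sum>j<k. p j) < d) \<and> d \<le> (\<Sum>j\<le>k. p j)) = (\<lambda>k. False)" by blast
  then show ?thesis using False by (simp add: design_select_def)
qed

lemma measurable_design_select: "design_select p n \<in> measurable borel (count_space UNIV)"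
  unfolding design_select_def by measurable

lemma measurable_design_select_compose:
  fixes g :: "nat \<Rightarrow> 'b::topological_space"
  shows "(\<lambda>u. g (design_select p n u)) \<in> borel_measurable borel"
  by (rule measurable_compose[OF measurable_design_select]) simp

lemma integral_design_select:
  fixes g :: "nat \<Rightarrow> 'b::{banach, second_countable_topology}"
  shows "(\<integral>u. g (design_select p n u) \<partial>uniform_measure lborel {0..1::real}) = (\<Sum>k<n. p k *\<^sub>R g k)"
proof -
  let ?U = "uniform_measure lborel {0..1::real}"
  interpret U: prob_space ?U by (rule prob_space_uniform_measure) auto
  have m [measurable]: "design_select p n \<in> measurable borel (count_space UNIV)" by (rule measurable_design_select)
  have meas: "measure ?U {u. design_select p n u = k} = p k" if k: "k < n" for k
  proof -
    have S: "{u. design_select p n u = k} \<in> sets lborel"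
      using measurable_sets[OF m, of "{k}"] by (simp add: vimage_def)
    have nn: "0 \<le> (\<Sum>j<k. p j)" "(\<Sum>j\<le>k. p j) = (\<Sum>j<k. p j) + p k" using p0 k by (auto intro!: sum_nonneg simp: atMost_lessThan)
    have le1: "(\<Sum>j\<le>k. p j) \<le> 1" unfolding atMost_lessThan p1[symmetric] using k by (intro partial_mono) auto
    \<comment> \<open>Within [0,1] the value \<open>k\<close> is taken on an interval of length
      \<open>p k\<close>. For \<open>k = 0\<close> it contains its left end, since no lower bound is
      imposed there.\<close>
    have "u \<in> {0..1} \<inter> {u. design_select p n u = k} \<longleftrightarrow> u \<in> (if k = 0 then {0..p 0} else {(\<Sum>j<k. p j)<..(\<Sum>j\<le>k. p j)})" for u
    proof (cases "0 \<le> u \<and> u \<le> 1")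
      case True
      then show ?thesis using design_select_iff[of u k] k by simp
    next
      case False
      then show ?thesis using nn le1 by auto
    qed
    then have "{0..1} \<inter> {u. design_select p n u = k} = (if k = 0 then {0..p 0} else {(\<Sum>j<k. p j)<..(\<Sum>j\<le>k. p j)})" by blast
    then have "measure lborel ({0..1} \<inter> {u. design_select p n u = k}) = p k"
      using p0[OF k] nn by auto
    then show ?thesis using S by (simp add: measure_uniform_measure)
  qed
  have AE01: "AE u in ?U. u \<in> {0..1}" by (rule AE_uniform_measureI) auto
  have "(\<integral>u. g (design_select p n u) \<partial>?U) = (\<integral>u. (\<Sum>k<n. indicator {u. design_select p n u = k} u *\<^sub>R g k) \<partial>?U)"
  proof (rule integral_cong_AE)
    show "AE u in ?U. g (design_select p n u) = (\<Sum>k<n. indicator {u. design_select p n u = k} u *\<^sub>R g k)"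
      using AE01
    proof eventually_elim
      case (elim u)
      then have "design_select p n u < n" using design_select_iff[of u "design_select p n u"] by auto
      moreover have "(\<Sum>k<n. indicator {u. design_select p n u = k} u *\<^sub>R g k) = (\<Sum>k<n. if k = design_select p n u then g k else 0)"
        by (intro sum.cong refl) auto
      ultimately show ?case by (simp add: sum.delta)
    qed
    show "(\<lambda>u. g (design_select p n u)) \<in> borel_measurable ?U"
      using measurable_design_select_compose[of g] measurable_cong_sets[of ?U borel] by simp
    have "{u. design_select p n u = k} \<in> sets borel" for k
      using measurable_sets[OF m, of "{k}"] by (simp add: vimage_def)
    then show "(\<lambda>u. \<Sum>k<n. indicator {u. design_select p n u = k} u *\<^sub>R g k) \<in> borel_measurable ?U"
      by (intro borel_measurable_sum borel_measurable_scaleR borel_measurable_const borel_measurable_indicator) simp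
  qed
  also have "\<dots> = (\<Sum>k<n. \<integral>u. indicator {u. design_select p n u = k} u *\<^sub>R g k \<partial>?U)"
    by (intro Bochner_Integration.integral_sum integrable_scaleR_left integrable_real_indicator) (auto simp: U.emeasure_eq_measure)
  also have "\<dots> = (\<Sum>k<n. p k *\<^sub>R g k)"
  proof (intro sum.cong refl)
    fix k assume k: "k \<in> {..<n}"
    have "{u. design_select p n u = k} \<in> sets borel"
      using measurable_sets[OF m, of "{k}"] by (simp add: vimage_def)
    then have ii: "integrable ?U (indicator {u. design_select p n u = k} :: real \<Rightarrow> real)"
      by (intro integrable_real_indicator) (auto simp: U.emeasure_eq_measure)
    have "(\<integral>u. indicator {u. design_select p n u = k} u *\<^sub>R g k \<partial>?U) = (\<integral>u. indicator {u. design_select p n u = k} u \<partial>?U) *\<^sub>R g k"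
      by (rule integral_scaleR_left) (rule ii)
    then show "(\<integral>u. indicator {u. design_select p n u = k} u *\<^sub>R g k \<partial>?U) = p k *\<^sub>R g k"
      using meas k by simp
  qed
  finally show ?thesis .
qed

end

section \<open>The sampling model: data, design and their joint law\<close>

locale poisson_design =
  fixes Pyx :: "('y::{banach, second_countable_topology} \<times> 'x::{banach, second_countable_topology}) measure"
    and Pd :: "'d measure" and D :: "'d \<Rightarrow> real" and Pe :: "'e measure"
    and \<pi> :: "'x incl_probs" and enum :: "nat \<Rightarrow> nat \<Rightarrow> nat \<Rightarrow> nat"
  assumes Pyx: "prob_space Pyx" "sets Pyx = sets borel"
    and Pd: "prob_space Pd"
    and D: "D \<in> borel_measurable Pd" "distr Pd borel D = uniform_measure lborel {0..1}"
    and Pe: "prob_space Pe"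
    and enum: "\<And>N. bij_betw (enum N) {..<2 ^ N} (binary_vectors N)"
    and design: "measurable_poisson_designs \<pi>"
begin

abbreviation "XY \<equiv> PiM UNIV (\<lambda>_::nat. Pyx)"
abbreviation "Om \<equiv> sample_space Pyx Pd Pe"
abbreviation "Q \<equiv> law_Y Pyx"

definition xv :: "nat \<Rightarrow> (nat \<Rightarrow> 'y \<times> 'x) \<Rightarrow> nat \<Rightarrow> 'x" where
  "xv N u = restrict (\<lambda>i. snd (u i)) {..<N}"

lemma Xvec_eq: "Xvec N \<omega> = xv N (fst \<omega>)"
  by (simp add: Xvec_def xv_def)

sublocale Pyx: prob_space Pyx by (rule Pyx)
sublocale Pd: prob_space Pd by (rule Pd)

lemma space_Pyx: "space Pyx = UNIV"
  using sets_eq_imp_space_eq[OF Pyx(2)] by simp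

lemma space_XY: "space XY = UNIV"
  by (simp add: space_PiM space_Pyx)

lemma prob_space_XY: "prob_space XY"
  by (intro prob_space_PiM Pyx)

lemma prob_space_DE: "prob_space (Pd \<Otimes>\<^sub>M PiM UNIV (\<lambda>_::nat. Pe))"
  by (intro prob_space_pair prob_space_PiM Pd Pe)

lemma prob_space_Om: "prob_space Om"
  unfolding sample_space_def by (intro prob_space_pair prob_space_XY prob_space_DE)

lemma measurable_fst_Pyx [measurable]: "fst \<in> measurable Pyx borel"
  using measurable_cong_sets[OF Pyx(2) refl] borel_measurable_continuous_onI[OF continuous_on_fst[OF continuous_on_id]] by blast

lemma measurable_snd_Pyx [measurable]: "snd \<in> measurable Pyx borel"
  using measurable_cong_sets[OF Pyx(2) refl] borel_measurable_continuous_onI[OF continuous_on_snd[OF continuous_on_id]] by blast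

lemma prob_space_Q: "prob_space Q"
  unfolding law_Y_def by (rule Pyx.prob_space_distr) measurable

lemma sets_Q [simp]: "sets Q = sets borel" by (simp add: law_Y_def)

lemma measurable_yseq: "(\<lambda>u i. fst (u i)) \<in> measurable XY (PiM UNIV (\<lambda>_. Q))"
  by (rule measurable_PiM_single') (auto simp: law_Y_def space_PiM)

lemma distr_yseq: "distr XY (PiM UNIV (\<lambda>_. Q)) (\<lambda>u i. fst (u i)) = PiM UNIV (\<lambda>_::nat. Q)"
proof (rule measure_eqI_PiM_infinite[symmetric, OF refl])
  interpret PQ: prob_space "PiM UNIV (\<lambda>_::nat. Q)" by (intro prob_space_PiM prob_space_Q)
  show "finite_measure (PiM UNIV (\<lambda>_::nat. Q))" by unfold_locales
  fix A and J :: "nat set" assume J: "finite J" "J \<subseteq> UNIV" and A: "\<And>i. i \<in> J \<Longrightarrow> A i \<in> sets Q"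
  have fA: "fst -` A i \<inter> space Pyx \<in> sets Pyx" if "i \<in> J" for i
    using A[OF that] by (intro measurable_sets[OF measurable_fst_Pyx]) auto
  have "emeasure (PiM UNIV (\<lambda>_. Q)) (prod_emb UNIV (\<lambda>_. Q) J (Pi\<^sub>E J A)) = (\<Prod>j\<in>J. emeasure Q (A j))"
    using J A by (intro emeasure_PiM_emb prob_space_Q) auto
  also have "\<dots> = (\<Prod>j\<in>J. emeasure Pyx (fst -` A j \<inter> space Pyx))"
    using A unfolding law_Y_def by (intro prod.cong refl emeasure_distr) (auto simp: law_Y_def)
  also have "\<dots> = emeasure XY (prod_emb UNIV (\<lambda>_. Pyx) J (\<Pi>\<^sub>E j\<in>J. fst -` A j \<inter> space Pyx))"
    using J fA by (intro emeasure_PiM_emb[symmetric] Pyx) auto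
  also have "prod_emb UNIV (\<lambda>_. Pyx) J (\<Pi>\<^sub>E j\<in>J. fst -` A j \<inter> space Pyx) =
      (\<lambda>u i. fst (u i)) -` prod_emb UNIV (\<lambda>_. Q) J (Pi\<^sub>E J A) \<inter> space XY"
    by (auto simp: prod_emb_def space_PiM space_Pyx PiE_iff law_Y_def)
  also have "emeasure XY \<dots> = emeasure (distr XY (PiM UNIV (\<lambda>_. Q)) (\<lambda>u i. fst (u i))) (prod_emb UNIV (\<lambda>_. Q) J (Pi\<^sub>E J A))"
    using J A by (intro emeasure_distr[symmetric] measurable_yseq sets_PiM_I) auto
  finally show "emeasure (PiM UNIV (\<lambda>_. Q)) (prod_emb UNIV (\<lambda>_. Q) J (Pi\<^sub>E J A)) =
     emeasure (distr XY (PiM UNIV (\<lambda>_. Q)) (\<lambda>u i. fst (u i))) (prod_emb UNIV (\<lambda>_. Q) J (Pi\<^sub>E J A))" .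
qed simp

lemma measurable_fst_Om: "fst \<in> measurable Om XY"
  unfolding sample_space_def by measurable

lemma distr_fst_Om: "distr Om XY fst = XY"
  unfolding sample_space_def by (rule prob_space.distr_pair_fst[OF prob_space_DE])

lemma measurable_xv: "xv N \<in> measurable XY (PiM {..<N} (\<lambda>_. borel))"
  unfolding xv_def by (intro measurable_restrict measurable_compose[OF _ measurable_snd_Pyx] measurable_component_singleton) simp

lemma xv_mem: "xv N u \<in> {..<N} \<rightarrow>\<^sub>E UNIV"
  by (auto simp: xv_def)

lemma incl_prob_bounds: "i < N \<Longrightarrow> 0 < \<pi> N i (xv N u) \<and> \<pi> N i (xv N u) \<le> 1"
  using design xv_mem unfolding measurable_poisson_designs_def by blast

lemma design_prob_nonneg: "0 \<le> design_prob \<pi> N s (xv N u)"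
  unfolding design_prob_def
proof (rule prod_nonneg)
  fix i assume "i \<in> {..<N}"
  then have "0 \<le> \<pi> N i (xv N u)" "0 \<le> 1 - \<pi> N i (xv N u)" using incl_prob_bounds[of i N u] by auto
  then show "0 \<le> \<pi> N i (xv N u) ^ s i * (1 - \<pi> N i (xv N u)) ^ (1 - s i)" by simp
qed

lemma design_prob_measurable: "s \<in> binary_vectors N \<Longrightarrow> (\<lambda>u. design_prob \<pi> N s (xv N u)) \<in> borel_measurable XY"
  using design measurable_compose[OF measurable_xv] unfolding measurable_poisson_designs_def by blast

text \<open>Measurability is assumed for the joint probabilities; an inclusion probability is
  recovered as the total probability of the vectors that include \<open>i\<close>.\<close>

lemma incl_prob_measurable:
  assumes i: "i < N"
  shows "(\<lambda>u. \<pi> N i (xv N u)) \<in> borel_measurable XY"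
proof -
  have "\<pi> N i x = (\<Sum>s\<in>binary_vectors N. design_prob \<pi> N s x * (\<Prod>l<N. if l = i \<and> s l = 0 then 0 else 1))" for x
  proof -
    have "(\<Sum>s\<in>binary_vectors N. design_prob \<pi> N s x * (\<Prod>l<N. if l = i \<and> s l = 0 then 0 else 1))
       = (\<Prod>l<N. \<pi> N l x * 1 + (1 - \<pi> N l x) * (if l = i then 0 else 1))"
      using design_mean_prod[of \<pi> N x "\<lambda>l b. if l = i \<and> b = 0 then 0 else 1 :: real"]
      by (simp add: design_mean_def)
    also have "\<dots> = (\<Prod>l<N. if l = i then \<pi> N i x else 1)" by (intro prod.cong) auto
    finally show ?thesis using i by simp
  qed
  then have "(\<lambda>u. \<pi> N i (xv N u)) = (\<lambda>u. \<Sum>s\<in>binary_vectors N. design_prob \<pi> N s (xv N u) * (\<Prod>l<N. if l = i \<and> s l = 0 then 0 else 1))"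
    by blast
  also have "\<dots> \<in> borel_measurable XY"
    by (intro borel_measurable_sum borel_measurable_times design_prob_measurable) auto
  finally show ?thesis .
qed

definition pk :: "nat \<Rightarrow> (nat \<Rightarrow> 'y \<times> 'x) \<Rightarrow> nat \<Rightarrow> real" where
  "pk N u j = design_prob \<pi> N (enum N j) (xv N u)"

lemma sum_pk: "(\<Sum>k<2 ^ N. pk N u k *\<^sub>R g (enum N k)) = design_mean \<pi> N (xv N u) g"
  unfolding pk_def design_mean_def by (rule sum.reindex_bij_betw[OF enum])

lemma pk_props: "(0::nat) < 2 ^ N" "\<And>j. j < 2 ^ N \<Longrightarrow> 0 \<le> pk N u j" "(\<Sum>j<2 ^ N. pk N u j) = 1"
  using sum_pk[of N u "\<lambda>_. 1 :: real"] by (auto simp: pk_def design_prob_nonneg design_mean_one)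

lemma Svec_eq: "Svec \<pi> enum D N \<omega> = enum N (design_select (pk N (fst \<omega>)) (2 ^ N) (D (fst (snd \<omega>))))"
  unfolding Svec_def Let_def Xvec_eq using the_eq_design_select[OF pk_props] by (simp add: pk_def[abs_def])

lemma integral_design_D:
  fixes G :: "(nat \<Rightarrow> nat) \<Rightarrow> 'b::{banach, second_countable_topology}"
  shows "(\<integral>d. G (enum N (design_select (pk N u) (2 ^ N) (D d))) \<partial>Pd) = design_mean \<pi> N (xv N u) G"
proof -
  have "(\<integral>d. G (enum N (design_select (pk N u) (2 ^ N) (D d))) \<partial>Pd) =
      (\<integral>t. G (enum N (design_select (pk N u) (2 ^ N) t)) \<partial>distr Pd borel D)"
    by (rule integral_distr[symmetric, OF D(1)])
       (rule measurable_design_select_compose[OF pk_props])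
  also have "\<dots> = (\<Sum>k<2 ^ N. pk N u k *\<^sub>R G (enum N k))"
    unfolding D(2) by (rule integral_design_select[OF pk_props])
  also have "\<dots> = design_mean \<pi> N (xv N u) G" by (rule sum_pk)
  finally show ?thesis .
qed

lemma measurable_select: "(\<lambda>\<omega>. design_select (pk N (fst \<omega>)) (2 ^ N) (D (fst (snd \<omega>)))) \<in> measurable Om (count_space UNIV)"
proof -
  have Dm [measurable]: "(\<lambda>\<omega>. D (fst (snd \<omega>))) \<in> borel_measurable Om"
    unfolding sample_space_def using D(1) by measurable
  have pm: "(\<lambda>\<omega>. pk N (fst \<omega>) j) \<in> borel_measurable Om" if "j < 2 ^ N" for j
    unfolding pk_def
    by (rule measurable_compose[OF measurable_fst_Om design_prob_measurable]) (use enum[of N] that in \<open>auto simp: bij_betw_def\<close>)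
  have pr: "Measurable.pred Om (\<lambda>\<omega>. k < 2 ^ N \<and> D (fst (snd \<omega>)) \<le> (\<Sum>j\<le>k. pk N (fst \<omega>) j))" for k
  proof (cases "k < 2 ^ N")
    case True
    then have [measurable]: "(\<lambda>\<omega>. \<Sum>j\<le>k. pk N (fst \<omega>) j) \<in> borel_measurable Om"
      by (intro borel_measurable_sum pm) auto
    show ?thesis by measurable
  qed simp
  show ?thesis unfolding design_select_def
  proof (rule measurable_If)
    show "(\<lambda>\<omega>. LEAST k. k < 2 ^ N \<and> D (fst (snd \<omega>)) \<le> (\<Sum>j\<le>k. pk N (fst \<omega>) j)) \<in> measurable Om (count_space UNIV)"
      by (rule measurable_Least[OF pr])
    show "{\<omega>\<in>space Om. D (fst (snd \<omega>)) \<le> 1} \<in> sets Om" using Dm by measurable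
  qed simp
qed

lemma measurable_design:
  assumes "\<And>s. (\<lambda>\<omega>. G s \<omega>) \<in> borel_measurable Om"
  shows "(\<lambda>\<omega>. G (Svec \<pi> enum D N \<omega>) \<omega>) \<in> borel_measurable Om"
  unfolding Svec_eq using assms
  by (intro measurable_compose_countable[OF _ measurable_select, where f = "\<lambda>k \<omega>. G (enum N k) \<omega>"])

text \<open>Conditioning on the data: the uniform variable is an independent randomizer, so Fubini's
  theorem integrates it out and leaves the design mean at fixed data.\<close>

lemma integral_design:
  fixes G :: "(nat \<Rightarrow> nat) \<Rightarrow> (nat \<Rightarrow> 'y \<times> 'x) \<Rightarrow> 'b::{banach, second_countable_topology}"
  assumes G: "\<And>s. G s \<in> borel_measurable XY" and b: "\<And>s u. norm (G s u) \<le> b"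
  shows "(\<integral>\<omega>. G (Svec \<pi> enum D N \<omega>) (fst \<omega>) \<partial>Om) = (\<integral>u. design_mean \<pi> N (xv N u) (\<lambda>s. G s u) \<partial>XY)"
proof -
  interpret XY: prob_space XY by (rule prob_space_XY)
  interpret DE: prob_space "Pd \<Otimes>\<^sub>M PiM UNIV (\<lambda>_::nat. Pe)" by (rule prob_space_DE)
  interpret Om: prob_space Om by (rule prob_space_Om)
  interpret PP: pair_sigma_finite XY "Pd \<Otimes>\<^sub>M PiM UNIV (\<lambda>_::nat. Pe)" ..
  have Gm: "(\<lambda>\<omega>. G (Svec \<pi> enum D N \<omega>) (fst \<omega>)) \<in> borel_measurable Om"
    by (rule measurable_design) (rule measurable_compose[OF measurable_fst_Om G])
  have i: "integrable Om (\<lambda>\<omega>. G (Svec \<pi> enum D N \<omega>) (fst \<omega>))"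
    by (rule Om.AE_bounded_integrable[OF Gm b])
  have "(\<integral>\<omega>. G (Svec \<pi> enum D N \<omega>) (fst \<omega>) \<partial>Om) =
     (\<integral>u. (\<integral>de. G (Svec \<pi> enum D N (u, de)) (fst (u, de)) \<partial>(Pd \<Otimes>\<^sub>M PiM UNIV (\<lambda>_::nat. Pe))) \<partial>XY)"
    using PP.integral_fst'[OF i[unfolded sample_space_def]] unfolding sample_space_def by simp
  also have "\<dots> = (\<integral>u. design_mean \<pi> N (xv N u) (\<lambda>s. G s u) \<partial>XY)"
  proof (intro Bochner_Integration.integral_cong refl)
    fix u
    have E: "prob_space (PiM UNIV (\<lambda>_::nat. Pe))" by (intro prob_space_PiM Pe)
    have "(\<integral>de. G (Svec \<pi> enum D N (u, de)) (fst (u, de)) \<partial>(Pd \<Otimes>\<^sub>M PiM UNIV (\<lambda>_::nat. Pe)))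
      = (\<integral>de. G (enum N (design_select (pk N u) (2 ^ N) (D (fst de)))) u \<partial>(Pd \<Otimes>\<^sub>M PiM UNIV (\<lambda>_::nat. Pe)))"
      by (simp add: Svec_eq)
    also have "\<dots> = (\<integral>d. G (enum N (design_select (pk N u) (2 ^ N) (D d))) u \<partial>distr (Pd \<Otimes>\<^sub>M PiM UNIV (\<lambda>_::nat. Pe)) Pd fst)"
      by (rule integral_distr[symmetric], measurable)
         (rule measurable_compose[OF D(1) measurable_design_select[OF pk_props]])
    also have "\<dots> = design_mean \<pi> N (xv N u) (\<lambda>s. G s u)"
      unfolding prob_space.distr_pair_fst[OF E] by (rule integral_design_D)
    finally show "(\<integral>de. G (Svec \<pi> enum D N (u, de)) (fst (u, de)) \<partial>(Pd \<Otimes>\<^sub>M PiM UNIV (\<lambda>_::nat. Pe))) = design_mean \<pi> N (xv N u) (\<lambda>s. G s u)" .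
  qed
  finally show ?thesis .
qed

lemma HT_process_eq:
  "f \<in> F \<Longrightarrow> HT_process \<pi> enum D F N \<omega> f =
     1 / sqrt N * (\<Sum>i<N. incl_weight \<pi> N (xv N (fst \<omega>)) (Svec \<pi> enum D N \<omega>) i * f (fst (fst \<omega> i)))"
  by (simp add: HT_process_def incl_weight_def Xvec_eq Yv_def)

lemma HT_cov_eq:
  assumes "f \<in> F" "g \<in> F"
  shows "HT_cov Pd \<pi> enum D F f g N \<omega> =
    1 / N * (\<Sum>i<N. (1 / \<pi> N i (xv N (fst \<omega>)) - 1) * (f (fst (fst \<omega> i)) * g (fst (fst \<omega> i))))"
proof -
  let ?u = "fst \<omega>"
  define T where "T s = (1 / sqrt N * (\<Sum>i<N. incl_weight \<pi> N (xv N ?u) s i * f (fst (?u i)))) *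
      (1 / sqrt N * (\<Sum>i<N. incl_weight \<pi> N (xv N ?u) s i * g (fst (?u i))))" for s
  have "HT_cov Pd \<pi> enum D F f g N \<omega> = (\<integral>d. T (enum N (design_select (pk N ?u) (2 ^ N) (D d))) \<partial>Pd)"
    unfolding HT_cov_def design_expectation_def HT_process_eq[OF assms(1)] HT_process_eq[OF assms(2)] Svec_eq T_def by simp
  also have "\<dots> = design_mean \<pi> N (xv N ?u) T" by (rule integral_design_D)
  also have "T = (\<lambda>s. 1 / N * ((\<Sum>i<N. incl_weight \<pi> N (xv N ?u) s i * f (fst (?u i))) * (\<Sum>i<N. incl_weight \<pi> N (xv N ?u) s i * g (fst (?u i)))))"
    by (rule ext) (simp add: T_def)
  finally show ?thesis
    unfolding design_mean_cmult using incl_prob_bounds by (subst (asm) design_mean_cross) auto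
qed

end

subsection \<open>Convergence in probability\<close>

text \<open>Extracts an actual sample point at which \<open>X\<close> is near its limit.
  Inequalities valid on events of probability at least 1/2 thereby pass to the constant
  \<open>c\<close>.\<close>

lemma conv_in_prob_witness:
  assumes P: "prob_space P" and X: "\<And>N. X N \<in> borel_measurable P" and c: "conv_in_prob P X c"
    and A: "\<forall>\<^sub>F N in sequentially. measure P (A N) \<ge> 1 / 2" "\<And>N. A N \<subseteq> space P" and e: "e > 0"
  shows "\<exists>N. \<exists>\<omega>\<in>A N. \<bar>X N \<omega> - c\<bar> \<le> e"
proof -
  interpret prob_space P by fact
  have "(\<lambda>N. measure P {\<omega> \<in> space P. \<bar>X N \<omega> - c\<bar> > e}) \<longlonglongrightarrow> 0" using c e by (simp add: conv_in_prob_def)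
  then have "\<forall>\<^sub>F N in sequentially. measure P {\<omega> \<in> space P. \<bar>X N \<omega> - c\<bar> > e} < 1 / 2"
    by (rule order_tendstoD(2)) simp
  with A(1) have "\<forall>\<^sub>F N in sequentially. measure P (A N) \<ge> 1 / 2 \<and> measure P {\<omega> \<in> space P. \<bar>X N \<omega> - c\<bar> > e} < 1 / 2"
    by eventually_elim simp
  then obtain N where N: "measure P (A N) \<ge> 1 / 2" "measure P {\<omega> \<in> space P. \<bar>X N \<omega> - c\<bar> > e} < 1 / 2"
    unfolding eventually_sequentially by blast
  have m: "{\<omega> \<in> space P. \<bar>X N \<omega> - c\<bar> > e} \<in> sets P" using X[of N] by measurable
  have "\<not> A N \<subseteq> {\<omega> \<in> space P. \<bar>X N \<omega> - c\<bar> > e}"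
    using finite_measure_mono[OF _ m, of "A N"] N by force
  then show ?thesis using A(2)[of N] by (force simp: not_less)
qed

lemma conv_in_prob_nonneg:
  assumes P: "prob_space P" and X: "\<And>N. X N \<in> borel_measurable P" and c: "conv_in_prob P X c"
    and nn: "\<And>N \<omega>. 0 \<le> X N \<omega>"
  shows "0 \<le> c"
proof (rule field_le_epsilon)
  fix e :: real assume "e > 0"
  then obtain N \<omega> where "\<bar>X N \<omega> - c\<bar> \<le> e"
    using conv_in_prob_witness[OF P X c, of "\<lambda>_. space P" e] prob_space.prob_space[OF P] by auto
  then show "0 \<le> c + e" using nn[of N \<omega>] by linarith
qed

lemma conv_in_prob_unique:
  assumes P: "prob_space P" and X: "\<And>N. X N \<in> borel_measurable P" and c: "conv_in_prob P X c" "conv_in_prob P X c'"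
  shows "c = c'"
proof (rule ccontr)
  assume ne: "c \<noteq> c'"
  interpret prob_space P by fact
  define e where "e = \<bar>c - c'\<bar> / 3"
  have e: "e > 0" using ne by (simp add: e_def)
  have "(\<lambda>N. measure P {\<omega> \<in> space P. \<bar>X N \<omega> - c'\<bar> > e}) \<longlonglongrightarrow> 0" using c(2) e by (simp add: conv_in_prob_def)
  then have "\<forall>\<^sub>F N in sequentially. measure P {\<omega> \<in> space P. \<bar>X N \<omega> - c'\<bar> > e} < 1 / 2"
    by (rule order_tendstoD(2)) simp
  then have "\<forall>\<^sub>F N in sequentially. measure P (space P - {\<omega> \<in> space P. \<bar>X N \<omega> - c'\<bar> > e}) \<ge> 1 / 2"
  proof eventually_elim
    case (elim N)
    have "{\<omega> \<in> space P. \<bar>X N \<omega> - c'\<bar> > e} \<in> sets P" using X[of N] by measurable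
    then show ?case using elim by (simp add: prob_compl)
  qed
  from conv_in_prob_witness[OF P X c(1) this Diff_subset e] obtain N \<omega>
    where "\<omega> \<in> space P - {\<omega> \<in> space P. \<bar>X N \<omega> - c'\<bar> > e}" "\<bar>X N \<omega> - c\<bar> \<le> e"
    by blast
  then have "\<bar>X N \<omega> - c\<bar> \<le> e" "\<bar>X N \<omega> - c'\<bar> \<le> e" by auto
  moreover have "\<bar>c - c'\<bar> = 3 * e" by (simp add: e_def)
  ultimately show False using e by linarith
qed

lemma conv_in_prob_sum:
  assumes P: "prob_space P" and I: "finite I" and X: "\<And>i N. i \<in> I \<Longrightarrow> X i N \<in> borel_measurable P"
    and c: "\<And>i. i \<in> I \<Longrightarrow> conv_in_prob P (X i) (c i)"
  shows "conv_in_prob P (\<lambda>N \<omega>. \<Sum>i\<in>I. b i * X i N \<omega>) (\<Sum>i\<in>I. b i * c i)"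
  unfolding conv_in_prob_def
proof (intro allI impI)
  fix e :: real assume e: "e > 0"
  interpret prob_space P by fact
  \<comment> \<open>The tolerances give each summand a share \<open>e / (card I + 1)\<close>; both
    added ones avoid division by zero.\<close>
  define d where "d i = e / ((card I + 1) * (\<bar>b i\<bar> + 1))" for i
  have d: "d i > 0" for i using e by (simp add: d_def add_nonneg_pos)
  have lim: "(\<lambda>N. \<Sum>i\<in>I. measure P {\<omega> \<in> space P. \<bar>X i N \<omega> - c i\<bar> > d i}) \<longlonglongrightarrow> (\<Sum>i\<in>I. 0)"
    using c d by (intro tendsto_sum) (simp add: conv_in_prob_def)
  show "(\<lambda>N. measure P {\<omega> \<in> space P. \<bar>(\<Sum>i\<in>I. b i * X i N \<omega>) - (\<Sum>i\<in>I. b i * c i)\<bar> > e}) \<longlonglongrightarrow> 0"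
  proof (rule Lim_null_comparison[OF always_eventually[OF allI]])
    show "(\<lambda>N. \<Sum>i\<in>I. measure P {\<omega> \<in> space P. \<bar>X i N \<omega> - c i\<bar> > d i}) \<longlonglongrightarrow> 0" using lim by simp
    fix N
    have m: "{\<omega> \<in> space P. \<bar>X i N \<omega> - c i\<bar> > d i} \<in> sets P" if "i \<in> I" for i using X[OF that, of N] by measurable
    have "measure P {\<omega> \<in> space P. \<bar>(\<Sum>i\<in>I. b i * X i N \<omega>) - (\<Sum>i\<in>I. b i * c i)\<bar> > e} \<le> measure P (\<Union>i\<in>I. {\<omega> \<in> space P. \<bar>X i N \<omega> - c i\<bar> > d i})"
    proof (rule finite_measure_mono)
      show "(\<Union>i\<in>I. {\<omega> \<in> space P. \<bar>X i N \<omega> - c i\<bar> > d i}) \<in> sets P" using I m by (intro sets.finite_UN) auto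
      show "{\<omega> \<in> space P. \<bar>(\<Sum>i\<in>I. b i * X i N \<omega>) - (\<Sum>i\<in>I. b i * c i)\<bar> > e} \<subseteq> (\<Union>i\<in>I. {\<omega> \<in> space P. \<bar>X i N \<omega> - c i\<bar> > d i})"
      proof (rule subsetI, rule ccontr)
        fix \<omega> assume w: "\<omega> \<in> {\<omega> \<in> space P. \<bar>(\<Sum>i\<in>I. b i * X i N \<omega>) - (\<Sum>i\<in>I. b i * c i)\<bar> > e}"
          and "\<omega> \<notin> (\<Union>i\<in>I. {\<omega> \<in> space P. \<bar>X i N \<omega> - c i\<bar> > d i})"
        then have le: "\<bar>X i N \<omega> - c i\<bar> \<le> d i" if "i \<in> I" for i using that by (auto simp: not_less)
        have "\<bar>(\<Sum>i\<in>I. b i * X i N \<omega>) - (\<Sum>i\<in>I. b i * c i)\<bar> = \<bar>\<Sum>i\<in>I. b i * (X i N \<omega> - c i)\<bar>"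
          by (simp add: sum_subtractf right_diff_distrib)
        also have "\<dots> \<le> (\<Sum>i\<in>I. e / (card I + 1))"
        proof (rule order_trans[OF sum_abs sum_mono])
          fix i assume i: "i \<in> I"
          have "\<bar>b i * (X i N \<omega> - c i)\<bar> \<le> (\<bar>b i\<bar> + 1) * d i"
            unfolding abs_mult using le[OF i] by (intro mult_mono) auto
          also have "\<dots> = e / (card I + 1)" by (simp add: d_def field_simps add_nonneg_eq_0_iff)
          finally show "\<bar>b i * (X i N \<omega> - c i)\<bar> \<le> e / (card I + 1)" .
        qed
        also have "\<dots> \<le> e" using e by (simp add: field_simps)
        finally show False using w by simp
      qed
    qed
    also have "\<dots> \<le> (\<Sum>i\<in>I. measure P {\<omega> \<in> space P. \<bar>X i N \<omega> - c i\<bar> > d i})"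
      using I m by (intro measure_UNION_le) auto
    finally show "norm (measure P {\<omega> \<in> space P. \<bar>(\<Sum>i\<in>I. b i * X i N \<omega>) - (\<Sum>i\<in>I. b i * c i)\<bar> > e}) \<le> (\<Sum>i\<in>I. measure P {\<omega> \<in> space P. \<bar>X i N \<omega> - c i\<bar> > d i})"
      by simp
  qed
qed

subsection \<open>The characteristic function of a centred Bernoulli variable\<close>

text \<open>The quadratic and the cubic Taylor bound merged into the form of a Lindeberg
  term.\<close>

lemma iexp_second_order: "cmod (iexp x - (1 + \<i> * x - x\<^sup>2 / 2)) \<le> x\<^sup>2 * min 1 \<bar>x\<bar>"
proof -
  have s: "(\<Sum>k\<le>2. (\<i> * complex_of_real x) ^ k / fact k) = 1 + \<i> * x - x\<^sup>2 / 2"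
    by (simp add: numeral_2_eq_2 power2_eq_square complex_eq_iff)
  have "cmod (iexp x - (1 + \<i> * x - x\<^sup>2 / 2)) \<le> \<bar>x\<bar> ^ 3 / 6" "cmod (iexp x - (1 + \<i> * x - x\<^sup>2 / 2)) \<le> \<bar>x\<bar>\<^sup>2"
    using iexp_approx1[of x 2] iexp_approx2[of x 2] unfolding s by (simp_all add: fact_numeral)
  moreover have "\<bar>x\<bar> ^ 3 = x\<^sup>2 * \<bar>x\<bar>" "0 \<le> \<bar>x\<bar> ^ 3" "\<bar>x\<bar>\<^sup>2 = x\<^sup>2"
    by (simp_all add: power3_eq_cube power2_eq_square flip: abs_mult)
  ultimately have "cmod (iexp x - (1 + \<i> * x - x\<^sup>2 / 2)) \<le> x\<^sup>2 * \<bar>x\<bar>" "cmod (iexp x - (1 + \<i> * x - x\<^sup>2 / 2)) \<le> x\<^sup>2 * 1"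
    by linarith+
  then show ?thesis unfolding min_def by presburger
qed

lemma exp_minus_second_order:
  assumes "0 \<le> (y::real)" shows "\<bar>exp (- y) - (1 - y)\<bar> \<le> y * min 1 y"
proof -
  have "1 - y \<le> exp (- y)" using exp_ge_add_one_self[of "- y"] by simp
  moreover have "exp (- y) \<le> 1 / (1 + y)"
    using exp_ge_add_one_self[of y] assms by (simp add: exp_minus inverse_eq_divide frac_le)
  moreover have "1 / (1 + y) - (1 - y) = y * (y / (1 + y))" using assms by (simp add: field_simps add_nonneg_eq_0_iff)
  moreover have "y * (y / (1 + y)) \<le> y * min 1 y"
    using assms by (intro mult_left_mono) (auto simp: field_simps)
  ultimately show ?thesis by linarith
qed

text \<open>The variable equals \<open>(1 / p - 1) * c\<close> with probability \<open>p\<close> and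
  \<open>- c\<close> otherwise, so it has mean 0 and variance \<open>(1 / p - 1) * c^2\<close> and
  matches the Gaussian exponential to second order. The mixture of its two Taylor remainders and the
  remainder of the exponential are each at most \<open>b\<close>.\<close>

lemma char_centred_bernoulli:
  fixes p c C :: real
  assumes p: "0 < p" "p \<le> 1" and C: "1 \<le> C" "1 / p - 1 \<le> C"
  shows "cmod (p *\<^sub>R iexp ((1 / p - 1) * c) + (1 - p) *\<^sub>R iexp (- c) - of_real (exp (- ((1 / p - 1) * c\<^sup>2) / 2)))
    \<le> 2 * C ^ 3 * (c\<^sup>2 * min 1 \<bar>c\<bar>)"
proof -
  define w where "w = 1 / p - 1"
  define q where "q x = 1 + \<i> * complex_of_real x - (complex_of_real x)\<^sup>2 / 2" for x :: real
  define b where "b = C ^ 3 * (c\<^sup>2 * min 1 \<bar>c\<bar>)"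
  have w: "0 \<le> w" "w \<le> C" using p C by (auto simp: w_def)
  have m: "min 1 (C * \<bar>c\<bar>) \<le> C * min 1 \<bar>c\<bar>" 
  proof (cases "\<bar>c\<bar> \<le> 1")
    case False
    then have "1 * 1 \<le> C * \<bar>c\<bar>" using C(1) by (intro mult_mono) auto
    then show ?thesis using False C(1) by (simp add: min_def)
  qed (simp add: min_def)
  have bound: "cmod (iexp x - q x) \<le> b" if x: "\<bar>x\<bar> \<le> C * \<bar>c\<bar>" for x
  proof -
    have "x\<^sup>2 \<le> (C * \<bar>c\<bar>)\<^sup>2" using x by (metis abs_ge_zero power2_abs power_mono)
    moreover have "min 1 \<bar>x\<bar> \<le> C * min 1 \<bar>c\<bar>" using x m by (meson min.mono order_refl order_trans)
    ultimately have "x\<^sup>2 * min 1 \<bar>x\<bar> \<le> (C * \<bar>c\<bar>)\<^sup>2 * (C * min 1 \<bar>c\<bar>)" by (intro mult_mono) auto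
    moreover have "(C * \<bar>c\<bar>)\<^sup>2 * (C * min 1 \<bar>c\<bar>) = b"
    proof -
      have "(C * \<bar>c\<bar>)\<^sup>2 = C\<^sup>2 * c\<^sup>2" "C ^ 3 = C\<^sup>2 * C"
        by (simp_all add: power_mult_distrib eval_nat_numeral)
      then show ?thesis unfolding b_def by (simp only: mult_ac)
    qed
    ultimately show ?thesis using iexp_second_order[of x] unfolding q_def of_real_divide of_real_power of_real_numeral by linarith
  qed
  have b1: "cmod (iexp (w * c) - q (w * c)) \<le> b" using w by (intro bound) (auto simp: abs_mult intro!: mult_right_mono)
  have "1 * \<bar>c\<bar> \<le> C * \<bar>c\<bar>" using C by (intro mult_right_mono) auto
  then have b2: "cmod (iexp (- c) - q (- c)) \<le> b" by (intro bound) auto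
  define y where "y = w * c\<^sup>2 / 2"
  have y0: "0 \<le> y" using w by (simp add: y_def)
  have b3: "\<bar>exp (- y) - (1 - y)\<bar> \<le> b"
  proof -
    have "y \<le> C * c\<^sup>2 / 2" unfolding y_def using w by (intro divide_right_mono mult_right_mono) auto
    moreover have "0 \<le> C * c\<^sup>2" using C by simp
    ultimately have yC: "y \<le> C * c\<^sup>2" by linarith
    have "min 1 y \<le> C * min 1 \<bar>c\<bar>"
    proof (cases "\<bar>c\<bar> \<le> 1")
      case True
      have "c\<^sup>2 \<le> \<bar>c\<bar>" using power_decreasing[of 1 2 "\<bar>c\<bar>"] True by simp
      then have "C * c\<^sup>2 \<le> C * \<bar>c\<bar>" using C by (intro mult_left_mono) auto
      then show ?thesis using yC True by (simp add: min_def)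
    qed (use C in \<open>simp add: min_def\<close>)
    then have "y * min 1 y \<le> (C * c\<^sup>2) * (C * min 1 \<bar>c\<bar>)" using yC y0 by (intro mult_mono) auto
    also have "\<dots> = C ^ 2 * (c\<^sup>2 * min 1 \<bar>c\<bar>)" by (simp add: power2_eq_square mult_ac)
    also have "\<dots> \<le> b" unfolding b_def using C by (intro mult_right_mono power_increasing) auto
    finally show ?thesis using exp_minus_second_order[OF y0] by linarith
  qed
  have pw: "p * w = 1 - p" using p by (simp add: w_def field_simps)
  have id: "p *\<^sub>R q (w * c) + (1 - p) *\<^sub>R q (- c) = of_real (1 - y)"
  proof -
    have "p *\<^sub>R q (w * c) + (1 - p) *\<^sub>R q (- c) =
      of_real (p + (1 - p)) + \<i> * of_real (p * w * c - (1 - p) * c) - of_real (p * w * (w * c\<^sup>2) + (1 - p) * c\<^sup>2) / 2"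
      by (simp add: q_def scaleR_conv_of_real algebra_simps power2_eq_square add_divide_distrib diff_divide_distrib)
    also have "p * w * c - (1 - p) * c = 0" unfolding pw by simp
    also have "p * w * (w * c\<^sup>2) + (1 - p) * c\<^sup>2 = w * c\<^sup>2"
    proof -
      have "p * w * (w * c\<^sup>2) + (1 - p) * c\<^sup>2 = (p * w) * (w * c\<^sup>2) + (p * w) * c\<^sup>2" unfolding pw ..
      also have "\<dots> = (p * (w + 1)) * (w * c\<^sup>2)" by (simp add: algebra_simps)
      also have "p * (w + 1) = 1" using p by (simp add: w_def)
      finally show ?thesis by simp
    qed
    finally show ?thesis by (simp add: y_def)
  qed
  have "p *\<^sub>R iexp (w * c) + (1 - p) *\<^sub>R iexp (- c) - of_real (exp (- y))
     = p *\<^sub>R (iexp (w * c) - q (w * c)) + (1 - p) *\<^sub>R (iexp (- c) - q (- c)) - of_real (exp (- y) - (1 - y))"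
    using id by (simp add: scaleR_diff_right algebra_simps)
  also have "cmod \<dots> \<le> cmod (p *\<^sub>R (iexp (w * c) - q (w * c))) + cmod ((1 - p) *\<^sub>R (iexp (- c) - q (- c))) + cmod (of_real (exp (- y) - (1 - y)))"
    by (meson norm_triangle_ineq norm_triangle_ineq4 add_mono order_refl order_trans)
  also have "\<dots> \<le> p * b + (1 - p) * b + b"
    using b1 b2 b3 p unfolding norm_scaleR norm_of_real by (intro add_mono mult_mono) auto
  also have "\<dots> = 2 * b" by (simp add: algebra_simps)
  finally show ?thesis by (simp add: w_def y_def b_def)
qed

subsection \<open>Asymptotic equicontinuity of the Horvitz--Thompson process\<close>

locale ht_design = poisson_design Pyx Pd D Pe \<pi> enum
  for Pyx :: "('y::{banach, second_countable_topology} \<times> 'x::{banach, second_countable_topology}) measure"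
    and Pd :: "'d measure" and D :: "'d \<Rightarrow> real" and Pe :: "'e measure"
    and \<pi> :: "'x incl_probs" and enum :: "nat \<Rightarrow> nat \<Rightarrow> nat \<Rightarrow> nat" +
  fixes F :: "('y \<Rightarrow> real) set" and \<Sigma>' :: "('y \<Rightarrow> real) \<Rightarrow> ('y \<Rightarrow> real) \<Rightarrow> real" and L :: real
  assumes F_meas: "F \<subseteq> borel_measurable borel"
    and F_donsker: "donsker (law_Y Pyx) F"
    and cov_limit: "\<And>f g. f \<in> F \<Longrightarrow> g \<in> F \<Longrightarrow>
      conv_in_prob (sample_space Pyx Pd Pe) (HT_cov Pd \<pi> enum D F f g) (\<Sigma>' f g)"
    and L_pos: "L > 0"
    and incl_bound: "(\<lambda>N. measure (sample_space Pyx Pd Pe)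
        {\<omega> \<in> space (sample_space Pyx Pd Pe). (MIN i\<in>{..<N}. \<pi> N i (Xvec N \<omega>)) \<ge> L}) \<longlonglongrightarrow> 1"
    and mean_bound: "bdd_above ((\<lambda>f. \<bar>integral\<^sup>L (law_Y Pyx) f\<bar>) ` F)"
    and F_ne: "F \<noteq> {}"
begin

sublocale Om: prob_space Om by (rule prob_space_Om)
sublocale XY: prob_space XY by (rule prob_space_XY)

definition HT :: "nat \<Rightarrow> ('y, 'x, 'd, 'e) sample \<Rightarrow> ('y \<Rightarrow> real) \<Rightarrow> real" where
  "HT = HT_process \<pi> enum D F"

definition ys :: "(nat \<Rightarrow> 'y \<times> 'x) \<Rightarrow> nat \<Rightarrow> 'y" where
  "ys u i = fst (u i)"

lemma HT_eq:
  "f \<in> F \<Longrightarrow> HT N \<omega> f =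
     1 / sqrt N * (\<Sum>i<N. incl_weight \<pi> N (xv N (fst \<omega>)) (Svec \<pi> enum D N \<omega>) i * f (ys (fst \<omega>) i))"
  by (simp add: HT_def HT_process_eq ys_def)

lemma F_abs_bdd: "\<exists>B. \<forall>f\<in>F. \<bar>f y\<bar> \<le> B"
  by (rule donsker_abs_bdd[OF F_donsker mean_bound]) (simp add: law_Y_def)

lemma HT_mem: "HT N \<omega> \<in> mspace (linf F)"
proof -
  obtain B where B: "\<And>y f. f \<in> F \<Longrightarrow> \<bar>f y\<bar> \<le> B y" using F_abs_bdd by metis
  have "\<bar>HT N \<omega> f\<bar> \<le> 1 / sqrt N * (\<Sum>i<N. \<bar>incl_weight \<pi> N (xv N (fst \<omega>)) (Svec \<pi> enum D N \<omega>) i\<bar> * B (ys (fst \<omega>) i))"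
    if f: "f \<in> F" for f
  proof -
    have "\<bar>\<Sum>i<N. incl_weight \<pi> N (xv N (fst \<omega>)) (Svec \<pi> enum D N \<omega>) i * f (ys (fst \<omega>) i)\<bar>
       \<le> (\<Sum>i<N. \<bar>incl_weight \<pi> N (xv N (fst \<omega>)) (Svec \<pi> enum D N \<omega>) i\<bar> * B (ys (fst \<omega>) i))"
      using B[OF f] by (intro order_trans[OF sum_abs] sum_mono) (auto simp: abs_mult intro!: mult_left_mono)
    then show ?thesis unfolding HT_eq[OF f] abs_mult by (intro mult_mono) auto
  qed
  moreover have "HT N \<omega> \<in> extensional F" by (simp add: HT_def HT_process_def)
  ultimately show ?thesis unfolding mem_linf by blast
qed

lemma measurable_ys: "(\<lambda>u. ys u i) \<in> measurable XY borel"
  unfolding ys_def by (rule measurable_compose[OF _ measurable_fst_Pyx]) (rule measurable_component_singleton, simp)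

lemma measurable_ys_seq: "ys \<in> measurable XY (PiM UNIV (\<lambda>_. Q))" "distr XY (PiM UNIV (\<lambda>_. Q)) ys = PiM UNIV (\<lambda>_. Q)"
  using measurable_yseq distr_yseq unfolding ys_def[abs_def] by blast+

lemma measurable_incl_weight: "i < N \<Longrightarrow> (\<lambda>u. incl_weight \<pi> N (xv N u) s i) \<in> borel_measurable XY"
  unfolding incl_weight_def using incl_prob_measurable by measurable

lemma measurable_ht_sum:
  assumes f: "f \<in> borel_measurable borel"
  shows "(\<lambda>u. 1 / sqrt N * (\<Sum>i<N. incl_weight \<pi> N (xv N u) s i * f (ys u i))) \<in> borel_measurable XY"
  by (intro borel_measurable_times borel_measurable_const borel_measurable_sum measurable_incl_weight
      measurable_compose[OF measurable_ys f]) simp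

lemma HT_measurable: "f \<in> F \<Longrightarrow> (\<lambda>\<omega>. HT N \<omega> f) \<in> borel_measurable Om"
proof -
  assume f: "f \<in> F"
  then have "f \<in> borel_measurable borel" using F_meas by auto
  from measurable_design[OF measurable_compose[OF measurable_fst_Om measurable_ht_sum[OF this]]]
  show ?thesis unfolding HT_eq[OF f] .
qed

lemma measure_Om_fst: "A \<in> sets XY \<Longrightarrow> measure Om {\<omega>\<in>space Om. fst \<omega> \<in> A} = measure XY A"
proof -
  assume A: "A \<in> sets XY"
  have "measure XY A = measure (distr Om XY fst) A" by (simp add: distr_fst_Om)
  also have "\<dots> = measure Om (fst -` A \<inter> space Om)" by (rule measure_distr[OF measurable_fst_Om A])
  also have "fst -` A \<inter> space Om = {\<omega>\<in>space Om. fst \<omega> \<in> A}" by auto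
  finally show ?thesis by simp
qed

definition Gd :: "nat \<Rightarrow> (nat \<Rightarrow> 'y \<times> 'x) set" where
  "Gd N = {u\<in>space XY. \<forall>i<N. L \<le> \<pi> N i (xv N u)}"

lemma Gd_sets [measurable]: "Gd N \<in> sets XY"
proof -
  have "Gd N = space XY \<inter> (\<Inter>i\<in>{..<N}. {u\<in>space XY. L \<le> \<pi> N i (xv N u)})" by (auto simp: Gd_def)
  moreover have "{u\<in>space XY. L \<le> \<pi> N i (xv N u)} \<in> sets XY" if "i < N" for i
    using incl_prob_measurable[OF that] by measurable
  ultimately show ?thesis by (cases "N = 0") (auto intro!: sets.finite_INT)
qed

lemma Gd_prob: "(\<lambda>N. measure XY (space XY - Gd N)) \<longlonglongrightarrow> 0"
proof -
  have "\<forall>\<^sub>F N in sequentially. measure XY (Gd N) = measure Om {\<omega> \<in> space Om. (MIN i\<in>{..<N}. \<pi> N i (Xvec N \<omega>)) \<ge> L}"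
  \<comment> \<open>The minimum over an empty index set is unspecified, so \<open>N = 0\<close> is
    left out.\<close>
  proof (rule eventually_sequentiallyI[of 1])
    fix N :: nat assume "1 \<le> N"
    then have "(MIN i\<in>{..<N}. \<pi> N i (Xvec N \<omega>)) \<ge> L \<longleftrightarrow> (\<forall>i<N. L \<le> \<pi> N i (Xvec N \<omega>))" for \<omega> :: "('y, 'x, 'd, 'e) sample"
      by (subst Min_ge_iff) (auto simp: lessThan_empty_iff)
    then show "measure XY (Gd N) = measure Om {\<omega> \<in> space Om. (MIN i\<in>{..<N}. \<pi> N i (Xvec N \<omega>)) \<ge> L}"
      unfolding measure_Om_fst[OF Gd_sets, symmetric] by (simp add: Gd_def Xvec_eq space_XY)
  qed
  then have "(\<lambda>N. measure XY (Gd N)) \<longlonglongrightarrow> 1" using incl_bound by (simp add: filterlim_cong)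
  then have "(\<lambda>N. 1 - measure XY (Gd N)) \<longlonglongrightarrow> 1 - 1" by (intro tendsto_intros)
  then show ?thesis by (simp add: XY.prob_compl)
qed

text \<open>Where all inclusion probabilities are at least \<open>L\<close>, this bounds the weights
  and their variances alike; the summand 1 secures \<open>1 <= C\<close>.\<close>

definition C :: real where "C = 1 / L + 1"

lemma C_ge: "1 \<le> C" "1 / L \<le> C" using L_pos by (auto simp: C_def)

lemma incl_weight_le:
  assumes "u \<in> Gd N" "s \<in> binary_vectors N" "i < N"
  shows "\<bar>incl_weight \<pi> N (xv N u) s i\<bar> \<le> C"
proof -
  have p: "0 < \<pi> N i (xv N u)" "\<pi> N i (xv N u) \<le> 1" "L \<le> \<pi> N i (xv N u)"
    using incl_prob_bounds[OF assms(3), of u] assms by (auto simp: Gd_def)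
  have "1 / \<pi> N i (xv N u) \<le> 1 / L" "1 \<le> 1 / \<pi> N i (xv N u)" using p L_pos by (auto simp: frac_le)
  moreover have "s i = 0 \<or> s i = 1" using assms(2,3) by (auto simp: binary_vectors_def PiE_iff)
  ultimately show ?thesis using C_ge by (auto simp: incl_weight_def)
qed

text \<open>On the null event \<open>D > 1\<close> the sample vector may fail to be binary. The
  probability of a binary vector is the total mass of the design, which is 1.\<close>

lemma AE_Svec: "AE \<omega> in Om. Svec \<pi> enum D N \<omega> \<in> binary_vectors N"
proof -
  have m: "(\<lambda>\<omega>. of_bool (Svec \<pi> enum D N \<omega> \<in> binary_vectors N) :: real) \<in> borel_measurable Om"
    by (rule measurable_design[where G = "\<lambda>s _. of_bool (s \<in> binary_vectors N)"]) simp
  have "(\<integral>\<omega>. (of_bool (Svec \<pi> enum D N \<omega> \<in> binary_vectors N) :: real) \<partial>Om) = (\<integral>u. design_mean \<pi> N (xv N u) (\<lambda>s. of_bool (s \<in> binary_vectors N)) \<partial>XY)"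
    by (rule integral_design[where G = "\<lambda>s _. of_bool (s \<in> binary_vectors N)" and b = 1]) auto
  also have "\<dots> = (\<integral>u. 1 \<partial>XY)"
  proof (intro Bochner_Integration.integral_cong refl)
    fix u
    have "design_mean \<pi> N (xv N u) (\<lambda>s. of_bool (s \<in> binary_vectors N) :: real) = design_mean \<pi> N (xv N u) (\<lambda>s. 1)"
      unfolding design_mean_def by (intro sum.cong) auto
    then show "design_mean \<pi> N (xv N u) (\<lambda>s. of_bool (s \<in> binary_vectors N) :: real) = 1" by (simp add: design_mean_one)
  qed
  finally have i1: "(\<integral>\<omega>. of_bool (Svec \<pi> enum D N \<omega> \<in> binary_vectors N) \<partial>Om) = (1 :: real)" by (simp add: XY.prob_space)
  have i: "integrable Om (\<lambda>\<omega>. of_bool (Svec \<pi> enum D N \<omega> \<in> binary_vectors N) :: real)"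
    by (rule Om.AE_bounded_integrable[OF m, of 1]) auto
  have "(\<integral>\<omega>. 1 - of_bool (Svec \<pi> enum D N \<omega> \<in> binary_vectors N) \<partial>Om) = (0 :: real)"
    using i i1 by (simp add: Om.prob_space)
  then have "AE \<omega> in Om. 1 - of_bool (Svec \<pi> enum D N \<omega> \<in> binary_vectors N) = (0 :: real)"
    by (subst (asm) integral_nonneg_eq_0_iff_AE) (use i in auto)
  then show ?thesis by eventually_elim (auto split: if_splits)
qed

text \<open>The weight is a product of factors depending on different indicators; each is affine in
  a centred variable, so its mean is 1/2 whatever the sign.\<close>

lemma design_mean_sign_weight:
  "design_mean \<pi> N (xv N u) (\<lambda>s. sign_weight N (\<lambda>i. incl_weight \<pi> N (xv N u) s i / c) e) = 1 / 2 ^ N"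
proof -
  have "design_mean \<pi> N (xv N u) (\<lambda>s. sign_weight N (\<lambda>i. incl_weight \<pi> N (xv N u) s i / c) e) =
    (\<Prod>i<N. \<pi> N i (xv N u) * ((1 + e i * ((real 1 / \<pi> N i (xv N u) - 1) / c)) / 2)
       + (1 - \<pi> N i (xv N u)) * ((1 + e i * ((real 0 / \<pi> N i (xv N u) - 1) / c)) / 2))"
    unfolding sign_weight_def incl_weight_def
    using design_mean_prod[of \<pi> N "xv N u" "\<lambda>i b. (1 + e i * ((real b / \<pi> N i (xv N u) - 1) / c)) / 2"] by simp
  also have "\<dots> = (\<Prod>i<N. 1 / 2)"
  proof (intro prod.cong refl)
    fix i assume "i \<in> {..<N}"
    then have "\<pi> N i (xv N u) \<noteq> 0" using incl_prob_bounds[of i N u] by auto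
    then show "\<pi> N i (xv N u) * ((1 + e i * ((real 1 / \<pi> N i (xv N u) - 1) / c)) / 2)
       + (1 - \<pi> N i (xv N u)) * ((1 + e i * ((real 0 / \<pi> N i (xv N u) - 1) / c)) / 2) = 1 / 2"
      by (cases "c = 0") (simp_all add: field_simps)
  qed
  finally show ?thesis by (simp add: power_divide)
qed

text \<open>Three exceptional events share \<open>\<eta>\<close>: some inclusion probability is
  below \<open>L\<close>, the sign average of the majorants is large, or the mixture
  \<open>R\<close> exceeds \<open>t\<close> although its design mean is small. Off them
  \<open>R\<close> dominates the oscillation almost surely.\<close>

lemma HT_osc:
  assumes t: "t > 0" and \<eta>: "\<eta> > 0"
  shows "\<exists>r. finite (r ` F) \<and> r ` F \<subseteq> F \<and> (\<forall>f\<in>F. r (r f) = r f) \<and>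
    (\<forall>\<^sub>F N in sequentially. outer_small Om {\<omega>. osc F r (HT N \<omega>) > t} \<eta>)"
proof -
  let ?PQ = "PiM UNIV (\<lambda>_::nat. Q)"
  \<comment> \<open>At this level the design mean of \<open>R\<close> is at most
    \<open>C * t'\<close>, and Markov's inequality gives exactly \<open>\<eta> / 3\<close>.\<close>
  define t' where "t' = \<eta> * t / (3 * C)"
  have t': "t' > 0" "C * t' / t = \<eta> / 3" using t \<eta> C_ge by (auto simp: t'_def)
  have \<eta>3: "\<eta> / 3 > 0" using \<eta> by simp
  obtain r where r0: "finite (r ` F) \<and> r ` F \<subseteq> F \<and> (\<forall>f\<in>F. r (r f) = r f) \<and>
    (\<forall>\<^sub>F N in sequentially. \<exists>U. (\<forall>e\<in>signs N. U e \<in> borel_measurable ?PQ \<and> (\<forall>z. 0 \<le> U e z)) \<and>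
      (AE z in ?PQ. \<forall>e\<in>signs N. sup_signed F r N e z \<le> U e z) \<and>
      measure ?PQ {z\<in>space ?PQ. sign_avg N (\<lambda>e. U e z) > t'} \<le> \<eta> / 3)"
    using donsker_sign_majorant[OF prob_space_Q F_donsker F_ne mean_bound t'(1) \<eta>3] ..
  then have r: "finite (r ` F)" "r ` F \<subseteq> F" "\<forall>f\<in>F. r (r f) = r f"
    and ev: "\<forall>\<^sub>F N in sequentially. \<exists>U. (\<forall>e\<in>signs N. U e \<in> borel_measurable ?PQ \<and> (\<forall>z. 0 \<le> U e z)) \<and>
      (AE z in ?PQ. \<forall>e\<in>signs N. sup_signed F r N e z \<le> U e z) \<and>
      measure ?PQ {z\<in>space ?PQ. sign_avg N (\<lambda>e. U e z) > t'} \<le> \<eta> / 3"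
    by blast+
  have "\<forall>\<^sub>F N in sequentially. measure XY (space XY - Gd N) < \<eta> / 3"
    by (rule order_tendstoD(2)[OF Gd_prob \<eta>3])
  with ev have "\<forall>\<^sub>F N in sequentially. outer_small Om {\<omega>. osc F r (HT N \<omega>) > t} \<eta>"
  proof eventually_elim
    case (elim N)
    obtain U where U: "\<And>e. e \<in> signs N \<Longrightarrow> U e \<in> borel_measurable ?PQ" "\<And>e z. e \<in> signs N \<Longrightarrow> 0 \<le> U e z"
      "AE z in ?PQ. \<forall>e\<in>signs N. sup_signed F r N e z \<le> U e z"
      "measure ?PQ {z\<in>space ?PQ. sign_avg N (\<lambda>e. U e z) > t'} \<le> \<eta> / 3"
      using elim(1) by blast
    define W where "W s u e = sign_weight N (\<lambda>i. incl_weight \<pi> N (xv N u) s i / C) e" for s u e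
    define R where "R s u = C * (\<Sum>e\<in>signs N. W s u e * U e (ys u))" for s u
    define A1 where "A1 = {u\<in>space XY. sign_avg N (\<lambda>e. U e (ys u)) > t'}"
    have Uys: "(\<lambda>u. U e (ys u)) \<in> borel_measurable XY" if "e \<in> signs N" for e
      by (rule measurable_compose[OF measurable_ys_seq(1) U(1)[OF that]])
    have Wm: "(\<lambda>u. W s u e) \<in> borel_measurable XY" for s e
      unfolding W_def sign_weight_def using measurable_incl_weight
      by (intro borel_measurable_prod borel_measurable_divide borel_measurable_add borel_measurable_times borel_measurable_const) auto
    have Rm [measurable]: "R s \<in> borel_measurable XY" for s
      unfolding R_def[abs_def] by (intro borel_measurable_times borel_measurable_const borel_measurable_sum Wm Uys)
    have avgm: "(\<lambda>z. sign_avg N (\<lambda>e. U e z)) \<in> borel_measurable ?PQ"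
      unfolding sign_avg_eq_sum using U(1) by (intro borel_measurable_divide borel_measurable_sum) auto
    have A1m [measurable]: "A1 \<in> sets XY"
      unfolding A1_def using measurable_compose[OF measurable_ys_seq(1) avgm] by measurable
    have A1p: "measure XY A1 \<le> \<eta> / 3"
    proof -
      have S: "{z\<in>space ?PQ. sign_avg N (\<lambda>e. U e z) > t'} \<in> sets ?PQ" using avgm by measurable
      have "A1 = ys -` {z\<in>space ?PQ. sign_avg N (\<lambda>e. U e z) > t'} \<inter> space XY"
        using measurable_space[OF measurable_ys_seq(1)] by (auto simp: A1_def)
      then have "measure XY A1 = measure (distr XY ?PQ ys) {z\<in>space ?PQ. sign_avg N (\<lambda>e. U e z) > t'}"
        using measure_distr[OF measurable_ys_seq(1) S] by simp
      then show ?thesis using U(4) by (simp add: measurable_ys_seq(2))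
    qed
    have W0: "0 \<le> W s u e" if "u \<in> Gd N" "s \<in> binary_vectors N" "e \<in> signs N" for s u e
      unfolding W_def using incl_weight_le[OF that(1,2)] C_ge
      by (intro sign_weight_nonneg[OF that(3)]) (simp add: abs_divide divide_le_eq)
    have R0: "0 \<le> R s u" if "u \<in> Gd N" "s \<in> binary_vectors N" for s u
      unfolding R_def using W0[OF that] U(2) C_ge by (intro mult_nonneg_nonneg sum_nonneg) auto
    have Rmean: "design_mean \<pi> N (xv N u) (\<lambda>s. R s u) = C * sign_avg N (\<lambda>e. U e (ys u))" for u
    proof -
      have "design_mean \<pi> N (xv N u) (\<lambda>s. R s u) = C * (\<Sum>e\<in>signs N. U e (ys u) * design_mean \<pi> N (xv N u) (\<lambda>s. W s u e))"
        unfolding R_def design_mean_cmult design_mean_sum by (simp add: design_mean_cmult[symmetric] mult.commute)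
      then show ?thesis unfolding W_def design_mean_sign_weight sign_avg_eq_sum by (simp add: sum_divide_distrib)
    qed
    define B where "B = {\<omega>\<in>space Om. fst \<omega> \<in> space XY - Gd N} \<union> {\<omega>\<in>space Om. fst \<omega> \<in> A1} \<union>
       {\<omega>\<in>space Om. fst \<omega> \<in> Gd N - A1 \<and> R (Svec \<pi> enum D N \<omega>) (fst \<omega>) > t}"
    have fm [measurable]: "fst \<in> measurable Om XY" by (rule measurable_fst_Om)
    define g where "g s u = (of_bool (u \<in> Gd N - A1 \<and> R s u > t) :: real)" for s u
    have gm: "g s \<in> borel_measurable XY" for s
    proof -
      have "{u\<in>space XY. u \<in> Gd N - A1 \<and> R s u > t} \<in> sets XY" by measurable
      then have "indicator {u\<in>space XY. u \<in> Gd N - A1 \<and> R s u > t} \<in> borel_measurable XY" by (rule borel_measurable_indicator)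
      moreover have "g s = indicator {u\<in>space XY. u \<in> Gd N - A1 \<and> R s u > t}"
        by (auto simp: g_def indicator_def space_XY)
      ultimately show ?thesis by simp
    qed
    have gom: "(\<lambda>\<omega>. g (Svec \<pi> enum D N \<omega>) (fst \<omega>)) \<in> borel_measurable Om"
      by (rule measurable_design[where G = "\<lambda>s \<omega>. g s (fst \<omega>)"]) (rule measurable_compose[OF fm gm])
    have S3: "{\<omega>\<in>space Om. fst \<omega> \<in> Gd N - A1 \<and> R (Svec \<pi> enum D N \<omega>) (fst \<omega>) > t} \<in> sets Om"
    proof -
      have "{\<omega>\<in>space Om. g (Svec \<pi> enum D N \<omega>) (fst \<omega>) = 1} \<in> sets Om" using gom by measurable
      then show ?thesis by (simp add: g_def)
    qed
    have P3: "measure Om {\<omega>\<in>space Om. fst \<omega> \<in> Gd N - A1 \<and> R (Svec \<pi> enum D N \<omega>) (fst \<omega>) > t} \<le> \<eta> / 3"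
    proof -
      have "measure Om {\<omega>\<in>space Om. fst \<omega> \<in> Gd N - A1 \<and> R (Svec \<pi> enum D N \<omega>) (fst \<omega>) > t}
         = (\<integral>\<omega>. indicator {\<omega>\<in>space Om. fst \<omega> \<in> Gd N - A1 \<and> R (Svec \<pi> enum D N \<omega>) (fst \<omega>) > t} \<omega> \<partial>Om)"
        using S3 by simp
      also have "\<dots> = (\<integral>\<omega>. g (Svec \<pi> enum D N \<omega>) (fst \<omega>) \<partial>Om)"
        by (intro Bochner_Integration.integral_cong) (auto simp: g_def indicator_def)
      also have "\<dots> = (\<integral>u. design_mean \<pi> N (xv N u) (\<lambda>s. g s u) \<partial>XY)"
        by (rule integral_design[OF gm, where b = 1]) (simp add: g_def)
      also have "\<dots> \<le> (\<integral>u. \<eta> / 3 \<partial>XY)"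
      proof (rule integral_mono)
        have "(\<lambda>u. design_mean \<pi> N (xv N u) (\<lambda>s. g s u)) \<in> borel_measurable XY"
          unfolding design_mean_def by (intro borel_measurable_sum borel_measurable_scaleR design_prob_measurable gm)
        moreover have "\<bar>design_mean \<pi> N (xv N u) (\<lambda>s. g s u)\<bar> \<le> 1" for u
        proof -
          have "\<bar>design_mean \<pi> N (xv N u) (\<lambda>s. g s u)\<bar> \<le> (\<Sum>s\<in>binary_vectors N. design_prob \<pi> N s (xv N u) *\<^sub>R 1)"
            unfolding design_mean_def using design_prob_nonneg
            by (intro order_trans[OF sum_abs] sum_mono) (auto simp: g_def)
          then show ?thesis using design_mean_one[of \<pi> N "xv N u"] by (simp add: design_mean_def)
        qed
        ultimately show "integrable XY (\<lambda>u. design_mean \<pi> N (xv N u) (\<lambda>s. g s u))"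
          by (intro XY.AE_bounded_integrable[of _ 1]) auto
        fix u
        show "design_mean \<pi> N (xv N u) (\<lambda>s. g s u) \<le> \<eta> / 3"
        proof (cases "u \<in> Gd N - A1")
          case True
          have "design_mean \<pi> N (xv N u) (\<lambda>s. g s u) \<le> design_mean \<pi> N (xv N u) (\<lambda>s. (1 / t) * R s u)"
            unfolding design_mean_def
          proof (rule sum_mono, rule scaleR_left_mono[OF _ design_prob_nonneg])
            fix s assume "s \<in> binary_vectors N"
            then have "0 \<le> R s u" using R0 True by auto
            then show "g s u \<le> (1 / t) * R s u" using t by (auto simp: g_def)
          qed
          also have "\<dots> = C / t * sign_avg N (\<lambda>e. U e (ys u))" unfolding design_mean_cmult Rmean by simp
          also have "\<dots> \<le> C / t * t'" using True t C_ge by (intro mult_left_mono) (auto simp: A1_def space_XY)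
          finally show ?thesis using t'(2) by simp
        next
          case False
          then have "g s u = 0" for s by (auto simp: g_def)
          then show ?thesis using \<eta> by (simp add: design_mean_def)
        qed
      qed simp
      finally show ?thesis by (simp add: XY.prob_space)
    qed
    have S1: "{\<omega>\<in>space Om. fst \<omega> \<in> space XY - Gd N} \<in> sets Om" "{\<omega>\<in>space Om. fst \<omega> \<in> A1} \<in> sets Om" by measurable
    have "measure Om B \<le> measure Om {\<omega>\<in>space Om. fst \<omega> \<in> space XY - Gd N} + measure Om {\<omega>\<in>space Om. fst \<omega> \<in> A1} +
        measure Om {\<omega>\<in>space Om. fst \<omega> \<in> Gd N - A1 \<and> R (Svec \<pi> enum D N \<omega>) (fst \<omega>) > t}"
      unfolding B_def using S1 S3 by (intro order_trans[OF measure_Un_le] add_mono measure_Un_le order_refl) auto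
    also have "\<dots> \<le> \<eta>"
      using elim(2) A1p P3 measure_Om_fst[of "space XY - Gd N"] measure_Om_fst[OF A1m] by simp
    finally have "outer_small Om B \<eta>"
      using S1 S3 by (intro outer_smallI[of B]) (auto simp: B_def)
    moreover have "AE \<omega> in Om. \<omega> \<in> {\<omega>. osc F r (HT N \<omega>) > t} \<longrightarrow> \<omega> \<in> B"
    proof -
      have "AE z in distr XY ?PQ ys. \<forall>e\<in>signs N. sup_signed F r N e z \<le> U e z"
        unfolding measurable_ys_seq(2) by (rule U(3))
      from AE_distrD[OF measurable_ys_seq(1) this]
      have "AE u in distr Om XY fst. \<forall>e\<in>signs N. sup_signed F r N e (ys u) \<le> U e (ys u)"
        unfolding distr_fst_Om .
      from AE_distrD[OF fm this] AE_Svec[of N] AE_space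
      show ?thesis
      proof eventually_elim
        case (elim \<omega>)
        show ?case
        proof (rule impI, rule ccontr)
          assume big: "\<omega> \<in> {\<omega>. osc F r (HT N \<omega>) > t}" and nB: "\<omega> \<notin> B"
          let ?u = "fst \<omega>" and ?s = "Svec \<pi> enum D N \<omega>"
          have G: "?u \<in> Gd N" and Rt: "R ?s ?u \<le> t" using nB elim(3) by (auto simp: B_def space_XY)
          have yin: "ys ?u \<in> space ?PQ" using measurable_space[OF measurable_ys_seq(1)] by (simp add: space_XY)
          have "osc F r (HT N \<omega>) \<le> t"
          proof (rule osc_le[OF F_ne])
            fix f assume f: "f \<in> F"
            have rf: "r f \<in> F" using f r by auto
            let ?c = "\<lambda>i. f (ys ?u i) - r f (ys ?u i)"
            have "(\<Sum>i<N. incl_weight \<pi> N (xv N ?u) ?s i * ?c i) = C * (\<Sum>i<N. incl_weight \<pi> N (xv N ?u) ?s i / C * ?c i)"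
              using C_ge by (simp add: sum_distrib_left)
            also have "\<dots> = C * (\<Sum>e\<in>signs N. W ?s ?u e * (\<Sum>i<N. e i * ?c i))"
              unfolding W_def sum_sign_weight_mult ..
            finally have HTd: "HT N \<omega> f - HT N \<omega> (r f) = C * (\<Sum>e\<in>signs N. W ?s ?u e * (1 / sqrt N * (\<Sum>i<N. e i * ?c i)))"
              unfolding HT_eq[OF f] HT_eq[OF rf]
              by (simp add: right_diff_distrib[symmetric] diff_divide_distrib[symmetric] sum_subtractf[symmetric] sum_divide_distrib[symmetric])
            have "\<bar>HT N \<omega> f - HT N \<omega> (r f)\<bar> \<le> C * (\<Sum>e\<in>signs N. W ?s ?u e * U e (ys ?u))"
            proof -
              have "\<bar>\<Sum>e\<in>signs N. W ?s ?u e * (1 / sqrt N * (\<Sum>i<N. e i * ?c i))\<bar> \<le> (\<Sum>e\<in>signs N. W ?s ?u e * U e (ys ?u))"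
              proof (rule order_trans[OF sum_abs sum_mono])
                fix e assume e: "e \<in> signs N"
                have "\<bar>1 / sqrt N * (\<Sum>i<N. e i * ?c i)\<bar> \<le> sup_signed F r N e (ys ?u)"
                  by (rule le_sup_signed[OF prob_space_Q F_donsker F_ne r(2) mean_bound yin f])
                also have "\<dots> \<le> U e (ys ?u)" using elim(1) e by blast
                finally have "W ?s ?u e * \<bar>1 / sqrt N * (\<Sum>i<N. e i * ?c i)\<bar> \<le> W ?s ?u e * U e (ys ?u)"
                  by (rule mult_left_mono[OF _ W0[OF G elim(2) e]])
                then show "\<bar>W ?s ?u e * (1 / sqrt N * (\<Sum>i<N. e i * ?c i))\<bar> \<le> W ?s ?u e * U e (ys ?u)"
                  unfolding abs_mult[of "W ?s ?u e"] abs_of_nonneg[OF W0[OF G elim(2) e]] .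
              qed
              then show ?thesis using C_ge unfolding HTd abs_mult[of C] by (intro mult_mono) auto
            qed
            also have "\<dots> = R ?s ?u" by (simp add: R_def)
            finally show "\<bar>HT N \<omega> f - HT N \<omega> (r f)\<bar> \<le> t" using Rt by linarith
          qed
          then show False using big by simp
        qed
      qed
    qed
    ultimately show ?case by (rule AE_imp_outer_small_cong[OF Om.prob_space_axioms])
  qed
  then show ?thesis using r by blast
qed

end

subsection \<open>Finite-dimensional limits of the Horvitz--Thompson process\<close>

lemma exp_minus_lipschitz:
  assumes "0 \<le> (a::real)" "0 \<le> b"
  shows "\<bar>exp (- a) - exp (- b)\<bar> \<le> \<bar>a - b\<bar>"
proof -
  have *: "exp (- x) - exp (- y) \<le> y - x" if "0 \<le> x" "x \<le> y" for x y :: real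
  proof -
    have "exp (- y) = exp (- x) * exp (- (y - x))" by (simp add: exp_add[symmetric])
    then have "exp (- x) - exp (- y) = exp (- x) * (1 - exp (- (y - x)))" by (simp add: algebra_simps)
    also have "\<dots> \<le> 1 * (y - x)"
    proof (rule mult_mono)
      show "1 - exp (- (y - x)) \<le> y - x" using exp_ge_add_one_self[of "- (y - x)"] by linarith
    qed (use that in auto)
    finally show ?thesis by simp
  qed
  show ?thesis using *[of a b] *[of b a] assms by (cases "a \<le> b") auto
qed

lemma integrable_square_add:
  fixes f g :: "'a \<Rightarrow> real"
  assumes [measurable]: "f \<in> borel_measurable M" "g \<in> borel_measurable M"
    and "integrable M (\<lambda>x. (f x)\<^sup>2)" "integrable M (\<lambda>x. (g x)\<^sup>2)"
  shows "integrable M (\<lambda>x. (f x + g x)\<^sup>2)"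
proof (rule Bochner_Integration.integrable_bound)
  show "integrable M (\<lambda>x. 2 * (f x)\<^sup>2 + 2 * (g x)\<^sup>2)" using assms by simp
  show "AE x in M. norm ((f x + g x)\<^sup>2) \<le> norm (2 * (f x)\<^sup>2 + 2 * (g x)\<^sup>2)"
  proof (rule AE_I2)
    fix x
    have "0 \<le> (f x - g x)\<^sup>2" by simp
    then have "(f x + g x)\<^sup>2 \<le> 2 * (f x)\<^sup>2 + 2 * (g x)\<^sup>2" by (simp add: power2_eq_square algebra_simps)
    then show "norm ((f x + g x)\<^sup>2) \<le> norm (2 * (f x)\<^sup>2 + 2 * (g x)\<^sup>2)" by simp
  qed
qed measurable

lemma HT_cov_commute: "HT_cov Pd \<pi> enum D F f g = HT_cov Pd \<pi> enum D F g f"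
  by (intro ext) (simp add: HT_cov_def mult.commute)

section \<open>Conditional design variances and the limiting covariance\<close>

context ht_design
begin

lemma law_Y_eq_distr: "Q = distr XY borel (\<lambda>u. ys u i)"
proof -
  have "distr XY Pyx (\<lambda>u. u i) = Pyx" by (rule distr_PiM_component) (auto intro: Pyx)
  then have "Q = distr (distr XY Pyx (\<lambda>u. u i)) borel fst" by (simp add: law_Y_def)
  also have "\<dots> = distr XY borel (fst \<circ> (\<lambda>u. u i))" by (rule distr_distr) measurable
  finally show ?thesis by (simp add: ys_def o_def)
qed

lemma integral_ys: "h \<in> borel_measurable borel \<Longrightarrow> (\<integral>u. h (ys u i) \<partial>XY) = integral\<^sup>L Q h" for h :: "'y \<Rightarrow> real"
  unfolding law_Y_eq_distr[of i] by (rule integral_distr[OF measurable_ys, symmetric])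

lemma integrable_ys: "integrable Q h \<Longrightarrow> integrable XY (\<lambda>u. h (ys u i))" for h :: "'y \<Rightarrow> real"
  by (rule integrable_distr[OF measurable_ys]) (simp add: law_Y_eq_distr[of i, symmetric])

lemma borel_Q: "h \<in> borel_measurable borel \<Longrightarrow> h \<in> borel_measurable Q" for h :: "'y \<Rightarrow> real"
  by (simp add: law_Y_def)

text \<open>The design variance, given the data, of the process at \<open>g\<close>. It is written
  for arbitrary \<open>g\<close> because linear combinations of members of \<open>F\<close> usually
  lie outside \<open>F\<close>.\<close>

definition V :: "('y \<Rightarrow> real) \<Rightarrow> nat \<Rightarrow> (nat \<Rightarrow> 'y \<times> 'x) \<Rightarrow> real" where
  "V g N u = 1 / N * (\<Sum>i<N. (1 / \<pi> N i (xv N u) - 1) * (g (ys u i))\<^sup>2)"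

lemma V_measurable: "g \<in> borel_measurable borel \<Longrightarrow> V g N \<in> borel_measurable XY"
  unfolding V_def[abs_def] using incl_prob_measurable measurable_compose[OF measurable_ys]
  by (intro borel_measurable_times borel_measurable_const borel_measurable_sum borel_measurable_diff
      borel_measurable_divide borel_measurable_power) auto

lemma V_nonneg: "0 \<le> V g N u"
  unfolding V_def
proof (intro mult_nonneg_nonneg sum_nonneg)
  fix i assume "i \<in> {..<N}"
  then show "0 \<le> 1 / \<pi> N i (xv N u) - 1" using incl_prob_bounds[of i N u] by simp
qed auto

definition comb :: "(nat \<Rightarrow> 'y \<Rightarrow> real) \<Rightarrow> (nat \<Rightarrow> real) \<Rightarrow> nat \<Rightarrow> 'y \<Rightarrow> real" where
  "comb s a k y = (\<Sum>j<k. a j * s j y)"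

lemma comb_measurable: "range s \<subseteq> F \<Longrightarrow> comb s a k \<in> borel_measurable borel"
  unfolding comb_def[abs_def] using F_meas by (intro borel_measurable_sum borel_measurable_times borel_measurable_const) auto

lemma HT_cov_measurable:
  assumes "f \<in> F" "g \<in> F"
  shows "HT_cov Pd \<pi> enum D F f g N \<in> borel_measurable Om"
proof -
  have m: "f \<in> borel_measurable borel" "g \<in> borel_measurable borel" using assms F_meas by auto
  have "(\<lambda>u. 1 / N * (\<Sum>i<N. (1 / \<pi> N i (xv N u) - 1) * (f (ys u i) * g (ys u i)))) \<in> borel_measurable XY"
    using incl_prob_measurable measurable_compose[OF measurable_ys m(1)] measurable_compose[OF measurable_ys m(2)]
    by (intro borel_measurable_times borel_measurable_const borel_measurable_sum borel_measurable_diff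
      borel_measurable_divide) auto
  from measurable_compose[OF measurable_fst_Om this] show ?thesis
    unfolding HT_cov_eq[OF assms, abs_def] ys_def .
qed

lemma V_eq_HT_cov:
  assumes s: "range s \<subseteq> F"
  shows "V (comb s a k) N (fst \<omega>) = (\<Sum>p\<in>{..<k} \<times> {..<k}. (a (fst p) * a (snd p)) * HT_cov Pd \<pi> enum D F (s (fst p)) (s (snd p)) N \<omega>)"
proof -
  have sF: "s j \<in> F" for j using s by auto
  let ?w = "\<lambda>i. 1 / \<pi> N i (xv N (fst \<omega>)) - 1"
  have "(\<Sum>p\<in>{..<k} \<times> {..<k}. (a (fst p) * a (snd p)) * HT_cov Pd \<pi> enum D F (s (fst p)) (s (snd p)) N \<omega>)
    = (\<Sum>p\<in>{..<k} \<times> {..<k}. \<Sum>i<N. 1 / N * (?w i * ((a (fst p) * s (fst p) (ys (fst \<omega>) i)) * (a (snd p) * s (snd p) (ys (fst \<omega>) i)))))"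
    unfolding HT_cov_eq[OF sF sF] ys_def by (simp add: sum_distrib_left mult_ac)
  also have "\<dots> = (\<Sum>i<N. \<Sum>p\<in>{..<k} \<times> {..<k}. 1 / N * (?w i * ((a (fst p) * s (fst p) (ys (fst \<omega>) i)) * (a (snd p) * s (snd p) (ys (fst \<omega>) i)))))"
    by (rule sum.swap)
  also have "\<dots> = (\<Sum>i<N. 1 / N * (?w i * (comb s a k (ys (fst \<omega>) i))\<^sup>2))"
  proof (intro sum.cong refl)
    fix i
    have "(comb s a k (ys (fst \<omega>) i))\<^sup>2 = (\<Sum>p\<in>{..<k} \<times> {..<k}. (a (fst p) * s (fst p) (ys (fst \<omega>) i)) * (a (snd p) * s (snd p) (ys (fst \<omega>) i)))"
      by (simp add: comb_def power2_eq_square sum_product sum.cartesian_product case_prod_beta')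
    then show "(\<Sum>p\<in>{..<k} \<times> {..<k}. 1 / N * (?w i * ((a (fst p) * s (fst p) (ys (fst \<omega>) i)) * (a (snd p) * s (snd p) (ys (fst \<omega>) i))))) = 1 / N * (?w i * (comb s a k (ys (fst \<omega>) i))\<^sup>2)"
      by (simp only: sum_distrib_left)
  qed
  finally show ?thesis by (simp add: V_def sum_distrib_left)
qed

definition lim_var :: "(nat \<Rightarrow> 'y \<Rightarrow> real) \<Rightarrow> (nat \<Rightarrow> real) \<Rightarrow> nat \<Rightarrow> real" where
  "lim_var s a k = (\<Sum>i<k. \<Sum>j<k. a i * a j * \<Sigma>' (s i) (s j))"

lemma V_conv:
  assumes s: "range s \<subseteq> F"
  shows "conv_in_prob Om (\<lambda>N \<omega>. V (comb s a k) N (fst \<omega>)) (lim_var s a k)"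
proof -
  have "conv_in_prob Om (\<lambda>N \<omega>. \<Sum>p\<in>{..<k} \<times> {..<k}. (a (fst p) * a (snd p)) * HT_cov Pd \<pi> enum D F (s (fst p)) (s (snd p)) N \<omega>)
     (\<Sum>p\<in>{..<k} \<times> {..<k}. (a (fst p) * a (snd p)) * \<Sigma>' (s (fst p)) (s (snd p)))"
    using s by (intro conv_in_prob_sum[OF Om.prob_space_axioms] HT_cov_measurable cov_limit) auto
  moreover have "(\<Sum>p\<in>{..<k} \<times> {..<k}. (a (fst p) * a (snd p)) * \<Sigma>' (s (fst p)) (s (snd p))) = lim_var s a k"
    by (simp add: lim_var_def sum.cartesian_product case_prod_beta')
  ultimately show ?thesis by (simp add: V_eq_HT_cov[OF s])
qed

lemma V_Om_measurable: "range s \<subseteq> F \<Longrightarrow> (\<lambda>\<omega>. V (comb s a k) N (fst \<omega>)) \<in> borel_measurable Om"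
  by (rule measurable_compose[OF measurable_fst_Om V_measurable[OF comb_measurable]])

lemma lim_var_nonneg: "range s \<subseteq> F \<Longrightarrow> 0 \<le> lim_var s a k"
  by (rule conv_in_prob_nonneg[OF Om.prob_space_axioms V_Om_measurable V_conv]) (auto intro: V_nonneg)

lemma \<Sigma>'_sym: "f \<in> F \<Longrightarrow> g \<in> F \<Longrightarrow> \<Sigma>' f g = \<Sigma>' g f"
proof (rule conv_in_prob_unique[OF Om.prob_space_axioms])
  assume fg: "f \<in> F" "g \<in> F"
  show "HT_cov Pd \<pi> enum D F f g N \<in> borel_measurable Om" for N using fg by (rule HT_cov_measurable)
  show "conv_in_prob Om (HT_cov Pd \<pi> enum D F f g) (\<Sigma>' f g)" using fg by (rule cov_limit)
  show "conv_in_prob Om (HT_cov Pd \<pi> enum D F f g) (\<Sigma>' g f)"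
    using cov_limit[OF fg(2,1)] unfolding HT_cov_commute[of Pd \<pi> enum D F g f] .
qed

lemma \<Sigma>'_psd: "range s \<subseteq> F \<Longrightarrow> psd_kernel (\<lambda>i j. \<Sigma>' (s i) (s j))"
  unfolding psd_kernel_def using \<Sigma>'_sym lim_var_nonneg[of s] by (auto simp: lim_var_def image_subset_iff)

lemma comb_square_integrable:
  assumes s: "range s \<subseteq> F"
  shows "integrable Q (\<lambda>y. (comb s a k y)\<^sup>2)"
proof (induction k)
  case 0 then show ?case by (simp add: comb_def)
next
  case (Suc k)
  have "s k \<in> F" using s by auto
  then have "integrable Q (\<lambda>y. (a k)\<^sup>2 * (s k y)\<^sup>2)"
    using donsker_square_integrable[OF prob_space_Q F_donsker] by simp
  then have "integrable Q (\<lambda>y. (a k * s k y)\<^sup>2)" by (simp add: power_mult_distrib)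
  moreover have "s k \<in> borel_measurable borel" using s F_meas by auto
  ultimately have "integrable Q (\<lambda>y. (comb s a k y + a k * s k y)\<^sup>2)"
    using comb_measurable[OF s, of a k] Suc by (intro integrable_square_add borel_Q) auto
  then show ?case by (simp add: comb_def)
qed

text \<open>Given the data the summands are independent, so the conditional characteristic function
  is a product, and it is close to \<open>exp (- V / 2)\<close> up to a Lindeberg sum of vanishing
  mean. The random variance converges in probability to a constant, and integrating over the data
  gives the limit.\<close>

lemma char_limit:
  assumes s: "range s \<subseteq> F"
  shows "(\<lambda>N. \<integral>\<omega>. iexp (\<Sum>j<k. a j * HT N \<omega> (s j)) \<partial>Om) \<longlonglongrightarrow> complex_of_real (exp (- lim_var s a k / 2))"
proof -
  have sF: "s j \<in> F" for j using s by auto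
  define g where "g = comb s a k"
  define v where "v = lim_var s a k"
  have v0: "0 \<le> v" unfolding v_def by (rule lim_var_nonneg[OF s])
  have gm [measurable]: "g \<in> borel_measurable borel" unfolding g_def by (rule comb_measurable[OF s])
  have g2: "integrable Q (\<lambda>y. (g y)\<^sup>2)" unfolding g_def by (rule comb_square_integrable[OF s])
  define c where "c N u i = g (ys u i) / sqrt N" for N u i
  \<comment> \<open>\<open>N\<close> times the Lindeberg term of one observation. It is dominated by
    \<open>g^2\<close> and tends to 0 pointwise.\<close>
  define w where "w N y = (g y)\<^sup>2 * min 1 (\<bar>g y\<bar> / sqrt N)" for N :: nat and y
  have wm: "w N \<in> borel_measurable borel" for N unfolding w_def[abs_def] by measurable
  have w_le: "\<bar>w N y\<bar> \<le> (g y)\<^sup>2" for N y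
  proof -
    have "(g y)\<^sup>2 * min 1 (\<bar>g y\<bar> / sqrt N) \<le> (g y)\<^sup>2 * 1" by (intro mult_left_mono) auto
    moreover have "0 \<le> (g y)\<^sup>2 * min 1 (\<bar>g y\<bar> / sqrt N)" by (intro mult_nonneg_nonneg) auto
    ultimately show ?thesis by (simp add: w_def)
  qed
  have wi: "integrable Q (w N)" for N
    by (rule Bochner_Integration.integrable_bound[OF g2 borel_Q[OF wm] AE_I2]) (simp add: w_le)
  have w_lim: "(\<lambda>N. integral\<^sup>L Q (w N)) \<longlonglongrightarrow> integral\<^sup>L Q (\<lambda>_. 0)"
  proof (rule integral_dominated_convergence[OF _ borel_Q[OF wm] g2])
    show "AE y in Q. (\<lambda>N. w N y) \<longlonglongrightarrow> 0"
    proof (rule AE_I2)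
      fix y
      have "(\<lambda>N. \<bar>g y\<bar> / sqrt (real N)) \<longlonglongrightarrow> 0"
        by (intro tendsto_divide_0[OF tendsto_const] filterlim_at_top_imp_at_infinity filterlim_compose[OF sqrt_at_top filterlim_real_sequentially])
      then have "(\<lambda>N. (g y)\<^sup>2 * min 1 (\<bar>g y\<bar> / sqrt (real N))) \<longlonglongrightarrow> (g y)\<^sup>2 * min 1 0"
        by (intro tendsto_mult tendsto_min tendsto_const)
      then show "(\<lambda>N. w N y) \<longlonglongrightarrow> 0" by (simp add: w_def)
    qed
  qed (use w_le in auto)
  define W where "W N u = (\<Sum>i<N. (c N u i)\<^sup>2 * min 1 \<bar>c N u i\<bar>)" for N u
  have W_eq: "W N u = (\<Sum>i<N. 1 / N * w N (ys u i))" for N u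
    unfolding W_def w_def c_def by (intro sum.cong refl) (simp add: power_divide abs_divide)
  have Wint: "integrable XY (W N)" for N
    unfolding W_eq[abs_def] using integrable_ys[OF wi] by (intro Bochner_Integration.integrable_sum integrable_mult_right) auto
  have W0: "0 \<le> W N u" for N u unfolding W_def by (intro sum_nonneg) auto
  have W_int: "integral\<^sup>L XY (W N) = (if N = 0 then 0 else integral\<^sup>L Q (w N))" for N
    unfolding W_eq[abs_def] using integrable_ys[OF wi] integral_ys[OF wm] by (simp add: Bochner_Integration.integral_sum)
  have W_lim: "(\<lambda>N. integral\<^sup>L XY (W N)) \<longlonglongrightarrow> 0"
  proof (rule Lim_transform_eventually[where f = "\<lambda>N. integral\<^sup>L Q (w N)"])
    show "\<forall>\<^sub>F N in sequentially. integral\<^sup>L Q (w N) = integral\<^sup>L XY (W N)"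
      by (rule eventually_sequentiallyI[of 1]) (simp add: W_int)
  qed (use w_lim in simp)
  \<comment> \<open>The conditional characteristic function given the data, factorized by
    independence of the indicators.\<close>
  define \<Psi> where "\<Psi> N u = (\<Prod>i<N. \<pi> N i (xv N u) *\<^sub>R iexp ((1 / \<pi> N i (xv N u) - 1) * c N u i) + (1 - \<pi> N i (xv N u)) *\<^sub>R iexp (- c N u i))" for N u
  have E: "(\<integral>\<omega>. iexp (\<Sum>j<k. a j * HT N \<omega> (s j)) \<partial>Om) = (\<integral>u. \<Psi> N u \<partial>XY)" for N
  proof -
    define T where "T s' u = iexp (1 / sqrt N * (\<Sum>i<N. incl_weight \<pi> N (xv N u) s' i * g (ys u i)))" for s' u
    have Tm: "T s' \<in> borel_measurable XY" for s'
      unfolding T_def[abs_def] using measurable_ht_sum[OF gm, of N s'] by measurable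
    have "(\<Sum>j<k. a j * HT N \<omega> (s j)) = 1 / sqrt N * (\<Sum>i<N. incl_weight \<pi> N (xv N (fst \<omega>)) (Svec \<pi> enum D N \<omega>) i * g (ys (fst \<omega>) i))" for \<omega>
    proof -
      have "(\<Sum>j<k. a j * HT N \<omega> (s j)) = (\<Sum>j<k. \<Sum>i<N. 1 / sqrt N * (incl_weight \<pi> N (xv N (fst \<omega>)) (Svec \<pi> enum D N \<omega>) i * (a j * s j (ys (fst \<omega>) i))))"
        unfolding HT_eq[OF sF] by (simp add: sum_distrib_left mult_ac)
      also have "\<dots> = (\<Sum>i<N. \<Sum>j<k. 1 / sqrt N * (incl_weight \<pi> N (xv N (fst \<omega>)) (Svec \<pi> enum D N \<omega>) i * (a j * s j (ys (fst \<omega>) i))))"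
        by (rule sum.swap)
      finally show ?thesis by (simp only: g_def comb_def sum_distrib_left)
    qed
    then have "(\<integral>\<omega>. iexp (\<Sum>j<k. a j * HT N \<omega> (s j)) \<partial>Om) = (\<integral>\<omega>. T (Svec \<pi> enum D N \<omega>) (fst \<omega>) \<partial>Om)"
      by (simp only: T_def)
    also have "\<dots> = (\<integral>u. design_mean \<pi> N (xv N u) (\<lambda>s'. T s' u) \<partial>XY)"
      by (rule integral_design[OF Tm, where b = 1]) (simp add: T_def)
    also have "\<dots> = (\<integral>u. \<Psi> N u \<partial>XY)"
    proof (intro Bochner_Integration.integral_cong refl)
      fix u
      have "T s' u = (\<Prod>i<N. iexp ((real (s' i) / \<pi> N i (xv N u) - 1) * c N u i))" for s'
      proof -
        have "1 / sqrt N * (\<Sum>i<N. incl_weight \<pi> N (xv N u) s' i * g (ys u i)) = (\<Sum>i<N. (real (s' i) / \<pi> N i (xv N u) - 1) * c N u i)"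
          unfolding sum_distrib_left by (intro sum.cong refl) (simp add: incl_weight_def c_def)
        then show ?thesis unfolding T_def by (simp only: iexp_sum finite_lessThan)
      qed
      then have "design_mean \<pi> N (xv N u) (\<lambda>s'. T s' u) = (\<Prod>i<N. \<pi> N i (xv N u) *\<^sub>R iexp ((real 1 / \<pi> N i (xv N u) - 1) * c N u i) + (1 - \<pi> N i (xv N u)) *\<^sub>R iexp ((real 0 / \<pi> N i (xv N u) - 1) * c N u i))"
        using design_mean_prod[of \<pi> N "xv N u" "\<lambda>i b. iexp ((real b / \<pi> N i (xv N u) - 1) * c N u i)"] by (simp only:)
      then show "design_mean \<pi> N (xv N u) (\<lambda>s'. T s' u) = \<Psi> N u" by (simp add: \<Psi>_def)
    qed
    finally show ?thesis .
  qed
  have Vprod: "complex_of_real (exp (- V g N u / 2)) = (\<Prod>i<N. of_real (exp (- ((1 / \<pi> N i (xv N u) - 1) * (c N u i)\<^sup>2) / 2)))" for N u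
  proof -
    have "- V g N u / 2 = (\<Sum>i<N. - ((1 / \<pi> N i (xv N u) - 1) * (c N u i)\<^sup>2) / 2)"
      unfolding V_def c_def by (simp add: sum_distrib_left sum_negf sum_divide_distrib power_divide)
    then show ?thesis by (simp add: exp_sum)
  qed
  have fac: "norm (\<pi> N i (xv N u) *\<^sub>R iexp x + (1 - \<pi> N i (xv N u)) *\<^sub>R iexp y) \<le> 1" if "i < N" for N i u x y
  proof -
    have p: "0 \<le> \<pi> N i (xv N u)" "\<pi> N i (xv N u) \<le> 1" using incl_prob_bounds[OF that, of u] by auto
    have "norm (\<pi> N i (xv N u) *\<^sub>R iexp x + (1 - \<pi> N i (xv N u)) *\<^sub>R iexp y) \<le> norm (\<pi> N i (xv N u) *\<^sub>R iexp x) + norm ((1 - \<pi> N i (xv N u)) *\<^sub>R iexp y)"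
      by (rule norm_triangle_ineq)
    then show ?thesis using p by simp
  qed
  have \<Psi>1: "norm (\<Psi> N u) \<le> 1" for N u
  proof -
    have "norm (\<Psi> N u) \<le> (\<Prod>i<N. 1)" unfolding \<Psi>_def prod_norm[symmetric] by (intro prod_mono conjI fac) auto
    then show ?thesis by simp
  qed
  have on_Gd: "norm (\<Psi> N u - of_real (exp (- V g N u / 2))) \<le> 2 * C ^ 3 * W N u" if u: "u \<in> Gd N" for N u
  proof -
    have "norm (\<Psi> N u - of_real (exp (- V g N u / 2))) \<le> (\<Sum>i<N. norm (\<pi> N i (xv N u) *\<^sub>R iexp ((1 / \<pi> N i (xv N u) - 1) * c N u i) + (1 - \<pi> N i (xv N u)) *\<^sub>R iexp (- c N u i) - of_real (exp (- ((1 / \<pi> N i (xv N u) - 1) * (c N u i)\<^sup>2) / 2))))"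
      unfolding \<Psi>_def Vprod
    proof (rule norm_prod_diff)
      fix i assume i: "i \<in> {..<N}"
      then show "norm (\<pi> N i (xv N u) *\<^sub>R iexp ((1 / \<pi> N i (xv N u) - 1) * c N u i) + (1 - \<pi> N i (xv N u)) *\<^sub>R iexp (- c N u i)) \<le> 1"
        by (intro fac) simp
      have "0 \<le> 1 / \<pi> N i (xv N u) - 1" using incl_prob_bounds[of i N u] i by simp
      then show "norm (complex_of_real (exp (- ((1 / \<pi> N i (xv N u) - 1) * (c N u i)\<^sup>2) / 2))) \<le> 1" by simp
    qed
    also have "\<dots> \<le> (\<Sum>i<N. 2 * C ^ 3 * ((c N u i)\<^sup>2 * min 1 \<bar>c N u i\<bar>))"
    proof (intro sum_mono char_centred_bernoulli C_ge)
      fix i assume i: "i \<in> {..<N}"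
      then show p: "0 < \<pi> N i (xv N u)" "\<pi> N i (xv N u) \<le> 1" using incl_prob_bounds[of i N u] by auto
      have "1 / \<pi> N i (xv N u) \<le> 1 / L" using u i L_pos by (intro frac_le) (auto simp: Gd_def)
      then show "1 / \<pi> N i (xv N u) - 1 \<le> C" using C_ge by linarith
    qed
    finally show ?thesis by (simp add: W_def sum_distrib_left)
  qed
  have Vm [measurable]: "V g N \<in> borel_measurable XY" for N by (rule V_measurable[OF gm])
  have \<Psi>m: "\<Psi> N \<in> borel_measurable XY" for N
  proof -
    have [measurable]: "(\<lambda>u. c N u i) \<in> borel_measurable XY" for i
      unfolding c_def using measurable_compose[OF measurable_ys gm] by measurable
    show ?thesis unfolding \<Psi>_def[abs_def]
      by (intro borel_measurable_prod) (use incl_prob_measurable in measurable)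
  qed
  \<comment> \<open>Four sources of error: the Lindeberg sum, the event that the bound
    \<open>L\<close> fails, where the difference is at most 2, a deviation of \<open>V\<close> by at
    most \<open>e\<close>, and the event of a larger deviation.\<close>
  have main: "norm ((\<integral>u. \<Psi> N u \<partial>XY) - of_real (exp (- v / 2)))
     \<le> 2 * C ^ 3 * integral\<^sup>L XY (W N) + 2 * measure XY (space XY - Gd N) + e + measure XY {u\<in>space XY. \<bar>V g N u - v\<bar> > e}" if e: "e > 0" for N e
  proof -
    have Sm [measurable]: "{u\<in>space XY. \<bar>V g N u - v\<bar> > e} \<in> sets XY" by measurable
    have i\<Psi>: "integrable XY (\<Psi> N)" by (rule XY.AE_bounded_integrable[OF \<Psi>m \<Psi>1])
    have pt: "norm (\<Psi> N u - of_real (exp (- v / 2))) \<le> 2 * C ^ 3 * W N u + 2 * indicator (space XY - Gd N) u + e + indicator {u\<in>space XY. \<bar>V g N u - v\<bar> > e} u" for u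
    proof -
      have a: "norm (\<Psi> N u - of_real (exp (- V g N u / 2))) \<le> 2 * C ^ 3 * W N u + 2 * indicator (space XY - Gd N) u"
      proof (cases "u \<in> Gd N")
        case True then show ?thesis using on_Gd[OF True] by simp
      next
        case False
        have "norm (\<Psi> N u - of_real (exp (- V g N u / 2))) \<le> norm (\<Psi> N u) + norm (complex_of_real (exp (- V g N u / 2)))"
          by (rule norm_triangle_ineq4)
        also have "\<dots> \<le> 1 + 1" using V_nonneg[of g N u] \<Psi>1[of N u] by (intro add_mono) auto
        finally have "norm (\<Psi> N u - of_real (exp (- V g N u / 2))) \<le> 2" by simp
        moreover have "0 \<le> 2 * C ^ 3 * W N u" using C_ge W0[of N u] by simp
        moreover have "indicator (space XY - Gd N) u = (1 :: real)" using False by (simp add: space_XY)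
        ultimately show ?thesis by linarith
      qed
      have b: "\<bar>exp (- V g N u / 2) - exp (- v / 2)\<bar> \<le> e + indicator {u\<in>space XY. \<bar>V g N u - v\<bar> > e} u"
      proof (cases "\<bar>V g N u - v\<bar> > e")
        case True
        have "0 \<le> exp (- V g N u / 2)" "exp (- V g N u / 2) \<le> 1" "0 \<le> exp (- v / 2)" "exp (- v / 2) \<le> 1"
          using V_nonneg[of g N u] v0 by auto
        then have "\<bar>exp (- V g N u / 2) - exp (- v / 2)\<bar> \<le> 1" by linarith
        then show ?thesis using True e by (simp add: space_XY)
      next
        case False
        have "\<bar>exp (- (V g N u / 2)) - exp (- (v / 2))\<bar> \<le> \<bar>V g N u / 2 - v / 2\<bar>"
          using V_nonneg[of g N u] v0 by (intro exp_minus_lipschitz) auto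
        then show ?thesis using False e by simp
      qed
      have "\<Psi> N u - of_real (exp (- v / 2)) = (\<Psi> N u - of_real (exp (- V g N u / 2))) + of_real (exp (- V g N u / 2) - exp (- v / 2))" by simp
      then have "norm (\<Psi> N u - of_real (exp (- v / 2))) \<le> norm (\<Psi> N u - of_real (exp (- V g N u / 2))) + \<bar>exp (- V g N u / 2) - exp (- v / 2)\<bar>"
        using norm_triangle_ineq[of "\<Psi> N u - of_real (exp (- V g N u / 2))" "of_real (exp (- V g N u / 2) - exp (- v / 2))"]
        unfolding norm_of_real by simp
      then show ?thesis using a b by linarith
    qed
    have "(\<integral>u. \<Psi> N u \<partial>XY) - of_real (exp (- v / 2)) = (\<integral>u. \<Psi> N u - of_real (exp (- v / 2)) \<partial>XY)"
      using i\<Psi> by (simp add: XY.prob_space)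
    also have "norm \<dots> \<le> (\<integral>u. norm (\<Psi> N u - of_real (exp (- v / 2))) \<partial>XY)"
      by (rule integral_norm_bound)
    also have "\<dots> \<le> (\<integral>u. 2 * C ^ 3 * W N u + 2 * indicator (space XY - Gd N) u + e + indicator {u\<in>space XY. \<bar>V g N u - v\<bar> > e} u \<partial>XY)"
    proof (rule integral_mono)
      show "integrable XY (\<lambda>u. norm (\<Psi> N u - of_real (exp (- v / 2))))" using i\<Psi> by (intro integrable_norm Bochner_Integration.integrable_diff) auto
      show "integrable XY (\<lambda>u. 2 * C ^ 3 * W N u + 2 * indicator (space XY - Gd N) u + e + indicator {u\<in>space XY. \<bar>V g N u - v\<bar> > e} u)"
        using Wint[of N] Sm by (intro Bochner_Integration.integrable_add integrable_mult_right integrable_const integrable_real_indicator) (auto simp: XY.emeasure_eq_measure)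
      show "norm (\<Psi> N u - of_real (exp (- v / 2))) \<le> 2 * C ^ 3 * W N u + 2 * indicator (space XY - Gd N) u + e + indicator {u\<in>space XY. \<bar>V g N u - v\<bar> > e} u" for u
        by (rule pt)
    qed
    also have "\<dots> = 2 * C ^ 3 * integral\<^sup>L XY (W N) + 2 * measure XY (space XY - Gd N) + e + measure XY {u\<in>space XY. \<bar>V g N u - v\<bar> > e}"
    proof -
      have "integrable XY (indicator (space XY - Gd N) :: _ \<Rightarrow> real)" "integrable XY (indicator {u\<in>space XY. \<bar>V g N u - v\<bar> > e} :: _ \<Rightarrow> real)"
        using Sm by (auto intro!: integrable_real_indicator simp: XY.emeasure_eq_measure)
      then show ?thesis using Wint[of N] by (simp add: XY.prob_space)
    qed
    finally show ?thesis .
  qed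
  have V_lim: "(\<lambda>N. measure XY {u\<in>space XY. \<bar>V g N u - v\<bar> > e}) \<longlonglongrightarrow> 0" if "e > 0" for e
  proof -
    have "measure XY {u\<in>space XY. \<bar>V g N u - v\<bar> > e} = measure Om {\<omega> \<in> space Om. \<bar>V g N (fst \<omega>) - v\<bar> > e}" for N
    proof -
      have "{u\<in>space XY. \<bar>V g N u - v\<bar> > e} \<in> sets XY" by measurable
      from measure_Om_fst[OF this] show ?thesis by (simp add: space_XY)
    qed
    then show ?thesis using V_conv[OF s, of a k] that unfolding conv_in_prob_def g_def v_def by simp
  qed
  show ?thesis
  proof (rule LIMSEQ_I)
    fix e :: real assume e: "e > 0"
    have "(\<lambda>N. 2 * C ^ 3 * integral\<^sup>L XY (W N) + 2 * measure XY (space XY - Gd N) + measure XY {u\<in>space XY. \<bar>V g N u - v\<bar> > e / 2}) \<longlonglongrightarrow> 2 * C ^ 3 * 0 + 2 * 0 + 0"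
      using e by (intro tendsto_add tendsto_mult tendsto_const W_lim Gd_prob V_lim) simp
    then have "\<forall>\<^sub>F N in sequentially. 2 * C ^ 3 * integral\<^sup>L XY (W N) + 2 * measure XY (space XY - Gd N) + measure XY {u\<in>space XY. \<bar>V g N u - v\<bar> > e / 2} < e / 2"
      using e by (intro order_tendstoD(2)[where y = "2 * C ^ 3 * 0 + 2 * 0 + 0"]) auto
    then obtain N0 where N0: "\<And>N. N \<ge> N0 \<Longrightarrow> 2 * C ^ 3 * integral\<^sup>L XY (W N) + 2 * measure XY (space XY - Gd N) + measure XY {u\<in>space XY. \<bar>V g N u - v\<bar> > e / 2} < e / 2"
      unfolding eventually_sequentially by blast
    have e2: "e / 2 > 0" using e by simp
    show "\<exists>N0. \<forall>N\<ge>N0. norm ((\<integral>\<omega>. iexp (\<Sum>j<k. a j * HT N \<omega> (s j)) \<partial>Om) - complex_of_real (exp (- lim_var s a k / 2))) < e"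
    proof (intro exI allI impI)
      fix N assume "N \<ge> N0"
      from N0[OF this] main[OF e2, of N]
      show "norm ((\<integral>\<omega>. iexp (\<Sum>j<k. a j * HT N \<omega> (s j)) \<partial>Om) - complex_of_real (exp (- lim_var s a k / 2))) < e"
        unfolding E v_def[symmetric] by linarith
    qed
  qed
qed

text \<open>The limiting variance is compared with \<open>V\<close> at a single sample point of an
  event of probability at least 1/2. To keep that probability, Markov's inequality bounds the
  average of squared differences by 4 times its mean, up to a margin; this is the origin of the
  4.\<close>

lemma \<Sigma>'_increment:
  assumes fg: "f \<in> F" "g \<in> F"
  shows "\<Sigma>' f f - \<Sigma>' f g - \<Sigma>' g f + \<Sigma>' g g \<le> 4 / L * (rho Q f g)\<^sup>2"
proof -
  define s where "s j = (if j = 0 then f else g)" for j :: nat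
  define a where "a j = (if j = 0 then 1 else -1 :: real)" for j :: nat
  have s: "range s \<subseteq> F" using fg by (auto simp: s_def)
  have two: "(\<Sum>j<2. h j) = h 0 + h 1" for h :: "nat \<Rightarrow> real" by (simp add: numeral_2_eq_2)
  have cmb: "comb s a 2 y = f y - g y" for y by (simp add: comb_def two s_def a_def)
  have lv: "lim_var s a 2 = \<Sigma>' f f - \<Sigma>' f g - \<Sigma>' g f + \<Sigma>' g g" by (simp add: lim_var_def two s_def a_def)
  define R where "R = integral\<^sup>L Q (\<lambda>y. (f y - g y)\<^sup>2)"
  have R0: "0 \<le> R" unfolding R_def by (intro integral_nonneg_AE) auto
  have rho2: "(rho Q f g)\<^sup>2 = R" using R0 by (simp add: rho_def R_def)
  have i2: "integrable Q (\<lambda>y. (f y - g y)\<^sup>2)" using comb_square_integrable[OF s, of a 2] by (simp add: cmb)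
  have m2: "(\<lambda>y. (f y - g y)\<^sup>2) \<in> borel_measurable borel"
    using fg F_meas by (intro borel_measurable_power borel_measurable_diff) auto
  have "lim_var s a 2 \<le> 4 / L * R + \<epsilon>" if \<epsilon>: "\<epsilon> > 0" for \<epsilon>
  proof -
    \<comment> \<open>A margin that keeps Markov's denominator positive when the distance is 0; it
      contributes \<open>4 / L * \<delta> = \<epsilon> / 2\<close>.\<close>
    define \<delta> where "\<delta> = \<epsilon> * L / 8"
    have \<delta>: "\<delta> > 0" using \<epsilon> L_pos by (simp add: \<delta>_def)
    define M where "M N u = 1 / N * (\<Sum>i<N. (f (ys u i) - g (ys u i))\<^sup>2)" for N u
    have Mint: "integrable XY (M N)" for N
      unfolding M_def[abs_def] using integrable_ys[OF i2] by (intro integrable_mult_right Bochner_Integration.integrable_sum) auto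
    have Mm [measurable]: "M N \<in> borel_measurable XY" for N using Mint[of N] by simp
    have MR: "integral\<^sup>L XY (M N) \<le> R" for N
      unfolding M_def[abs_def] using integrable_ys[OF i2] integral_ys[OF m2] R0 by (simp add: Bochner_Integration.integral_sum R_def)
    have Mp: "measure XY {u\<in>space XY. M N u \<ge> 4 * (R + \<delta>)} \<le> 1 / 4" for N
    proof -
      have "measure XY {u\<in>space XY. M N u \<ge> 4 * (R + \<delta>)} \<le> integral\<^sup>L XY (M N) / (4 * (R + \<delta>))"
        using R0 \<delta> by (intro integral_Markov_inequality_measure[where A = "{}"] Mint) (auto simp: M_def intro!: sum_nonneg divide_nonneg_nonneg)
      also have "\<dots> \<le> (R + \<delta>) / (4 * (R + \<delta>))" using MR[of N] \<delta> R0 by (intro divide_right_mono) auto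
      also have "\<dots> = 1 / 4" using R0 \<delta> by (simp add: field_simps)
      finally show ?thesis .
    qed
    define A where "A N = Gd N - {u\<in>space XY. M N u \<ge> 4 * (R + \<delta>)}" for N
    have Am: "A N \<in> sets XY" for N unfolding A_def by measurable
    have "\<forall>\<^sub>F N in sequentially. measure XY (space XY - Gd N) < 1 / 4"
      by (rule order_tendstoD(2)[OF Gd_prob]) simp
    then have evA: "\<forall>\<^sub>F N in sequentially. measure Om {\<omega>\<in>space Om. fst \<omega> \<in> A N} \<ge> 1 / 2"
    proof eventually_elim
      case (elim N)
      have "space XY - A N = (space XY - Gd N) \<union> {u\<in>space XY. M N u \<ge> 4 * (R + \<delta>)}" by (auto simp: A_def Gd_def)
      then have "measure XY (space XY - A N) \<le> measure XY (space XY - Gd N) + measure XY {u\<in>space XY. M N u \<ge> 4 * (R + \<delta>)}"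
        by (simp only:) (intro measure_Un_le, auto)
      then have "measure XY (space XY - A N) \<le> 1 / 2" using elim Mp[of N] by linarith
      then show ?case unfolding measure_Om_fst[OF Am] using XY.prob_compl[OF Am[of N]] by linarith
    qed
    have "\<epsilon> / 2 > 0" using \<epsilon> by simp
    from conv_in_prob_witness[OF Om.prob_space_axioms V_Om_measurable[OF s, of a 2] V_conv[OF s, of a 2] evA _ this, OF Collect_restrict]
    obtain N u where w: "u \<in> A N" "\<bar>V (comb s a 2) N u - lim_var s a 2\<bar> \<le> \<epsilon> / 2"
      by blast
    have "V (comb s a 2) N u \<le> 1 / N * (\<Sum>i<N. 1 / L * (f (ys u i) - g (ys u i))\<^sup>2)"
      unfolding V_def cmb
    proof (intro mult_left_mono sum_mono mult_right_mono)
      fix i assume "i \<in> {..<N}"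
      then have "1 / \<pi> N i (xv N u) \<le> 1 / L" using w(1) L_pos by (intro frac_le) (auto simp: A_def Gd_def)
      then show "1 / \<pi> N i (xv N u) - 1 \<le> 1 / L" by linarith
    qed auto
    also have "\<dots> = 1 / L * M N u" by (simp add: M_def sum_distrib_left mult_ac)
    also have "\<dots> \<le> 1 / L * (4 * (R + \<delta>))"
      using w(1) L_pos by (intro mult_left_mono) (auto simp: A_def space_XY)
    also have "\<dots> = 4 / L * R + \<epsilon> / 2" using L_pos by (simp add: \<delta>_def field_simps)
    finally show ?thesis using w(2) by linarith
  qed
  then show ?thesis unfolding rho2 lv[symmetric] by (rule field_le_epsilon)
qed

lemma HT_weak_limit:
  "\<exists>(M :: (('y \<Rightarrow> real) \<Rightarrow> real) measure) G.
      prob_space M \<and> zero_mean_gaussian_process M F \<Sigma>' G \<and> tight_borel_element (linf F) M G \<and>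
      weakly_converges (linf F) Om HT M G \<and> (AE v in M. rho_uniformly_continuous Q F (G v))"
proof -
  define P where "P r m \<longleftrightarrow> finite (r ` F) \<and> r ` F \<subseteq> F \<and> (\<forall>f\<in>F. r (r f) = r f) \<and>
    (\<forall>\<^sub>F N in sequentially. outer_small Om {\<omega>. osc F r (HT N \<omega>) > (1 / 2) ^ m} ((1 / 2) ^ m))" for r m
  have "\<exists>r. P r m" for m
    unfolding P_def by (rule HT_osc) auto
  then have "\<forall>m. \<exists>r. P r m" ..
  from choice[OF this] obtain r where "\<forall>m. P (r m) m" ..
  then have r: "r m ` F \<subseteq> F" "finite (r m ` F)" "f \<in> F \<Longrightarrow> r m (r m f) = r m f"
    "\<forall>\<^sub>F N in sequentially. outer_small Om {\<omega>. osc F (r m) (HT N \<omega>) > (1 / 2) ^ m} ((1 / 2) ^ m)" for m f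
    unfolding P_def by simp_all
  have char: "(\<lambda>N. \<integral>\<omega>. iexp (\<Sum>j<k. a j * HT N \<omega> (s j)) \<partial>Om)
      \<longlonglongrightarrow> complex_of_real (exp (- (\<Sum>i<k. \<Sum>j<k. a i * a j * \<Sigma>' (s i) (s j)) / 2))" if "range s \<subseteq> F" for s a and k :: nat
    using char_limit[OF that, of a k] by (simp add: lim_var_def)
  have "\<exists>(M :: (('y \<Rightarrow> real) \<Rightarrow> real) measure) G. prob_space M \<and> tight_borel_element (linf F) M G \<and>
    weakly_converges (linf F) Om HT M G"
    by (rule weak_limit_of_finite_approximations[where r = r, OF Om.prob_space_axioms F_ne HT_mem HT_measurable char \<Sigma>'_psd r])
  then
  obtain M :: "(('y \<Rightarrow> real) \<Rightarrow> real) measure" and G where MG: "prob_space M" "tight_borel_element (linf F) M G"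
      "weakly_converges (linf F) Om HT M G"
    by (elim exE conjE)
  have Gm: "G \<in> measurable M (borel_sigma (mtopology_of (linf F)))" using MG(2) by (simp add: tight_borel_element_def)
  have gauss: "zero_mean_gaussian_process M F \<Sigma>' G" "\<And>f. f \<in> F \<Longrightarrow> integrable M (\<lambda>v. (G v f)\<^sup>2)"
    "\<And>f. f \<in> F \<Longrightarrow> (\<lambda>v. G v f) \<in> borel_measurable M"
    by (rule weak_limit_gaussian[OF Om.prob_space_axioms MG(1) HT_mem HT_measurable char \<Sigma>'_psd Gm MG(3)]; assumption)+
  interpret M: prob_space M by (rule MG(1))
  have "AE v in M. \<forall>e>0. \<exists>\<delta>>0. \<forall>f\<in>F. \<forall>g\<in>F. rho Q f g < \<delta> \<longrightarrow> \<bar>G v f - G v g\<bar> < e"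
  proof (rule tight_paths_uniformly_continuous[OF MG(1,2)])
    fix \<eta> t :: real assume \<eta>: "\<eta> > 0" and t: "t > 0"
    \<comment> \<open>Chosen so that \<open>4 / L * \<delta>^2 = \<eta> * t^2\<close>, which
      Chebyshev's inequality turns into \<open>\<eta>\<close>.\<close>
    define \<delta> where "\<delta> = sqrt (\<eta> * t\<^sup>2 * L / 4)"
    have "\<delta> > 0" using \<eta> t L_pos by (simp add: \<delta>_def)
    moreover have "measure M {v\<in>space M. \<bar>G v f - G v g\<bar> > t} \<le> \<eta>" if fg: "f \<in> F" "g \<in> F" and d: "rho Q f g < \<delta>" for f g
    proof -
      note [measurable] = gauss(3)[OF fg(1)] gauss(3)[OF fg(2)]
      have i: "integrable M (\<lambda>v. (G v f)\<^sup>2)" "integrable M (\<lambda>v. (G v g)\<^sup>2)" using gauss(2) fg by auto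
      have ip: "integrable M (\<lambda>v. G v f * G v g)"
      proof (rule Bochner_Integration.integrable_bound)
        show "integrable M (\<lambda>v. (G v f)\<^sup>2 + (G v g)\<^sup>2)" using i by simp
        show "AE v in M. norm (G v f * G v g) \<le> norm ((G v f)\<^sup>2 + (G v g)\<^sup>2)"
        proof (rule AE_I2)
          fix v
          have "0 \<le> (\<bar>G v f\<bar> - \<bar>G v g\<bar>)\<^sup>2" by simp
          then have "2 * (\<bar>G v f\<bar> * \<bar>G v g\<bar>) \<le> (G v f)\<^sup>2 + (G v g)\<^sup>2" by (simp add: power2_diff)
          moreover have "0 \<le> \<bar>G v f\<bar> * \<bar>G v g\<bar>" by simp
          ultimately have "\<bar>G v f\<bar> * \<bar>G v g\<bar> \<le> (G v f)\<^sup>2 + (G v g)\<^sup>2" by linarith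
          then show "norm (G v f * G v g) \<le> norm ((G v f)\<^sup>2 + (G v g)\<^sup>2)" by (simp add: abs_mult)
        qed
      qed measurable
      have cov: "(\<integral>v. G v f' * G v g' \<partial>M) = \<Sigma>' f' g'" if "f' \<in> F" "g' \<in> F" for f' g'
        using gauss(1) that by (simp add: zero_mean_gaussian_process_def)
      have exp2: "(G v f - G v g)\<^sup>2 = (G v f)\<^sup>2 - 2 * (G v f * G v g) + (G v g)\<^sup>2" for v
        by (simp add: power2_eq_square algebra_simps)
      have i2: "integrable M (\<lambda>v. (G v f - G v g)\<^sup>2)" unfolding exp2 using i ip by simp
      have "(\<integral>v. (G v f - G v g)\<^sup>2 \<partial>M) = \<Sigma>' f f - 2 * \<Sigma>' f g + \<Sigma>' g g"
        unfolding exp2 using i ip cov[OF fg] cov[OF fg(1) fg(1)] cov[OF fg(2) fg(2)] by (simp add: power2_eq_square)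
      also have "\<dots> \<le> 4 / L * (rho Q f g)\<^sup>2" using \<Sigma>'_increment[OF fg] \<Sigma>'_sym[OF fg] by simp
      also have "\<dots> \<le> 4 / L * \<delta>\<^sup>2"
      proof -
        have "0 \<le> rho Q f g" unfolding rho_def by (intro real_sqrt_ge_zero integral_nonneg_AE) auto
        then show ?thesis using d L_pos by (intro mult_left_mono power_mono) auto
      qed
      also have "\<dots> = \<eta> * t\<^sup>2" using \<eta> t L_pos by (simp add: \<delta>_def)
      finally have le: "(\<integral>v. (G v f - G v g)\<^sup>2 \<partial>M) \<le> \<eta> * t\<^sup>2" .
      have "measure M {v\<in>space M. \<bar>G v f - G v g\<bar> > t} \<le> measure M {v\<in>space M. (G v f - G v g)\<^sup>2 \<ge> t\<^sup>2}"
      proof (rule M.finite_measure_mono)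
        show "{v\<in>space M. \<bar>G v f - G v g\<bar> > t} \<subseteq> {v\<in>space M. (G v f - G v g)\<^sup>2 \<ge> t\<^sup>2}"
          using t by (auto simp: abs_le_square_iff[symmetric])
      qed measurable
      also have "\<dots> \<le> (\<integral>v. (G v f - G v g)\<^sup>2 \<partial>M) / t\<^sup>2"
        using t by (intro integral_Markov_inequality_measure[where A = "{}"] i2) auto
      also have "\<dots> \<le> \<eta>" using le t by (simp add: divide_le_eq)
      finally show ?thesis .
    qed
    ultimately show "\<exists>\<delta>>0. \<forall>f\<in>F. \<forall>g\<in>F. rho Q f g < \<delta> \<longrightarrow> measure M {v\<in>space M. \<bar>G v f - G v g\<bar> > t} \<le> \<eta>" by blast
  qed
  then have "AE v in M. rho_uniformly_continuous Q F (G v)" by (simp add: rho_uniformly_continuous_def)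
  then show ?thesis using MG gauss(1) by blast
qed

end

text \<open>For the empty class the function space is a single point, and the point mass is the
  limit. The case is separate because suprema over an empty class are unspecified.\<close>

lemma weak_limit_empty:
  assumes P: "prob_space P" and X: "\<And>N \<omega>. \<omega> \<in> space P \<Longrightarrow> X N \<omega> \<in> mspace (linf ({} :: 't set))"
  shows "\<exists>(M :: ('t \<Rightarrow> real) measure) G. prob_space M \<and> zero_mean_gaussian_process M {} S G \<and>
    tight_borel_element (linf {}) M G \<and> weakly_converges (linf {}) P X M G"
proof -
  interpret P: prob_space P by fact
  define z :: "'t \<Rightarrow> real" where "z = (\<lambda>_. undefined)"
  have ms: "mspace (linf ({} :: 't set)) = {z}" 
  proof (intro set_eqI)
    fix x show "x \<in> mspace (linf ({} :: 't set)) \<longleftrightarrow> x \<in> {z}" unfolding mem_linf z_def by simp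
  qed
  have top: "topspace (mtopology_of (linf ({} :: 't set))) = {z}" unfolding topspace_mtopology_of by (rule ms)
  define M where "M = return (borel_sigma (mtopology_of (linf ({} :: 't set)))) z"
  have sp: "space M = {z}" by (simp add: M_def ms)
  have M: "prob_space M" unfolding M_def by (rule prob_space_return) (simp add: ms)
  interpret M: prob_space M by (rule M)
  have "normal_rv M (\<lambda>v. 0)" by (auto simp: normal_rv_def)
  then have "zero_mean_gaussian_process M {} S (\<lambda>v. v)"
    by (simp add: zero_mean_gaussian_process_def gaussian_process_def)
  moreover have "tight_borel_element (linf {}) M (\<lambda>v. v)"
    unfolding tight_borel_element_def
  proof (intro conjI allI impI)
    show "(\<lambda>v. v) \<in> measurable M (borel_sigma (mtopology_of (linf {})))" by (simp add: M_def)
    fix e :: real assume "e > 0"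
    moreover have "compactin (mtopology_of (linf ({} :: 't set))) {z}" using top by (simp add: compactin_sing)
    moreover have "{v \<in> space M. v \<in> {z}} = space M" using sp by auto
    ultimately show "\<exists>K. compactin (mtopology_of (linf {})) K \<and> 1 - e \<le> measure M {v \<in> space M. v \<in> K}"
      using M.prob_space by (intro exI[of _ "{z}"]) simp
  qed
  moreover have "weakly_converges (linf {}) P X M (\<lambda>v. v)"
    unfolding weakly_converges_def
  proof (intro allI impI)
    fix h :: "('t \<Rightarrow> real) \<Rightarrow> real"
    have "outer_expectation P (\<lambda>\<omega>. h (X N \<omega>)) = h z" for N
    proof -
      have "outer_expectation P (\<lambda>\<omega>. h (X N \<omega>)) = outer_expectation P (\<lambda>\<omega>. h z)"
        using X ms unfolding outer_expectation_def by (intro arg_cong[where f = Inf]) (auto 4 4)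
      also have "\<dots> = h z" by (subst P.outer_expectation_eq_integral[of _ "\<bar>h z\<bar>"]) (auto simp: P.prob_space)
      finally show ?thesis .
    qed
    moreover have "(\<integral>v. h v \<partial>M) = (\<integral>v. h z \<partial>M)" by (intro Bochner_Integration.integral_cong) (auto simp: sp)
    ultimately show "(\<lambda>N. outer_expectation P (\<lambda>\<omega>. h (X N \<omega>))) \<longlonglongrightarrow> integral\<^sup>L M h"
      by (simp add: M.prob_space)
  qed
  ultimately show ?thesis using M by blast
qed

theorem theorem3p1:
  fixes Pyx :: "('y::{banach, second_countable_topology}
                 \<times> 'x::{banach, second_countable_topology}) measure"
    and Pd :: "'d measure" and D :: "'d \<Rightarrow> real"
    and Pe :: "'e measure" and \<epsilon> :: "'e \<Rightarrow> real"
    and \<pi> :: "'x incl_probs"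
    and enum :: "nat \<Rightarrow> nat \<Rightarrow> nat \<Rightarrow> nat"
    and F :: "('y \<Rightarrow> real) set"
    and \<Sigma>' :: "('y \<Rightarrow> real) \<Rightarrow> ('y \<Rightarrow> real) \<Rightarrow> real"
    and L :: real
  assumes Pyx: "prob_space Pyx" "sets Pyx = sets borel"
    and Pd: "prob_space Pd"
    and D: "D \<in> borel_measurable Pd" "distr Pd borel D = uniform_measure lborel {0..1}"
    and Pe: "prob_space Pe"
    and rademacher: "\<epsilon> \<in> borel_measurable Pe"
      "measure Pe {w \<in> space Pe. \<epsilon> w = 1} = 1 / 2"
      "measure Pe {w \<in> space Pe. \<epsilon> w = - 1} = 1 / 2"
    and enum: "\<And>N. bij_betw (enum N) {..<2 ^ N} (binary_vectors N)"
    and design: "measurable_poisson_designs \<pi>"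
    and F_meas: "F \<subseteq> borel_measurable borel"
    and F_donsker: "donsker (law_Y Pyx) F"
    and cov_limit: "\<And>f g. f \<in> F \<Longrightarrow> g \<in> F \<Longrightarrow>
      conv_in_prob (sample_space Pyx Pd Pe) (HT_cov Pd \<pi> enum D F f g) (\<Sigma>' f g)"
    and L_pos: "L > 0"
    and incl_bound: "(\<lambda>N. measure (sample_space Pyx Pd Pe)
        {\<omega> \<in> space (sample_space Pyx Pd Pe). (MIN i\<in>{..<N}. \<pi> N i (Xvec N \<omega>)) \<ge> L}) \<longlonglongrightarrow> 1"
    and mean_bound: "bdd_above ((\<lambda>f. \<bar>integral\<^sup>L (law_Y Pyx) f\<bar>) ` F)"
  shows "\<exists>(M :: (('y \<Rightarrow> real) \<Rightarrow> real) measure) G.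
      prob_space M \<and>
      zero_mean_gaussian_process M F \<Sigma>' G \<and>
      tight_borel_element (linf F) M G \<and>
      weakly_converges (linf F) (sample_space Pyx Pd Pe) (HT_process \<pi> enum D F) M G \<and>
      (AE v in M. rho_uniformly_continuous (law_Y Pyx) F (G v))"
proof (cases "F = {}")
  case True
  interpret poisson_design Pyx Pd D Pe \<pi> enum
    by (rule poisson_design.intro[OF Pyx Pd D Pe enum design])
  have "HT_process \<pi> enum D F N \<omega> \<in> mspace (linf {})" for N and \<omega> :: "('y, 'x, 'd, 'e) sample"
    unfolding mem_linf by (simp add: HT_process_def True restrict_def)
  from weak_limit_empty[OF prob_space_Om this, of \<Sigma>'] show ?thesis
    unfolding True by (simp add: rho_uniformly_continuous_def)
next
  case False
  interpret ht_design Pyx Pd D Pe \<pi> enum F \<Sigma>' L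
    by (rule ht_design.intro[OF poisson_design.intro[OF Pyx Pd D Pe enum design]
      ht_design_axioms.intro[OF F_meas F_donsker cov_limit L_pos incl_bound mean_bound False]])
  show ?thesis using HT_weak_limit unfolding HT_def .
qed

end
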